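(* Let $G=\mathbb{Q}_8=\langle x,y\mid x^4=1,\ y^2=x^2,\ xy=yx^{-1}\rangle$ be the quaternion group and let $\Bbbk=\mathbb{C}$. Up to isomorphism of the underlying Yetter-Drinfeld modules, the Nichols algebras $\mathcal{B}(V)$ of the finite-dimensional irreducible Yetter-Drinfeld modules $V$ over $\Bbbk G$ that have finite Gelfand-Kirillov dimension are exactly those in the following list (that is, for a finite-dimensional irreducible $V\in{}^G_G\mathcal{YD}$ one has $\mathrm{GKdim}\,\mathcal{B}(V)<\infty$ if and only if $V$ is isomorphic to the Yetter-Drinfeld module defining one of the following Nichols algebras): (1) $\mathcal{B}(\mathcal{O}_1,\rho_i)$ with $1\le i\le 5$; (2) $\mathcal{B}(\mathcal{O}_x,\phi_0)$ and $\mathcal{B}(\mathcal{O}_x,\phi_2)$; (3) $\mathcal{B}(\mathcal{O}_{x^2},\rho_i)$ with $1\le i\le 5$; (4) $\mathcal{B}(\mathcal{O}_y,\phi_0)$ and $\mathcal{B}(\mathcal{O}_y,\phi_2)$; (5) $\mathcal{B}(\mathcal{O}_{xy},\phi_0)$ and $\mathcal{B}(\mathcal{O}_{xy},\phi_2)$.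
   Context: The base field is $\Bbbk=\mathbb{C}$ and $\mathbf{i}=\sqrt{-1}$. For a group $G$ and $g,h\in G$, write $g\rhd h=ghg^{-1}$, let $\mathcal{O}_g$ be the conjugacy class of $g$, and let $G^g=\{h\in G\mid hg=gh\}$ be its centralizer. Yetter-Drinfeld modules: a Yetter-Drinfeld module over $\Bbbk G$ is a $G$-graded vector space $M=\bigoplus_{g\in G}M_g$ with a (left) $\Bbbk G$-module structure such that $g\cdot M_h=M_{ghg^{-1}}$ for all $g,h\in G$. The coaction is $\delta(m)=g\otimes m$ for $m\in M_g$. Morphisms are the $G$-linear maps preserving the grading; the category is denoted ${}^G_G\mathcal{YD}$, and irreducible means simple in this category. Each $V\in{}^G_G\mathcal{YD}$ is a braided vector space with braiding $c(u\otimes v)=g\cdot v\otimes u$ for $u\in V_g$, $v\in V$. Nichols algebra: for $V\in{}^G_G\mathcal{YD}$, the tensor algebra $T(V)$ is a braided Hopf algebra in ${}^G_G\mathcal{YD}$ whose comultiplication is the algebra map (into $T(V)\otimes T(V)$ with the multiplication twisted by the braiding) such that the elements of $V$ are primitive. Let $I(V)$ be the largest coideal of $T(V)$ contained in $\bigoplus_{n\ge 2}T^n(V)$. The Nichols algebra of $V$ is $\mathcal{B}(V)=T(V)/I(V)$. The modules $M(\mathcal{O}_g,\rho)$: for $g\in G$ and a representation $(\rho,W)$ of $G^g$, let $M(\mathcal{O}_g,\rho)=\Bbbk G\otimes_{\Bbbk G^g}W$ be the induced $\Bbbk G$-module with grading $\deg(h\otimes w)=h\rhd g$ for $h\in G$,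 $w\in W$; this is an object of ${}^G_G\mathcal{YD}$. Write $\mathcal{B}(\mathcal{O}_g,\rho)=\mathcal{B}(M(\mathcal{O}_g,\rho))$. The quaternion group: for $G=\mathbb{Q}_8$ the conjugacy classes are $\mathcal{O}_1=\{1\}$, $\mathcal{O}_{x^2}=\{x^2\}$, $\mathcal{O}_x=\{x,x^3\}$, $\mathcal{O}_y=\{y,x^2y\}$, $\mathcal{O}_{xy}=\{xy,x^3y\}$, with chosen representatives $1,x^2,x,y,xy$. The centralizers are $G^1=G^{x^2}=G$, and $G^g=\langle g\rangle\cong\mathbb{Z}/4$ for $g\in\{x,y,xy\}$. Representations: $\rho_1,\dots,\rho_5$ are the irreducible complex representations of $\mathbb{Q}_8$. The representations $\rho_1,\rho_2,\rho_3,\rho_4$ are one-dimensional with $(\rho_i(x),\rho_i(y))=(1,1),(1,-1),(-1,1),(-1,-1)$ respectively. The representation $\rho_5$ is two-dimensional with character $2,-2,0,0,0$ on $1,x^2,x,y,xy$; explicitly, on a basis $v_1,v_2$: $x v_1=\mathbf{i}v_1$, $x v_2=-\mathbf{i}v_2$, $y v_1=v_2$, $y v_2=-v_1$. For $g\in\{x,y,xy\}$ and $0\le t\le 3$, $\phi_t$ denotes the one-dimensional representation of $G^g=\langle g\rangle$ given by $\phi_t(g^k)=e^{t\pi\mathbf{i}k/2}$. Gelfand-Kirillov dimension: for a $\Bbbk$-algebra $A$, $\mathrm{GKdim}(A)=\sup_{U}\limsup_{n\to\infty}\log_n\dim(U^n)$, the supremum being over all finite-dimensional subspaces $U$ of $A$,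 where $U^n$ is the span of all $n$-fold products of elements of $U$. *)

theory Defs
  imports
    Complex_Main
    "HOL-Library.Poly_Mapping"
    "HOL-Library.Extended_Real"
    "HOL-Library.Liminf_Limsup"
    "HOL-Algebra.QuotRing"
    "Jordan_Normal_Form.VS_Connect"
begin

section \<open>Complex vector spaces with explicit carriers\<close>

text \<open>
  Vector spaces are module records over \<open>class_ring\<close>, in the sense of the locale
  \<open>vectorspace\<close>.  The same record type also carries associative algebras, the multiplication
  and unit being the fields \<open>mult\<close> and \<open>one\<close>; for mere vector spaces these two
  fields are meaningless.
\<close>

abbreviation CC :: "complex ring" where
  "CC \<equiv> class_ring"

abbreviation cspan :: "(complex, 'a, 'm) module_scheme \<Rightarrow> 'a set \<Rightarrow> 'a set" where
  "cspan M S \<equiv> LinearCombinations.module.span CC M S"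

abbreviation csubspace :: "'a set \<Rightarrow> (complex, 'a, 'm) module_scheme \<Rightarrow> bool" where
  "csubspace U M \<equiv> VectorSpace.subspace CC U M"

abbreviation chom ::
  "(complex, 'a, 'm) module_scheme \<Rightarrow> (complex, 'b, 'n) module_scheme \<Rightarrow> ('a \<Rightarrow> 'b) set" where
  "chom M N \<equiv> LinearCombinations.module_hom CC M N"

abbreviation cfin_dim :: "(complex, 'a, 'm) module_scheme \<Rightarrow> bool" where
  "cfin_dim M \<equiv> VectorSpace.vectorspace.fin_dim CC M"

abbreviation cdim :: "(complex, 'a, 'm) module_scheme \<Rightarrow> nat" where
  "cdim M \<equiv> VectorSpace.vectorspace.dim CC M"

abbreviation cbasis :: "(complex, 'a, 'm) module_scheme \<Rightarrow> 'a set \<Rightarrow> bool" where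
  "cbasis M B \<equiv> VectorSpace.vectorspace.basis CC M B"

definition free_space :: "'s set \<Rightarrow> (complex, 's \<Rightarrow>\<^sub>0 complex) module" where
  "free_space S =
     \<lparr>carrier = {f. Poly_Mapping.keys f \<subseteq> S}, mult = undefined, one = undefined,
      zero = 0, add = (+), smult = (\<lambda>c. Poly_Mapping.map ((*) c))\<rparr>"

abbreviation bvec :: "'s \<Rightarrow> ('s \<Rightarrow>\<^sub>0 complex)" where
  "bvec s \<equiv> Poly_Mapping.single s 1"

definition lin_ext :: "('s \<Rightarrow> ('t \<Rightarrow>\<^sub>0 complex)) \<Rightarrow> ('s \<Rightarrow>\<^sub>0 complex) \<Rightarrow> ('t \<Rightarrow>\<^sub>0 complex)" where
  "lin_ext \<phi> f =
     (\<Sum>s\<in>Poly_Mapping.keys f. Poly_Mapping.map ((*) (Poly_Mapping.lookup f s)) (\<phi> s))"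

definition bilin_ext ::
  "('s \<Rightarrow> 't \<Rightarrow> ('r \<Rightarrow>\<^sub>0 complex)) \<Rightarrow> ('s \<Rightarrow>\<^sub>0 complex) \<Rightarrow> ('t \<Rightarrow>\<^sub>0 complex) \<Rightarrow> ('r \<Rightarrow>\<^sub>0 complex)" where
  "bilin_ext \<beta> f h = lin_ext (\<lambda>s. lin_ext (\<beta> s) h) f"

text \<open>
  If the linear map \<open>\<phi>\<close> maps the subspace \<open>N\<close> into itself, then
  \<open>coset_map M N \<phi>\<close> is the induced map on cosets, \<open>N + a \<mapsto> N + \<phi>(a)\<close>.
\<close>

definition coset_map ::
  "(complex, 'a, 'm) module_scheme \<Rightarrow> 'a set \<Rightarrow> ('a \<Rightarrow> 'a) \<Rightarrow> 'a set \<Rightarrow> 'a set" where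
  "coset_map M N \<phi> X = N <+>\<^bsub>M\<^esub> (\<phi> ` X)"

text \<open>
  The quotient of a vector space by a subspace, and of an algebra by an ideal: the factor ring
  \<open>M Quot N\<close> of the library together with scalar multiplication of cosets.
\<close>

definition quotient_module ::
  "(complex, 'a, 'm) module_scheme \<Rightarrow> 'a set \<Rightarrow> (complex, 'a set) module" where
  "quotient_module M N =
     ring.extend (M Quot N) (module.fields (\<lambda>c. coset_map M N (\<lambda>a. c \<odot>\<^bsub>M\<^esub> a)))"

lemma quotient_module_simps:
  "carrier (quotient_module M N) = a_rcosets\<^bsub>M\<^esub> N"
  "mult (quotient_module M N) = rcoset_mult M N"
  "one (quotient_module M N) = N +>\<^bsub>M\<^esub> \<one>\<^bsub>M\<^esub>"
  "zero (quotient_module M N) = N"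
  "add (quotient_module M N) = set_add M"
  "smult (quotient_module M N) c X = N <+>\<^bsub>M\<^esub> ((\<lambda>a. c \<odot>\<^bsub>M\<^esub> a) ` X)"
  by (simp_all add: quotient_module_def ring.defs module.defs FactRing_def coset_map_def)


section \<open>Gelfand--Kirillov dimension\<close>

definition power_space :: "(complex, 'a, 'm) module_scheme \<Rightarrow> 'a set \<Rightarrow> nat \<Rightarrow> 'a set" where
  "power_space A U n =
     cspan A {foldr (mult A) us \<one>\<^bsub>A\<^esub> | us. length us = n \<and> set us \<subseteq> U}"

text \<open>The case distinction implements \<open>log 0 = -\<infinity>\<close>; in Isabelle \<open>log b 0 = 0\<close>.\<close>

definition GKdim :: "(complex, 'a, 'm) module_scheme \<Rightarrow> ereal" where
  "GKdim A =
     (SUP U \<in> {U. csubspace U A \<and> cfin_dim (A\<lparr>carrier := U\<rparr>)}.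
        limsup (\<lambda>n. let d = cdim (A\<lparr>carrier := power_space A U n\<rparr>)
                    in if d = 0 then -\<infinity> else ereal (log (real n) (real d))))"


section \<open>Yetter--Drinfeld modules over a group algebra\<close>

record ('g, 'v) yd_struct = "(complex, 'v) module" +
  yd_act :: "'g \<Rightarrow> 'v \<Rightarrow> 'v"
  yd_comp :: "'g \<Rightarrow> 'v set"

text \<open>\<open>m\<close> is the family of homogeneous components of \<open>v\<close>.\<close>

definition homogeneous_parts ::
  "('g, 'k) monoid_scheme \<Rightarrow> ('g, 'v, 'm) yd_struct_scheme \<Rightarrow> 'v \<Rightarrow> ('g \<Rightarrow> 'v) \<Rightarrow> bool" where
  "homogeneous_parts G V v m \<longleftrightarrow>
     (\<forall>g\<in>carrier G. m g \<in> yd_comp V g) \<and> (\<forall>g. g \<notin> carrier G \<longrightarrow> m g = \<zero>\<^bsub>V\<^esub>) \<and>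
     finite {g. m g \<noteq> \<zero>\<^bsub>V\<^esub>} \<and> v = finsum V m {g. m g \<noteq> \<zero>\<^bsub>V\<^esub>}"

locale yd_module = grp: group G + spc: vectorspace CC V
  for G :: "('g, 'k) monoid_scheme" and V :: "('g, 'v, 'm) yd_struct_scheme" +
  assumes act_linear: "g \<in> carrier G \<Longrightarrow> yd_act V g \<in> chom V V"
    and act_one: "v \<in> carrier V \<Longrightarrow> yd_act V \<one>\<^bsub>G\<^esub> v = v"
    and act_mult: "\<lbrakk>g \<in> carrier G; h \<in> carrier G; v \<in> carrier V\<rbrakk> \<Longrightarrow>
          yd_act V (g \<otimes>\<^bsub>G\<^esub> h) v = yd_act V g (yd_act V h v)"
    and comp_subspace: "g \<in> carrier G \<Longrightarrow> csubspace (yd_comp V g) V"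
    and comp_direct_sum: "v \<in> carrier V \<Longrightarrow> \<exists>!m. homogeneous_parts G V v m"
    and act_comp: "\<lbrakk>g \<in> carrier G; h \<in> carrier G\<rbrakk> \<Longrightarrow>
          yd_act V g ` yd_comp V h = yd_comp V (g \<otimes>\<^bsub>G\<^esub> h \<otimes>\<^bsub>G\<^esub> inv\<^bsub>G\<^esub> g)"

definition yd_submodule ::
  "('g, 'k) monoid_scheme \<Rightarrow> ('g, 'v, 'm) yd_struct_scheme \<Rightarrow> 'v set \<Rightarrow> bool" where
  "yd_submodule G V U \<longleftrightarrow>
     csubspace U V \<and>
     (\<forall>g\<in>carrier G. yd_act V g ` U \<subseteq> U) \<and>
     (\<forall>u\<in>U. \<forall>m. homogeneous_parts G V u m \<longrightarrow> (\<forall>g. m g \<in> U))"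

definition yd_irreducible ::
  "('g, 'k) monoid_scheme \<Rightarrow> ('g, 'v, 'm) yd_struct_scheme \<Rightarrow> bool" where
  "yd_irreducible G V \<longleftrightarrow>
     carrier V \<noteq> {\<zero>\<^bsub>V\<^esub>} \<and>
     (\<forall>U. yd_submodule G V U \<longrightarrow> U = {\<zero>\<^bsub>V\<^esub>} \<or> U = carrier V)"

definition yd_isomorphic ::
  "('g, 'k) monoid_scheme \<Rightarrow> ('g, 'v, 'm) yd_struct_scheme \<Rightarrow> ('g, 'w, 'n) yd_struct_scheme \<Rightarrow> bool"
where
  "yd_isomorphic G V W \<longleftrightarrow>
     (\<exists>f \<in> chom V W. bij_betw f (carrier V) (carrier W) \<and>
        (\<forall>g\<in>carrier G. \<forall>v\<in>carrier V. f (yd_act V g v) = yd_act W g (f v)) \<and>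
        (\<forall>g\<in>carrier G. f ` yd_comp V g \<subseteq> yd_comp W g))"


subsection \<open>The modules \<open>M(O\<^sub>g, \<rho>)\<close>\<close>

definition centralizer :: "('g, 'k) monoid_scheme \<Rightarrow> 'g \<Rightarrow> 'g set" where
  "centralizer G g = {h \<in> carrier G. h \<otimes>\<^bsub>G\<^esub> g = g \<otimes>\<^bsub>G\<^esub> h}"

text \<open>
  The induced module \<open>\<complex>G \<otimes> W\<close> over \<open>\<complex>G\<^sup>g\<close> is the quotient of the space freely spanned by
  the symbols \<open>(h, w)\<close>, standing for \<open>h \<otimes> w\<close>, by the relations saying that \<open>h \<otimes> w\<close> is linear
  in \<open>w\<close> and balanced over \<open>G\<^sup>g\<close>.  (As \<open>\<complex>G\<close> has basis \<open>G\<close>, no linearity relation is needed in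
  the first argument.)
\<close>

definition induced_free ::
  "('g, 'k) monoid_scheme \<Rightarrow> (complex, 'w, 'n) module_scheme \<Rightarrow>
     (complex, ('g \<times> 'w) \<Rightarrow>\<^sub>0 complex) module" where
  "induced_free G W = free_space (carrier G \<times> carrier W)"

definition induced_relations ::
  "('g, 'k) monoid_scheme \<Rightarrow> 'g \<Rightarrow> (complex, 'w, 'n) module_scheme \<Rightarrow> ('g \<Rightarrow> 'w \<Rightarrow> 'w) \<Rightarrow>
     (('g \<times> 'w) \<Rightarrow>\<^sub>0 complex) set" where
  "induced_relations G g W \<rho> = cspan (induced_free G W)
     ({bvec (h, w \<oplus>\<^bsub>W\<^esub> w') - bvec (h, w) - bvec (h, w') | h w w'.
         h \<in> carrier G \<and> w \<in> carrier W \<and> w' \<in> carrier W} \<union>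
      {bvec (h, c \<odot>\<^bsub>W\<^esub> w) - Poly_Mapping.single (h, w) c | h c w.
         h \<in> carrier G \<and> w \<in> carrier W} \<union>
      {bvec (h \<otimes>\<^bsub>G\<^esub> k, w) - bvec (h, \<rho> k w) | h k w.
         h \<in> carrier G \<and> k \<in> centralizer G g \<and> w \<in> carrier W})"

definition yd_induced ::
  "('g, 'k) monoid_scheme \<Rightarrow> 'g \<Rightarrow> (complex, 'w, 'n) module_scheme \<Rightarrow> ('g \<Rightarrow> 'w \<Rightarrow> 'w) \<Rightarrow>
     ('g, (('g \<times> 'w) \<Rightarrow>\<^sub>0 complex) set) yd_struct" where
  "yd_induced G g W \<rho> =
     (let F = induced_free G W; N = induced_relations G g W \<rho>; Q = quotient_module F N
      in module.extend Q (yd_struct.fields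
           (\<lambda>s. coset_map F N (lin_ext (\<lambda>(h, w). bvec (s \<otimes>\<^bsub>G\<^esub> h, w))))
           (\<lambda>s. cspan Q {N +>\<^bsub>F\<^esub> bvec (h, w) | h w.
                   h \<in> carrier G \<and> w \<in> carrier W \<and> h \<otimes>\<^bsub>G\<^esub> g \<otimes>\<^bsub>G\<^esub> inv\<^bsub>G\<^esub> h = s})))"


section \<open>Nichols algebras\<close>

text \<open>
  The tensor algebra \<open>T(V)\<close> is realised as the free associative algebra on a basis \<open>B\<close> of \<open>V\<close>
  consisting of homogeneous vectors: it has the words over \<open>B\<close> as a basis, the word
  \<open>[b\<^sub>1, \<dots>, b\<^sub>n]\<close> standing for the tensor \<open>b\<^sub>1 \<otimes> \<dots> \<otimes> b\<^sub>n\<close> of \<open>T\<^sup>n(V)\<close>.  Likewise \<open>T(V) \<otimes> T(V)\<close> has the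
  pairs of words as a basis.  Up to isomorphism nothing depends on the choice of \<open>B\<close>.
\<close>

definition homogeneous_basis ::
  "('g, 'k) monoid_scheme \<Rightarrow> ('g, 'v, 'm) yd_struct_scheme \<Rightarrow> 'v set \<Rightarrow> bool" where
  "homogeneous_basis G V B \<longleftrightarrow> cbasis V B \<and> B \<subseteq> (\<Union>g\<in>carrier G. yd_comp V g)"

definition coords :: "(complex, 'v, 'm) module_scheme \<Rightarrow> 'v set \<Rightarrow> 'v \<Rightarrow> ('v \<Rightarrow>\<^sub>0 complex)" where
  "coords V B v = (THE a. Poly_Mapping.keys a \<subseteq> B \<and>
     v = (\<Oplus>\<^bsub>V\<^esub>b\<in>Poly_Mapping.keys a. Poly_Mapping.lookup a b \<odot>\<^bsub>V\<^esub> b))"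

definition tensor_algebra :: "'v set \<Rightarrow> (complex, 'v list \<Rightarrow>\<^sub>0 complex) module" where
  "tensor_algebra B =
     (free_space (lists B))\<lparr>mult := bilin_ext (\<lambda>u w. bvec (u @ w)), one := bvec []\<rparr>"

definition embed ::
  "(complex, 'v, 'm) module_scheme \<Rightarrow> 'v set \<Rightarrow> 'v \<Rightarrow> ('v list \<Rightarrow>\<^sub>0 complex)" where
  "embed V B v = lin_ext (\<lambda>b. bvec [b]) (coords V B v)"

definition degree_of ::
  "('g, 'k) monoid_scheme \<Rightarrow> ('g, 'v, 'm) yd_struct_scheme \<Rightarrow> 'v \<Rightarrow> 'g" where
  "degree_of G V b = (THE g. g \<in> carrier G \<and> b \<in> yd_comp V g)"

definition word_degree ::
  "('g, 'k) monoid_scheme \<Rightarrow> ('g, 'v, 'm) yd_struct_scheme \<Rightarrow> 'v list \<Rightarrow> 'g" where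
  "word_degree G V w = foldr (\<lambda>b g. degree_of G V b \<otimes>\<^bsub>G\<^esub> g) w \<one>\<^bsub>G\<^esub>"

text \<open>\<open>g \<cdot> (b\<^sub>1 \<dots> b\<^sub>n) = (g \<cdot> b\<^sub>1) \<dots> (g \<cdot> b\<^sub>n)\<close>\<close>

definition word_act ::
  "('g, 'v, 'm) yd_struct_scheme \<Rightarrow> 'v set \<Rightarrow> 'g \<Rightarrow> 'v list \<Rightarrow> ('v list \<Rightarrow>\<^sub>0 complex)" where
  "word_act V B g w =
     foldr (\<lambda>b p. embed V B (yd_act V g b) \<otimes>\<^bsub>tensor_algebra B\<^esub> p) w \<one>\<^bsub>tensor_algebra B\<^esub>"

definition pure_tensor ::
  "('v list \<Rightarrow>\<^sub>0 complex) \<Rightarrow> ('v list \<Rightarrow>\<^sub>0 complex) \<Rightarrow> (('v list \<times> 'v list) \<Rightarrow>\<^sub>0 complex)" where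
  "pure_tensor = bilin_ext (\<lambda>u w. bvec (u, w))"

text \<open>
  The multiplication of \<open>T(V) \<otimes> T(V)\<close> is twisted by the braiding:
  \<open>(u \<otimes> w) (u' \<otimes> w') = u (h \<cdot> u') \<otimes> w w'\<close> for \<open>w\<close> of degree \<open>h\<close>.
\<close>

definition tensor_square ::
  "('g, 'k) monoid_scheme \<Rightarrow> ('g, 'v, 'm) yd_struct_scheme \<Rightarrow> 'v set \<Rightarrow>
     (complex, ('v list \<times> 'v list) \<Rightarrow>\<^sub>0 complex) module" where
  "tensor_square G V B =
     (free_space (lists B \<times> lists B))
       \<lparr>mult := bilin_ext (\<lambda>(u, w) (u', w').
          pure_tensor (bvec u \<otimes>\<^bsub>tensor_algebra B\<^esub> word_act V B (word_degree G V w) u')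
            (bvec (w @ w'))),
        one := bvec ([], [])\<rparr>"

text \<open>
  The comultiplication is the algebra map with \<open>b \<mapsto> b \<otimes> 1 + 1 \<otimes> b\<close> for \<open>b \<in> B\<close>.
\<close>

definition comult ::
  "('g, 'k) monoid_scheme \<Rightarrow> ('g, 'v, 'm) yd_struct_scheme \<Rightarrow> 'v set \<Rightarrow>
     ('v list \<Rightarrow>\<^sub>0 complex) \<Rightarrow> (('v list \<times> 'v list) \<Rightarrow>\<^sub>0 complex)" where
  "comult G V B =
     lin_ext (\<lambda>w. foldr
       (\<lambda>b t. (pure_tensor (bvec [b]) (bvec []) + pure_tensor (bvec []) (bvec [b]))
                \<otimes>\<^bsub>tensor_square G V B\<^esub> t)
       w \<one>\<^bsub>tensor_square G V B\<^esub>)"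

definition counit :: "('v list \<Rightarrow>\<^sub>0 complex) \<Rightarrow> complex" where
  "counit p = Poly_Mapping.lookup p []"

definition coideal ::
  "('g, 'k) monoid_scheme \<Rightarrow> ('g, 'v, 'm) yd_struct_scheme \<Rightarrow> 'v set \<Rightarrow>
     ('v list \<Rightarrow>\<^sub>0 complex) set \<Rightarrow> bool" where
  "coideal G V B I \<longleftrightarrow>
     csubspace I (tensor_algebra B) \<and>
     (\<forall>p\<in>I. counit p = 0 \<and>
        comult G V B p \<in> cspan (tensor_square G V B)
          ({pure_tensor p q | p q. p \<in> I \<and> q \<in> carrier (tensor_algebra B)} \<union>
           {pure_tensor p q | p q. p \<in> carrier (tensor_algebra B) \<and> q \<in> I}))"

definition degree_ge_2 :: "'v set \<Rightarrow> ('v list \<Rightarrow>\<^sub>0 complex) set" where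
  "degree_ge_2 B =
     {p \<in> carrier (tensor_algebra B). \<forall>w\<in>Poly_Mapping.keys p. 2 \<le> length w}"

definition nichols_ideal ::
  "('g, 'k) monoid_scheme \<Rightarrow> ('g, 'v, 'm) yd_struct_scheme \<Rightarrow> 'v set \<Rightarrow>
     ('v list \<Rightarrow>\<^sub>0 complex) set" where
  "nichols_ideal G V B = (GREATEST I. coideal G V B I \<and> I \<subseteq> degree_ge_2 B)"

definition nichols_algebra ::
  "('g, 'k) monoid_scheme \<Rightarrow> ('g, 'v, 'm) yd_struct_scheme \<Rightarrow>
     (complex, ('v list \<Rightarrow>\<^sub>0 complex) set) module" where
  "nichols_algebra G V =
     (let B = (SOME B. homogeneous_basis G V B)
      in quotient_module (tensor_algebra B) (nichols_ideal G V B))"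


section \<open>The quaternion group and its representations\<close>

text \<open>The pair \<open>(a, b)\<close> stands for \<open>x\<^sup>a y\<^sup>b\<close>.  The relations give
  \<open>x\<^sup>a y x\<^sup>c y\<^sup>d = x\<^sup>a\<^sup>-\<^sup>c y\<^sup>1\<^sup>+\<^sup>d\<close> and \<open>y\<^sup>2 = x\<^sup>2\<close>.\<close>

definition Q8 :: "(int \<times> int) monoid" where
  "Q8 = \<lparr>carrier = {0..3} \<times> {0..1},
         mult = (\<lambda>(a, b) (c, d).
           ((a + (if b = 0 then c else - c) + (if b = 1 \<and> d = 1 then 2 else 0)) mod 4,
            (b + d) mod 2)),
         one = (0, 0)\<rparr>"

definition qx :: "int \<times> int" where "qx = (1, 0)"
definition qy :: "int \<times> int" where "qy = (0, 1)"

lemma Q8_mult: "(a,b) \<otimes>\<^bsub>Q8\<^esub> (c,d) = ((a + (if b = 0 then c else - c) + (if b = 1 \<and> d = 1 then 2 else 0)) mod 4,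
            (b + d) mod 2)" by (simp only: Q8_def monoid.simps prod.case)
lemma Q8_carrier: "(a, b) \<in> carrier Q8 \<longleftrightarrow> 0 \<le> a \<and> a \<le> 3 \<and> (b = 0 \<or> b = 1)"
  by (simp add: Q8_def) linarith
lemma Q8_one: "\<one>\<^bsub>Q8\<^esub> = (0, 0)" by (simp only: Q8_def monoid.simps)
lemma Q8_assoc: "b = 0 \<or> b = 1 \<Longrightarrow> d = 0 \<or> d = 1 \<Longrightarrow> f = 0 \<or> f = 1 \<Longrightarrow> (a,b) \<otimes>\<^bsub>Q8\<^esub> (c,d) \<otimes>\<^bsub>Q8\<^esub> (e,f) = (a,b) \<otimes>\<^bsub>Q8\<^esub> ((c,d) \<otimes>\<^bsub>Q8\<^esub> (e,f))"
  by (elim disjE) (simp_all add: Q8_mult mod_simps, simp_all add: mod_eq_dvd_iff,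
      simp_all add: minus_mult_div_eq_mod[symmetric] algebra_simps)

lemma group_Q8: "group Q8"
proof (rule groupI, goal_cases)
  case (1 u v) then show ?case by (cases u; cases v) (auto simp: Q8_carrier Q8_mult)
next
  case 2 show ?case by (simp add: Q8_carrier Q8_one)
next
  case (3 u v w) then show ?case by (cases u; cases v; cases w) (simp add: Q8_carrier Q8_assoc)
next
  case (4 u) then show ?case by (cases u) (auto simp: Q8_carrier Q8_one Q8_mult)
next
  case (5 u)
  obtain a b where u: "u = (a, b)" by fastforce
  show ?case
  proof (cases "b = 0")
    case True
    then show ?thesis
      by (intro bexI[of _ "((- a) mod 4, 0)"]) (simp_all add: u Q8_carrier Q8_mult Q8_one mod_simps)
  next
    case False
    with 5 have "b = 1" by (simp add: u Q8_carrier)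
    then show ?thesis
      by (intro bexI[of _ "((a + 2) mod 4, 1)"])
        (simp_all add: u Q8_carrier Q8_mult Q8_one mod_simps,
         simp add: minus_mult_div_eq_mod[symmetric] algebra_simps)
  qed
qed

lemma Q8_pow:
  "u [^]\<^bsub>Q8\<^esub> (0::nat) = \<one>\<^bsub>Q8\<^esub>"
  "u [^]\<^bsub>Q8\<^esub> (Suc n) = u [^]\<^bsub>Q8\<^esub> n \<otimes>\<^bsub>Q8\<^esub> u"
  by simp_all

lemma Q8_x_pow: "qx [^]\<^bsub>Q8\<^esub> (n::nat) = (int n mod 4, 0)"
  by (induction n) (simp_all only: Q8_pow Q8_one, simp_all add: Q8_mult qx_def mod_simps algebra_simps)

lemma Q8_relations:
  "qx \<in> carrier Q8" "qy \<in> carrier Q8"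
  "qx [^]\<^bsub>Q8\<^esub> (4::nat) = \<one>\<^bsub>Q8\<^esub>"
  "qy [^]\<^bsub>Q8\<^esub> (2::nat) = qx [^]\<^bsub>Q8\<^esub> (2::nat)"
  "qx \<otimes>\<^bsub>Q8\<^esub> qy = qy \<otimes>\<^bsub>Q8\<^esub> inv\<^bsub>Q8\<^esub> qx"
proof -
  interpret group Q8 by (rule group_Q8)
  show c: "qx \<in> carrier Q8" "qy \<in> carrier Q8" by (simp_all add: Q8_carrier qx_def qy_def)
  show "qx [^]\<^bsub>Q8\<^esub> (4::nat) = \<one>\<^bsub>Q8\<^esub>" "qy [^]\<^bsub>Q8\<^esub> (2::nat) = qx [^]\<^bsub>Q8\<^esub> (2::nat)"
    unfolding Q8_x_pow numeral_2_eq_2 Q8_pow by (simp_all add: Q8_one Q8_mult qx_def qy_def)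
  have "inv\<^bsub>Q8\<^esub> qx = (3, 0)"
    by (rule inv_equality) (simp_all add: Q8_mult Q8_one Q8_carrier qx_def)
  then show "qx \<otimes>\<^bsub>Q8\<^esub> qy = qy \<otimes>\<^bsub>Q8\<^esub> inv\<^bsub>Q8\<^esub> qx"
    by (simp add: Q8_mult qx_def qy_def)
qed

lemma Q8_normal_form:
  assumes "(a, b) \<in> carrier Q8"
  shows "(a, b) = qx [^]\<^bsub>Q8\<^esub> nat a \<otimes>\<^bsub>Q8\<^esub> qy [^]\<^bsub>Q8\<^esub> nat b"
proof -
  have "qy [^]\<^bsub>Q8\<^esub> nat b = (0, b)"
  proof (cases "b = 0")
    case True then show ?thesis by (simp add: Q8_one)
  next
    case False
    with assms have "nat b = Suc 0" "b = 1" by (simp_all add: Q8_carrier)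
    then show ?thesis by (simp only: Q8_pow) (simp add: Q8_one Q8_mult qy_def)
  qed
  moreover have "qx [^]\<^bsub>Q8\<^esub> nat a = (a, 0)" using assms by (simp add: Q8_x_pow Q8_carrier)
  ultimately show ?thesis using assms by (auto simp: Q8_mult Q8_carrier)
qed

text \<open>The relations satisfied by \<open>x\<close> and \<open>y\<close> present the group.\<close>

lemma Q8_universal:
  assumes H: "group H" and ab: "a \<in> carrier H" "b \<in> carrier H"
    and rel: "a [^]\<^bsub>H\<^esub> (4::nat) = \<one>\<^bsub>H\<^esub>" "b [^]\<^bsub>H\<^esub> (2::nat) = a [^]\<^bsub>H\<^esub> (2::nat)"
      "a \<otimes>\<^bsub>H\<^esub> b = b \<otimes>\<^bsub>H\<^esub> inv\<^bsub>H\<^esub> a"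
  shows "\<exists>f\<in>hom Q8 H. f qx = a \<and> f qy = b \<and>
    (\<forall>f'\<in>hom Q8 H. f' qx = a \<and> f' qy = b \<longrightarrow> (\<forall>g\<in>carrier Q8. f' g = f g))"
proof -
  interpret H: group H by (rule H)
  interpret Q: group Q8 by (rule group_Q8)
  define f where "f = (\<lambda>(i::int, j::int). a [^]\<^bsub>H\<^esub> i \<otimes>\<^bsub>H\<^esub> b [^]\<^bsub>H\<^esub> j)"
  have a4: "a [^]\<^bsub>H\<^esub> (4::int) = \<one>\<^bsub>H\<^esub>" using rel(1) int_pow_int[of H a 4] by simp
  have b2: "b \<otimes>\<^bsub>H\<^esub> b = a [^]\<^bsub>H\<^esub> (2::int)"
    using rel(2) ab int_pow_int[of H a 2] by (simp add: numeral_2_eq_2)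
  have pm: "a [^]\<^bsub>H\<^esub> (i mod 4) = a [^]\<^bsub>H\<^esub> i" for i :: int
  proof -
    have "a [^]\<^bsub>H\<^esub> i = a [^]\<^bsub>H\<^esub> (4 * (i div 4) + i mod 4)" by simp
    also have "\<dots> = (a [^]\<^bsub>H\<^esub> (4::int)) [^]\<^bsub>H\<^esub> (i div 4) \<otimes>\<^bsub>H\<^esub> a [^]\<^bsub>H\<^esub> (i mod 4)"
      using ab by (simp only: H.int_pow_mult H.int_pow_pow)
    finally show ?thesis using ab by (simp add: a4)
  qed
  have ba: "b \<otimes>\<^bsub>H\<^esub> a [^]\<^bsub>H\<^esub> i = a [^]\<^bsub>H\<^esub> (- i) \<otimes>\<^bsub>H\<^esub> b" for i :: int
  proof -
    have "a \<otimes>\<^bsub>H\<^esub> b \<otimes>\<^bsub>H\<^esub> inv\<^bsub>H\<^esub> b = b \<otimes>\<^bsub>H\<^esub> inv\<^bsub>H\<^esub> a \<otimes>\<^bsub>H\<^esub> inv\<^bsub>H\<^esub> b"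
      using rel(3) by simp
    then have "a = b \<otimes>\<^bsub>H\<^esub> inv\<^bsub>H\<^esub> a \<otimes>\<^bsub>H\<^esub> inv\<^bsub>H\<^esub> b" using ab by (simp add: H.m_assoc)
    then have "inv\<^bsub>H\<^esub> a = b \<otimes>\<^bsub>H\<^esub> a \<otimes>\<^bsub>H\<^esub> inv\<^bsub>H\<^esub> b"
      using ab by (metis H.inv_closed H.inv_inv H.inv_mult_group H.m_assoc H.m_closed)
    then have 1: "inv\<^bsub>H\<^esub> a \<otimes>\<^bsub>H\<^esub> b = b \<otimes>\<^bsub>H\<^esub> a" using ab by (simp add: H.m_assoc)
    have *: "b \<otimes>\<^bsub>H\<^esub> c [^]\<^bsub>H\<^esub> n = d [^]\<^bsub>H\<^esub> n \<otimes>\<^bsub>H\<^esub> b"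
      if "b \<otimes>\<^bsub>H\<^esub> c = d \<otimes>\<^bsub>H\<^esub> b" "c \<in> carrier H" "d \<in> carrier H" for c d and n :: nat
    proof (induction n)
      case (Suc n)
      have "b \<otimes>\<^bsub>H\<^esub> c [^]\<^bsub>H\<^esub> Suc n = (b \<otimes>\<^bsub>H\<^esub> c [^]\<^bsub>H\<^esub> n) \<otimes>\<^bsub>H\<^esub> c"
        using ab that by (simp add: H.m_assoc)
      also have "\<dots> = d [^]\<^bsub>H\<^esub> n \<otimes>\<^bsub>H\<^esub> (b \<otimes>\<^bsub>H\<^esub> c)" using ab that by (simp add: Suc H.m_assoc)
      also have "\<dots> = d [^]\<^bsub>H\<^esub> Suc n \<otimes>\<^bsub>H\<^esub> b" using ab that by (simp add: H.m_assoc)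
      finally show ?case .
    qed (use ab in simp)
    show ?thesis
    proof (cases i rule: int_cases2)
      case (nonneg n)
      have "(inv\<^bsub>H\<^esub> a) [^]\<^bsub>H\<^esub> n = a [^]\<^bsub>H\<^esub> (- i)"
        using ab nonneg by (simp add: H.nat_pow_inv H.int_pow_neg int_pow_int)
      then show ?thesis using *[of a "inv\<^bsub>H\<^esub> a" n] 1 ab nonneg by (simp add: int_pow_int)
    next
      case (nonpos n)
      have "(inv\<^bsub>H\<^esub> a) [^]\<^bsub>H\<^esub> n = a [^]\<^bsub>H\<^esub> i"
        using ab nonpos by (simp add: H.nat_pow_inv H.int_pow_neg int_pow_int)
      then show ?thesis using *[of "inv\<^bsub>H\<^esub> a" a n] rel(3) ab nonpos by (simp add: int_pow_int)
    qed
  qed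
  have "f \<in> hom Q8 H"
  proof (rule homI)
    fix g assume "g \<in> carrier Q8" then show "f g \<in> carrier H" using ab by (simp add: f_def split: prod.split)
  next
    fix g g' assume g: "g \<in> carrier Q8" "g' \<in> carrier Q8"
    obtain i j k l where ij: "g = (i, j)" "g' = (k, l)" by (metis surj_pair)
    have jl: "j = 0 \<or> j = 1" "l = 0 \<or> l = 1" using g by (simp_all add: ij Q8_carrier)
    have assoc: "a [^]\<^bsub>H\<^esub> i \<otimes>\<^bsub>H\<^esub> b \<otimes>\<^bsub>H\<^esub> (a [^]\<^bsub>H\<^esub> k \<otimes>\<^bsub>H\<^esub> z) = a [^]\<^bsub>H\<^esub> (i - k) \<otimes>\<^bsub>H\<^esub> (b \<otimes>\<^bsub>H\<^esub> z)"
      if "z \<in> carrier H" for z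
    proof -
      have "a [^]\<^bsub>H\<^esub> i \<otimes>\<^bsub>H\<^esub> b \<otimes>\<^bsub>H\<^esub> (a [^]\<^bsub>H\<^esub> k \<otimes>\<^bsub>H\<^esub> z) = a [^]\<^bsub>H\<^esub> i \<otimes>\<^bsub>H\<^esub> (b \<otimes>\<^bsub>H\<^esub> a [^]\<^bsub>H\<^esub> k) \<otimes>\<^bsub>H\<^esub> z"
        using ab that by (simp add: H.m_assoc)
      also have "\<dots> = (a [^]\<^bsub>H\<^esub> i \<otimes>\<^bsub>H\<^esub> a [^]\<^bsub>H\<^esub> (- k)) \<otimes>\<^bsub>H\<^esub> (b \<otimes>\<^bsub>H\<^esub> z)"
        using ab that by (simp add: ba H.m_assoc)
      also have "a [^]\<^bsub>H\<^esub> i \<otimes>\<^bsub>H\<^esub> a [^]\<^bsub>H\<^esub> (- k) = a [^]\<^bsub>H\<^esub> (i - k)"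
        using ab H.int_pow_mult[of a i "- k"] by simp
      finally show ?thesis .
    qed
    have i1: "b [^]\<^bsub>H\<^esub> (1::int) = b" using ab by (simp add: H.int_pow_1)
    have i0: "b [^]\<^bsub>H\<^esub> (0::int) = \<one>\<^bsub>H\<^esub>" by simp
    have add: "a [^]\<^bsub>H\<^esub> m \<otimes>\<^bsub>H\<^esub> a [^]\<^bsub>H\<^esub> n = a [^]\<^bsub>H\<^esub> (m + n)" for m n :: int
      using ab by (simp add: H.int_pow_mult)
    show "f (g \<otimes>\<^bsub>Q8\<^esub> g') = f g \<otimes>\<^bsub>H\<^esub> f g'"
    proof (cases "j = 0")
      case True
      have "l mod 2 = l" using jl by auto
      then show ?thesis using ab True by (simp add: f_def ij Q8_mult pm i0 add[symmetric] H.m_assoc)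
    next
      case False
      then have j: "j = 1" using jl by simp
      show ?thesis
      proof (cases "l = 0")
        case True
        then show ?thesis using ab assoc[of "\<one>\<^bsub>H\<^esub>"] by (simp add: f_def ij Q8_mult pm i0 i1 j)
      next
        case False
        then have l: "l = 1" using jl by simp
        show ?thesis using ab assoc[of b]
          by (simp add: f_def ij Q8_mult pm i0 i1 j l b2 add)
      qed
    qed
  qed
  moreover have "f qx = a" "f qy = b" using ab by (simp_all add: f_def qx_def qy_def H.int_pow_1)
  moreover have "f' g = f g" if f': "f' \<in> hom Q8 H" "f' qx = a" "f' qy = b" and g: "g \<in> carrier Q8"
    for f' g
  proof -
    obtain i j where ij: "g = (i, j)" by fastforce
    have p: "f' (u [^]\<^bsub>Q8\<^esub> n) = f' u [^]\<^bsub>H\<^esub> n" if "u \<in> carrier Q8" for u and n :: nat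
      using f'(1) that hom_nat_pow[OF f'(1) that group_Q8 H] by simp
    have "f' g = f' (qx [^]\<^bsub>Q8\<^esub> nat i \<otimes>\<^bsub>Q8\<^esub> qy [^]\<^bsub>Q8\<^esub> nat j)"
      using Q8_normal_form g unfolding ij by metis
    also have "\<dots> = a [^]\<^bsub>H\<^esub> nat i \<otimes>\<^bsub>H\<^esub> b [^]\<^bsub>H\<^esub> nat j"
      using hom_mult[OF f'(1)] f'(2,3) p Q8_relations(1,2) Q.nat_pow_closed by metis
    also have "\<dots> = f g"
    proof -
      have "int (nat i) = i" "int (nat j) = j" using g by (auto simp: ij Q8_carrier)
      then show ?thesis unfolding f_def ij by (simp flip: int_pow_int)
    qed
    finally show ?thesis .
  qed
  ultimately show ?thesis by blast
qed

definition rho_dim :: "nat \<Rightarrow> nat" where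
  "rho_dim i = (if i = 5 then 2 else 1)"

definition rho_x :: "nat \<Rightarrow> complex mat" where
  "rho_x i = (if i = 5 then mat_of_rows_list 2 [[\<i>, 0], [0, - \<i>]]
              else mat_of_rows_list 1 [[if i \<in> {1, 2} then 1 else - 1]])"

definition rho_y :: "nat \<Rightarrow> complex mat" where
  "rho_y i = (if i = 5 then mat_of_rows_list 2 [[0, - 1], [1, 0]]
              else mat_of_rows_list 1 [[if i \<in> {1, 3} then 1 else - 1]])"

text \<open>The matrix of \<open>\<rho>\<^sub>i(x\<^sup>a y\<^sup>b)\<close>, for \<open>1 \<le> i \<le> 5\<close>.\<close>

definition rho :: "nat \<Rightarrow> int \<times> int \<Rightarrow> complex mat" where
  "rho i = (\<lambda>(a, b). rho_x i ^\<^sub>m nat a * rho_y i ^\<^sub>m nat b)"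

text \<open>\<open>\<phi>\<^sub>t(g\<^sup>k) = exp(t \<pi> \<i> k / 2)\<close>; for \<open>g\<close> of order 4 this does not depend on the
  exponent \<open>k\<close> representing a given element of \<open>\<langle>g\<rangle>\<close>.\<close>

definition phi :: "nat \<Rightarrow> int \<times> int \<Rightarrow> int \<times> int \<Rightarrow> complex" where
  "phi t g h =
     (let k = (LEAST k::nat. g [^]\<^bsub>Q8\<^esub> k = h)
      in exp (of_nat t * of_real pi * \<i> * of_nat k / 2))"

definition M_rho ::
  "int \<times> int \<Rightarrow> nat \<Rightarrow>
     (int \<times> int, (((int \<times> int) \<times> complex vec) \<Rightarrow>\<^sub>0 complex) set) yd_struct" where
  "M_rho g i = yd_induced Q8 g (module_vec TYPE(complex) (rho_dim i)) (\<lambda>h v. rho i h *\<^sub>v v)"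

definition M_phi ::
  "int \<times> int \<Rightarrow> nat \<Rightarrow>
     (int \<times> int, (((int \<times> int) \<times> complex vec) \<Rightarrow>\<^sub>0 complex) set) yd_struct" where
  "M_phi g t = yd_induced Q8 g (module_vec TYPE(complex) 1) (\<lambda>h v. phi t g h \<cdot>\<^sub>v v)"

end

theory Submission
  imports Defs "HOL-Library.List_Lexorder"
begin

text \<open>
  Every finite-dimensional irreducible Yetter--Drinfeld module \<open>V\<close> over the quaternion group
  admits a basis of homogeneous vectors on which the degrees act diagonally, say
  \<open>g\<^sub>b \<cdot> a = \<chi>(b, a) a\<close> for basis vectors \<open>a, b\<close> with \<open>g\<^sub>b\<close> the degree of \<open>b\<close>.  The Nichols algebra is
  then determined by the matrix \<open>\<chi>\<close>, and finiteness of the Gelfand--Kirillov dimension can be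
  read off from \<open>\<chi>\<close> in the two cases that occur.

  For diagonal braidings the ideal \<open>I(V)\<close> consists of the elements
  of \<open>T(V)\<close> all of whose iterated skew derivatives have zero constant term.  Applying the
  derivations \<open>\<partial>\<^sub>b\<close> along the letters of a word \<open>w\<close> and taking the constant term gives a linear form
  \<open>phi_word \<chi> w\<close>; all these forms together map \<open>T(V)\<close> to functions on words, and this map is
  multiplicative for the quantum shuffle product (\<open>phi_tmul\<close>).  Its kernel is
  a coideal, because the coproduct corresponds to cutting words into two pieces (\<open>phi_pair_cop\<close>), and
  it contains every coideal in degrees at least two, because such a coideal is stable under the \<open>\<partial>\<^sub>b\<close>
  (\<open>nichols_ideal_eq\<close>).

  If \<open>\<chi>\<close> is constant with value \<open>1\<close> or \<open>-1\<close>, any two basis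
  vectors commute up to this sign in the Nichols algebra, which is a symmetric or an exterior algebra.
  Products of \<open>n\<close> elements of a fixed finite-dimensional subspace are spanned by polynomially many
  sorted words (\<open>GKdim_finite_if_sign\<close>).

  The other case is \<open>B = {x, y}\<close> with
  \<open>\<chi>(x, x) = \<chi>(y, y) = q\<close>, \<open>\<chi>(x, y) = \<chi>(y, x) = 1/q\<close> and \<open>q\<^sup>2 \<noteq> 1\<close>, the braiding of affine
  Cartan type \<open>A\<^sub>1\<close>.  In the shuffle algebra let \<open>X\<^sub>0 = x\<close> and let
  \<open>X\<^sub>n\<^sub>+\<^sub>1\<close> be the commutator of the word \<open>xy\<close> with \<open>X\<^sub>n\<close>; these are root vectors for the infinitely many real
  roots \<open>\<alpha> + n\<delta>\<close>.  All words in \<open>X\<^sub>n\<close> have partial sums \<open>#x - #y\<close> that stay positive, and the word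
  \<open>x (xy)\<^sup>n\<close> occurs with coefficient \<open>(1/q - q)\<^sup>n \<noteq> 0\<close>.  Comparing the words
  \<open>x (xy)^m\<^sub>1 x (xy)^m\<^sub>2 \<dots>\<close> lexicographically shows that the products
  \<open>X(m\<^sub>1) X(m\<^sub>2) \<dots>\<close> with \<open>m\<^sub>1 > m\<^sub>2 > \<dots>\<close> are linearly independent (\<open>shuf_prod_triangular\<close>).  Products of
  \<open>D\<close> root vectors with indices below \<open>D M\<close> have degree linear in \<open>M\<close>, and there are at least
  \<open>M\<^sup>D\<close> of them; hence the dimension exceeds every \<open>D\<close>.

  An irreducible \<open>V\<close> is spanned by the orbit of any nonzero
  homogeneous vector.  If the degree is central, a simultaneous eigenvector argument for \<open>x\<close> and \<open>y\<close>
  inside the homogeneous component produces a copy of one of the \<open>\<rho>\<^sub>i\<close>; if it is one of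
  \<open>x, y, xy\<close> or an inverse, an eigenvector of that degree produces some \<open>\<phi>\<^sub>t\<close>.  In either case \<open>V\<close> is
  the induced module (\<open>induced_isomorphic\<close>).  Central degrees act by \<open>1\<close> or \<open>-1\<close>, and so do all
  degrees for \<open>\<phi>\<^sub>0\<close> and \<open>\<phi>\<^sub>2\<close>.  For \<open>\<phi>\<^sub>1\<close> and \<open>\<phi>\<^sub>3\<close> the two basis vectors have mutually
  inverse degrees, and \<open>\<chi>\<close> is the affine matrix above with \<open>q\<close> a primitive fourth root of unity.
\<close>

section \<open>Linear maps between free vector spaces\<close>

abbreviation scale :: "complex \<Rightarrow> ('s \<Rightarrow>\<^sub>0 complex) \<Rightarrow> ('s \<Rightarrow>\<^sub>0 complex)" where
  "scale c \<equiv> Poly_Mapping.map ((*) c)"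

lemma lookup_scale [simp]: "Poly_Mapping.lookup (scale c f) k = c * Poly_Mapping.lookup f k"
  by transfer (simp add: when_def)

lemma scale_simps [simp]:
  "scale c (Poly_Mapping.single s d) = Poly_Mapping.single s (c * d)"
  "scale c 0 = 0" "scale 0 f = 0" "scale 1 f = f" "scale c (scale d f) = scale (c * d) f"
  by (rule poly_mapping_eqI; simp add: lookup_single when_def)+

lemma map_ident_poly [simp]: "Poly_Mapping.map (\<lambda>a. a) f = (f :: 's \<Rightarrow>\<^sub>0 complex)"
  by (rule poly_mapping_eqI, transfer) (simp add: when_def)

lemma scale_distrib:
  "scale c (f + g) = scale c f + scale c g" "scale (c + d) f = scale c f + scale d f"
  "scale c (f - g) = scale c f - scale c g" "scale c (- f) = - scale c f"
  by (rule poly_mapping_eqI; simp add: lookup_add lookup_minus algebra_simps)+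

lemma scale_minus1 [simp]: "scale (- 1) f = - f"
  by (rule poly_mapping_eqI) simp

lemma scale_sum: "scale c (sum f A) = (\<Sum>a\<in>A. scale c (f a))"
  by (rule poly_mapping_eqI) (simp add: lookup_sum sum_distrib_left)

lemma keys_scale: "Poly_Mapping.keys (scale c f) \<subseteq> Poly_Mapping.keys f"
  by (auto simp: in_keys_iff)

definition lin_map :: "(('s \<Rightarrow>\<^sub>0 complex) \<Rightarrow> ('t \<Rightarrow>\<^sub>0 complex)) \<Rightarrow> bool" where
  "lin_map F \<longleftrightarrow> (\<forall>p q. F (p + q) = F p + F q) \<and> (\<forall>c p. F (scale c p) = scale c (F p))"

definition lin_form :: "(('s \<Rightarrow>\<^sub>0 complex) \<Rightarrow> complex) \<Rightarrow> bool" where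
  "lin_form F \<longleftrightarrow> (\<forall>p q. F (p + q) = F p + F q) \<and> (\<forall>c p. F (scale c p) = c * F p)"

lemma lin_mapD:
  assumes "lin_map F"
  shows "F (p + q) = F p + F q" "F (scale c p) = scale c (F p)" "F 0 = 0" "F (- p) = - F p"
    "F (p - q) = F p - F q" "F (sum h A) = (\<Sum>a\<in>A. F (h a))"
proof -
  show 1: "F (p + q) = F p + F q" "F (scale c p) = scale c (F p)" for p q c
    using assms by (auto simp: lin_map_def)
  show 0: "F 0 = 0" using 1(2)[of 0 0] by simp
  show 2: "F (- p) = - F p" for p using 1(2)[of "-1" p] by simp
  show "F (p - q) = F p - F q" using 1(1)[of p "- q"] 2 by simp
  show "F (sum h A) = (\<Sum>a\<in>A. F (h a))"
    by (induction A rule: infinite_finite_induct) (simp_all add: 0 1)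
qed

lemma lin_formD:
  assumes "lin_form F"
  shows "F (p + q) = F p + F q" "F (scale c p) = c * F p" "F 0 = 0" "F (- p) = - F p"
    "F (p - q) = F p - F q" "F (sum h A) = (\<Sum>a\<in>A. F (h a))"
proof -
  show 1: "F (p + q) = F p + F q" "F (scale c p) = c * F p" for p q c
    using assms by (auto simp: lin_form_def)
  show 0: "F 0 = 0" using 1(2)[of 0 0] by simp
  show 2: "F (- p) = - F p" for p using 1(2)[of "-1" p] by simp
  show "F (p - q) = F p - F q" using 1(1)[of p "- q"] 2 by simp
  show "F (sum h A) = (\<Sum>a\<in>A. F (h a))"
    by (induction A rule: infinite_finite_induct) (simp_all add: 0 1)
qed

lemma poly_mapping_sum_singles:
  "f = (\<Sum>s\<in>Poly_Mapping.keys f. scale (Poly_Mapping.lookup f s) (bvec s))"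
  by (rule poly_mapping_eqI)
    (auto simp: lookup_sum lookup_single when_def in_keys_iff intro!: sum.neutral)

lemma free_induct [consumes 1, case_names zero add single]:
  fixes f :: "'s \<Rightarrow>\<^sub>0 complex"
  assumes "Poly_Mapping.keys f \<subseteq> S"
    and "P 0" "\<And>f g. P f \<Longrightarrow> P g \<Longrightarrow> P (f + g)" "\<And>s c. s \<in> S \<Longrightarrow> P (Poly_Mapping.single s c)"
  shows "P f"
proof -
  have "P (\<Sum>s\<in>A. scale (Poly_Mapping.lookup f s) (bvec s))" if "finite A" "A \<subseteq> S" for A
    using that by (induction A) (simp_all add: assms)
  from this[OF finite_keys assms(1)] show ?thesis by (subst poly_mapping_sum_singles)
qed

lemma lin_map_eqI:
  assumes "lin_map F" "lin_map G" "Poly_Mapping.keys p \<subseteq> S" "\<And>s. s \<in> S \<Longrightarrow> F (bvec s) = G (bvec s)"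
  shows "F p = G p"
  using assms(3)
proof (induction rule: free_induct)
  case (single s c)
  then show ?case using lin_mapD(2)[OF assms(1), of c "bvec s"] lin_mapD(2)[OF assms(2), of c "bvec s"] assms(4)
    by simp
qed (simp_all add: lin_mapD[OF assms(1)] lin_mapD[OF assms(2)])

lemma lin_form_eqI:
  assumes "lin_form F" "lin_form G" "Poly_Mapping.keys p \<subseteq> S" "\<And>s. s \<in> S \<Longrightarrow> F (bvec s) = G (bvec s)"
  shows "F p = G p"
  using assms(3)
proof (induction rule: free_induct)
  case (single s c)
  then show ?case using lin_formD(2)[OF assms(1), of c "bvec s"] lin_formD(2)[OF assms(2), of c "bvec s"] assms(4)
    by simp
qed (simp_all add: lin_formD[OF assms(1)] lin_formD[OF assms(2)])

lemma lin_map_eqI':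
  "lin_map F \<Longrightarrow> lin_map G \<Longrightarrow> (\<And>s. F (bvec s) = G (bvec s)) \<Longrightarrow> F p = G p"
  by (rule lin_map_eqI[of F G p UNIV]) simp_all

lemma lin_form_eqI':
  "lin_form F \<Longrightarrow> lin_form G \<Longrightarrow> (\<And>s. F (bvec s) = G (bvec s)) \<Longrightarrow> F p = G p"
  by (rule lin_form_eqI[of F G p UNIV]) simp_all

lemma lookup_lin_ext:
  assumes "finite A" "Poly_Mapping.keys f \<subseteq> A"
  shows "lin_ext \<phi> f = (\<Sum>s\<in>A. scale (Poly_Mapping.lookup f s) (\<phi> s))"
  unfolding lin_ext_def by (rule sum.mono_neutral_left) (use assms in \<open>auto simp: in_keys_iff\<close>)

lemma lin_map_lin_ext: "lin_map (lin_ext \<phi>)"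
  unfolding lin_map_def
proof (intro conjI allI)
  fix p q :: "'a \<Rightarrow>\<^sub>0 complex" and c
  let ?A = "Poly_Mapping.keys p \<union> Poly_Mapping.keys q \<union> Poly_Mapping.keys (p + q) \<union> Poly_Mapping.keys (scale c p)"
  have A: "finite ?A" by simp
  show "lin_ext \<phi> (p + q) = lin_ext \<phi> p + lin_ext \<phi> q"
    by (subst (1 2 3) lookup_lin_ext[OF A]) (auto simp: lookup_add scale_distrib sum.distrib)
  show "lin_ext \<phi> (scale c p) = scale c (lin_ext \<phi> p)"
    by (subst (1 2) lookup_lin_ext[OF A]) (auto simp: scale_sum)
qed

lemmas lin_ext_simps = lin_mapD[OF lin_map_lin_ext]

lemma lin_ext_single [simp]: "lin_ext \<phi> (Poly_Mapping.single s c) = scale c (\<phi> s)"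
  by (subst lookup_lin_ext[of "{s}"]) auto

lemma lin_ext_cong: "(\<And>s. s \<in> Poly_Mapping.keys f \<Longrightarrow> \<phi> s = \<psi> s) \<Longrightarrow> lin_ext \<phi> f = lin_ext \<psi> f"
  unfolding lin_ext_def by simp

lemma keys_minus:
  "Poly_Mapping.keys (f - g) \<subseteq> Poly_Mapping.keys f \<union> Poly_Mapping.keys (g :: 's \<Rightarrow>\<^sub>0 complex)"
  by (auto simp: in_keys_iff lookup_minus)

lemma keys_sum_subset: "(\<And>a. a \<in> A \<Longrightarrow> Poly_Mapping.keys (h a) \<subseteq> S) \<Longrightarrow> Poly_Mapping.keys (sum h A) \<subseteq> S"
proof (induction A rule: infinite_finite_induct)
  case (insert a A)
  then show ?case using Poly_Mapping.keys_add[of "h a" "sum h A"] by auto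
qed auto

lemma keys_lin_ext:
  assumes "\<And>s. s \<in> Poly_Mapping.keys f \<Longrightarrow> Poly_Mapping.keys (\<phi> s) \<subseteq> T"
  shows "Poly_Mapping.keys (lin_ext \<phi> f) \<subseteq> T"
  unfolding lin_ext_def by (rule keys_sum_subset) (rule order.trans[OF keys_scale assms])

lemma keys_closed:
  fixes f g :: "'s \<Rightarrow>\<^sub>0 complex"
  shows "Poly_Mapping.keys f \<subseteq> S \<Longrightarrow> Poly_Mapping.keys g \<subseteq> S \<Longrightarrow> Poly_Mapping.keys (f + g) \<subseteq> S"
  "Poly_Mapping.keys f \<subseteq> S \<Longrightarrow> Poly_Mapping.keys g \<subseteq> S \<Longrightarrow> Poly_Mapping.keys (f - g) \<subseteq> S"
  "Poly_Mapping.keys f \<subseteq> S \<Longrightarrow> Poly_Mapping.keys (scale c f) \<subseteq> S"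
  using Poly_Mapping.keys_add[of f g] keys_scale[of c f] keys_minus[of f g] by blast+

lemma bilin_ext_single_left [simp]:
  "bilin_ext \<beta> (Poly_Mapping.single s c) h = scale c (lin_ext (\<beta> s) h)"
  by (simp add: bilin_ext_def)

lemma lin_map_bilin_ext_left: "lin_map (\<lambda>f. bilin_ext \<beta> f h)"
  unfolding bilin_ext_def by (rule lin_map_lin_ext)

lemma lin_map_bilin_ext_right: "lin_map (bilin_ext \<beta> f)"
  unfolding lin_map_def
proof (intro conjI allI)
  show "bilin_ext \<beta> f (p + q) = bilin_ext \<beta> f p + bilin_ext \<beta> f q" for p q
    unfolding bilin_ext_def lin_ext_def[of _ f] by (simp add: lin_ext_simps scale_distrib sum.distrib)
  show "bilin_ext \<beta> f (scale c p) = scale c (bilin_ext \<beta> f p)" for p c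
    unfolding bilin_ext_def lin_ext_def[of _ f] by (simp add: lin_ext_simps scale_sum mult.commute)
qed

lemmas bilin_ext_simps = lin_mapD[OF lin_map_bilin_ext_left] lin_mapD[OF lin_map_bilin_ext_right]

lemma keys_bilin_ext:
  assumes "\<And>s t. s \<in> Poly_Mapping.keys f \<Longrightarrow> t \<in> Poly_Mapping.keys h \<Longrightarrow> Poly_Mapping.keys (\<beta> s t) \<subseteq> T"
  shows "Poly_Mapping.keys (bilin_ext \<beta> f h) \<subseteq> T"
  unfolding bilin_ext_def by (intro keys_lin_ext assms)

lemma lin_map_comp: "lin_map F \<Longrightarrow> lin_map G \<Longrightarrow> lin_map (\<lambda>p. F (G p))"
  by (simp add: lin_map_def)

lemma lin_map_scale: "lin_map F \<Longrightarrow> lin_map (\<lambda>p. scale c (F p))"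
  by (simp add: lin_map_def scale_distrib mult.commute)

lemma lin_map_add: "lin_map F \<Longrightarrow> lin_map G \<Longrightarrow> lin_map (\<lambda>p. F p + G p)"
  by (simp add: lin_map_def scale_distrib)

lemma lin_map_id: "lin_map (\<lambda>p. p)"
  by (simp add: lin_map_def)

lemma lin_form_comp: "lin_form F \<Longrightarrow> lin_map G \<Longrightarrow> lin_form (\<lambda>p. F (G p))"
  by (simp add: lin_map_def lin_form_def)

lemma lin_form_lookup: "lin_form (\<lambda>p. Poly_Mapping.lookup p s)"
  by (simp add: lin_form_def lookup_add)

lemma lin_form_scale: "lin_form F \<Longrightarrow> lin_form (\<lambda>p. c * F p)"
  by (simp add: lin_form_def algebra_simps)

lemma lin_form_zero: "lin_form (\<lambda>_. 0)"
  by (simp add: lin_form_def)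

definition form_ext :: "('s \<Rightarrow> complex) \<Rightarrow> ('s \<Rightarrow>\<^sub>0 complex) \<Rightarrow> complex" where
  "form_ext \<psi> f = (\<Sum>s\<in>Poly_Mapping.keys f. Poly_Mapping.lookup f s * \<psi> s)"

lemma form_ext_superset:
  assumes "finite A" "Poly_Mapping.keys f \<subseteq> A"
  shows "form_ext \<psi> f = (\<Sum>s\<in>A. Poly_Mapping.lookup f s * \<psi> s)"
  unfolding form_ext_def by (rule sum.mono_neutral_left) (use assms in \<open>auto simp: in_keys_iff\<close>)

lemma form_ext_single [simp]: "form_ext \<psi> (Poly_Mapping.single s c) = c * \<psi> s"
  by (subst form_ext_superset[of "{s}"]) auto

lemma lin_form_form_ext: "lin_form (form_ext \<psi>)"
  unfolding lin_form_def
proof (intro conjI allI)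
  fix p q :: "'a \<Rightarrow>\<^sub>0 complex" and c
  let ?A = "Poly_Mapping.keys p \<union> Poly_Mapping.keys q \<union> Poly_Mapping.keys (p + q) \<union> Poly_Mapping.keys (scale c p)"
  have A: "finite ?A" by simp
  show "form_ext \<psi> (p + q) = form_ext \<psi> p + form_ext \<psi> q"
    by (subst (1 2 3) form_ext_superset[OF A]) (auto simp: lookup_add algebra_simps sum.distrib)
  show "form_ext \<psi> (scale c p) = c * form_ext \<psi> p"
    by (subst (1 2) form_ext_superset[OF A]) (auto simp: sum_distrib_left mult.assoc)
qed

lemmas form_ext_simps = lin_formD[OF lin_form_form_ext]

section \<open>Subspaces, quotients and dimensions\<close>

lemma vectorspace_CC_I:
  fixes M :: "(complex, 'a, 'm) module_scheme"
  assumes "abelian_group M"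
    and "\<And>c v. v \<in> carrier M \<Longrightarrow> c \<odot>\<^bsub>M\<^esub> v \<in> carrier M"
    and "\<And>c d v. v \<in> carrier M \<Longrightarrow> (c + d) \<odot>\<^bsub>M\<^esub> v = c \<odot>\<^bsub>M\<^esub> v \<oplus>\<^bsub>M\<^esub> d \<odot>\<^bsub>M\<^esub> v"
    and "\<And>c v w. v \<in> carrier M \<Longrightarrow> w \<in> carrier M \<Longrightarrow> c \<odot>\<^bsub>M\<^esub> (v \<oplus>\<^bsub>M\<^esub> w) = c \<odot>\<^bsub>M\<^esub> v \<oplus>\<^bsub>M\<^esub> c \<odot>\<^bsub>M\<^esub> w"
    and "\<And>c d v. v \<in> carrier M \<Longrightarrow> (c * d) \<odot>\<^bsub>M\<^esub> v = c \<odot>\<^bsub>M\<^esub> (d \<odot>\<^bsub>M\<^esub> v)"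
    and "\<And>v. v \<in> carrier M \<Longrightarrow> 1 \<odot>\<^bsub>M\<^esub> v = v"
  shows "vectorspace CC M"
proof -
  have "module CC M"
    by (rule moduleI) (simp_all add: assms class_cring.cring_axioms)
  then show ?thesis unfolding vectorspace_def using class_field by auto
qed

lemma CC_smult:
  assumes "vectorspace CC M" "v \<in> carrier M"
  shows "0 \<odot>\<^bsub>M\<^esub> v = \<zero>\<^bsub>M\<^esub>" "1 \<odot>\<^bsub>M\<^esub> v = v" "c \<odot>\<^bsub>M\<^esub> v \<in> carrier M" "c \<odot>\<^bsub>M\<^esub> \<zero>\<^bsub>M\<^esub> = \<zero>\<^bsub>M\<^esub>"
    "(c + d) \<odot>\<^bsub>M\<^esub> v = c \<odot>\<^bsub>M\<^esub> v \<oplus>\<^bsub>M\<^esub> d \<odot>\<^bsub>M\<^esub> v" "c \<odot>\<^bsub>M\<^esub> (d \<odot>\<^bsub>M\<^esub> v) = (c * d) \<odot>\<^bsub>M\<^esub> v"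
    "w \<in> carrier M \<Longrightarrow> c \<odot>\<^bsub>M\<^esub> (v \<oplus>\<^bsub>M\<^esub> w) = c \<odot>\<^bsub>M\<^esub> v \<oplus>\<^bsub>M\<^esub> c \<odot>\<^bsub>M\<^esub> w"
    "(- 1) \<odot>\<^bsub>M\<^esub> v = \<ominus>\<^bsub>M\<^esub> v"
proof -
  interpret vectorspace CC M by (rule assms)
  note v = assms(2)
  show 0: "0 \<odot>\<^bsub>M\<^esub> v = \<zero>\<^bsub>M\<^esub>" using lmult_0[OF v] by simp
  show 1: "1 \<odot>\<^bsub>M\<^esub> v = v" using smult_one[OF v] by simp
  show "c \<odot>\<^bsub>M\<^esub> v \<in> carrier M" using smult_closed[of c v] v by simp
  show "c \<odot>\<^bsub>M\<^esub> \<zero>\<^bsub>M\<^esub> = \<zero>\<^bsub>M\<^esub>" using rmult_0[of c] by simp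
  show a: "(c + d) \<odot>\<^bsub>M\<^esub> v = c \<odot>\<^bsub>M\<^esub> v \<oplus>\<^bsub>M\<^esub> d \<odot>\<^bsub>M\<^esub> v" for c d using smult_l_distr[of c d v] v by simp
  show "c \<odot>\<^bsub>M\<^esub> (d \<odot>\<^bsub>M\<^esub> v) = (c * d) \<odot>\<^bsub>M\<^esub> v" using smult_assoc1[of c d v] v by simp
  show "w \<in> carrier M \<Longrightarrow> c \<odot>\<^bsub>M\<^esub> (v \<oplus>\<^bsub>M\<^esub> w) = c \<odot>\<^bsub>M\<^esub> v \<oplus>\<^bsub>M\<^esub> c \<odot>\<^bsub>M\<^esub> w"
    using smult_r_distr[of c v w] v by simp
  have "(- 1) \<odot>\<^bsub>M\<^esub> v \<oplus>\<^bsub>M\<^esub> v = \<zero>\<^bsub>M\<^esub>" using a[of "- 1" 1] 0 1 by simp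
  then show "(- 1) \<odot>\<^bsub>M\<^esub> v = \<ominus>\<^bsub>M\<^esub> v" using minus_equality v smult_closed[of "- 1" v] by auto
qed

lemma csubspaceI:
  assumes "vectorspace CC M" "N \<subseteq> carrier M" "\<zero>\<^bsub>M\<^esub> \<in> N"
    "\<And>v w. v \<in> N \<Longrightarrow> w \<in> N \<Longrightarrow> v \<oplus>\<^bsub>M\<^esub> w \<in> N" "\<And>c v. v \<in> N \<Longrightarrow> c \<odot>\<^bsub>M\<^esub> v \<in> N"
  shows "csubspace N M"
  unfolding subspace_def submodule_def using assms(1,2,3) by (simp add: vectorspace_def assms(4,5))

lemma csubspaceD:
  assumes "csubspace N M"
  shows "vectorspace CC M" "N \<subseteq> carrier M" "\<zero>\<^bsub>M\<^esub> \<in> N"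
    "v \<in> N \<Longrightarrow> w \<in> N \<Longrightarrow> v \<oplus>\<^bsub>M\<^esub> w \<in> N" "v \<in> N \<Longrightarrow> c \<odot>\<^bsub>M\<^esub> v \<in> N"
  using assms unfolding subspace_def submodule_def by simp_all

lemma cspan_closed:
  assumes "vectorspace CC M" "S \<subseteq> carrier M"
  shows "csubspace (cspan M S) M" "S \<subseteq> cspan M S"
  using vectorspace.span_is_subspace[OF assms] module.in_own_span[of CC M S] assms
  by (auto simp: vectorspace_def)

lemma cspan_least:
  assumes "csubspace N M" "S \<subseteq> N"
  shows "cspan M S \<subseteq> N"
  using module.span_is_subset[of CC M S N] assms by (auto simp: subspace_def vectorspace_def)

text \<open>The free space, the tensor algebra, its tensor square and the free space underlying an induced module
  carry the same vector space structure and differ in the set of basis symbols and in the multiplication.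
  The predicate isolates the vector space structure, so that facts about subspaces and quotients apply to
  all of them.\<close>

definition free_like :: "(complex, 's \<Rightarrow>\<^sub>0 complex, 'm) module_scheme \<Rightarrow> 's set \<Rightarrow> bool" where
  "free_like M S \<longleftrightarrow> carrier M = {f. Poly_Mapping.keys f \<subseteq> S} \<and> zero M = 0 \<and> add M = (+) \<and> smult M = scale"

lemma free_likeD:
  assumes "free_like M S"
  shows "p \<in> carrier M \<longleftrightarrow> Poly_Mapping.keys p \<subseteq> S" "\<zero>\<^bsub>M\<^esub> = 0" "p \<oplus>\<^bsub>M\<^esub> q = p + q" "c \<odot>\<^bsub>M\<^esub> p = scale c p"
  using assms by (auto simp: free_like_def)

lemma free_like_space: "free_like (free_space S) S" "free_like (tensor_algebra B) (lists B)"
  "free_like (tensor_square G V B) (lists B \<times> lists B)" "free_like (induced_free H W) (carrier H \<times> carrier W)"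
  by (auto simp: free_like_def free_space_def tensor_algebra_def tensor_square_def induced_free_def)

lemma free_like_vectorspace:
  assumes "free_like M S"
  shows "vectorspace CC M"
proof (rule vectorspace_CC_I)
  note f = free_likeD[OF assms]
  show "abelian_group M"
  proof (rule abelian_groupI)
    fix v assume v: "v \<in> carrier M"
    show "\<exists>w\<in>carrier M. w \<oplus>\<^bsub>M\<^esub> v = \<zero>\<^bsub>M\<^esub>"
      by (rule bexI[of _ "- v"]) (use v in \<open>simp_all add: f\<close>)
  qed (simp_all add: f keys_closed add.assoc add.commute)
qed (simp_all add: free_likeD[OF assms] keys_closed scale_distrib)

lemma free_like_subspaceI:
  assumes "free_like M S" "\<And>p. p \<in> N \<Longrightarrow> Poly_Mapping.keys p \<subseteq> S" "0 \<in> N"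
    "\<And>p q. p \<in> N \<Longrightarrow> q \<in> N \<Longrightarrow> p + q \<in> N" "\<And>c p. p \<in> N \<Longrightarrow> scale c p \<in> N"
  shows "csubspace N M"
proof (rule csubspaceI[OF free_like_vectorspace[OF assms(1)]])
  show "N \<subseteq> carrier M" using assms(2) free_likeD(1)[OF assms(1)] by blast
  show "\<zero>\<^bsub>M\<^esub> \<in> N" using assms(3) free_likeD(2)[OF assms(1)] by simp
  show "v \<oplus>\<^bsub>M\<^esub> w \<in> N" if "v \<in> N" "w \<in> N" for v w
    using assms(4)[OF that] free_likeD(3)[OF assms(1)] by simp
  show "c \<odot>\<^bsub>M\<^esub> v \<in> N" if "v \<in> N" for c v
    using assms(5)[OF that] free_likeD(4)[OF assms(1)] by simp
qed

lemma free_like_subspaceD: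
  assumes "free_like M S" "csubspace N M"
  shows "p \<in> N \<Longrightarrow> Poly_Mapping.keys p \<subseteq> S" "0 \<in> N"
    "p \<in> N \<Longrightarrow> q \<in> N \<Longrightarrow> p + q \<in> N" "p \<in> N \<Longrightarrow> scale c p \<in> N" "p \<in> N \<Longrightarrow> - p \<in> N"
    "p \<in> N \<Longrightarrow> q \<in> N \<Longrightarrow> p - q \<in> N" "(\<And>a. a \<in> A \<Longrightarrow> h a \<in> N) \<Longrightarrow> sum h A \<in> N"
proof -
  note d = csubspaceD[OF assms(2)] and f = free_likeD[OF assms(1)]
  show "p \<in> N \<Longrightarrow> Poly_Mapping.keys p \<subseteq> S" using d(2) f(1)[of p] by auto
  show 0: "0 \<in> N" using d(3) f(2) by simp
  show a: "p \<in> N \<Longrightarrow> q \<in> N \<Longrightarrow> p + q \<in> N" "p \<in> N \<Longrightarrow> scale c p \<in> N" for p q c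
    using d(4)[of p q] d(5)[of p c] f(3)[of p q] f(4)[of c p] by simp_all
  show n: "p \<in> N \<Longrightarrow> - p \<in> N" for p using a(2)[of p "-1"] by simp
  show "p \<in> N \<Longrightarrow> q \<in> N \<Longrightarrow> p - q \<in> N" using a(1)[of p "- q"] n[of q] by simp
  show "(\<And>a. a \<in> A \<Longrightarrow> h a \<in> N) \<Longrightarrow> sum h A \<in> N"
    by (induction A rule: infinite_finite_induct) (simp_all add: 0 a)
qed

lemma coset_elements: "free_like M S \<Longrightarrow> N +>\<^bsub>M\<^esub> p = {n + p | n. n \<in> N}"
  by (auto simp: a_r_coset_def' free_likeD)

lemma coset_eq_iff:
  assumes M: "free_like M S" "csubspace N M"
  shows "N +>\<^bsub>M\<^esub> p = N +>\<^bsub>M\<^esub> q \<longleftrightarrow> p - q \<in> N"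
proof
  assume "N +>\<^bsub>M\<^esub> p = N +>\<^bsub>M\<^esub> q"
  moreover have "0 + p \<in> N +>\<^bsub>M\<^esub> p"
    using free_like_subspaceD(2)[OF M] by (auto simp: coset_elements[OF M(1)])
  ultimately obtain n where "n \<in> N" "0 + p = n + q" by (auto simp: coset_elements[OF M(1)])
  then show "p - q \<in> N" by (simp add: algebra_simps)
next
  assume n: "p - q \<in> N"
  have "n + p \<in> {n + q |n. n \<in> N}" if "n \<in> N" for n
    by (rule CollectI, rule exI[of _ "n + (p - q)"]) (simp add: free_like_subspaceD(3)[OF M that n])
  moreover have "n + q \<in> {n + p |n. n \<in> N}" if "n \<in> N" for n
    by (rule CollectI, rule exI[of _ "n - (p - q)"]) (simp add: free_like_subspaceD(6)[OF M that n])
  ultimately show "N +>\<^bsub>M\<^esub> p = N +>\<^bsub>M\<^esub> q" unfolding coset_elements[OF M(1)] by blast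
qed

context
  fixes M :: "(complex, 's \<Rightarrow>\<^sub>0 complex, 'm) module_scheme" and S N
  assumes M: "free_like M S" and N: "csubspace N M"
begin

private lemma NI: "0 \<in> N" "p \<in> N \<Longrightarrow> q \<in> N \<Longrightarrow> p + q \<in> N" "p \<in> N \<Longrightarrow> scale c p \<in> N"
  "p \<in> N \<Longrightarrow> q \<in> N \<Longrightarrow> p - q \<in> N"
  by (simp_all add: free_like_subspaceD[OF M N])

lemma quotient_carrier: "carrier (quotient_module M N) = (\<lambda>p. N +>\<^bsub>M\<^esub> p) ` {p. Poly_Mapping.keys p \<subseteq> S}"
  using M by (auto simp: quotient_module_simps A_RCOSETS_def' free_like_def)

lemma coset_zero: "N +>\<^bsub>M\<^esub> 0 = N"
  by (auto simp: coset_elements[OF M])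

lemma quotient_zero: "\<zero>\<^bsub>quotient_module M N\<^esub> = N +>\<^bsub>M\<^esub> 0"
  by (simp add: quotient_module_simps coset_zero)

lemma quotient_add: "(N +>\<^bsub>M\<^esub> p) \<oplus>\<^bsub>quotient_module M N\<^esub> (N +>\<^bsub>M\<^esub> q) = N +>\<^bsub>M\<^esub> (p + q)"
proof -
  have "(N +>\<^bsub>M\<^esub> p) \<oplus>\<^bsub>quotient_module M N\<^esub> (N +>\<^bsub>M\<^esub> q) = {(n + p) + (n' + q) | n n'. n \<in> N \<and> n' \<in> N}"
    by (auto simp: quotient_module_simps set_add_def' free_likeD[OF M] coset_elements[OF M])
  also have "\<dots> = {n + (p + q) |n. n \<in> N}"
  proof (intro equalityI subsetI)
    fix z assume "z \<in> {(n + p) + (n' + q) | n n'. n \<in> N \<and> n' \<in> N}"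
    then obtain n n' where n: "z = (n + p) + (n' + q)" "n \<in> N" "n' \<in> N" by blast
    then show "z \<in> {n + (p + q) |n. n \<in> N}"
      using NI(2)[OF n(2,3)] by (intro CollectI exI[of _ "n + n'"]) (simp add: algebra_simps)
  next
    fix z assume "z \<in> {n + (p + q) |n. n \<in> N}"
    then obtain n where n: "z = n + (p + q)" "n \<in> N" by blast
    then show "z \<in> {(n + p) + (n' + q) | n n'. n \<in> N \<and> n' \<in> N}"
      using NI(1) by (intro CollectI exI[of _ n] exI[of _ 0]) (simp add: algebra_simps)
  qed
  finally show ?thesis by (simp add: coset_elements[OF M])
qed

text \<open>Since \<open>F\<close> maps \<open>N\<close> into \<open>N\<close>, the image of a coset lies in one coset, and adding \<open>N\<close> fills it up.\<close>

lemma coset_map_coset: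
  assumes F: "\<And>p q. F (p + q) = F p + F q" "\<And>p. p \<in> N \<Longrightarrow> F p \<in> N"
  shows "coset_map M N F (N +>\<^bsub>M\<^esub> p) = N +>\<^bsub>M\<^esub> F p"
proof -
  have "F ` (N +>\<^bsub>M\<^esub> p) = (\<lambda>n. F n + F p) ` N"
    unfolding coset_elements[OF M] by (auto simp: F(1)[symmetric] intro!: imageI)
  then have "coset_map M N F (N +>\<^bsub>M\<^esub> p) = {n + (F n' + F p) | n n'. n \<in> N \<and> n' \<in> N}"
    by (auto simp: coset_map_def set_add_def' free_likeD[OF M])
  also have "\<dots> = {n + F p |n. n \<in> N}"
  proof (intro equalityI subsetI)
    fix z assume "z \<in> {n + (F n' + F p) | n n'. n \<in> N \<and> n' \<in> N}"
    then obtain n n' where n: "z = n + (F n' + F p)" "n \<in> N" "n' \<in> N" by blast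
    then show "z \<in> {n + F p |n. n \<in> N}"
      using NI(2)[OF n(2) F(2)[OF n(3)]] by (intro CollectI exI[of _ "n + F n'"]) (simp add: algebra_simps)
  next
    fix z assume "z \<in> {n + F p |n. n \<in> N}"
    then obtain n where n: "z = n + F p" "n \<in> N" by blast
    have F0: "F 0 = 0" using F(1)[of 0 0] by simp
    then show "z \<in> {n + (F n' + F p) | n n'. n \<in> N \<and> n' \<in> N}"
      using NI(1) n by (intro CollectI exI[of _ n] exI[of _ 0]) (simp add: algebra_simps)
  qed
  finally show ?thesis by (simp add: coset_elements[OF M])
qed

lemma quotient_smult: "c \<odot>\<^bsub>quotient_module M N\<^esub> (N +>\<^bsub>M\<^esub> p) = N +>\<^bsub>M\<^esub> scale c p"
proof -
  have "c \<odot>\<^bsub>quotient_module M N\<^esub> (N +>\<^bsub>M\<^esub> p) = coset_map M N (scale c) (N +>\<^bsub>M\<^esub> p)"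
    by (simp add: quotient_module_simps coset_map_def free_likeD[OF M])
  also have "\<dots> = N +>\<^bsub>M\<^esub> scale c p"
    by (rule coset_map_coset) (simp_all add: scale_distrib NI)
  finally show ?thesis .
qed

lemmas quotient_ops = quotient_zero quotient_add quotient_smult

lemma quotient_vectorspace: "vectorspace CC (quotient_module M N)"
proof (rule vectorspace_CC_I)
  show "abelian_group (quotient_module M N)"
  proof (rule abelian_groupI)
    fix v assume "v \<in> carrier (quotient_module M N)"
    then obtain p where p: "v = N +>\<^bsub>M\<^esub> p" "Poly_Mapping.keys p \<subseteq> S" by (auto simp: quotient_carrier)
    show "\<exists>w\<in>carrier (quotient_module M N). w \<oplus>\<^bsub>quotient_module M N\<^esub> v = \<zero>\<^bsub>quotient_module M N\<^esub>"
      by (rule bexI[of _ "N +>\<^bsub>M\<^esub> (- p)"]) (use p in \<open>auto simp: quotient_carrier quotient_ops\<close>)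
  qed (auto simp: quotient_carrier quotient_ops keys_closed ac_simps)
qed (auto simp: quotient_carrier quotient_ops keys_closed scale_distrib)

lemma quotient_in_span:
  assumes P: "P \<subseteq> carrier (quotient_module M N)"
    and w: "\<And>w. w \<in> T \<Longrightarrow> N +>\<^bsub>M\<^esub> bvec w \<in> cspan (quotient_module M N) P"
    and p: "Poly_Mapping.keys p \<subseteq> T"
  shows "N +>\<^bsub>M\<^esub> p \<in> cspan (quotient_module M N) P"
proof -
  note sp = csubspaceD[OF cspan_closed(1)[OF quotient_vectorspace P]]
  show ?thesis using p
  proof (induction rule: free_induct)
    case zero
    then show ?case using sp(3) by (simp add: quotient_zero)
  next
    case (add f g)
    then show ?case using sp(4)[of "N +>\<^bsub>M\<^esub> f" "N +>\<^bsub>M\<^esub> g"] by (simp add: quotient_add)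
  next
    case (single s c)
    then show ?case using sp(5)[OF w[OF single], of c] by (simp add: quotient_smult)
  qed
qed

lemma quotient_finsum:
  assumes "finite A" "\<And>a. a \<in> A \<Longrightarrow> Poly_Mapping.keys (h a) \<subseteq> S"
  shows "(\<Oplus>\<^bsub>quotient_module M N\<^esub>a\<in>A. N +>\<^bsub>M\<^esub> h a) = N +>\<^bsub>M\<^esub> (\<Sum>a\<in>A. h a)"
proof -
  interpret Q: vectorspace CC "quotient_module M N" by (rule quotient_vectorspace)
  show ?thesis using assms
  proof (induction A)
    case empty
    then show ?case by (simp add: quotient_zero)
  next
    case (insert a A)
    have "(\<lambda>a. N +>\<^bsub>M\<^esub> h a) \<in> A \<rightarrow> carrier (quotient_module M N)"
      "N +>\<^bsub>M\<^esub> h a \<in> carrier (quotient_module M N)"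
      using insert by (auto simp: quotient_carrier)
    then show ?case using insert by (simp add: quotient_add)
  qed
qed

text \<open>Lower bounds for dimensions in a quotient are obtained without choosing bases: it suffices to exhibit
  vectors no nontrivial combination of which falls into \<open>N\<close>.\<close>

lemma quotient_dim_ge:
  assumes I: "finite I" "\<And>i. i \<in> I \<Longrightarrow> Poly_Mapping.keys (v i) \<subseteq> S"
    and ind: "\<And>a. (\<Sum>i\<in>I. scale (a i) (v i)) \<in> N \<Longrightarrow> \<forall>i\<in>I. a i = 0"
    and W: "csubspace W (quotient_module M N)" "\<And>i. i \<in> I \<Longrightarrow> N +>\<^bsub>M\<^esub> v i \<in> W"
    and fd: "cfin_dim ((quotient_module M N)\<lparr>carrier := W\<rparr>)"
  shows "card I \<le> cdim ((quotient_module M N)\<lparr>carrier := W\<rparr>)"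
proof -
  let ?Q = "quotient_module M N" let ?pr = "\<lambda>i. N +>\<^bsub>M\<^esub> v i"
  interpret Q: vectorspace CC ?Q by (rule quotient_vectorspace)
  interpret W: vectorspace CC "?Q\<lparr>carrier := W\<rparr>" by (rule Q.subspace_is_vs[OF W(1)])
  have inj: "inj_on ?pr I"
  proof (rule inj_onI, rule ccontr)
    fix i j assume ij: "i \<in> I" "j \<in> I" "?pr i = ?pr j" "i \<noteq> j"
    define a :: "'a \<Rightarrow> complex" where "a k = (if k = i then 1 else if k = j then - 1 else 0)" for k
    have "(\<Sum>k\<in>I. scale (a k) (v k)) = (\<Sum>k\<in>{i, j}. scale (a k) (v k))"
      by (rule sum.mono_neutral_right) (use ij I(1) in \<open>auto simp: a_def\<close>)
    also have "\<dots> = v i - v j" using ij by (simp add: a_def)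
    also have "\<dots> \<in> N" using ij(3) by (simp add: coset_eq_iff[OF M N])
    finally show False using ind[of a] ij(1) by (auto simp: a_def)
  qed
  have "Q.lin_indpt (?pr ` I)"
  proof (rule Q.finite_lin_indpt2)
    show "finite (?pr ` I)" "?pr ` I \<subseteq> carrier ?Q" using I by (auto simp: quotient_carrier)
    fix a :: "('s \<Rightarrow>\<^sub>0 complex) set \<Rightarrow> complex"
    assume "Q.lincomb a (?pr ` I) = \<zero>\<^bsub>?Q\<^esub>"
    moreover have "Q.lincomb a (?pr ` I) = (\<Oplus>\<^bsub>?Q\<^esub>i\<in>I. a (?pr i) \<odot>\<^bsub>?Q\<^esub> ?pr i)"
      unfolding Q.lincomb_def
      by (rule Q.finsum_reindex) (use I inj in \<open>auto simp: quotient_carrier quotient_smult keys_closed\<close>)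
    moreover have "\<dots> = N +>\<^bsub>M\<^esub> (\<Sum>i\<in>I. scale (a (?pr i)) (v i))"
      unfolding quotient_smult by (rule quotient_finsum) (use I in \<open>auto simp: keys_closed\<close>)
    ultimately have "(\<Sum>i\<in>I. scale (a (?pr i)) (v i)) \<in> N"
      by (simp add: quotient_zero coset_eq_iff[OF M N])
    then show "\<forall>u\<in>?pr ` I. a u = \<zero>\<^bsub>CC\<^esub>" using ind[of "\<lambda>i. a (?pr i)"] by auto
  qed
  moreover have sub: "?pr ` I \<subseteq> W" using W(2) by auto
  ultimately have "W.lin_indpt (?pr ` I)"
    using Q.span_li_not_depend(2)[OF sub] W(1) by (simp add: subspace_def)
  then have "card (?pr ` I) \<le> W.dim" using W.li_le_dim(2)[OF fd] sub by simp
  then show ?thesis using card_image[OF inj] by simp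
qed

end

text \<open>An upper bound for \<open>dim W\<close> may use a spanning set \<open>P\<close> that is not contained in \<open>W\<close>: linearly
  independent subsets of \<open>W\<close> are independent in the span of \<open>P\<close>, hence have at most \<open>card P\<close> elements, and a
  maximal one is a basis.\<close>

lemma subspace_dim_le:
  assumes Z: "vectorspace CC Z" and W: "csubspace W Z" and P: "finite P" "P \<subseteq> carrier Z" "W \<subseteq> cspan Z P"
  shows "cfin_dim (Z\<lparr>carrier := W\<rparr>)" "cdim (Z\<lparr>carrier := W\<rparr>) \<le> card P"
proof -
  interpret Z: vectorspace CC Z by (rule Z)
  interpret W: vectorspace CC "Z\<lparr>carrier := W\<rparr>" by (rule Z.subspace_is_vs[OF W])
  have sP: "csubspace (cspan Z P) Z" using Z.span_is_subspace P(2) by blast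
  interpret S: vectorspace CC "Z\<lparr>carrier := cspan Z P\<rparr>" by (rule Z.subspace_is_vs[OF sP])
  have gen: "S.gen_set P"
    using Z.span_li_not_depend(1)[of P "cspan Z P"] Z.in_own_span[OF P(2)] sP by (simp add: subspace_def)
  have bound: "finite A \<and> card A \<le> card P" if A: "A \<subseteq> W" "W.lin_indpt A" for A
  proof -
    have "Z.lin_indpt A" using Z.span_li_not_depend(2)[OF A(1)] W A(2) by (simp add: subspace_def)
    then have li: "S.lin_indpt A"
      using Z.span_li_not_depend(2)[of A "cspan Z P"] sP A(1) P(3) by (auto simp: subspace_def)
    have f: "S.fin_dim" unfolding S.fin_dim_def using P(1) gen Z.in_own_span[OF P(2)] by auto
    have Ac: "A \<subseteq> carrier (Z\<lparr>carrier := cspan Z P\<rparr>)" using A(1) P(3) by auto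
    have "finite A" by (rule S.fin_dim_li_fin[OF f li Ac])
    then show ?thesis
      using S.li_smaller_than_gen[OF _ P(1) Ac _ li gen] Z.in_own_span[OF P(2)] by simp
  qed
  have "\<exists>A. finite A \<and> maximal A (\<lambda>S. S \<subseteq> carrier (Z\<lparr>carrier := W\<rparr>) \<and> W.lin_indpt S)"
  proof (rule maximal_exists)
    show "{} \<subseteq> carrier (Z\<lparr>carrier := W\<rparr>) \<and> W.lin_indpt {}" by (simp add: W.lin_dep_def)
  qed (use bound in auto)
  then obtain A where A: "finite A" "W.basis A" using W.max_li_is_basis by blast
  then have b: "W.gen_set A" "W.lin_indpt A" "A \<subseteq> W" by (auto simp: W.basis_def)
  then show "W.fin_dim" unfolding W.fin_dim_def using A(1) by auto
  show "W.dim \<le> card P" using W.dim_basis[OF A] bound[OF b(3,2)] by simp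
qed

section \<open>Quantum shuffles\<close>

text \<open>The scalar picked up when the letter \<open>b\<close> is moved from the right end of \<open>w\<close> to its left end by the
  braiding \<open>c(a \<otimes> b) = \<chi>(a, b) b \<otimes> a\<close>.\<close>

definition bw :: "('a \<Rightarrow> 'a \<Rightarrow> complex) \<Rightarrow> 'a list \<Rightarrow> 'a \<Rightarrow> complex" where
  "bw \<chi> w b = prod_list (map (\<lambda>a. \<chi> a b) w)"

lemma bw_simps [simp]: "bw \<chi> [] b = 1" "bw \<chi> (a # w) b = \<chi> a b * bw \<chi> w b"
  by (simp_all add: bw_def)

text \<open>The quantum shuffle product, for functions on words.  The recursion splits according to
  the origin of the first letter: it belongs to the word of \<open>f\<close>, or it belongs to the word of \<open>g\<close> and has
  crossed the whole word \<open>u\<close> taken from \<open>f\<close>.\<close>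

fun shuf :: "('a \<Rightarrow> 'a \<Rightarrow> complex) \<Rightarrow> ('a list \<Rightarrow> complex) \<Rightarrow> ('a list \<Rightarrow> complex) \<Rightarrow> 'a list \<Rightarrow> complex"
where
  "shuf \<chi> f g [] = f [] * g []"
| "shuf \<chi> f g (b # w) =
     shuf \<chi> (\<lambda>u. f (b # u)) g w + shuf \<chi> (\<lambda>u. bw \<chi> u b * f u) (\<lambda>v. g (b # v)) w"

definition wdelta :: "'a list \<Rightarrow> 'a list \<Rightarrow> complex" where
  "wdelta u w = (if w = u then 1 else 0)"

lemma wdelta_Cons [simp]:
  "wdelta (a # u) (b # w) = (if a = b then wdelta u w else 0)"
  "wdelta [] (b # w) = 0"
  by (auto simp: wdelta_def)

lemma wdelta_weight [simp]: "(\<lambda>w. bw \<chi> w b * wdelta u w) = (\<lambda>w. bw \<chi> u b * wdelta u w)"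
  by (auto simp: wdelta_def fun_eq_iff)

lemma shuf_zero_left [simp]: "shuf \<chi> (\<lambda>_. 0) g w = 0"
  by (induction w arbitrary: g) simp_all

lemma shuf_zero_right [simp]: "shuf \<chi> f (\<lambda>_. 0) w = 0"
  by (induction w arbitrary: f) simp_all

lemma shuf_scale_left: "shuf \<chi> (\<lambda>u. c * f u) g w = c * shuf \<chi> f g w"
proof (induction w arbitrary: f g)
  case (Cons b w)
  have "(\<lambda>u. bw \<chi> u b * (c * f u)) = (\<lambda>u. c * (bw \<chi> u b * f u))" by (simp add: mult.left_commute)
  then show ?case using Cons by (simp add: algebra_simps)
qed simp

lemma shuf_divide: "shuf \<chi> (\<lambda>u. f u / c) g w = shuf \<chi> f g w / c"
  using shuf_scale_left[of \<chi> "1 / c" f g w] by simp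

lemma shuf_one_left [simp]: "shuf \<chi> (wdelta []) g w = g w"
proof (induction w arbitrary: g)
  case (Cons b w)
  then show ?case by simp
qed (simp add: wdelta_def)

lemma shuf_one_right [simp]: "shuf \<chi> f (wdelta []) w = f w"
  by (induction w arbitrary: f) (simp_all, simp add: wdelta_def)

lemma shuf_support:
  assumes "shuf \<chi> f g w \<noteq> 0"
  shows "\<exists>u v. f u \<noteq> 0 \<and> g v \<noteq> 0 \<and> w \<in> shuffles u v"
  using assms
proof (induction w arbitrary: f g)
  case (Cons b w)
  from Cons.prems consider "shuf \<chi> (\<lambda>u. f (b # u)) g w \<noteq> 0"
    | "shuf \<chi> (\<lambda>u. bw \<chi> u b * f u) (\<lambda>v. g (b # v)) w \<noteq> 0" by fastforce
  then show ?case
  proof cases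
    case 1
    from Cons.IH[OF this] obtain u v where "f (b # u) \<noteq> 0" "g v \<noteq> 0" "w \<in> shuffles u v" by blast
    then show ?thesis by (intro exI[of _ "b # u"] exI[of _ v]) (simp add: Cons_in_shuffles_leftI)
  next
    case 2
    from Cons.IH[OF this] obtain u v where "f u \<noteq> 0" "g (b # v) \<noteq> 0" "w \<in> shuffles u v"
      by auto
    then show ?thesis by (intro exI[of _ u] exI[of _ "b # v"]) (simp add: Cons_in_shuffles_rightI)
  qed
qed auto

section \<open>Skew derivations of the tensor algebra\<close>

text \<open>The multiplication of the tensor algebra is used as a total operation, independent of the basis \<open>B\<close>.\<close>

definition tmul :: "('v list \<Rightarrow>\<^sub>0 complex) \<Rightarrow> ('v list \<Rightarrow>\<^sub>0 complex) \<Rightarrow> ('v list \<Rightarrow>\<^sub>0 complex)" where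
  "tmul = bilin_ext (\<lambda>u w. bvec (u @ w))"

lemma tmul_single [simp]:
  "tmul (Poly_Mapping.single u c) (Poly_Mapping.single w d) = Poly_Mapping.single (u @ w) (c * d)"
  by (simp add: tmul_def)

lemma lin_map_tmul: "lin_map (\<lambda>p. tmul p q)" "lin_map (tmul p)"
  unfolding tmul_def by (rule lin_map_bilin_ext_left lin_map_bilin_ext_right)+

lemma lin_map_tmul_intro:
  "lin_map G \<Longrightarrow> lin_map (\<lambda>p. tmul (G p) q)" "lin_map G \<Longrightarrow> lin_map (\<lambda>p. tmul q (G p))"
  by (erule lin_map_comp[OF lin_map_tmul(1)], erule lin_map_comp[OF lin_map_tmul(2)])

lemmas lin_intros = lin_map_id lin_map_add lin_map_scale lin_map_tmul_intro

lemmas tmul_simps = lin_mapD[OF lin_map_tmul(1)] lin_mapD[OF lin_map_tmul(2)]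

lemma tmul_one [simp]: "tmul (bvec []) p = p" "tmul p (bvec []) = p"
proof -
  show "tmul (bvec []) p = p"
    by (rule lin_map_eqI[OF lin_map_tmul(2) lin_map_id, of _ UNIV]) auto
  show "tmul p (bvec []) = p"
    by (rule lin_map_eqI[OF lin_map_tmul(1) lin_map_id, of _ UNIV]) auto
qed

lemma keys_tmul:
  "Poly_Mapping.keys p \<subseteq> lists B \<Longrightarrow> Poly_Mapping.keys q \<subseteq> lists B \<Longrightarrow> Poly_Mapping.keys (tmul p q) \<subseteq> lists B"
  unfolding tmul_def by (rule keys_bilin_ext) auto

lemma tmul_assoc: "tmul (tmul p q) r = tmul p (tmul q r)"
proof -
  have 1: "tmul (tmul (bvec s) (bvec t)) r = tmul (bvec s) (tmul (bvec t) r)" for s t :: "'a list"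
    by (rule lin_map_eqI'[where p = r]) (intro lin_intros, intro lin_intros, simp)
  have 2: "tmul (tmul (bvec s) q) r = tmul (bvec s) (tmul q r)" for s
    by (rule lin_map_eqI'[where p = q]) (intro lin_intros, intro lin_intros, rule 1)
  show ?thesis
    by (rule lin_map_eqI'[where p = p]) (intro lin_intros, intro lin_intros, rule 2)
qed

abbreviation letter_mul :: "'v \<Rightarrow> ('v list \<Rightarrow>\<^sub>0 complex) \<Rightarrow> ('v list \<Rightarrow>\<^sub>0 complex)" where
  "letter_mul a \<equiv> tmul (bvec [a])"

text \<open>The skew derivation \<open>\<partial>\<^sub>b\<close>: it removes an occurrence of \<open>b\<close> after moving it to the left end, so the
  result is the sum over all occurrences, each weighted by the letters that precede it.\<close>

primrec der_word :: "('v \<Rightarrow> 'v \<Rightarrow> complex) \<Rightarrow> 'v \<Rightarrow> 'v list \<Rightarrow> ('v list \<Rightarrow>\<^sub>0 complex)" where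
  "der_word \<chi> b [] = 0"
| "der_word \<chi> b (a # w) = (if a = b then bvec w else 0) + scale (\<chi> a b) (letter_mul a (der_word \<chi> b w))"

definition der :: "('v \<Rightarrow> 'v \<Rightarrow> complex) \<Rightarrow> 'v \<Rightarrow> ('v list \<Rightarrow>\<^sub>0 complex) \<Rightarrow> ('v list \<Rightarrow>\<^sub>0 complex)" where
  "der \<chi> b = lin_ext (der_word \<chi> b)"

text \<open>Multiplication of each word by the cost of moving \<open>b\<close> across it; it is the correction term in the
  Leibniz rule for \<open>\<partial>\<^sub>b\<close>.\<close>

definition twist :: "('v \<Rightarrow> 'v \<Rightarrow> complex) \<Rightarrow> 'v \<Rightarrow> ('v list \<Rightarrow>\<^sub>0 complex) \<Rightarrow> ('v list \<Rightarrow>\<^sub>0 complex)" where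
  "twist \<chi> b = lin_ext (\<lambda>w. Poly_Mapping.single w (bw \<chi> w b))"

lemma lin_map_der: "lin_map (der \<chi> b)" "lin_map (twist \<chi> b)"
  unfolding der_def twist_def by (rule lin_map_lin_ext)+

lemma lin_map_der_intro:
  "lin_map G \<Longrightarrow> lin_map (\<lambda>p. der \<chi> b (G p))" "lin_map G \<Longrightarrow> lin_map (\<lambda>p. twist \<chi> b (G p))"
  by (erule lin_map_comp[OF lin_map_der(1)], erule lin_map_comp[OF lin_map_der(2)])

lemmas lin_intros' = lin_intros lin_map_der_intro

lemmas der_simps = lin_mapD[OF lin_map_der(1)] lin_mapD[OF lin_map_der(2)]

lemma der_single [simp]: "der \<chi> b (Poly_Mapping.single w c) = scale c (der_word \<chi> b w)"
  "twist \<chi> b (Poly_Mapping.single w c) = Poly_Mapping.single w (c * bw \<chi> w b)"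
  by (simp_all add: der_def twist_def)

lemma der_letter_mul:
  "der \<chi> b (letter_mul a p) = (if a = b then p else 0) + scale (\<chi> a b) (letter_mul a (der \<chi> b p))"
proof (rule lin_map_eqI'[where p = p])
  show "lin_map (\<lambda>p. der \<chi> b (letter_mul a p))" by (intro lin_intros')
  have "lin_map (\<lambda>p. scale (\<chi> a b) (letter_mul a (der \<chi> b p)))" by (intro lin_intros')
  then show "lin_map (\<lambda>p. (if a = b then p else 0) + scale (\<chi> a b) (letter_mul a (der \<chi> b p)))"
    by (cases "a = b") (simp_all add: lin_map_add[OF lin_map_id])
qed simp

lemma twist_letter_mul: "twist \<chi> b (letter_mul a p) = scale (\<chi> a b) (letter_mul a (twist \<chi> b p))"
  by (rule lin_map_eqI'[where p = p]) (intro lin_intros', intro lin_intros', simp)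

text \<open>An occurrence of \<open>b\<close> in the second factor has to cross the first factor, which accounts for the twist.\<close>

lemma der_tmul: "der \<chi> b (tmul p q) = tmul (der \<chi> b p) q + tmul (twist \<chi> b p) (der \<chi> b q)"
proof (rule lin_map_eqI'[where p = p])
  show "lin_map (\<lambda>p. der \<chi> b (tmul p q))" by (intro lin_intros')
  show "lin_map (\<lambda>p. tmul (der \<chi> b p) q + tmul (twist \<chi> b p) (der \<chi> b q))" by (intro lin_intros')
  fix w :: "'a list"
  show "der \<chi> b (tmul (bvec w) q) = tmul (der \<chi> b (bvec w)) q + tmul (twist \<chi> b (bvec w)) (der \<chi> b q)"
  proof (induction w)
    case Nil
    then show ?case by (simp add: tmul_simps)
  next
    case (Cons a w)
    have e: "bvec (a # w) = letter_mul a (bvec w)" by simp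
    show ?case unfolding e tmul_assoc der_letter_mul twist_letter_mul Cons
      by (simp add: tmul_simps tmul_assoc scale_distrib del: tmul_single)
  qed
qed

text \<open>The coefficient of the word \<open>w\<close> in the image of \<open>p\<close> under the map from the tensor algebra to the
  quantum shuffle algebra.\<close>

primrec phi_word :: "('v \<Rightarrow> 'v \<Rightarrow> complex) \<Rightarrow> 'v list \<Rightarrow> ('v list \<Rightarrow>\<^sub>0 complex) \<Rightarrow> complex" where
  "phi_word \<chi> [] p = Poly_Mapping.lookup p []"
| "phi_word \<chi> (b # w) p = phi_word \<chi> w (der \<chi> b p)"

lemma lin_form_phi: "lin_form (phi_word \<chi> w)"
proof (induction w)
  case (Cons b w)
  then show ?case using lin_form_comp[OF Cons lin_map_der(1)] by simp
qed (simp add: lin_form_lookup)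

lemmas phi_simps = lin_formD[OF lin_form_phi]

lemma der_twist: "der \<chi> a (twist \<chi> b p) = scale (\<chi> a b) (twist \<chi> b (der \<chi> a p))"
proof (rule lin_map_eqI'[where p = p])
  show "lin_map (\<lambda>p. scale (\<chi> a b) (twist \<chi> b (der \<chi> a p)))" by (intro lin_intros')
  show "lin_map (\<lambda>p. der \<chi> a (twist \<chi> b p))" by (intro lin_intros')
  fix w :: "'a list"
  show "der \<chi> a (twist \<chi> b (bvec w)) = scale (\<chi> a b) (twist \<chi> b (der \<chi> a (bvec w)))"
  proof (induction w)
    case (Cons c w)
    have e: "bvec (c # w) = letter_mul c (bvec w)" by simp
    show ?case unfolding e twist_letter_mul der_letter_mul der_simps Cons
      by (cases "c = a") (simp_all add: Cons tmul_simps der_letter_mul twist_letter_mul scale_distrib der_simps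
          mult.left_commute mult.commute[of "\<chi> c b" "\<chi> a b"] del: tmul_single)
  qed (simp add: der_simps)
qed

lemma phi_twist: "phi_word \<chi> w (twist \<chi> b p) = bw \<chi> w b * phi_word \<chi> w p"
proof (induction w arbitrary: p)
  case Nil
  have "Poly_Mapping.lookup (twist \<chi> b p) [] = Poly_Mapping.lookup p []"
    by (rule lin_form_eqI'[where p = p])
      (intro lin_form_comp[OF lin_form_lookup] lin_intros', rule lin_form_lookup, simp add: lookup_single when_def)
  then show ?case by simp
qed (simp add: der_twist phi_simps mult_ac)

text \<open>The map to the shuffle algebra is multiplicative: the Leibniz rule for \<open>\<partial>\<^sub>b\<close> is
  the recursion that defines the shuffle product.\<close>

lemma phi_tmul:
  "phi_word \<chi> w (tmul p q) = shuf \<chi> (\<lambda>u. phi_word \<chi> u p) (\<lambda>u. phi_word \<chi> u q) w"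
proof (induction w arbitrary: p q)
  case Nil
  have "Poly_Mapping.lookup (tmul p q) [] = Poly_Mapping.lookup p [] * Poly_Mapping.lookup q []"
  proof (rule lin_form_eqI'[where p = p])
    show "lin_form (\<lambda>p. Poly_Mapping.lookup (tmul p q) [])"
      by (intro lin_form_comp[OF lin_form_lookup] lin_map_tmul)
    show "lin_form (\<lambda>p. Poly_Mapping.lookup p [] * Poly_Mapping.lookup q [])"
      using lin_form_scale[OF lin_form_lookup, of "Poly_Mapping.lookup q []" "[]"]
      by (simp only: mult.commute[of "Poly_Mapping.lookup q []"])
    fix w
    show "Poly_Mapping.lookup (tmul (bvec w) q) [] = Poly_Mapping.lookup (bvec w) [] * Poly_Mapping.lookup q []"
    proof (rule lin_form_eqI'[where p = q])
      show "lin_form (\<lambda>q. Poly_Mapping.lookup (tmul (bvec w) q) [])"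
        by (rule lin_form_comp[OF lin_form_lookup lin_map_tmul(2)])
      show "lin_form (\<lambda>q. Poly_Mapping.lookup (bvec w) [] * Poly_Mapping.lookup q [])"
        by (rule lin_form_scale[OF lin_form_lookup])
    qed (simp add: lookup_single when_def)
  qed
  then show ?case by simp
qed (simp add: der_tmul phi_simps phi_twist)

lemma phi_letters [simp]:
  "phi_word \<chi> w (bvec []) = wdelta [] w" "phi_word \<chi> w (bvec [a]) = wdelta [a] w"
proof -
  show 1: "phi_word \<chi> w (bvec []) = wdelta [] w" for w
    by (cases w) (auto simp: wdelta_def phi_simps)
  show "phi_word \<chi> w (bvec [a]) = wdelta [a] w"
    by (cases w) (auto simp: wdelta_def phi_simps tmul_simps 1 lookup_single when_def)
qed

definition phi_kernel :: "('v \<Rightarrow> 'v \<Rightarrow> complex) \<Rightarrow> 'v set \<Rightarrow> ('v list \<Rightarrow>\<^sub>0 complex) set" where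
  "phi_kernel \<chi> B = {p. Poly_Mapping.keys p \<subseteq> lists B \<and> (\<forall>w. phi_word \<chi> w p = 0)}"

lemma phi_kernel_subspace: "csubspace (phi_kernel \<chi> B) (tensor_algebra B)"
  by (rule free_like_subspaceI[OF free_like_space(2)]) (auto simp: phi_kernel_def phi_simps keys_closed)

lemma shuf_zero: "(\<And>u. f u = 0) \<Longrightarrow> shuf \<chi> f g w = 0" "(\<And>u. g u = 0) \<Longrightarrow> shuf \<chi> f g w = 0"
proof -
  assume "\<And>u. f u = 0"
  then have "f = (\<lambda>_. 0)" by auto
  then show "shuf \<chi> f g w = 0" by simp
next
  assume "\<And>u. g u = 0"
  then have "g = (\<lambda>_. 0)" by auto
  then show "shuf \<chi> f g w = 0" by simp
qed

lemma phi_kernel_ideal: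
  assumes "p \<in> phi_kernel \<chi> B" "Poly_Mapping.keys q \<subseteq> lists B"
  shows "tmul p q \<in> phi_kernel \<chi> B" "tmul q p \<in> phi_kernel \<chi> B"
  using assms unfolding phi_kernel_def by (simp_all add: keys_tmul phi_tmul shuf_zero)

section \<open>The coproduct of the tensor algebra\<close>

text \<open>The scalar by which the degree of \<open>a\<close> acts on the word \<open>w\<close>; here the fixed letter is the one that moves
  to the right, whereas in \<open>bw\<close> the fixed letter moves to the left.\<close>

definition left_weight :: "('v \<Rightarrow> 'v \<Rightarrow> complex) \<Rightarrow> 'v \<Rightarrow> 'v list \<Rightarrow> complex" where
  "left_weight \<chi> a w = prod_list (map (\<chi> a) w)"

lemma left_weight_simps [simp]:
  "left_weight \<chi> a [] = 1" "left_weight \<chi> a (b # w) = \<chi> a b * left_weight \<chi> a w"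
  by (simp_all add: left_weight_def)

lemma pure_tensor_single [simp]:
  "pure_tensor (Poly_Mapping.single u c) (Poly_Mapping.single w d) = Poly_Mapping.single (u, w) (c * d)"
  by (simp add: pure_tensor_def)

lemma lin_map_pure_tensor: "lin_map (\<lambda>p. pure_tensor p q)" "lin_map (pure_tensor p)"
  unfolding pure_tensor_def by (rule lin_map_bilin_ext_left lin_map_bilin_ext_right)+

lemmas pure_tensor_simps = lin_mapD[OF lin_map_pure_tensor(1)] lin_mapD[OF lin_map_pure_tensor(2)]

text \<open>Multiplication by the primitive element \<open>a \<otimes> 1 + 1 \<otimes> a\<close> in the braided tensor square.\<close>

definition letter_cop :: "('v \<Rightarrow> 'v \<Rightarrow> complex) \<Rightarrow> 'v \<Rightarrow> ('v list \<times> 'v list \<Rightarrow>\<^sub>0 complex) \<Rightarrow> ('v list \<times> 'v list \<Rightarrow>\<^sub>0 complex)"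
where
  "letter_cop \<chi> a = lin_ext (\<lambda>(s, r). bvec (a # s, r) + Poly_Mapping.single (s, a # r) (left_weight \<chi> a s))"

primrec cop_word :: "('v \<Rightarrow> 'v \<Rightarrow> complex) \<Rightarrow> 'v list \<Rightarrow> ('v list \<times> 'v list \<Rightarrow>\<^sub>0 complex)" where
  "cop_word \<chi> [] = bvec ([], [])"
| "cop_word \<chi> (a # w) = letter_cop \<chi> a (cop_word \<chi> w)"

definition cop :: "('v \<Rightarrow> 'v \<Rightarrow> complex) \<Rightarrow> ('v list \<Rightarrow>\<^sub>0 complex) \<Rightarrow> ('v list \<times> 'v list \<Rightarrow>\<^sub>0 complex)" where
  "cop \<chi> = lin_ext (cop_word \<chi>)"

lemma lin_map_cop: "lin_map (cop \<chi>)" "lin_map (letter_cop \<chi> a)"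
  unfolding cop_def letter_cop_def by (rule lin_map_lin_ext)+

lemmas cop_simps = lin_mapD[OF lin_map_cop(1)] lin_mapD[OF lin_map_cop(2)]

lemma cop_single [simp]: "cop \<chi> (Poly_Mapping.single w c) = scale c (cop_word \<chi> w)"
  "letter_cop \<chi> a (Poly_Mapping.single (s, r) c) =
    Poly_Mapping.single (a # s, r) c + Poly_Mapping.single (s, a # r) (c * left_weight \<chi> a s)"
  by (simp_all add: cop_def letter_cop_def scale_distrib)

lemma cop_letter_mul: "cop \<chi> (letter_mul a p) = letter_cop \<chi> a (cop \<chi> p)"
  by (rule lin_map_eqI'[where p = p])
    (rule lin_map_comp[OF lin_map_cop(1) lin_map_tmul(2)], rule lin_map_comp[OF lin_map_cop(2,1)], simp)

lemma keys_cop_word: "w \<in> lists B \<Longrightarrow> Poly_Mapping.keys (cop_word \<chi> w) \<subseteq> lists B \<times> lists B"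
proof (induction w)
  case (Cons a w)
  have a: "a \<in> B" and IH: "Poly_Mapping.keys (cop_word \<chi> w) \<subseteq> lists B \<times> lists B" using Cons by auto
  show ?case unfolding cop_word.simps letter_cop_def
  proof (rule keys_lin_ext)
    fix sr assume "sr \<in> Poly_Mapping.keys (cop_word \<chi> w)"
    then have "sr \<in> lists B \<times> lists B" using IH by blast
    then obtain s r where sr: "sr = (s, r)" "s \<in> lists B" "r \<in> lists B" by (rule SigmaE)
    have "Poly_Mapping.keys (bvec (a # s, r) + Poly_Mapping.single (s, a # r) (left_weight \<chi> a s)) \<subseteq> lists B \<times> lists B"
      by (rule keys_closed(1)) (use sr a in auto)
    then show "Poly_Mapping.keys (case sr of (s, r) \<Rightarrow> bvec (a # s, r) + Poly_Mapping.single (s, a # r) (left_weight \<chi> a s))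
        \<subseteq> lists B \<times> lists B" by (simp add: sr(1))
  qed
qed simp

text \<open>This is \<open>\<partial>\<^sub>b \<otimes> id\<close>.\<close>

definition der_left :: "('v \<Rightarrow> 'v \<Rightarrow> complex) \<Rightarrow> 'v \<Rightarrow> ('v list \<times> 'v list \<Rightarrow>\<^sub>0 complex) \<Rightarrow> ('v list \<times> 'v list \<Rightarrow>\<^sub>0 complex)"
where
  "der_left \<chi> b = lin_ext (\<lambda>(s, r). pure_tensor (der_word \<chi> b s) (bvec r))"

lemma lin_map_der_left: "lin_map (der_left \<chi> b)"
  unfolding der_left_def by (rule lin_map_lin_ext)

lemmas der_left_simps = lin_mapD[OF lin_map_der_left]

lemma der_left_single [simp]:
  "der_left \<chi> b (Poly_Mapping.single (s, r) c) = scale c (pure_tensor (der_word \<chi> b s) (bvec r))"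
  by (simp add: der_left_def)

text \<open>Every word that occurs in \<open>\<partial>\<^sub>b s\<close> is \<open>s\<close> with one letter \<open>b\<close> removed, so its left weight differs from that
  of \<open>s\<close> by the factor \<open>\<chi>(a, b)\<close>.\<close>

lemma left_weight_der:
  "lin_ext (\<lambda>u. Poly_Mapping.single u (left_weight \<chi> a u * \<chi> a b)) (der_word \<chi> b s) =
    scale (left_weight \<chi> a s) (der_word \<chi> b s)"
proof (induction s)
  case (Cons c s)
  have *: "lin_ext (\<lambda>u. Poly_Mapping.single u (left_weight \<chi> a u * \<chi> a b)) (letter_mul c p) =
    scale (\<chi> a c) (letter_mul c (lin_ext (\<lambda>u. Poly_Mapping.single u (left_weight \<chi> a u * \<chi> a b)) p))" for p
    by (rule lin_map_eqI'[where p = p])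
      (rule lin_map_comp[OF lin_map_lin_ext lin_map_tmul(2)],
       rule lin_map_scale[OF lin_map_comp[OF lin_map_tmul(2) lin_map_lin_ext]], simp add: mult.assoc)
  have e: "\<chi> c b * (\<chi> a c * left_weight \<chi> a s) = \<chi> a c * left_weight \<chi> a s * \<chi> c b" by simp
  have "lin_ext (\<lambda>u. Poly_Mapping.single u (left_weight \<chi> a u * \<chi> a b)) (der_word \<chi> b (c # s)) =
      (if c = b then Poly_Mapping.single s (left_weight \<chi> a s * \<chi> a b) else 0) +
      scale (\<chi> c b * (\<chi> a c * left_weight \<chi> a s)) (letter_mul c (der_word \<chi> b s))"
    by (simp add: lin_ext_simps * Cons tmul_simps)
  also have "\<dots> = scale (left_weight \<chi> a (c # s)) (der_word \<chi> b (c # s))"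
    unfolding e by (simp add: scale_distrib mult.commute[of "left_weight \<chi> a s" "\<chi> a b"])
  finally show ?case .
qed (simp add: lin_ext_simps)

lemma der_left_letter_cop:
  "der_left \<chi> b (letter_cop \<chi> a t) = (if a = b then t else 0) + scale (\<chi> a b) (letter_cop \<chi> a (der_left \<chi> b t))"
proof (rule lin_map_eqI'[where p = t])
  show "lin_map (\<lambda>t. der_left \<chi> b (letter_cop \<chi> a t))"
    by (rule lin_map_comp[OF lin_map_der_left lin_map_cop(2)])
  have "lin_map (\<lambda>t. scale (\<chi> a b) (letter_cop \<chi> a (der_left \<chi> b t)))"
    by (rule lin_map_scale[OF lin_map_comp[OF lin_map_cop(2) lin_map_der_left]])
  then show "lin_map (\<lambda>t. (if a = b then t else 0) + scale (\<chi> a b) (letter_cop \<chi> a (der_left \<chi> b t)))"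
    by (cases "a = b") (simp_all add: lin_map_add[OF lin_map_id])
  fix sr :: "'a list \<times> 'a list"
  obtain s r where sr: "sr = (s, r)" by fastforce
  have *: "scale (\<chi> a b) (letter_cop \<chi> a (pure_tensor p (bvec r))) =
     scale (\<chi> a b) (pure_tensor (letter_mul a p) (bvec r)) +
     pure_tensor (lin_ext (\<lambda>u. Poly_Mapping.single u (left_weight \<chi> a u * \<chi> a b)) p) (bvec (a # r))" for p
    by (rule lin_map_eqI'[where p = p])
      (rule lin_map_scale[OF lin_map_comp[OF lin_map_cop(2) lin_map_pure_tensor(1)]],
       rule lin_map_add[OF lin_map_scale[OF lin_map_comp[OF lin_map_pure_tensor(1) lin_map_tmul(2)]]
         lin_map_comp[OF lin_map_pure_tensor(1) lin_map_lin_ext]],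
       simp add: scale_distrib mult.commute[of "\<chi> a b" "left_weight \<chi> a s" for s])
  show "der_left \<chi> b (letter_cop \<chi> a (bvec sr)) =
      (if a = b then bvec sr else 0) + scale (\<chi> a b) (letter_cop \<chi> a (der_left \<chi> b (bvec sr)))"
    unfolding sr by (simp add: der_left_simps * left_weight_der pure_tensor_simps add.assoc)
qed

text \<open>Coassociativity in disguise: \<open>\<partial>\<^sub>b\<close> reads off the part of the coproduct that has the single letter \<open>b\<close> in
  the first factor.  Both sides satisfy the same recursion on words.\<close>

lemma der_left_cop: "der_left \<chi> b (cop \<chi> p) = cop \<chi> (der \<chi> b p)"
proof (rule lin_map_eqI'[where p = p])
  show "lin_map (\<lambda>p. der_left \<chi> b (cop \<chi> p))" by (rule lin_map_comp[OF lin_map_der_left lin_map_cop(1)])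
  show "lin_map (\<lambda>p. cop \<chi> (der \<chi> b p))" by (rule lin_map_comp[OF lin_map_cop(1) lin_map_der(1)])
  fix w :: "'a list"
  show "der_left \<chi> b (cop \<chi> (bvec w)) = cop \<chi> (der \<chi> b (bvec w))"
  proof (induction w)
    case Nil
    then show ?case by (simp add: pure_tensor_simps cop_simps)
  next
    case (Cons a w)
    then show ?case by (simp add: der_left_letter_cop cop_simps cop_letter_mul)
  qed
qed

definition phi_pair :: "('v \<Rightarrow> 'v \<Rightarrow> complex) \<Rightarrow> 'v list \<Rightarrow> 'v list \<Rightarrow> ('v list \<times> 'v list \<Rightarrow>\<^sub>0 complex) \<Rightarrow> complex" where
  "phi_pair \<chi> u v = form_ext (\<lambda>(s, r). phi_word \<chi> u (bvec s) * phi_word \<chi> v (bvec r))"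

lemma lin_form_phi_pair: "lin_form (phi_pair \<chi> u v)"
  unfolding phi_pair_def by (rule lin_form_form_ext)

lemmas phi_pair_simps = lin_formD[OF lin_form_phi_pair]

lemma phi_pair_pure: "phi_pair \<chi> u v (pure_tensor p q) = phi_word \<chi> u p * phi_word \<chi> v q"
proof (rule lin_form_eqI'[where p = p])
  show "lin_form (\<lambda>p. phi_pair \<chi> u v (pure_tensor p q))"
    by (rule lin_form_comp[OF lin_form_phi_pair lin_map_pure_tensor(1)])
  show "lin_form (\<lambda>p. phi_word \<chi> u p * phi_word \<chi> v q)"
    using lin_form_scale[OF lin_form_phi, of "phi_word \<chi> v q" \<chi> u]
    by (simp only: mult.commute[of "phi_word \<chi> v q"])
  fix s
  show "phi_pair \<chi> u v (pure_tensor (bvec s) q) = phi_word \<chi> u (bvec s) * phi_word \<chi> v q"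
    by (rule lin_form_eqI'[where p = q])
      (rule lin_form_comp[OF lin_form_phi_pair lin_map_pure_tensor(2)],
       rule lin_form_scale[OF lin_form_phi], simp add: phi_pair_def)
qed

text \<open>The counit axiom for the first factor, composed with the function \<open>\<psi>\<close> on words.\<close>

lemma counit_cop_word:
  "form_ext (\<lambda>(s, r). if s = [] then \<psi> r else 0) (cop_word \<chi> w) = \<psi> w"
proof (induction w arbitrary: \<psi>)
  case (Cons a w)
  have "form_ext (\<lambda>(s, r). if s = [] then \<psi> r else 0) (letter_cop \<chi> a t) =
      form_ext (\<lambda>(s, r). if s = [] then \<psi> (a # r) else 0) t" for t
    by (rule lin_form_eqI'[where p = t])
      (rule lin_form_comp[OF lin_form_form_ext lin_map_cop(2)], rule lin_form_form_ext,
       auto simp: form_ext_simps)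
  then show ?case using Cons by simp
qed simp

text \<open>The coproduct becomes deconcatenation in the shuffle algebra.  The letters of \<open>u\<close> are consumed one by
  one by derivations of the first factor; the counit then leaves \<open>v\<close> to the second factor.\<close>

lemma phi_pair_cop: "phi_pair \<chi> u v (cop \<chi> p) = phi_word \<chi> (u @ v) p"
proof (induction u arbitrary: p)
  case Nil
  show ?case
  proof (rule lin_form_eqI'[where p = p])
    show "lin_form (\<lambda>p. phi_pair \<chi> [] v (cop \<chi> p))" by (rule lin_form_comp[OF lin_form_phi_pair lin_map_cop(1)])
    show "lin_form (phi_word \<chi> ([] @ v))" by (rule lin_form_phi)
    have "(\<lambda>(s, r). phi_word \<chi> [] (bvec s) * phi_word \<chi> v (bvec r)) =
        (\<lambda>(s, r). if s = [] then phi_word \<chi> v (bvec r) else 0)"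
      by (auto simp: fun_eq_iff lookup_single when_def)
    then show "phi_pair \<chi> [] v (cop \<chi> (bvec w)) = phi_word \<chi> ([] @ v) (bvec w)" for w
      unfolding phi_pair_def by (simp add: counit_cop_word[of "\<lambda>r. phi_word \<chi> v (bvec r)"])
  qed
next
  case (Cons b u)
  have "phi_pair \<chi> (b # u) v t = phi_pair \<chi> u v (der_left \<chi> b t)" for t
  proof (rule lin_form_eqI'[where p = t])
    fix sr :: "'a list \<times> 'a list"
    obtain s r where sr: "sr = (s, r)" by fastforce
    show "phi_pair \<chi> (b # u) v (bvec sr) = phi_pair \<chi> u v (der_left \<chi> b (bvec sr))"
      unfolding sr by (simp add: phi_pair_pure) (simp add: phi_pair_def)
  qed (rule lin_form_phi_pair lin_form_comp[OF lin_form_phi_pair lin_map_der_left])+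
  then show ?case using Cons by (simp add: der_left_cop)
qed

text \<open>For linear maps \<open>f, g\<close> of vector spaces the kernel of \<open>f \<otimes> g\<close> is \<open>ker f \<otimes> T + T \<otimes> ker g\<close>.  The
  proof eliminates the terms of the sum one at a time, in the manner of Gaussian elimination.\<close>

lemma kernel_pure_sum:
  fixes T :: "('v list \<times> 'v list \<Rightarrow>\<^sub>0 complex) set" and p q :: "nat \<Rightarrow> 'v list \<Rightarrow>\<^sub>0 complex"
  assumes T: "csubspace T (tensor_square G V B)"
    and T1: "\<And>p q. p \<in> phi_kernel \<chi> B \<Longrightarrow> Poly_Mapping.keys q \<subseteq> lists B \<Longrightarrow> pure_tensor p q \<in> T"
    and T2: "\<And>p q. Poly_Mapping.keys p \<subseteq> lists B \<Longrightarrow> q \<in> phi_kernel \<chi> B \<Longrightarrow> pure_tensor p q \<in> T"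
    and "\<And>i. Poly_Mapping.keys (p i) \<subseteq> lists B" "\<And>i. Poly_Mapping.keys (q i) \<subseteq> lists B"
    and "\<And>u v. (\<Sum>i<n. phi_word \<chi> u (p i) * phi_word \<chi> v (q i)) = 0"
  shows "(\<Sum>i<n. pure_tensor (p i) (q i)) \<in> T"
  using assms(4-)
proof (induction n arbitrary: q)
  case 0
  then show ?case using free_like_subspaceD(2)[OF free_like_space(3) T] by simp
next
  case (Suc n)
  note Tc = free_like_subspaceD[OF free_like_space(3) T]
  show ?case
  proof (cases "q n \<in> phi_kernel \<chi> B")
    case True
    have "(\<Sum>i<n. pure_tensor (p i) (q i)) \<in> T"
    proof (rule Suc.IH[OF Suc.prems(1,2)])
      show "(\<Sum>i<n. phi_word \<chi> u (p i) * phi_word \<chi> v (q i)) = 0" for u v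
        using Suc.prems(3)[of u v] True by (simp add: phi_kernel_def)
    qed
    then show ?thesis using T2[OF Suc.prems(1) True, of n] Tc(3) by simp
  next
    case False
    then obtain v0 where v0: "phi_word \<chi> v0 (q n) \<noteq> 0" using Suc.prems(2)[of n] by (auto simp: phi_kernel_def)
    \<comment> \<open>The coefficients \<open>c i\<close> cancel the values at \<open>v0\<close>, so that \<open>P\<close> lies in the kernel and
      \<open>p n\<close> can be replaced by a combination of the other \<open>p i\<close>.\<close>
    define c where "c i = - phi_word \<chi> v0 (q i) / phi_word \<chi> v0 (q n)" for i
    define P where "P = p n - (\<Sum>i<n. scale (c i) (p i))"
    have "phi_word \<chi> u P = 0" for u
    proof -
      have "(\<Sum>i<n. c i * phi_word \<chi> u (p i)) * phi_word \<chi> v0 (q n) = - (\<Sum>i<n. phi_word \<chi> u (p i) * phi_word \<chi> v0 (q i))"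
        using v0 unfolding sum_distrib_right sum_negf[symmetric] by (intro sum.cong) (auto simp: c_def)
      also have "\<dots> = phi_word \<chi> u (p n) * phi_word \<chi> v0 (q n)"
        using Suc.prems(3)[of u v0] by (simp add: minus_equation_iff add_eq_0_iff)
      finally show ?thesis using v0 by (simp add: P_def phi_simps)
    qed
    moreover have "Poly_Mapping.keys P \<subseteq> lists B"
      unfolding P_def by (intro keys_closed keys_sum_subset Suc.prems(1))
    ultimately have P: "P \<in> phi_kernel \<chi> B" by (simp add: phi_kernel_def)
    have "(\<Sum>i<n. pure_tensor (p i) (q i + scale (c i) (q n))) \<in> T"
    proof (rule Suc.IH[OF Suc.prems(1)])
      show "Poly_Mapping.keys (q i + scale (c i) (q n)) \<subseteq> lists B" for i
        by (intro keys_closed Suc.prems(2))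
      fix u v
      have "phi_word \<chi> u (p n) = phi_word \<chi> u P + (\<Sum>i<n. c i * phi_word \<chi> u (p i))"
        by (simp add: P_def phi_simps)
      then have pn: "phi_word \<chi> u (p n) = (\<Sum>i<n. c i * phi_word \<chi> u (p i))" using P by (simp add: phi_kernel_def)
      have "(\<Sum>i<n. phi_word \<chi> u (p i) * phi_word \<chi> v (q i + scale (c i) (q n))) =
         (\<Sum>i<n. phi_word \<chi> u (p i) * phi_word \<chi> v (q i)) + (\<Sum>i<n. c i * phi_word \<chi> u (p i)) * phi_word \<chi> v (q n)"
        unfolding sum_distrib_right sum.distrib[symmetric] by (intro sum.cong) (auto simp: phi_simps algebra_simps)
      then show "(\<Sum>i<n. phi_word \<chi> u (p i) * phi_word \<chi> v (q i + scale (c i) (q n))) = 0"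
        using Suc.prems(3)[of u v] pn by simp
    qed
    moreover have "(\<Sum>i<Suc n. pure_tensor (p i) (q i)) =
        pure_tensor P (q n) + (\<Sum>i<n. pure_tensor (p i) (q i + scale (c i) (q n)))"
      by (simp add: P_def pure_tensor_simps sum.distrib)
    moreover have "pure_tensor P (q n) \<in> T" by (rule T1[OF P Suc.prems(2)])
    ultimately show ?thesis using Tc(3) by simp
  qed
qed

lemma kernel_phi_pair:
  fixes t :: "'v list \<times> 'v list \<Rightarrow>\<^sub>0 complex"
  assumes t: "Poly_Mapping.keys t \<subseteq> lists B \<times> lists B" "\<And>u v. phi_pair \<chi> u v t = 0"
  shows "t \<in> cspan (tensor_square G V B)
    ({pure_tensor p q | p q. p \<in> phi_kernel \<chi> B \<and> q \<in> carrier (tensor_algebra B)} \<union>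
     {pure_tensor p q | p q. p \<in> carrier (tensor_algebra B) \<and> q \<in> phi_kernel \<chi> B})" (is "t \<in> cspan ?M ?S")
proof -
  have c: "p \<in> carrier (tensor_algebra B) \<longleftrightarrow> Poly_Mapping.keys p \<subseteq> lists B" for p
    by (rule free_likeD(1)[OF free_like_space(2)])
  have k: "p \<in> phi_kernel \<chi> B \<Longrightarrow> Poly_Mapping.keys p \<subseteq> lists B" for p by (simp add: phi_kernel_def)
  have pt: "Poly_Mapping.keys (pure_tensor p q) \<subseteq> lists B \<times> lists B"
    if "Poly_Mapping.keys p \<subseteq> lists B" "Poly_Mapping.keys q \<subseteq> lists B" for p q :: "'v list \<Rightarrow>\<^sub>0 complex"
    unfolding pure_tensor_def by (rule keys_bilin_ext) (use that in auto)
  have S: "?S \<subseteq> carrier ?M"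
    using pt k by (auto simp: c free_likeD(1)[OF free_like_space(3)])
  note sp = cspan_closed[OF free_like_vectorspace[OF free_like_space(3)] S]
  obtain h where h: "bij_betw h {..<card (Poly_Mapping.keys t)} (Poly_Mapping.keys t)"
    using ex_bij_betw_nat_finite[of "Poly_Mapping.keys t"] by (auto simp: atLeast0LessThan)
  let ?n = "card (Poly_Mapping.keys t)"
  define h' where "h' i = (if i < ?n then h i else ([], []))" for i
  define P where "P i = Poly_Mapping.single (fst (h' i)) (Poly_Mapping.lookup t (h' i))" for i
  define Q where "Q i = (bvec (snd (h' i)) :: 'v list \<Rightarrow>\<^sub>0 complex)" for i
  have h': "h' i \<in> lists B \<times> lists B" for i
    using h t(1) by (auto simp: h'_def bij_betw_def)
  have "t = (\<Sum>sr\<in>Poly_Mapping.keys t. scale (Poly_Mapping.lookup t sr) (bvec sr))"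
    by (rule poly_mapping_sum_singles)
  also have "\<dots> = (\<Sum>i<?n. scale (Poly_Mapping.lookup t (h i)) (bvec (h i)))"
    by (rule sum.reindex_bij_betw[OF h, symmetric])
  also have "\<dots> = (\<Sum>i<?n. pure_tensor (P i) (Q i))"
    by (rule sum.cong) (simp_all add: P_def Q_def h'_def)
  finally have tL: "t = (\<Sum>i<?n. pure_tensor (P i) (Q i))" .
  have "(\<Sum>i<?n. pure_tensor (P i) (Q i)) \<in> cspan ?M ?S"
  proof (rule kernel_pure_sum[OF sp(1), of \<chi>])
    show "pure_tensor p q \<in> cspan ?M ?S" if "p \<in> phi_kernel \<chi> B" "Poly_Mapping.keys q \<subseteq> lists B" for p q
    proof -
      have "pure_tensor p q \<in> ?S" using that by (auto simp: c)
      then show ?thesis using sp(2) by blast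
    qed
    show "pure_tensor p q \<in> cspan ?M ?S" if "Poly_Mapping.keys p \<subseteq> lists B" "q \<in> phi_kernel \<chi> B" for p q
    proof -
      have "pure_tensor p q \<in> ?S" using that by (auto simp: c)
      then show ?thesis using sp(2) by blast
    qed
    show "Poly_Mapping.keys (P i) \<subseteq> lists B" "Poly_Mapping.keys (Q i) \<subseteq> lists B" for i
      using h'[of i] by (simp_all add: P_def Q_def mem_Times_iff)
    show "(\<Sum>i<?n. phi_word \<chi> u (P i) * phi_word \<chi> v (Q i)) = 0" for u v
    proof -
      have "phi_pair \<chi> u v (\<Sum>i<?n. pure_tensor (P i) (Q i)) = 0" using t(2)[of u v] tL by simp
      then show ?thesis by (simp add: phi_pair_simps phi_pair_pure)
    qed
  qed
  then show ?thesis using tL by simp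
qed

section \<open>The Nichols algebra of a diagonal braiding\<close>

lemma (in yd_module) component_unique:
  assumes "b \<in> yd_comp V g" "b \<in> yd_comp V h" "g \<in> carrier G" "h \<in> carrier G" "b \<noteq> \<zero>\<^bsub>V\<^esub>"
  shows "g = h"
proof -
  have b: "b \<in> carrier V" using csubspaceD(2)[OF comp_subspace[OF assms(3)]] assms(1) by blast
  have hp: "homogeneous_parts G V b (\<lambda>k. if k = g then b else \<zero>\<^bsub>V\<^esub>)"
    if "b \<in> yd_comp V g" "g \<in> carrier G" for g
  proof -
    have "{k. (if k = g then b else \<zero>\<^bsub>V\<^esub>) \<noteq> \<zero>\<^bsub>V\<^esub>} = {g}" using assms(5) by auto
    then show ?thesis unfolding homogeneous_parts_def
      using that b csubspaceD(3)[OF comp_subspace] by auto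
  qed
  have "(\<lambda>k. if k = g then b else \<zero>\<^bsub>V\<^esub>) = (\<lambda>k. if k = h then b else \<zero>\<^bsub>V\<^esub>)"
    using comp_direct_sum[OF b] hp[OF assms(1,3)] hp[OF assms(2,4)] by blast
  then show ?thesis using assms(5) by metis
qed

text \<open>\<open>\<chi> b a\<close> is the scalar by which the degree of \<open>b\<close> acts on \<open>a\<close>, so that the braiding is
  \<open>c(b \<otimes> a) = \<chi>(b, a) a \<otimes> b\<close>.\<close>

locale diagonal_basis = yd_module +
  fixes B and \<chi>
  assumes basis: "homogeneous_basis G V B"
    and diagonal: "\<lbrakk>a \<in> B; b \<in> B; g \<in> carrier G; b \<in> yd_comp V g\<rbrakk> \<Longrightarrow> yd_act V g a = \<chi> b a \<odot>\<^bsub>V\<^esub> a"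
begin

lemma basis_facts: "\<not> spc.lin_dep B" "cspan V B = carrier V" "B \<subseteq> carrier V"
  using basis unfolding homogeneous_basis_def spc.basis_def by auto

lemma basis_nonzero: "b \<in> B \<Longrightarrow> b \<noteq> \<zero>\<^bsub>V\<^esub>"
  using spc.vs_zero_lin_dep[OF basis_facts(3,1)] by auto

lemma degree_of: "b \<in> B \<Longrightarrow> degree_of G V b \<in> carrier G \<and> b \<in> yd_comp V (degree_of G V b)"
proof -
  assume b: "b \<in> B"
  then obtain g where g: "g \<in> carrier G" "b \<in> yd_comp V g" using basis unfolding homogeneous_basis_def by blast
  show ?thesis unfolding degree_of_def
  proof (rule theI)
    show "g \<in> carrier G \<and> b \<in> yd_comp V g" using g by simp
    show "h = g" if "h \<in> carrier G \<and> b \<in> yd_comp V h" for h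
      using component_unique[of b h g] basis_nonzero[OF b] g that by simp
  qed
qed

lemma coords_smult:
  assumes a: "a \<in> B"
  shows "coords V B (c \<odot>\<^bsub>V\<^esub> a) = Poly_Mapping.single a c"
  unfolding coords_def
proof (rule the_equality)
  have aV: "a \<in> carrier V" using a basis_facts(3) by blast
  show s: "Poly_Mapping.keys (Poly_Mapping.single a c) \<subseteq> B \<and> c \<odot>\<^bsub>V\<^esub> a =
      (\<Oplus>\<^bsub>V\<^esub>b\<in>Poly_Mapping.keys (Poly_Mapping.single a c). Poly_Mapping.lookup (Poly_Mapping.single a c) b \<odot>\<^bsub>V\<^esub> b)"
    using a aV CC_smult(1)[OF spc.vectorspace_axioms aV] CC_smult(3)[OF spc.vectorspace_axioms aV]
    by (cases "c = 0") auto
  fix p assume p: "Poly_Mapping.keys p \<subseteq> B \<and> c \<odot>\<^bsub>V\<^esub> a = (\<Oplus>\<^bsub>V\<^esub>b\<in>Poly_Mapping.keys p. Poly_Mapping.lookup p b \<odot>\<^bsub>V\<^esub> b)"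
  define A where "A = insert a (Poly_Mapping.keys p)"
  have A: "finite A" "A \<subseteq> B" "A \<subseteq> carrier V" using p a basis_facts(3) by (auto simp: A_def)
  have ext: "(\<Oplus>\<^bsub>V\<^esub>b\<in>Poly_Mapping.keys q. Poly_Mapping.lookup q b \<odot>\<^bsub>V\<^esub> b) = spc.lincomb (Poly_Mapping.lookup q) A"
    if "Poly_Mapping.keys q \<subseteq> A" for q
    unfolding spc.lincomb_def
  proof (rule spc.add.finprod_mono_neutral_cong_left[OF A(1) that])
    show "Poly_Mapping.lookup q b \<odot>\<^bsub>V\<^esub> b = \<zero>\<^bsub>V\<^esub>" if "b \<in> A - Poly_Mapping.keys q" for b
      using that A(3) CC_smult(1)[OF spc.vectorspace_axioms, of b] by (auto simp: in_keys_iff)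
    show "(\<lambda>b. Poly_Mapping.lookup q b \<odot>\<^bsub>V\<^esub> b) \<in> A \<rightarrow> carrier V"
      using A(3) CC_smult(3)[OF spc.vectorspace_axioms] by blast
  qed simp
  let ?l = "Poly_Mapping.lookup p" and ?s = "Poly_Mapping.lookup (Poly_Mapping.single a c)"
  have "spc.lincomb ?l A = c \<odot>\<^bsub>V\<^esub> a"
    using p by (subst ext[symmetric]) (auto simp: A_def)
  moreover have "spc.lincomb ?s A = c \<odot>\<^bsub>V\<^esub> a"
    by (subst ext[symmetric], simp add: A_def, rule conjunct2[OF s, symmetric])
  ultimately have "spc.lincomb ?l A = spc.lincomb ?s A" by simp
  moreover have "spc.lincomb (\<lambda>v. ?l v \<ominus>\<^bsub>CC\<^esub> ?s v) A = spc.lincomb ?l A \<ominus>\<^bsub>V\<^esub> spc.lincomb ?s A"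
    by (rule spc.lincomb_diff[OF A(1,3)]) simp_all
  moreover have "spc.lincomb ?s A \<in> carrier V" by (rule spc.lincomb_closed[OF A(3)]) simp
  ultimately have "spc.lincomb (\<lambda>v. ?l v - ?s v) A = \<zero>\<^bsub>V\<^esub>"
    by (simp add: class_ring_simps spc.r_neg a_minus_def)
  then have "\<forall>v\<in>A. Poly_Mapping.lookup p v - Poly_Mapping.lookup (Poly_Mapping.single a c) v = 0"
    using spc.not_lindepD[OF basis_facts(1) A(1,2), of "\<lambda>v. ?l v - ?s v"] by auto
  then have "\<forall>v\<in>A. Poly_Mapping.lookup p v = Poly_Mapping.lookup (Poly_Mapping.single a c) v" by simp
  moreover have "Poly_Mapping.lookup p v = 0 \<and> Poly_Mapping.lookup (Poly_Mapping.single a c) v = 0" if "v \<notin> A" for v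
    using that by (auto simp: A_def in_keys_iff lookup_single when_def)
  ultimately show "p = Poly_Mapping.single a c" by (intro poly_mapping_eqI) metis
qed

lemma tensor_mult: "x \<otimes>\<^bsub>tensor_algebra B\<^esub> y = tmul x y" "\<one>\<^bsub>tensor_algebra B\<^esub> = bvec []"
  by (simp_all add: tensor_algebra_def tmul_def)

lemma embed_act:
  assumes "a \<in> B" "b \<in> B"
  shows "embed V B (yd_act V (degree_of G V b) a) = Poly_Mapping.single [a] (\<chi> b a)"
    and "embed V B (yd_act V \<one>\<^bsub>G\<^esub> a) = bvec [a]"
proof -
  have aV: "a \<in> carrier V" using assms basis_facts(3) by blast
  have "yd_act V (degree_of G V b) a = \<chi> b a \<odot>\<^bsub>V\<^esub> a"
    using diagonal[OF assms] degree_of[OF assms(2)] by blast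
  then show "embed V B (yd_act V (degree_of G V b) a) = Poly_Mapping.single [a] (\<chi> b a)"
    by (simp add: embed_def coords_smult[OF assms(1)])
  have "coords V B a = bvec a" using coords_smult[OF assms(1), of 1] CC_smult(2)[OF spc.vectorspace_axioms aV] by simp
  then show "embed V B (yd_act V \<one>\<^bsub>G\<^esub> a) = bvec [a]" by (simp add: embed_def act_one[OF aV])
qed

lemma word_act_degree:
  assumes b: "b \<in> B" and u: "u \<in> lists B"
  shows "word_act V B (word_degree G V [b]) u = Poly_Mapping.single u (left_weight \<chi> b u)"
proof -
  have "word_degree G V [b] = degree_of G V b" using degree_of[OF b] by (simp add: word_degree_def)
  moreover have "word_act V B (degree_of G V b) u = Poly_Mapping.single u (left_weight \<chi> b u)"
    using u by (induction u) (auto simp: word_act_def tensor_mult embed_act(1)[OF _ b])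
  ultimately show ?thesis by simp
qed

lemma word_act_one: "u \<in> lists B \<Longrightarrow> word_act V B (word_degree G V []) u = bvec u"
  by (induction u) (auto simp: word_act_def word_degree_def tensor_mult embed_act(2))

text \<open>In the product of the tensor square the degree of the second factor acts on the first factor of \<open>t\<close>,
  for \<open>1 \<otimes> b\<close> by the scalar \<open>left_weight\<close>, for \<open>b \<otimes> 1\<close> trivially.\<close>

lemma letter_comult:
  assumes b: "b \<in> B" and t: "Poly_Mapping.keys t \<subseteq> lists B \<times> lists B"
  shows "(pure_tensor (bvec [b]) (bvec []) + pure_tensor (bvec []) (bvec [b])) \<otimes>\<^bsub>tensor_square G V B\<^esub> t =
    letter_cop \<chi> b t"
proof -
  define \<beta> where "\<beta> = (\<lambda>(u, w) (u', w').
          pure_tensor (bvec u \<otimes>\<^bsub>tensor_algebra B\<^esub> word_act V B (word_degree G V w) u') (bvec (w @ w')))"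
  have "(pure_tensor (bvec [b]) (bvec []) + pure_tensor (bvec []) (bvec [b])) \<otimes>\<^bsub>tensor_square G V B\<^esub> t =
      lin_ext (\<beta> ([b], [])) t + lin_ext (\<beta> ([], [b])) t"
    by (simp add: tensor_square_def \<beta>_def bilin_ext_simps)
  also have "lin_ext (\<beta> ([b], [])) t = lin_ext (\<lambda>(s, r). bvec (b # s, r)) t"
    by (rule lin_ext_cong) (use t in \<open>auto simp: \<beta>_def tensor_mult word_act_one subset_iff\<close>)
  also have "lin_ext (\<beta> ([], [b])) t = lin_ext (\<lambda>(s, r). Poly_Mapping.single (s, b # r) (left_weight \<chi> b s)) t"
    by (rule lin_ext_cong) (use t in \<open>auto simp: \<beta>_def tensor_mult word_act_degree[OF b] subset_iff\<close>)
  also have "lin_ext (\<lambda>(s, r). bvec (b # s, r)) t + lin_ext (\<lambda>(s, r). Poly_Mapping.single (s, b # r) (left_weight \<chi> b s)) t =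
      letter_cop \<chi> b t"
    unfolding letter_cop_def lin_ext_def by (simp add: case_prod_unfold scale_distrib sum.distrib)
  finally show ?thesis .
qed

lemma comult_cop:
  assumes "Poly_Mapping.keys p \<subseteq> lists B"
  shows "comult G V B p = cop \<chi> p"
proof -
  have "foldr (\<lambda>b t. (pure_tensor (bvec [b]) (bvec []) + pure_tensor (bvec []) (bvec [b]))
                \<otimes>\<^bsub>tensor_square G V B\<^esub> t) w \<one>\<^bsub>tensor_square G V B\<^esub> = cop_word \<chi> w" if "w \<in> lists B" for w
    using that
  proof (induction w)
    case Nil
    then show ?case by (simp add: tensor_square_def)
  next
    case (Cons b w)
    then show ?case using letter_comult[OF _ keys_cop_word] by simp
  qed
  then show ?thesis unfolding comult_def cop_def using assms by (intro lin_ext_cong) blast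
qed

lemma phi_kernel_counit: "p \<in> phi_kernel \<chi> B \<Longrightarrow> Poly_Mapping.lookup p [] = 0"
proof -
  assume "p \<in> phi_kernel \<chi> B"
  then have "phi_word \<chi> [] p = 0" unfolding phi_kernel_def by blast
  then show "Poly_Mapping.lookup p [] = 0" by simp
qed

text \<open>If \<open>p\<close> is in the kernel, all forms \<open>phi_pair\<close> vanish on its coproduct, as they compute coefficients of \<open>p\<close>
  at concatenated words.\<close>

lemma phi_kernel_coideal: "coideal G V B (phi_kernel \<chi> B)"
  unfolding coideal_def
proof (intro conjI ballI)
  show "csubspace (phi_kernel \<chi> B) (tensor_algebra B)" by (rule phi_kernel_subspace)
  fix p assume p: "p \<in> phi_kernel \<chi> B"
  then have k: "Poly_Mapping.keys p \<subseteq> lists B" by (simp add: phi_kernel_def)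
  show "counit p = 0"
    using phi_kernel_counit[OF p] by (simp add: counit_def)
  have "Poly_Mapping.keys (cop \<chi> p) \<subseteq> lists B \<times> lists B"
    unfolding cop_def by (rule keys_lin_ext, rule keys_cop_word) (use k in blast)
  then show "comult G V B p \<in> cspan (tensor_square G V B)
          ({pure_tensor p q | p q. p \<in> phi_kernel \<chi> B \<and> q \<in> carrier (tensor_algebra B)} \<union>
           {pure_tensor p q | p q. p \<in> carrier (tensor_algebra B) \<and> q \<in> phi_kernel \<chi> B})"
    unfolding comult_cop[OF k]
    by (rule kernel_phi_pair) (use p in \<open>simp add: phi_pair_cop phi_kernel_def\<close>)
qed

lemma phi_kernel_degree: "phi_kernel \<chi> B \<subseteq> degree_ge_2 B"
proof
  fix p assume p: "p \<in> phi_kernel \<chi> B"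
  have d: "Poly_Mapping.lookup (der \<chi> b p) [] = Poly_Mapping.lookup p [b]" for b
  proof (rule lin_form_eqI'[where p = p])
    show "lin_form (\<lambda>p. Poly_Mapping.lookup (der \<chi> b p) [])"
      by (rule lin_form_comp[OF lin_form_lookup lin_map_der(1)])
    show "lin_form (\<lambda>p. Poly_Mapping.lookup p [b])" by (rule lin_form_lookup)
    have l: "Poly_Mapping.lookup (letter_mul a q) [] = 0" for a :: 'c and q
      by (rule lin_form_eqI'[where p = q])
        (rule lin_form_comp[OF lin_form_lookup lin_map_tmul(2)], rule lin_form_zero, simp add: lookup_single)
    show "Poly_Mapping.lookup (der \<chi> b (bvec w)) [] = Poly_Mapping.lookup (bvec w) [b]" for w
      by (cases w) (auto simp: lookup_add l lookup_single when_def)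
  qed
  have "2 \<le> length w" if "w \<in> Poly_Mapping.keys p" for w
  proof (rule ccontr)
    assume "\<not> 2 \<le> length w"
    then consider "w = []" | b where "w = [b]" by (cases w; cases "tl w") auto
    then show False
    proof cases
      case 1
      then show ?thesis using that phi_kernel_counit[OF p] by (simp add: in_keys_iff)
    next
      case (2 b)
      have "phi_word \<chi> [b] p = 0" using p unfolding phi_kernel_def by blast
      then show ?thesis using that d[of b] 2 by (simp add: in_keys_iff)
    qed
  qed
  then show "p \<in> degree_ge_2 B"
    using p free_likeD(1)[OF free_like_space(2)] unfolding degree_ge_2_def phi_kernel_def by blast
qed

text \<open>The part of the coproduct with the letter \<open>b\<close> in the first factor is \<open>b \<otimes> \<partial>\<^sub>b w\<close>.\<close>

lemma left_letter_cop_word: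
  "lin_ext (\<lambda>(s, r). if s = [b] then bvec r else 0) (cop_word \<chi> w) = der_word \<chi> b w"
proof (induction w)
  case (Cons a w)
  have 0: "lin_ext (\<lambda>(s, r). if s = [] then bvec r else 0) (cop_word \<chi> w) = bvec w"
  proof (rule poly_mapping_eqI)
    fix k
    have "Poly_Mapping.lookup (lin_ext (\<lambda>(s, r). if s = [] then bvec r else 0) t) k =
        form_ext (\<lambda>(s, r). if s = [] then Poly_Mapping.lookup (bvec r) k else 0) t" for t :: "'c list \<times> 'c list \<Rightarrow>\<^sub>0 complex"
      by (rule lin_form_eqI'[where p = t])
        (rule lin_form_comp[OF lin_form_lookup lin_map_lin_ext], rule lin_form_form_ext, auto)
    then show "Poly_Mapping.lookup (lin_ext (\<lambda>(s, r). if s = [] then bvec r else 0) (cop_word \<chi> w)) k =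
        Poly_Mapping.lookup (bvec w) k"
      by (simp add: counit_cop_word)
  qed
  have "lin_ext (\<lambda>(s, r). if s = [b] then bvec r else 0) (letter_cop \<chi> a t) =
     (if a = b then lin_ext (\<lambda>(s, r). if s = [] then bvec r else 0) t else 0) +
     scale (\<chi> a b) (letter_mul a (lin_ext (\<lambda>(s, r). if s = [b] then bvec r else 0) t))" for t
  proof (rule lin_map_eqI'[where p = t])
    show "lin_map (\<lambda>t. lin_ext (\<lambda>(s, r). if s = [b] then bvec r else 0) (letter_cop \<chi> a t))"
      by (rule lin_map_comp[OF lin_map_lin_ext lin_map_cop(2)])
    have "lin_map (\<lambda>t. scale (\<chi> a b) (letter_mul a (lin_ext (\<lambda>(s, r). if s = [b] then bvec r else 0) t)))"
      by (rule lin_map_scale[OF lin_map_comp[OF lin_map_tmul(2) lin_map_lin_ext]])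
    then show "lin_map (\<lambda>t. (if a = b then lin_ext (\<lambda>(s, r). if s = [] then bvec r else 0) t else 0) +
       scale (\<chi> a b) (letter_mul a (lin_ext (\<lambda>(s, r). if s = [b] then bvec r else 0) t)))"
      by (cases "a = b") (simp_all add: lin_map_add[OF lin_map_lin_ext])
    fix sr :: "'c list \<times> 'c list"
    obtain s r where "sr = (s, r)" by fastforce
    then show "lin_ext (\<lambda>(s, r). if s = [b] then bvec r else 0) (letter_cop \<chi> a (bvec sr)) =
     (if a = b then lin_ext (\<lambda>(s, r). if s = [] then bvec r else 0) (bvec sr) else 0) +
     scale (\<chi> a b) (letter_mul a (lin_ext (\<lambda>(s, r). if s = [b] then bvec r else 0) (bvec sr)))"
      by (auto simp: lin_ext_simps tmul_simps)
  qed
  then show ?case by (simp add: Cons 0)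
qed simp

text \<open>A coideal in degrees at least two is stable under every \<open>\<partial>\<^sub>b\<close>: apply to the coproduct the map
  that extracts the coefficient of \<open>b\<close> in the first factor.  It kills \<open>I \<otimes> T\<close>, since elements of \<open>I\<close> have no linear part,
  and sends \<open>T \<otimes> I\<close> to \<open>I\<close>.  As the counit vanishes on \<open>I\<close>, all iterated derivatives have zero constant term.\<close>

lemma coideal_subset_phi_kernel:
  assumes I: "coideal G V B I" "I \<subseteq> degree_ge_2 B"
  shows "I \<subseteq> phi_kernel \<chi> B"
proof -
  have sub: "csubspace I (tensor_algebra B)" using I(1) by (simp add: coideal_def)
  note Ic = free_like_subspaceD[OF free_like_space(2) sub]
  have der: "der \<chi> b p \<in> I" if p: "p \<in> I" for p b
  proof -
    let ?F = "lin_ext (\<lambda>(s, r). if s = [b] then bvec r else (0 :: 'c list \<Rightarrow>\<^sub>0 complex))"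
    let ?T = "{t. Poly_Mapping.keys t \<subseteq> lists B \<times> lists B \<and> ?F t \<in> I}"
    have k: "Poly_Mapping.keys p \<subseteq> lists B" by (rule Ic(1)[OF p])
    have F: "?F (pure_tensor p q) = scale (Poly_Mapping.lookup p [b]) q" for p q :: "'c list \<Rightarrow>\<^sub>0 complex"
    proof (rule lin_map_eqI'[where p = p])
      show "lin_map (\<lambda>p. ?F (pure_tensor p q))" by (rule lin_map_comp[OF lin_map_lin_ext lin_map_pure_tensor(1)])
      show "lin_map (\<lambda>p. scale (Poly_Mapping.lookup p [b]) q)"
        by (simp add: lin_map_def lookup_add scale_distrib)
      show "?F (pure_tensor (bvec s) q) = scale (Poly_Mapping.lookup (bvec s) [b]) q" for s
        by (rule lin_map_eqI'[where p = q])
          (rule lin_map_comp[OF lin_map_lin_ext lin_map_pure_tensor(2)], rule lin_map_scale[OF lin_map_id],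
           simp add: lookup_single when_def)
    qed
    have T: "csubspace ?T (tensor_square G V B)"
      by (rule free_like_subspaceI[OF free_like_space(3)]) (auto simp: keys_closed lin_ext_simps Ic)
    have pt: "Poly_Mapping.keys (pure_tensor p q) \<subseteq> lists B \<times> lists B"
      if "Poly_Mapping.keys p \<subseteq> lists B" "Poly_Mapping.keys q \<subseteq> lists B" for p q :: "'c list \<Rightarrow>\<^sub>0 complex"
      unfolding pure_tensor_def by (rule keys_bilin_ext) (use that in auto)
    have l0: "Poly_Mapping.lookup p [b] = 0" if "p \<in> I" for p
      using I(2) that unfolding degree_ge_2_def by (force simp: in_keys_iff)
    have "cspan (tensor_square G V B)
          ({pure_tensor p q | p q. p \<in> I \<and> q \<in> carrier (tensor_algebra B)} \<union>
           {pure_tensor p q | p q. p \<in> carrier (tensor_algebra B) \<and> q \<in> I}) \<subseteq> ?T"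
    proof (rule cspan_least[OF T], rule Un_least)
      show "{pure_tensor p q | p q. p \<in> I \<and> q \<in> carrier (tensor_algebra B)} \<subseteq> ?T"
      proof clarify
        fix p q assume pq: "p \<in> I" "q \<in> carrier (tensor_algebra B)"
        then have "Poly_Mapping.keys q \<subseteq> lists B" using free_likeD(1)[OF free_like_space(2)] by blast
        then show "Poly_Mapping.keys (pure_tensor p q) \<subseteq> lists B \<times> lists B \<and> ?F (pure_tensor p q) \<in> I"
          using pt[OF Ic(1)[OF pq(1)]] by (simp add: F l0[OF pq(1)] Ic(2) del: lists_eq_set)
      qed
      show "{pure_tensor p q | p q. p \<in> carrier (tensor_algebra B) \<and> q \<in> I} \<subseteq> ?T"
      proof clarify
        fix p q assume pq: "p \<in> carrier (tensor_algebra B)" "q \<in> I"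
        then have "Poly_Mapping.keys p \<subseteq> lists B" using free_likeD(1)[OF free_like_space(2)] by blast
        then show "Poly_Mapping.keys (pure_tensor p q) \<subseteq> lists B \<times> lists B \<and> ?F (pure_tensor p q) \<in> I"
          using pt[OF _ Ic(1)[OF pq(2)]] by (simp add: F Ic(4)[OF pq(2)] del: lists_eq_set)
      qed
    qed
    moreover have "comult G V B p \<in> cspan (tensor_square G V B)
          ({pure_tensor p q | p q. p \<in> I \<and> q \<in> carrier (tensor_algebra B)} \<union>
           {pure_tensor p q | p q. p \<in> carrier (tensor_algebra B) \<and> q \<in> I})"
      using I(1) p unfolding coideal_def by simp
    ultimately have "comult G V B p \<in> ?T" by (rule subsetD)
    then have "?F (comult G V B p) \<in> I" by simp
    moreover have "?F (cop \<chi> q) = der \<chi> b q" for q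
      by (rule lin_map_eqI'[where p = q])
        (rule lin_map_comp[OF lin_map_lin_ext lin_map_cop(1)], rule lin_map_der(1), simp add: left_letter_cop_word)
    ultimately show ?thesis by (simp add: comult_cop[OF k])
  qed
  have "phi_word \<chi> w p = 0" if "p \<in> I" for w p
    using that
  proof (induction w arbitrary: p)
    case Nil
    then show ?case using I(1) by (simp add: coideal_def counit_def)
  qed (simp add: der)
  then show ?thesis using Ic(1) unfolding phi_kernel_def by blast
qed

theorem nichols_ideal_eq: "nichols_ideal G V B = phi_kernel \<chi> B"
  unfolding nichols_ideal_def
  by (rule Greatest_equality) (use phi_kernel_coideal phi_kernel_degree coideal_subset_phi_kernel in auto)

end

section \<open>Growth of Nichols algebras\<close>

text \<open>The factor \<open>2\<close> is harmless for deciding finiteness and avoids a limit: for large \<open>n\<close> one has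
  \<open>m n + 1 \<le> n\<^sup>2\<close>, so the logarithm to base \<open>n\<close> of the bound is at most \<open>2 d\<close>.\<close>

lemma GKdim_le:
  assumes "\<And>U. csubspace U A \<Longrightarrow> cfin_dim (A\<lparr>carrier := U\<rparr>) \<Longrightarrow>
    \<exists>m. \<forall>n. cdim (A\<lparr>carrier := power_space A U n\<rparr>) \<le> (m * n + 1) ^ d"
  shows "GKdim A \<le> ereal (2 * real d)"
  unfolding GKdim_def
proof (rule SUP_least)
  fix U assume "U \<in> {U. csubspace U A \<and> cfin_dim (A\<lparr>carrier := U\<rparr>)}"
  then obtain m where m: "\<And>n. cdim (A\<lparr>carrier := power_space A U n\<rparr>) \<le> (m * n + 1) ^ d"
    using assms by blast
  have "(let e = cdim (A\<lparr>carrier := power_space A U n\<rparr>) in if e = 0 then -\<infinity> else ereal (log (real n) (real e)))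
      \<le> ereal (2 * real d)" if n: "n \<ge> m + 2" for n
  proof (cases "cdim (A\<lparr>carrier := power_space A U n\<rparr>) = 0")
    case False
    let ?e = "cdim (A\<lparr>carrier := power_space A U n\<rparr>)"
    have "m * n + 1 \<le> n ^ 2"
    proof -
      have "m * n + 1 \<le> (m + 1) * n" using n by simp
      also have "\<dots> \<le> n * n" using n by (intro mult_right_mono) auto
      finally show ?thesis by (simp add: power2_eq_square)
    qed
    then have "(m * n + 1) ^ d \<le> n ^ (2 * d)" unfolding power_mult by (rule power_mono) simp
    then have "?e \<le> n ^ (2 * d)" using m[of n] by (rule order.trans[rotated])
    then have "real ?e \<le> real n ^ (2 * d)" by (metis of_nat_le_iff of_nat_power)
    moreover have "1 < real n" "0 < real ?e" using n False by simp_all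
    ultimately have "log (real n) (real ?e) \<le> log (real n) (real n ^ (2 * d))" by (intro log_mono) auto
    also have "\<dots> = 2 * real d" using n by (simp add: log_nat_power)
    finally show ?thesis using False by (simp add: Let_def)
  qed (simp add: Let_def)
  then show "limsup (\<lambda>n. let e = cdim (A\<lparr>carrier := power_space A U n\<rparr>)
                    in if e = 0 then -\<infinity> else ereal (log (real n) (real e))) \<le> ereal (2 * real d)"
    by (intro Limsup_bounded eventually_sequentiallyI[of "m + 2"])
qed

text \<open>Growth is only required along the multiples of \<open>C\<close>, which the upper limit detects; for
  \<open>M \<ge> C + 2\<close> one has \<open>C M \<le> M\<^sup>2\<close>, so \<open>M\<^sup>D\<close> has logarithm at least \<open>D / 2\<close> to base \<open>C M\<close>.\<close>

lemma GKdim_infinite: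
  assumes U: "csubspace U A" "cfin_dim (A\<lparr>carrier := U\<rparr>)"
    and growth: "\<And>D. \<exists>C>0. \<forall>M\<ge>1. M ^ D \<le> cdim (A\<lparr>carrier := power_space A U (C * M)\<rparr>)"
  shows "GKdim A = \<infinity>"
proof (rule ereal_top)
  fix B :: real
  obtain D :: nat where "2 * B \<le> real D" using real_arch_simple by blast
  then have D: "B \<le> real D / 2" by simp
  define X where "X n = (let e = cdim (A\<lparr>carrier := power_space A U n\<rparr>)
                    in if e = 0 then -\<infinity> else ereal (log (real n) (real e)))" for n
  obtain C where C: "C > 0" "\<And>M. M \<ge> 1 \<Longrightarrow> M ^ D \<le> cdim (A\<lparr>carrier := power_space A U (C * M)\<rparr>)"
    using growth[of D] by blast
  have big: "ereal (real D / 2) \<le> X (C * M)" if M: "M \<ge> C + 2" for M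
  proof -
    let ?e = "cdim (A\<lparr>carrier := power_space A U (C * M)\<rparr>)"
    have e: "M ^ D \<le> ?e" using C(2)[of M] M by simp
    have "0 < M ^ D" using M by simp
    then have e0: "?e \<noteq> 0" using e by linarith
    have "1 * 2 \<le> C * M" using C(1) M by (intro mult_le_mono) auto
    then have CM: "1 < real (C * M)" by linarith
    have "real (C * M) \<le> real M ^ 2"
    proof -
      have "C * M \<le> M * M" using M by (intro mult_right_mono) auto
      then show ?thesis by (metis of_nat_le_iff of_nat_mult power2_eq_square)
    qed
    then have "log (real (C * M)) (real (C * M)) \<le> log (real (C * M)) (real M ^ 2)"
      using CM by (intro log_mono) auto
    then have half: "1 / 2 \<le> log (real (C * M)) (real M)" using CM M by (simp add: log_nat_power)
    have "real D / 2 \<le> real D * log (real (C * M)) (real M)" using mult_left_mono[OF half, of "real D"] by simp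
    also have "\<dots> = log (real (C * M)) (real M ^ D)" using M by (simp add: log_nat_power)
    also have "\<dots> \<le> log (real (C * M)) (real ?e)"
      using CM M e by (intro log_mono) (auto simp flip: of_nat_power)
    finally show ?thesis using e0 by (simp add: X_def Let_def)
  qed
  have "ereal (real D / 2) \<le> limsup X"
  proof (rule ccontr)
    assume "\<not> ?thesis"
    then have "eventually (\<lambda>n. X n < ereal (real D / 2)) sequentially"
      by (intro Limsup_lessD) simp
    then obtain N where N: "\<And>n. n \<ge> N \<Longrightarrow> X n < ereal (real D / 2)"
      unfolding eventually_sequentially by blast
    have "1 * (N + C + 2) \<le> C * (N + C + 2)" using C(1) by (intro mult_right_mono) auto
    then have "N \<le> C * (N + C + 2)" by (rule order.trans[rotated]) simp
    then show False using N[of "C * (N + C + 2)"] big[of "N + C + 2"] by simp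
  qed
  also have "\<dots> \<le> GKdim A"
  proof -
    define F where "F W = limsup (\<lambda>n. let e = cdim (A\<lparr>carrier := power_space A W n\<rparr>)
                    in if e = 0 then -\<infinity> else ereal (log (real n) (real e)))" for W
    have "F U \<le> (SUP W \<in> {W. csubspace W A \<and> cfin_dim (A\<lparr>carrier := W\<rparr>)}. F W)"
      using U by (intro SUP_upper) simp
    then show ?thesis unfolding GKdim_def F_def X_def .
  qed
  finally show "ereal B \<le> GKdim A" using D by (meson ereal_less_eq(3) order.trans)
qed

context diagonal_basis
begin

abbreviation nich where "nich \<equiv> quotient_module (tensor_algebra B) (phi_kernel \<chi> B)"
abbreviation cls where "cls p \<equiv> phi_kernel \<chi> B +>\<^bsub>tensor_algebra B\<^esub> p"

lemmas TN = free_like_space(2)[of B] phi_kernel_subspace[of \<chi> B]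
lemmas kern = free_like_subspaceD[OF TN]

lemma cls_mult:
  assumes p: "Poly_Mapping.keys p \<subseteq> lists B" and q: "Poly_Mapping.keys q \<subseteq> lists B"
  shows "cls p \<otimes>\<^bsub>nich\<^esub> cls q = cls (tmul p q)" "\<one>\<^bsub>nich\<^esub> = cls (bvec [])"
proof -
  have "cls (tmul (n + p) (n' + q)) = cls (tmul p q)"
    if n: "n \<in> phi_kernel \<chi> B" "n' \<in> phi_kernel \<chi> B" for n n'
  proof -
    have "tmul (n + p) (n' + q) - tmul p q = tmul n (n' + q) + tmul p n'" by (simp add: tmul_simps)
    also have "\<dots> \<in> phi_kernel \<chi> B"
      by (intro kern(3) phi_kernel_ideal n keys_closed p q kern(1)[OF n(2)])
    finally show ?thesis by (simp add: coset_eq_iff[OF TN])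
  qed
  moreover have "0 \<in> phi_kernel \<chi> B" by (rule kern(2))
  moreover have "cls p \<otimes>\<^bsub>nich\<^esub> cls q =
      (\<Union>n\<in>phi_kernel \<chi> B. \<Union>n'\<in>phi_kernel \<chi> B. cls (tmul (n + p) (n' + q)))"
    unfolding quotient_module_simps rcoset_mult_def tensor_mult coset_elements[OF TN(1)] by auto
  ultimately show "cls p \<otimes>\<^bsub>nich\<^esub> cls q = cls (tmul p q)" by auto
  show "\<one>\<^bsub>nich\<^esub> = cls (bvec [])" by (simp add: quotient_module_simps tensor_mult)
qed

text \<open>The image in the Nichols algebra of the polynomials of degree at most \<open>k\<close>.  Every finite-dimensional subspace lies
  in one of these, and \<open>bounded_part k\<close> is the \<open>k\<close>-th power of \<open>bounded_part 1\<close>.\<close>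

definition bounded_part :: "nat \<Rightarrow> ('c list \<Rightarrow>\<^sub>0 complex) set set" where
  "bounded_part k = cls ` {p. Poly_Mapping.keys p \<subseteq> {w \<in> lists B. length w \<le> k}}"

lemma bounded_part_subspace: "csubspace (bounded_part k) nich"
proof (rule csubspaceI[OF quotient_vectorspace[OF TN]])
  show "bounded_part k \<subseteq> carrier nich" by (auto simp: bounded_part_def quotient_carrier[OF TN])
  show "\<zero>\<^bsub>nich\<^esub> \<in> bounded_part k" by (auto simp: bounded_part_def quotient_zero[OF TN])
  show "v \<oplus>\<^bsub>nich\<^esub> w \<in> bounded_part k" if vw: "v \<in> bounded_part k" "w \<in> bounded_part k" for v w
  proof -
    obtain p q where "v = cls p" "w = cls q" "Poly_Mapping.keys p \<subseteq> {w \<in> lists B. length w \<le> k}"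
      "Poly_Mapping.keys q \<subseteq> {w \<in> lists B. length w \<le> k}" using vw unfolding bounded_part_def by blast
    then show ?thesis unfolding bounded_part_def
      by (intro image_eqI[of _ _ "p + q"]) (simp_all only: quotient_add[OF TN] mem_Collect_eq keys_closed(1))
  qed
  show "c \<odot>\<^bsub>nich\<^esub> v \<in> bounded_part k" if v: "v \<in> bounded_part k" for c v
  proof -
    obtain p where "v = cls p" "Poly_Mapping.keys p \<subseteq> {w \<in> lists B. length w \<le> k}"
      using v unfolding bounded_part_def by blast
    then show ?thesis unfolding bounded_part_def
      by (intro image_eqI[of _ _ "scale c p"]) (simp_all only: quotient_smult[OF TN] mem_Collect_eq keys_closed(3))
  qed
qed

lemmas cls_in_span = quotient_in_span[OF TN]

lemma bounded_part_mult:
  assumes "u \<in> bounded_part j" "v \<in> bounded_part k"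
  shows "u \<otimes>\<^bsub>nich\<^esub> v \<in> bounded_part (j + k)"
proof -
  obtain p q where pq: "u = cls p" "v = cls q" "Poly_Mapping.keys p \<subseteq> {w \<in> lists B. length w \<le> j}"
    "Poly_Mapping.keys q \<subseteq> {w \<in> lists B. length w \<le> k}" using assms unfolding bounded_part_def by blast
  have "Poly_Mapping.keys (tmul p q) \<subseteq> {w \<in> lists B. length w \<le> j + k}"
    unfolding tmul_def by (rule keys_bilin_ext) (use pq(3,4) in fastforce)
  moreover have "u \<otimes>\<^bsub>nich\<^esub> v = cls (tmul p q)" unfolding pq(1,2) by (rule cls_mult(1)) (use pq in blast)+
  ultimately show ?thesis unfolding bounded_part_def by blast
qed

lemma power_space_bounded:
  assumes U: "U \<subseteq> bounded_part m"
  shows "power_space nich U n \<subseteq> bounded_part (m * n)"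
  unfolding power_space_def
proof (rule cspan_least[OF bounded_part_subspace], clarify)
  fix us assume "set us \<subseteq> U"
  then show "foldr (\<otimes>\<^bsub>nich\<^esub>) us \<one>\<^bsub>nich\<^esub> \<in> bounded_part (m * length us)"
  proof (induction us)
    case Nil
    have "\<one>\<^bsub>nich\<^esub> = cls (bvec [])" by (rule cls_mult(2)[of 0 0]) auto
    then show ?case by (auto simp: bounded_part_def)
  next
    case (Cons u us)
    then show ?case using bounded_part_mult[of u m _ "m * length us"] U by auto
  qed
qed

lemma finite_dim_bounded:
  assumes U: "csubspace U nich" "cfin_dim (nich\<lparr>carrier := U\<rparr>)"
  shows "\<exists>m. U \<subseteq> bounded_part m"
proof -
  interpret Q: vectorspace CC nich by (rule quotient_vectorspace[OF TN])
  interpret W: vectorspace CC "nich\<lparr>carrier := U\<rparr>" by (rule Q.subspace_is_vs[OF U(1)])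
  obtain A where A: "finite A" "A \<subseteq> U" "W.span A = U" using U(2) unfolding W.fin_dim_def by auto
  have span: "cspan nich A = U" using Q.span_li_not_depend(1)[OF A(2)] U(1) A(3) by (simp add: subspace_def)
  have mono: "bounded_part m \<subseteq> bounded_part m'" if "m \<le> m'" for m m'
    unfolding bounded_part_def by (rule image_mono) (use that in auto)
  have one: "\<exists>m. a \<in> bounded_part m" if a: "a \<in> A" for a
  proof -
    have "a \<in> carrier nich" using a A(2) csubspaceD(2)[OF U(1)] by blast
    then obtain p where p: "a = cls p" "Poly_Mapping.keys p \<subseteq> lists B" by (auto simp: quotient_carrier[OF TN])
    have "Poly_Mapping.keys p \<subseteq> {w \<in> lists B. length w \<le> Max (length ` Poly_Mapping.keys p)}" using p(2) by auto
    then show ?thesis unfolding bounded_part_def p(1) by blast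
  qed
  have "\<exists>m. A \<subseteq> bounded_part m" using A(1) one
  proof (induction A)
    case (insert a A)
    then obtain m m' where "A \<subseteq> bounded_part m" "a \<in> bounded_part m'" by blast
    then have "insert a A \<subseteq> bounded_part (max m m')" using mono[of m "max m m'"] mono[of m' "max m m'"] by auto
    then show ?case by blast
  qed simp
  then obtain m where "A \<subseteq> bounded_part m" by blast
  then have "cspan nich A \<subseteq> bounded_part m" by (rule cspan_least[OF bounded_part_subspace])
  then show ?thesis using span by blast
qed

text \<open>The subspace \<open>bounded_part 1\<close> contains the unit, which serves to pad words of length less than \<open>n\<close>.\<close>

lemma power_space_generators: "power_space nich (bounded_part 1) n = bounded_part n"
proof
  show "power_space nich (bounded_part 1) n \<subseteq> bounded_part n" using power_space_bounded[of "bounded_part 1" 1 n] by simp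
  let ?P = "{foldr (\<otimes>\<^bsub>nich\<^esub>) us \<one>\<^bsub>nich\<^esub> | us. length us = n \<and> set us \<subseteq> bounded_part 1}"
  have one: "\<one>\<^bsub>nich\<^esub> = cls (bvec [])" by (rule cls_mult(2)[of 0 0]) auto
  have P: "?P \<subseteq> carrier nich"
  proof
    fix z assume "z \<in> ?P"
    then obtain us where us: "z = foldr (\<otimes>\<^bsub>nich\<^esub>) us \<one>\<^bsub>nich\<^esub>" "set us \<subseteq> bounded_part 1" by blast
    have "foldr (\<otimes>\<^bsub>nich\<^esub>) us \<one>\<^bsub>nich\<^esub> \<in> bounded_part (length us)" using us(2)
    proof (induction us)
      case Nil
      then show ?case by (auto simp: bounded_part_def one)
    next
      case (Cons u us)
      then show ?case using bounded_part_mult[of u 1 _ "length us"] by simp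
    qed
    then show "z \<in> carrier nich" using us(1) csubspaceD(2)[OF bounded_part_subspace] by blast
  qed
  have word: "cls (bvec w) \<in> ?P" if w: "w \<in> lists B" "length w \<le> n" for w
  proof -
    define us where "us = map (\<lambda>b. cls (bvec [b])) w @ replicate (n - length w) (cls (bvec []))"
    have "foldr (\<otimes>\<^bsub>nich\<^esub>) (replicate j (cls (bvec []))) \<one>\<^bsub>nich\<^esub> = cls (bvec [])" for j
      by (induction j) (simp_all add: one cls_mult(1))
    then have "foldr (\<otimes>\<^bsub>nich\<^esub>) us \<one>\<^bsub>nich\<^esub> = cls (bvec w)"
      using w(1) unfolding us_def by (induction w) (simp_all add: cls_mult(1))
    moreover have "length us = n" "set us \<subseteq> bounded_part 1"
      using w by (auto simp: us_def bounded_part_def)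
    ultimately show ?thesis by (auto intro!: exI[of _ us])
  qed
  show "bounded_part n \<subseteq> power_space nich (bounded_part 1) n"
  proof
    fix z assume "z \<in> bounded_part n"
    then obtain p where p: "z = cls p" "Poly_Mapping.keys p \<subseteq> {w \<in> lists B. length w \<le> n}"
      unfolding bounded_part_def by blast
    have "cls p \<in> cspan nich ?P"
      by (rule cls_in_span[OF P _ p(2)]) (use word cspan_closed(2)[OF quotient_vectorspace[OF TN] P] in blast)
    then show "z \<in> power_space nich (bounded_part 1) n" unfolding power_space_def p(1) .
  qed
qed

lemma bounded_part_finite_dim:
  assumes "finite B"
  shows "cfin_dim (nich\<lparr>carrier := bounded_part k\<rparr>)"
proof (rule subspace_dim_le(1)[OF quotient_vectorspace[OF TN] bounded_part_subspace])
  let ?P = "(\<lambda>w. cls (bvec w)) ` {w \<in> lists B. length w \<le> k}"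
  have "finite {w. set w \<subseteq> B \<and> length w \<le> k}" by (rule finite_lists_length_le[OF assms])
  then show "finite ?P" by (simp add: lists_eq_set)
  show P: "?P \<subseteq> carrier nich" by (auto simp: quotient_carrier[OF TN])
  show "bounded_part k \<subseteq> cspan nich ?P"
  proof
    fix z assume "z \<in> bounded_part k"
    then obtain p where p: "z = cls p" "Poly_Mapping.keys p \<subseteq> {w \<in> lists B. length w \<le> k}"
      unfolding bounded_part_def by blast
    show "z \<in> cspan nich ?P" unfolding p(1)
      by (rule cls_in_span[OF P _ p(2)]) (use cspan_closed(2)[OF quotient_vectorspace[OF TN] P] in blast)
  qed
qed

text \<open>It suffices to find, for every \<open>D\<close>, families of \<open>M\<^sup>D\<close> elements of degree linear in \<open>M\<close> that are independent
  modulo the Nichols ideal.\<close>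

theorem GKdim_infinite_if_independent:
  assumes B: "finite B"
    and ind: "\<And>D. \<exists>C>0. \<forall>M\<ge>1. \<exists>I v. finite (I :: 'i set) \<and> card I \<ge> M ^ D \<and>
      (\<forall>i\<in>I. Poly_Mapping.keys (v i) \<subseteq> {w \<in> lists B. length w \<le> C * M}) \<and>
      (\<forall>a. (\<Sum>i\<in>I. scale (a i) (v i)) \<in> phi_kernel \<chi> B \<longrightarrow> (\<forall>i\<in>I. a i = 0))"
  shows "GKdim nich = \<infinity>"
proof (rule GKdim_infinite[OF bounded_part_subspace bounded_part_finite_dim[OF B]])
  fix D
  obtain C where C: "C > 0" "\<And>M. M \<ge> 1 \<Longrightarrow> \<exists>I v. finite (I :: 'i set) \<and> card I \<ge> M ^ D \<and>
      (\<forall>i\<in>I. Poly_Mapping.keys (v i) \<subseteq> {w \<in> lists B. length w \<le> C * M}) \<and>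
      (\<forall>a. (\<Sum>i\<in>I. scale (a i) (v i)) \<in> phi_kernel \<chi> B \<longrightarrow> (\<forall>i\<in>I. a i = 0))"
    using ind[of D] by blast
  have "M ^ D \<le> cdim (nich\<lparr>carrier := power_space nich (bounded_part 1) (C * M)\<rparr>)" if M1: "M \<ge> 1" for M
  proof -
    obtain I :: "'i set" and v where Iv: "finite I \<and> card I \<ge> M ^ D \<and>
      (\<forall>i\<in>I. Poly_Mapping.keys (v i) \<subseteq> {w \<in> lists B. length w \<le> C * M}) \<and>
      (\<forall>a. (\<Sum>i\<in>I. scale (a i) (v i)) \<in> phi_kernel \<chi> B \<longrightarrow> (\<forall>i\<in>I. a i = 0))"
      using C(2)[OF M1] by (elim exE)
    then have I: "finite I" "card I \<ge> M ^ D"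
      "\<And>i. i \<in> I \<Longrightarrow> Poly_Mapping.keys (v i) \<subseteq> {w \<in> lists B. length w \<le> C * M}"
      "\<And>a. (\<Sum>i\<in>I. scale (a i) (v i)) \<in> phi_kernel \<chi> B \<Longrightarrow> (\<forall>i\<in>I. a i = 0)"
      by simp_all
    have "card I \<le> cdim (nich\<lparr>carrier := bounded_part (C * M)\<rparr>)"
    proof (rule quotient_dim_ge[OF TN I(1) _ I(4) bounded_part_subspace _ bounded_part_finite_dim[OF B]])
      show "Poly_Mapping.keys (v i) \<subseteq> lists B" if "i \<in> I" for i using I(3)[OF that] by blast
      show "cls (v i) \<in> bounded_part (C * M)" if "i \<in> I" for i
        using I(3)[OF that] unfolding bounded_part_def by blast
    qed
    then show ?thesis using I(2) unfolding power_space_generators by (rule order.trans[rotated])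
  qed
  then show "\<exists>C>0. \<forall>M\<ge>1. M ^ D \<le> cdim (nich\<lparr>carrier := power_space nich (bounded_part 1) (C * M)\<rparr>)"
    using C(1) by blast
qed

text \<open>The words agree in the Nichols algebra up to a scalar, which may be zero.  The relation is reflexive,
  transitive and compatible with left multiplication, which is enough for sorting words.\<close>

definition proportional :: "'c list \<Rightarrow> 'c list \<Rightarrow> bool" where
  "proportional w w' \<longleftrightarrow> (\<exists>c. bvec w - scale c (bvec w') \<in> phi_kernel \<chi> B)"

lemma proportional_refl: "proportional w w"
  unfolding proportional_def by (rule exI[of _ 1]) (simp add: kern(2))

lemma proportional_trans: "proportional u v \<Longrightarrow> proportional v w \<Longrightarrow> proportional u w"
proof -
  assume "proportional u v" "proportional v w"
  then obtain c d where cd: "bvec u - scale c (bvec v) \<in> phi_kernel \<chi> B" "bvec v - scale d (bvec w) \<in> phi_kernel \<chi> B"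
    unfolding proportional_def by blast
  have "bvec u - scale (c * d) (bvec w) = (bvec u - scale c (bvec v)) + scale c (bvec v - scale d (bvec w))"
    by (simp add: scale_distrib)
  also have "\<dots> \<in> phi_kernel \<chi> B" by (intro kern cd)
  finally show ?thesis unfolding proportional_def by blast
qed

lemma proportional_Cons:
  assumes "b \<in> B" "proportional u v"
  shows "proportional (b # u) (b # v)"
proof -
  obtain c where c: "bvec u - scale c (bvec v) \<in> phi_kernel \<chi> B" using assms(2) unfolding proportional_def by blast
  have "bvec (b # u) - scale c (bvec (b # v)) = tmul (bvec [b]) (bvec u - scale c (bvec v))"
    by (simp add: tmul_simps)
  also have "\<dots> \<in> phi_kernel \<chi> B" by (rule phi_kernel_ideal(2)[OF c]) (use assms(1) in auto)
  finally show ?thesis unfolding proportional_def by blast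
qed

text \<open>Words can be sorted up to scalars, so in degree at most \<open>k\<close> the algebra is spanned by sorted words,
  given by exponents at most \<open>k\<close> for the elements of \<open>B\<close>.  There are at most \<open>(k + 1)\<^sup>|\<^sup>B\<^sup>|\<close> of these.\<close>

theorem GKdim_finite_if_commutation:
  assumes B: "finite B"
    and sw: "\<And>a b. a \<in> B \<Longrightarrow> b \<in> B \<Longrightarrow> proportional [a, b] [b, a]"
  shows "GKdim nich < \<infinity>"
proof -
  have swap: "proportional (a # b # w) (b # a # w)" if ab: "a \<in> B" "b \<in> B" "w \<in> lists B" for a b w
  proof -
    obtain c where c: "bvec [a, b] - scale c (bvec [b, a]) \<in> phi_kernel \<chi> B"
      using sw[OF ab(1,2)] unfolding proportional_def by blast
    have "bvec (a # b # w) - scale c (bvec (b # a # w)) = tmul (bvec [a, b] - scale c (bvec [b, a])) (bvec w)"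
      by (simp add: tmul_simps)
    also have "\<dots> \<in> phi_kernel \<chi> B" by (rule phi_kernel_ideal(1)[OF c]) (use ab in auto)
    finally show ?thesis unfolding proportional_def by blast
  qed
  have move: "proportional (a # l @ r) (l @ a # r)" if "a \<in> B" "l \<in> lists B" "r \<in> lists B" for a l r
    using that
  proof (induction l)
    case (Cons b l)
    have "proportional (a # b # l @ r) (b # a # l @ r)" by (rule swap) (use Cons in auto)
    moreover have "proportional (b # a # l @ r) (b # l @ a # r)" by (rule proportional_Cons) (use Cons in auto)
    ultimately show ?case by (auto intro: proportional_trans)
  qed (simp add: proportional_refl)
  have perm: "proportional w w'" if "mset w = mset w'" "w \<in> lists B" for w w'
    using that
  proof (induction w arbitrary: w')
    case (Cons a w)
    have "a \<in> set w'" using Cons.prems(1) by (metis list.set_intros(1) set_mset_mset)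
    then obtain l r where w': "w' = l @ a # r" by (meson split_list)
    have m: "mset w = mset (l @ r)" using Cons.prems(1) by (simp add: w')
    have lr: "set l \<subseteq> B" "set r \<subseteq> B"
      using Cons.prems(2) arg_cong[OF m, of set_mset] by auto
    have "proportional (a # w) (a # l @ r)"
      by (rule proportional_Cons, use Cons.prems(2) in simp, rule Cons.IH[OF m]) (use Cons.prems(2) in simp)
    moreover have "proportional (a # l @ r) (l @ a # r)" by (rule move) (use Cons.prems(2) lr in auto)
    ultimately show ?case unfolding w' by (rule proportional_trans)
  qed (simp add: proportional_refl)
  obtain bs where bs: "set bs = B" "distinct bs" using finite_distinct_list[OF B] by blast
  \<comment> \<open>The sorted word that contains each letter \<open>b\<close> with multiplicity \<open>f b\<close>.\<close>
  define canon where "canon f = concat (map (\<lambda>b. replicate (f b) b) bs)" for f :: "'c \<Rightarrow> nat"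
  have canon_mset: "mset (canon f) = mset w" if "w \<in> lists B" "\<And>b. b \<in> B \<Longrightarrow> f b = count (mset w) b" for f w
  proof (rule multiset_eqI)
    fix x
    have "count (mset (concat (map (\<lambda>b. replicate (f b) b) cs))) x = (if x \<in> set cs then f x else 0)"
      if "distinct cs" for cs
      using that by (induction cs) auto
    then show "count (mset (canon f)) x = count (mset w) x"
      using bs that by (auto simp: canon_def count_eq_zero_iff in_lists_conv_set)
  qed
  have canonB: "canon f \<in> lists B" for f unfolding canon_def using bs by auto
  define P where "P k = (\<lambda>f. cls (bvec (canon f))) ` (B \<rightarrow>\<^sub>E {..k})" for k
  have P: "P k \<subseteq> carrier nich" for k using canonB by (auto simp: P_def quotient_carrier[OF TN])
  have cardP: "finite (P k)" "card (P k) \<le> (k + 1) ^ card B" for k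
  proof -
    have f: "finite (B \<rightarrow>\<^sub>E {..k})" by (rule finite_PiE) (use B in auto)
    then show "finite (P k)" by (simp add: P_def)
    have "card (P k) \<le> card (B \<rightarrow>\<^sub>E {..k})" unfolding P_def by (rule card_image_le[OF f])
    then show "card (P k) \<le> (k + 1) ^ card B" using B by (simp add: card_PiE)
  qed
  have spanP: "bounded_part k \<subseteq> cspan nich (P k)" for k
  proof
    fix z assume "z \<in> bounded_part k"
    then obtain p where p: "z = cls p" "Poly_Mapping.keys p \<subseteq> {w \<in> lists B. length w \<le> k}"
      unfolding bounded_part_def by blast
    note sp = cspan_closed[OF quotient_vectorspace[OF TN] P[of k]]
    show "z \<in> cspan nich (P k)" unfolding p(1)
    proof (rule cls_in_span[OF P _ p(2)])
      fix w assume w: "w \<in> {w \<in> lists B. length w \<le> k}"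
      define f where "f = restrict (count (mset w)) B"
      have "count (mset w) b \<le> k" for b using w count_le_length[of w b] by (simp add: count_mset)
      then have f: "f \<in> B \<rightarrow>\<^sub>E {..k}" by (auto simp: f_def)
      have "mset w = mset (canon f)" by (rule canon_mset[symmetric]) (use w in \<open>auto simp: f_def\<close>)
      then have "proportional w (canon f)" by (rule perm) (use w in simp)
      then obtain c where "bvec w - scale c (bvec (canon f)) \<in> phi_kernel \<chi> B" unfolding proportional_def by blast
      then have "cls (bvec w) = c \<odot>\<^bsub>nich\<^esub> cls (bvec (canon f))"
        by (simp only: coset_eq_iff[OF TN] quotient_smult[OF TN])
      moreover have "cls (bvec (canon f)) \<in> cspan nich (P k)" using sp(2) f by (auto simp: P_def)
      ultimately show "cls (bvec w) \<in> cspan nich (P k)" using csubspaceD(5)[OF sp(1)] by simp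
    qed
  qed
  have "GKdim nich \<le> ereal (2 * real (card B))"
  proof (rule GKdim_le)
    fix U assume U: "csubspace U nich" "cfin_dim (nich\<lparr>carrier := U\<rparr>)"
    obtain m where m: "U \<subseteq> bounded_part m" using finite_dim_bounded[OF U] by blast
    have "cdim (nich\<lparr>carrier := power_space nich U n\<rparr>) \<le> (m * n + 1) ^ card B" for n
    proof -
      have foldU: "{foldr (\<otimes>\<^bsub>nich\<^esub>) us \<one>\<^bsub>nich\<^esub> | us. length us = n \<and> set us \<subseteq> U} \<subseteq> carrier nich"
      proof clarify
        fix us assume "set us \<subseteq> U"
        then show "foldr (\<otimes>\<^bsub>nich\<^esub>) us \<one>\<^bsub>nich\<^esub> \<in> carrier nich"
        proof -
          assume us: "set us \<subseteq> U"
          have "foldr (\<otimes>\<^bsub>nich\<^esub>) us \<one>\<^bsub>nich\<^esub> \<in> bounded_part (m * length us)" using us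
          proof (induction us)
            case Nil
            have "\<one>\<^bsub>nich\<^esub> = cls (bvec [])" by (rule cls_mult(2)[of 0 0]) auto
            then show ?case by (auto simp: bounded_part_def)
          next
            case (Cons u us)
            then show ?case using bounded_part_mult[of u m _ "m * length us"] m by auto
          qed
          then show ?thesis using csubspaceD(2)[OF bounded_part_subspace] by blast
        qed
      qed
      have sub: "csubspace (power_space nich U n) nich"
        unfolding power_space_def by (rule cspan_closed(1)[OF quotient_vectorspace[OF TN] foldU])
      have "power_space nich U n \<subseteq> cspan nich (P (m * n))"
        using power_space_bounded[OF m] spanP by blast
      then show ?thesis
        using subspace_dim_le(2)[OF quotient_vectorspace[OF TN] sub cardP(1) P] cardP(2)[of "m * n"] by fastforce
    qed
    then show "\<exists>m. \<forall>n. cdim (nich\<lparr>carrier := power_space nich U n\<rparr>) \<le> (m * n + 1) ^ card B" by blast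
  qed
  also have "\<dots> < \<infinity>" by simp
  finally show ?thesis .
qed

end

section \<open>Letters that commute up to sign\<close>

context diagonal_basis
begin

text \<open>For \<open>a \<noteq> b\<close> the derivatives of \<open>ab - \<epsilon> ba\<close> along \<open>a\<close> and \<open>b\<close> are \<open>(1 - \<epsilon>\<^sup>2) b\<close> and \<open>\<epsilon> a - \<epsilon> a\<close>;
  for \<open>a = b\<close> the derivative of \<open>(1 - \<epsilon>) aa\<close> is \<open>(1 - \<epsilon>) (1 + \<epsilon>) a\<close>.  All of them vanish as
  \<open>\<epsilon>\<^sup>2 = 1\<close>.\<close>

lemma sign_commutation:
  assumes "a \<in> B" "b \<in> B" and eps: "\<And>a b. a \<in> B \<Longrightarrow> b \<in> B \<Longrightarrow> \<chi> a b = \<epsilon>" "\<epsilon> * \<epsilon> = 1"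
  shows "proportional [a, b] [b, a]"
  unfolding proportional_def
proof (rule exI[of _ \<epsilon>])
  let ?p = "bvec [a, b] - scale \<epsilon> (bvec [b, a]) :: 'c list \<Rightarrow>\<^sub>0 complex"
  have der: "der \<chi> c ?p = 0" for c
  proof (cases "c \<in> {a, b}")
    case True
    then show ?thesis using assms eps(1)[OF assms(1,2)] eps(1)[OF assms(2,1)] eps(1)[OF assms(1,1)] eps(1)[OF assms(2,2)]
      by (cases "a = b") (auto simp: der_simps tmul_simps scale_distrib)
  qed (auto simp: der_simps tmul_simps)
  have "phi_word \<chi> w ?p = 0" for w
  proof (cases w)
    case (Cons c v)
    then have "phi_word \<chi> w ?p = phi_word \<chi> v (der \<chi> c ?p)" by (simp only: phi_word.simps)
    then show ?thesis by (simp only: der phi_simps)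
  qed (simp add: lookup_minus lookup_single)
  moreover have "Poly_Mapping.keys ?p \<subseteq> lists B" by (intro keys_closed) (use assms in auto)
  ultimately show "?p \<in> phi_kernel \<chi> B" by (simp add: phi_kernel_def)
qed

lemma GKdim_finite_if_sign:
  assumes "finite B" "\<And>a b. a \<in> B \<Longrightarrow> b \<in> B \<Longrightarrow> \<chi> a b = \<epsilon>" "\<epsilon> * \<epsilon> = 1"
  shows "GKdim nich < \<infinity>"
  by (rule GKdim_finite_if_commutation[OF assms(1)]) (rule sign_commutation[OF _ _ assms(2,3)])

end

section \<open>Root vectors for two letters of affine type\<close>

text \<open>The braiding matrix of affine Cartan type \<open>A\<^sub>1\<close>: \<open>\<chi>(x, y) \<chi>(y, x) = q\<^sup>-\<^sup>2\<close>.  The degree of \<open>xy\<close> is the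
  imaginary root; words with equally many \<open>x\<close> and \<open>y\<close> braid trivially with either letter.\<close>

locale two_letters =
  fixes x y :: 'a and q :: complex and \<chi> :: "'a \<Rightarrow> 'a \<Rightarrow> complex"
  assumes distinct_letters: "x \<noteq> y" and q_nonzero: "q \<noteq> 0" and q_square: "q\<^sup>2 \<noteq> 1"
    and chi: "\<chi> x x = q" "\<chi> y y = q" "\<chi> x y = 1 / q" "\<chi> y x = 1 / q"
begin

definition height :: "'a list \<Rightarrow> int" where
  "height w = int (count_list w x) - int (count_list w y)"

lemma height_simps [simp]: "height [] = 0" "height (u @ v) = height u + height v"
  "height (x # w) = 1 + height w" "height (y # w) = height w - 1"
  "a \<noteq> x \<Longrightarrow> a \<noteq> y \<Longrightarrow> height (a # w) = height w"
  using distinct_letters by (simp_all add: height_def)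

lemma height_Cons: "height (a # w) = height [a] + height w"
  using height_simps(2)[of "[a]" w] by simp

lemma height_shuffles: "w \<in> shuffles u v \<Longrightarrow> height w = height u + height v"
proof (induction u v arbitrary: w rule: shuffles.induct)
  case (3 a u b v)
  from 3(3) consider w' where "w = a # w'" "w' \<in> shuffles u (b # v)"
    | w' where "w = b # w'" "w' \<in> shuffles (a # u) v" by auto
  then show ?case
  proof cases
    case 1
    then show ?thesis using 3(1)[OF 1(2)] height_Cons[of a w'] height_Cons[of a u] by simp
  next
    case 2
    then show ?thesis using 3(2)[OF 2(2)] height_Cons[of b w'] height_Cons[of b v] by simp
  qed
qed auto

lemma prefix_shuffle:
  assumes "p @ r \<in> shuffles u v"
  shows "\<exists>u1 u2 v1 v2. u = u1 @ u2 \<and> v = v1 @ v2 \<and> p \<in> shuffles u1 v1 \<and> r \<in> shuffles u2 v2"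
  using assms
proof (induction p arbitrary: u v)
  case Nil
  then show ?case by (intro exI[of _ "[]"] exI[of _ u] exI[of _ v]) auto
next
  case (Cons a p)
  from Cons.prems consider u' where "u = a # u'" "p @ r \<in> shuffles u' v"
    | v' where "v = a # v'" "p @ r \<in> shuffles u v'"
    by (cases u; cases v) auto
  then show ?case
  proof cases
    case 1
    from Cons.IH[OF 1(2)] obtain u1 u2 v1 v2 where
      "u' = u1 @ u2" "v = v1 @ v2" "p \<in> shuffles u1 v1" "r \<in> shuffles u2 v2" by blast
    with 1 show ?thesis
      by (intro exI[of _ "a # u1"] exI[of _ u2] exI[of _ v1] exI[of _ v2]) (auto intro: Cons_in_shuffles_leftI)
  next
    case 2
    from Cons.IH[OF 2(2)] obtain u1 u2 v1 v2 where
      "u = u1 @ u2" "v' = v1 @ v2" "p \<in> shuffles u1 v1" "r \<in> shuffles u2 v2" by blast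
    with 2 show ?thesis
      by (intro exI[of _ u1] exI[of _ u2] exI[of _ "a # v1"] exI[of _ v2]) (auto intro: Cons_in_shuffles_rightI)
  qed
qed

text \<open>Lattice paths that stay strictly above the axis after the first step; root vectors are supported on such words.\<close>

definition rising :: "'a list \<Rightarrow> bool" where
  "rising w \<longleftrightarrow> w \<noteq> [] \<and> (\<forall>p r. w = p @ r \<longrightarrow> p \<noteq> [] \<longrightarrow> 1 \<le> height p)"

text \<open>Lattice paths that never go below the axis; a rising word is \<open>x\<close> followed by such a word.\<close>

definition dyck_prefix :: "'a list \<Rightarrow> bool" where
  "dyck_prefix w \<longleftrightarrow> (\<forall>p r. w = p @ r \<longrightarrow> 0 \<le> height p)"

lemma rising_ConsD:
  assumes r: "rising (a # w)"
  shows "a = x \<and> dyck_prefix w"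
proof
  have step: "1 \<le> height (a # p)" if "w = p @ r" for p r
  proof -
    have "a # w = (a # p) @ r" using that by simp
    then show ?thesis using r unfolding rising_def by blast
  qed
  have "1 \<le> height [a]" using step[of "[]" w] by simp
  then show a: "a = x" using height_simps(4)[of "[]"] height_simps(5)[of a "[]"]
    by (cases "a = x"; cases "a = y") auto
  show "dyck_prefix w" unfolding dyck_prefix_def using step a by fastforce
qed

lemma dyck_prefix_tail: "dyck_prefix (x # y # w) \<Longrightarrow> dyck_prefix w"
proof (unfold dyck_prefix_def, intro allI impI)
  fix p r assume d: "\<forall>p r. x # y # w = p @ r \<longrightarrow> 0 \<le> height p" and w: "w = p @ r"
  have "0 \<le> height (x # y # p)" using d w by (metis append_Cons)
  then show "0 \<le> height p" by simp
qed

lemma dyck_prefix_not_y: "\<not> dyck_prefix (y # w)"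
proof
  assume "dyck_prefix (y # w)"
  then have "0 \<le> height [y]" unfolding dyck_prefix_def by (metis append_Cons append_Nil)
  then show False by simp
qed

lemma not_rising_xy: "\<not> rising (x # y # w)"
  using rising_ConsD dyck_prefix_not_y by blast

text \<open>Already \<open>\<chi>(a, x) \<chi>(a, y) = 1\<close> for either letter \<open>a\<close>, so the word \<open>xy\<close> crosses every word at no cost.\<close>

lemma weight_xy: "bw \<chi> w x * bw \<chi> w y = 1" if "set w \<subseteq> {x, y}"
  using that by (induction w) (use q_nonzero chi in \<open>auto\<close>)

end

context two_letters
begin

definition comm_xy :: "('a list \<Rightarrow> complex) \<Rightarrow> 'a list \<Rightarrow> complex" where
  "comm_xy f w = shuf \<chi> (wdelta [x, y]) f w - shuf \<chi> f (wdelta [x, y]) w"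

lemma x_neq_y [simp]: "x \<noteq> y" "y \<noteq> x" using distinct_letters by auto

lemma shuf_y_left:
  "shuf \<chi> (wdelta [y]) f (y # w) = f w + q * shuf \<chi> (wdelta [y]) (\<lambda>u. f (y # u)) w"
  "shuf \<chi> (wdelta [y]) f (x # w) = 1 / q * shuf \<chi> (wdelta [y]) (\<lambda>u. f (x # u)) w"
  by (simp_all add: shuf_scale_left shuf_divide chi)

lemma shuf_xy_left:
  "shuf \<chi> (wdelta [x, y]) f (x # w) = shuf \<chi> (wdelta [y]) f w + shuf \<chi> (wdelta [x, y]) (\<lambda>u. f (x # u)) w"
  "b \<noteq> x \<Longrightarrow> \<chi> x b * \<chi> y b = 1 \<Longrightarrow> shuf \<chi> (wdelta [x, y]) f (b # w) = shuf \<chi> (wdelta [x, y]) (\<lambda>u. f (b # u)) w"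
  using q_nonzero by (auto simp: shuf_scale_left chi mult.assoc)

definition xy_pow :: "nat \<Rightarrow> 'a list" where
  "xy_pow n = concat (replicate n [x, y])"

lemma xy_pow_simps [simp]: "xy_pow 0 = []" "xy_pow (Suc n) = x # y # xy_pow n"
  by (simp_all add: xy_pow_def)

lemma weight_xy_pow: "bw \<chi> (xy_pow n) b = 1" if "b \<in> {x, y}"
  using that q_nonzero by (induction n) (auto simp: chi)

text \<open>At a word \<open>xyw\<close> the letters \<open>xy\<close> are both taken from \<open>f\<close> or both from the other factor, as \<open>f\<close> vanishes at words
  beginning with \<open>y\<close>.  The second possibility contributes \<open>f(w)\<close> to both products, because \<open>xy\<close> crosses any word at no cost,
  and the first one leads to the function \<open>u \<mapsto> f(xyu)\<close>, which is again supported on Dyck prefixes.\<close>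

lemma comm_xy_dyck:
  assumes "\<And>w. f w \<noteq> 0 \<Longrightarrow> dyck_prefix w" "\<And>w. f w \<noteq> 0 \<Longrightarrow> set w \<subseteq> {x, y}"
  shows "comm_xy f (xy_pow n) = 0"
  using assms
proof (induction n arbitrary: f)
  case 0
  then show ?case by (simp add: comm_xy_def wdelta_def)
next
  case (Suc n)
  have fy: "f (y # u) = 0" for u
    using Suc.prems(1) dyck_prefix_not_y by blast
  have w: "bw \<chi> u x * (bw \<chi> u y * f u) = f u" for u
    using Suc.prems(2)[of u] weight_xy[of u] by (cases "f u = 0") (simp_all flip: mult.assoc)
  have IH: "comm_xy (\<lambda>u. f (x # y # u)) (xy_pow n) = 0"
  proof (rule Suc.IH)
    fix u assume "f (x # y # u) \<noteq> 0"
    then show "dyck_prefix u" "set u \<subseteq> {x, y}"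
      using Suc.prems(1) dyck_prefix_tail Suc.prems(2)[of "x # y # u"] by auto
  qed
  show ?case using IH q_nonzero
    by (simp add: comm_xy_def shuf_xy_left shuf_y_left chi fy w mult.assoc mult.left_commute)
qed

text \<open>As \<open>f\<close> vanishes at words beginning with \<open>y\<close> or \<open>xy\<close>, both leading letters come from the other factor, and either order of
  the product gives \<open>f(w)\<close>.  This is why commutators with \<open>xy\<close> preserve rising support.\<close>

lemma comm_xy_xy:
  assumes "\<And>w. f w \<noteq> 0 \<Longrightarrow> rising w" "\<And>w. f w \<noteq> 0 \<Longrightarrow> set w \<subseteq> {x, y}"
  shows "comm_xy f (x # y # w) = 0"
proof -
  have 0: "f (y # u) = 0" "f (x # y # u) = 0" for u
    using assms(1) not_rising_xy rising_ConsD x_neq_y by blast+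
  have w: "bw \<chi> u x * (bw \<chi> u y * f u) = f u" for u
    using assms(2)[of u] weight_xy[of u] by (cases "f u = 0") (simp_all flip: mult.assoc)
  show ?thesis using q_nonzero
    by (simp add: comm_xy_def shuf_xy_left shuf_y_left chi 0 w mult.assoc mult.left_commute)
qed

lemma comm_xy_support:
  assumes "comm_xy f w \<noteq> 0"
  shows "\<exists>v. f v \<noteq> 0 \<and> w \<in> shuffles [x, y] v"
proof -
  have "shuf \<chi> (wdelta [x, y]) f w \<noteq> 0 \<or> shuf \<chi> f (wdelta [x, y]) w \<noteq> 0"
    using assms by (auto simp: comm_xy_def)
  then show ?thesis
    using shuf_support[of \<chi> "wdelta [x, y]" f w] shuf_support[of \<chi> f "wdelta [x, y]" w]
    by (auto simp: wdelta_def shuffles_commutes split: if_splits)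
qed

lemma rising_prefix:
  assumes "rising v" "v = v1 @ v2"
  shows "0 \<le> height v1" "v1 \<noteq> [] \<Longrightarrow> 1 \<le> height v1"
  using assms unfolding rising_def by (cases "v1 = []"; force)+

lemma comm_xy_rising:
  assumes r: "\<And>w. f w \<noteq> 0 \<Longrightarrow> rising w" and xy: "\<And>w. f w \<noteq> 0 \<Longrightarrow> set w \<subseteq> {x, y}"
    and w: "comm_xy f w \<noteq> 0"
  shows "rising w"
  unfolding rising_def
proof (intro conjI allI impI)
  obtain v where v: "f v \<noteq> 0" "w \<in> shuffles [x, y] v" using comm_xy_support[OF w] by blast
  then show "w \<noteq> []" by auto
  fix p s assume p: "w = p @ s" "p \<noteq> []"
  obtain u1 u2 v1 v2 where d: "[x, y] = u1 @ u2" "v = v1 @ v2" "p \<in> shuffles u1 v1"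
    using prefix_shuffle[of p s "[x, y]" v] v p by auto
  have u1: "u1 = [] \<or> u1 = [x] \<or> u1 = [x, y]" using d(1) by (cases u1; cases "tl u1") auto
  show "1 \<le> height p"
  proof (cases "v1 = []")
    case True
    then have "p = u1" using d(3) by simp
    moreover have "p \<noteq> [x, y]"
    proof
      assume "p = [x, y]"
      then have "comm_xy f w = 0" using comm_xy_xy[of f s, OF r xy] p by simp
      then show False using w by simp
    qed
    ultimately have "p = [x]" using u1 p by blast
    then show ?thesis by simp
  next
    case False
    then have "1 \<le> height v1" using rising_prefix(2)[OF r[OF v(1)] d(2)] by simp
    then show ?thesis using height_shuffles[OF d(3)] u1 by auto
  qed
qed

text \<open>If the first letter comes from \<open>f\<close>, what is left is a commutator at a power of \<open>xy\<close>, which vanishes by \<open>comm_xy_dyck\<close>.  If it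
  is the \<open>x\<close> of the other factor, its \<open>y\<close> has to be the third letter, since \<open>f\<close> vanishes at words beginning with \<open>xy\<close>;
  the two orders of the product give this term the coefficients \<open>1/q\<close> and \<open>q\<close>.\<close>

lemma comm_xy_leading:
  assumes r: "\<And>w. f w \<noteq> 0 \<Longrightarrow> rising w" and xy: "\<And>w. f w \<noteq> 0 \<Longrightarrow> set w \<subseteq> {x, y}"
  shows "comm_xy f (x # xy_pow (Suc n)) = (1 / q - q) * f (x # xy_pow n)"
proof -
  have 0: "f (x # y # u) = 0" for u using r not_rising_xy by blast
  have "comm_xy (\<lambda>u. f (x # u)) (xy_pow (Suc n)) = 0"
  proof (rule comm_xy_dyck)
    fix w assume "f (x # w) \<noteq> 0"
    then show "dyck_prefix w" "set w \<subseteq> {x, y}" using r rising_ConsD xy[of "x # w"] by auto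
  qed
  then have c: "shuf \<chi> (wdelta [x, y]) (\<lambda>u. f (x # u)) (xy_pow (Suc n)) =
      shuf \<chi> (\<lambda>u. f (x # u)) (wdelta [x, y]) (xy_pow (Suc n))"
    by (simp only: comm_xy_def right_minus_eq)
  have "comm_xy f (x # xy_pow (Suc n)) =
      shuf \<chi> (wdelta [y]) f (xy_pow (Suc n)) - shuf \<chi> (\<lambda>u. bw \<chi> u x * f u) (wdelta [y]) (xy_pow (Suc n))"
    unfolding comm_xy_def shuf_xy_left(1) shuf.simps(2)[of \<chi> f] c by (simp del: xy_pow_simps)
  also have "\<dots> = (1 / q - q) * f (x # xy_pow n)"
    using q_nonzero by (simp add: shuf_y_left 0 chi weight_xy_pow shuf_divide algebra_simps)
  finally show ?thesis .
qed

text \<open>The images in the shuffle algebra of root vectors for the real roots \<open>\<alpha> + n\<delta>\<close>, where \<open>\<alpha>\<close> is the degree of \<open>x\<close> and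
  \<open>\<delta>\<close> that of \<open>xy\<close>.\<close>

primrec root_vec :: "nat \<Rightarrow> 'a list \<Rightarrow> complex" where
  "root_vec 0 = wdelta [x]"
| "root_vec (Suc n) = comm_xy (root_vec n)"

lemma root_vec_support:
  assumes "root_vec n w \<noteq> 0"
  shows "rising w \<and> set w \<subseteq> {x, y} \<and> length w = 2 * n + 1 \<and> height w = 1"
  using assms
proof (induction n arbitrary: w)
  case 0
  then have "w = [x]" by (auto simp: wdelta_def split: if_splits)
  moreover have "rising [x]" unfolding rising_def by (auto simp: Cons_eq_append_conv)
  ultimately show ?case by simp
next
  case (Suc n)
  have w: "comm_xy (root_vec n) w \<noteq> 0" using Suc.prems by simp
  obtain v where v: "root_vec n v \<noteq> 0" "w \<in> shuffles [x, y] v" using comm_xy_support[OF w] by blast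
  have "rising w" by (rule comm_xy_rising[OF _ _ w]) (use Suc.IH in blast)+
  then show ?case using Suc.IH[OF v(1)] height_shuffles[OF v(2)] length_shuffles[OF v(2)]
      set_shuffles[OF v(2)] by auto
qed

lemma root_vec_leading: "root_vec n (x # xy_pow n) = (1 / q - q) ^ n"
proof (induction n)
  case (Suc n)
  have "root_vec (Suc n) (x # xy_pow (Suc n)) = (1 / q - q) * root_vec n (x # xy_pow n)"
    unfolding root_vec.simps by (rule comm_xy_leading) (use root_vec_support in blast)+
  then show ?case using Suc by simp
qed (simp add: wdelta_def)

lemma root_vec_leading_nonzero: "root_vec n (x # xy_pow n) \<noteq> 0"
proof -
  have "1 / q - q \<noteq> 0" using q_nonzero q_square by (auto simp: field_simps power2_eq_square)
  then show ?thesis by (simp add: root_vec_leading)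
qed

definition shuf_prod :: "nat list \<Rightarrow> 'a list \<Rightarrow> complex" where
  "shuf_prod ms = foldr (\<lambda>m. shuf \<chi> (root_vec m)) ms (wdelta [])"

lemma shuf_prod_simps [simp]:
  "shuf_prod [] = wdelta []" "shuf_prod (m # ms) = shuf \<chi> (root_vec m) (shuf_prod ms)"
  by (simp_all add: shuf_prod_def)

text \<open>The word \<open>x (xy)\<^sup>m\<close> plays the part of a leading term of the root vector with index \<open>m\<close>.\<close>

definition lead_word :: "nat list \<Rightarrow> 'a list" where
  "lead_word ms = concat (map (\<lambda>m. x # xy_pow m) ms)"

lemma lead_word_simps [simp]:
  "lead_word [] = []" "lead_word (m # ms) = (x # xy_pow m) @ lead_word ms"
  by (simp_all add: lead_word_def)

text \<open>Prefixes of height one are short.  For products of root vectors with small indices this holds because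
  such a prefix must stem from a single root vector.\<close>

definition short_heads :: "nat \<Rightarrow> ('a list \<Rightarrow> complex) \<Rightarrow> bool" where
  "short_heads l g \<longleftrightarrow> (\<forall>p r. g (p @ r) \<noteq> 0 \<longrightarrow> p \<noteq> [] \<longrightarrow>
     1 \<le> height p \<and> (height p = 1 \<longrightarrow> length p < l))"

lemma short_heads_prod:
  assumes "sorted_wrt (>) ms" "\<And>m. m \<in> set ms \<Longrightarrow> 2 * m + 1 < l"
  shows "short_heads l (shuf_prod ms)"
  using assms
proof (induction ms arbitrary: l)
  case Nil
  then show ?case by (simp add: short_heads_def wdelta_def)
next
  case (Cons m ms)
  have IH: "short_heads (2 * m + 1) (shuf_prod ms)" by (rule Cons.IH) (use Cons.prems in auto)
  show ?case unfolding short_heads_def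
  proof (intro allI impI)
    fix p r assume pr: "shuf_prod (m # ms) (p @ r) \<noteq> 0" "p \<noteq> []"
    obtain u v where uv: "root_vec m u \<noteq> 0" "shuf_prod ms v \<noteq> 0" "p @ r \<in> shuffles u v"
      using shuf_support[of \<chi> "root_vec m" "shuf_prod ms" "p @ r"] pr(1) by auto
    obtain u1 u2 v1 v2 where d: "u = u1 @ u2" "v = v1 @ v2" "p \<in> shuffles u1 v1"
      using prefix_shuffle[OF uv(3)] by auto
    note u = rising_prefix[OF conjunct1[OF root_vec_support[OF uv(1)]] d(1)]
    have v: "1 \<le> height v1 \<and> (height v1 = 1 \<longrightarrow> length v1 < 2 * m + 1)" if "v1 \<noteq> []"
      using IH uv(2) that unfolding short_heads_def d(2) by blast
    have l: "length u1 \<le> 2 * m + 1" using root_vec_support[OF uv(1)] d(1) by simp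
    have lm: "2 * m + 1 < l" using Cons.prems(2)[of m] by simp
    have hp: "height p = height u1 + height v1" and lp: "length p = length u1 + length v1"
      using height_shuffles[OF d(3)] length_shuffles[OF d(3)] by auto
    show "1 \<le> height p \<and> (height p = 1 \<longrightarrow> length p < l)"
    proof (cases "v1 = []")
      case True
      then show ?thesis using hp lp u(2) l lm pr(2) d(3) by auto
    next
      case False
      with v hp lp u l lm show ?thesis by (cases "u1 = []") auto
    qed
  qed
qed

text \<open>A long prefix of height one has to come from \<open>f\<close> alone: if both words contributed, its height would be at least two,
  and a contribution of \<open>g\<close> alone would be too short.\<close>

lemma shuf_pull_head:
  assumes f: "\<And>u. f u \<noteq> 0 \<Longrightarrow> rising u" and g: "short_heads l g"
    and w: "height w = 1" "l \<le> length w"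
  shows "shuf \<chi> f g (w @ r) = shuf \<chi> (\<lambda>u. f (w @ u)) g r"
proof -
  have "shuf \<chi> (\<lambda>u. f (a @ u)) g (b @ r) = shuf \<chi> (\<lambda>u. f (a @ b @ u)) g r" if "a @ b = w" for a b
    using that
  proof (induction b arbitrary: a)
    case (Cons c b)
    have "shuf \<chi> (\<lambda>u. bw \<chi> u c * f (a @ u)) (\<lambda>v. g (c # v)) (b @ r) = 0"
    proof (rule ccontr)
      assume "\<not> ?thesis"
      from shuf_support[OF this] obtain u v where
        uv: "f (a @ u) \<noteq> 0" "g (c # v) \<noteq> 0" "b @ r \<in> shuffles u v" by auto
      obtain u1 u2 v1 v2 where d: "u = u1 @ u2" "v = v1 @ v2" "b \<in> shuffles u1 v1"
        using prefix_shuffle[OF uv(3)] by auto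
      have h: "height w = height (a @ u1) + height (c # v1)" "length w = length (a @ u1) + length (c # v1)"
        using height_shuffles[OF d(3)] length_shuffles[OF d(3)] Cons.prems
          height_Cons[of c b] height_Cons[of c v1] by auto
      have 1: "1 \<le> height (c # v1)" "height (c # v1) = 1 \<Longrightarrow> length (c # v1) < l"
        using g uv(2) d(2) unfolding short_heads_def by (metis append_Cons list.distinct(1))+
      have r: "rising (a @ u)" using f uv(1) by blast
      have e: "a @ u = (a @ u1) @ u2" using d(1) by simp
      show False
      proof (cases "a @ u1 = []")
        case True
        then show False using h 1 w by simp
      next
        case False
        then show False using rising_prefix(2)[OF r e] h(1) 1(1) w(1) by simp
      qed
    qed
    then show ?case using Cons.IH[of "a @ [c]"] Cons.prems by simp
  qed simp
  from this[of "[]" w] show ?thesis by simp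
qed

lemma lead_word_height [simp]: "height (xy_pow n) = 0" "length (xy_pow n) = 2 * n"
  by (induction n) auto

text \<open>With decreasing indices the first factor has the longest head, and \<open>shuf_pull_head\<close> splits its leading word
  off.  If \<open>n > m\<close> the root vector of index \<open>m\<close> vanishes at \<open>x (xy)\<^sup>n\<close> for reasons of length, and if \<open>n < m\<close> the index
  list is smaller at its first entry.\<close>

lemma shuf_prod_triangular:
  assumes "sorted_wrt (>) ms" "length ns = length ms"
  shows "(shuf_prod ms (lead_word ns) \<noteq> 0 \<longrightarrow> ns \<le> ms) \<and> shuf_prod ms (lead_word ms) \<noteq> 0"
  using assms
proof (induction ms arbitrary: ns)
  case Nil
  then show ?case by (simp add: wdelta_def)
next
  case (Cons m ms)
  have g: "short_heads (2 * m + 1) (shuf_prod ms)" by (rule short_heads_prod) (use Cons.prems in auto)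
  have pull: "shuf_prod (m # ms) ((x # xy_pow n) @ r) = root_vec m (x # xy_pow n) * shuf_prod ms r"
    if "m \<le> n" for n r
  proof -
    have "shuf_prod (m # ms) ((x # xy_pow n) @ r) =
        shuf \<chi> (\<lambda>u. root_vec m ((x # xy_pow n) @ u)) (shuf_prod ms) r"
      unfolding shuf_prod_simps
      by (rule shuf_pull_head[OF _ g]) (use root_vec_support that in auto)
    also have "(\<lambda>u. root_vec m ((x # xy_pow n) @ u)) = (\<lambda>u. root_vec m (x # xy_pow n) * wdelta [] u)"
    proof
      fix u
      show "root_vec m ((x # xy_pow n) @ u) = root_vec m (x # xy_pow n) * wdelta [] u"
      proof (cases "u = []")
        case False
        have "root_vec m ((x # xy_pow n) @ u) = 0"
        proof (rule ccontr)
          assume "\<not> ?thesis"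
          then have "length ((x # xy_pow n) @ u) = 2 * m + 1" using root_vec_support by blast
          then show False using False that by (cases u) auto
        qed
        then show ?thesis using False by (simp add: wdelta_def)
      qed (simp add: wdelta_def)
    qed
    finally show ?thesis by (simp add: shuf_scale_left)
  qed
  obtain n ns' where ns: "ns = n # ns'" using Cons.prems(2) by (cases ns) auto
  have "n # ns' \<le> m # ms" if nz: "shuf_prod (m # ms) (lead_word (n # ns')) \<noteq> 0"
  proof (cases "n < m")
    case False
    then have p: "root_vec m (x # xy_pow n) * shuf_prod ms (lead_word ns') \<noteq> 0"
      using nz pull[of n "lead_word ns'"] by simp
    then have "length (x # xy_pow n) = 2 * m + 1" using root_vec_support by (metis mult_zero_left)
    then have "n = m" by simp
    moreover have "ns' \<le> ms" using Cons.IH[of ns'] Cons.prems ns p by auto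
    ultimately show ?thesis by simp
  qed simp
  moreover have "shuf_prod (m # ms) (lead_word (m # ms)) \<noteq> 0"
    using pull[of m "lead_word ms"] root_vec_leading_nonzero Cons.IH[of ms] Cons.prems by simp
  ultimately show ?case using ns by blast
qed

end
context two_letters
begin

text \<open>The element of the tensor algebra whose image in the shuffle algebra is the word \<open>xy\<close>; it exists because
  \<open>q\<^sup>2 \<noteq> 1\<close>, and its normalisation comes from inverting the two by two quantum symmetriser.\<close>

definition comm_elem :: "'a list \<Rightarrow>\<^sub>0 complex" where
  "comm_elem = scale (1 / (1 - 1 / q\<^sup>2)) (bvec [x, y] - scale (1 / q) (bvec [y, x]))"

lemma phi_comm_elem: "phi_word \<chi> w comm_elem = wdelta [x, y] w"
proof -
  have c: "1 - 1 / q\<^sup>2 \<noteq> 0" using q_nonzero q_square by (simp add: field_simps)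
  have xy: "phi_word \<chi> w (bvec [x, y]) = wdelta [x, y] w + 1 / q * wdelta [y, x] w"
    by (cases w) (auto simp: wdelta_def phi_simps tmul_simps chi lookup_single when_def)
  have yx: "phi_word \<chi> w (bvec [y, x]) = wdelta [y, x] w + 1 / q * wdelta [x, y] w"
    by (cases w) (auto simp: wdelta_def phi_simps tmul_simps chi lookup_single when_def)
  have "phi_word \<chi> w comm_elem = 1 / (1 - 1 / q\<^sup>2) * ((1 - 1 / q\<^sup>2) * wdelta [x, y] w)"
    unfolding comm_elem_def phi_simps xy yx by (simp add: power2_eq_square algebra_simps)
  also have "\<dots> = wdelta [x, y] w" using c by (simp only: mult.assoc[symmetric] times_divide_eq_left) simp
  finally show ?thesis .
qed

primrec root_elem :: "nat \<Rightarrow> 'a list \<Rightarrow>\<^sub>0 complex" where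
  "root_elem 0 = bvec [x]"
| "root_elem (Suc n) = tmul comm_elem (root_elem n) - tmul (root_elem n) comm_elem"

lemma phi_root_elem: "phi_word \<chi> w (root_elem n) = root_vec n w"
proof (induction n arbitrary: w)
  case (Suc n)
  then show ?case by (simp add: phi_simps phi_tmul phi_comm_elem comm_xy_def)
qed simp

definition prod_elem :: "nat list \<Rightarrow> 'a list \<Rightarrow>\<^sub>0 complex" where
  "prod_elem ms = foldr (\<lambda>m. tmul (root_elem m)) ms (bvec [])"

lemma phi_prod_elem: "phi_word \<chi> w (prod_elem ms) = shuf_prod ms w"
  by (induction ms arbitrary: w) (simp_all add: prod_elem_def phi_tmul phi_root_elem)

lemma keys_tmul_length:
  assumes "Poly_Mapping.keys p \<subseteq> {w \<in> lists B. length w \<le> j}" "Poly_Mapping.keys r \<subseteq> {w \<in> lists B. length w \<le> k}"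
  shows "Poly_Mapping.keys (tmul p r) \<subseteq> {w \<in> lists B. length w \<le> j + k}"
  unfolding tmul_def by (rule keys_bilin_ext) (use assms in fastforce)

lemma keys_comm_elem: "Poly_Mapping.keys comm_elem \<subseteq> {w \<in> lists {x, y}. length w \<le> 2}"
  unfolding comm_elem_def by (intro keys_closed) auto

lemma keys_root_elem: "Poly_Mapping.keys (root_elem n) \<subseteq> {w \<in> lists {x, y}. length w \<le> 2 * n + 1}"
proof (induction n)
  case (Suc n)
  show ?case unfolding root_elem.simps
    using keys_tmul_length[OF keys_comm_elem Suc] keys_tmul_length[OF Suc keys_comm_elem]
    by (intro keys_closed) (simp_all add: add.commute)
qed simp

lemma keys_prod_elem:
  assumes "\<And>m. m \<in> set ms \<Longrightarrow> 2 * m + 1 \<le> L"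
  shows "Poly_Mapping.keys (prod_elem ms) \<subseteq> {w \<in> lists {x, y}. length w \<le> length ms * L}"
  using assms
proof (induction ms)
  case (Cons m ms)
  have "Poly_Mapping.keys (root_elem m) \<subseteq> {w \<in> lists {x, y}. length w \<le> L}"
    using keys_root_elem[of m] Cons.prems[of m] by force
  from keys_tmul_length[OF this Cons.IH] Cons.prems show ?case by (simp add: prod_elem_def)
qed (simp add: prod_elem_def)

end

text \<open>The digits are moved into disjoint blocks of length \<open>M\<close>, which makes any list of digits below \<open>M\<close> strictly
  decreasing; in this way there are \<open>M\<^sup>D\<close> decreasing lists of length \<open>D\<close> with entries below \<open>D M\<close>.\<close>

fun spread :: "nat \<Rightarrow> nat list \<Rightarrow> nat list" where
  "spread M [] = []"
| "spread M (e # es) = (length es * M + e) # spread M es"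

lemma spread_bounds:
  assumes "set es \<subseteq> {..<M}"
  shows "length (spread M es) = length es" "m \<in> set (spread M es) \<Longrightarrow> m < length es * M"
    "sorted_wrt (>) (spread M es)"
proof -
  show "length (spread M es) = length es" by (induction es) auto
  have b: "m < length es * M" if "set es \<subseteq> {..<M}" "m \<in> set (spread M es)" for es m
    using that by (induction es) auto
  then show "m \<in> set (spread M es) \<Longrightarrow> m < length es * M" using assms by blast
  show "sorted_wrt (>) (spread M es)" using assms
  proof (induction es)
    case (Cons e es)
    have "m < length es * M" if "m \<in> set (spread M es)" for m
      using b[of es m] Cons.prems that by simp
    then show ?case using Cons by (auto simp: trans_less_add1)
  qed simp
qed

lemma inj_spread: "length es = length fs \<Longrightarrow> spread M es = spread M fs \<Longrightarrow> es = fs"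
  by (induction es fs rule: list_induct2) auto

context two_letters
begin

lemma prod_elem_independent:
  assumes I: "finite I" "\<And>es. es \<in> I \<Longrightarrow> length es = D \<and> set es \<subseteq> {..<M}"
    and z: "(\<Sum>es\<in>I. scale (a es) (prod_elem (spread M es))) \<in> phi_kernel \<chi> {x, y}"
  shows "\<forall>es\<in>I. a es = 0"
proof (rule ccontr)
  assume nz: "\<not> (\<forall>es\<in>I. a es = 0)"
  \<comment> \<open>Evaluating at the leading word of the largest index list that occurs isolates its coefficient.\<close>
  define S where "S = {es \<in> I. a es \<noteq> 0}"
  have S: "finite (spread M ` S)" "spread M ` S \<noteq> {}" using nz I(1) by (auto simp: S_def)
  obtain e0 where e0: "Max (spread M ` S) = spread M e0" "e0 \<in> S" using Max_in[OF S] by (rule imageE)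
  let ?w = "lead_word (spread M e0)"
  have t: "(shuf_prod (spread M es) ?w \<noteq> 0 \<longrightarrow> spread M e0 \<le> spread M es) \<and> shuf_prod (spread M es) (lead_word (spread M es)) \<noteq> 0"
    if "es \<in> I" for es
  proof (rule shuf_prod_triangular)
    have e0I: "e0 \<in> I" using e0(2) by (simp add: S_def)
    show "sorted_wrt (>) (spread M es)" using spread_bounds(3)[of es M] I(2)[OF that] by simp
    show "length (spread M e0) = length (spread M es)"
      using spread_bounds(1)[of es M] spread_bounds(1)[of e0 M] I(2)[OF that] I(2)[OF e0I] by simp
  qed
  have "phi_word \<chi> ?w (\<Sum>es\<in>I. scale (a es) (prod_elem (spread M es))) = 0"
    using z unfolding phi_kernel_def by blast
  then have "(\<Sum>es\<in>I. a es * shuf_prod (spread M es) ?w) = 0" by (simp add: phi_simps phi_prod_elem)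
  moreover have "(\<Sum>es\<in>I. a es * shuf_prod (spread M es) ?w) = (\<Sum>es\<in>{e0}. a es * shuf_prod (spread M es) ?w)"
  proof (rule sum.mono_neutral_right[OF I(1)])
    show "\<forall>es\<in>I - {e0}. a es * shuf_prod (spread M es) ?w = 0"
    proof (intro ballI, rule ccontr)
      fix es assume es: "es \<in> I - {e0}" "a es * shuf_prod (spread M es) ?w \<noteq> 0"
      then have "spread M e0 \<le> spread M es" "es \<in> S" using t[of es] by (auto simp: S_def)
      then have "spread M es = spread M e0" using Max_ge[OF S(1), of "spread M es"] e0(1) by auto
      then have "es = e0" using inj_spread[of es e0 M] I(2) es e0 by (auto simp: S_def)
      then show False using es by simp
    qed
  qed (use e0 in \<open>auto simp: S_def\<close>)
  ultimately show False using t[of e0] e0(2) by (auto simp: S_def)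
qed

text \<open>The products have \<open>D\<close> factors with indices below \<open>D M\<close>, hence of degree at most \<open>(2 D + 1) M\<close>.  The additional summand \<open>1\<close> keeps
  the constant positive for \<open>D = 0\<close>.\<close>

lemma prod_elem_family:
  "\<exists>C>0. \<forall>M\<ge>1. \<exists>I v. finite (I :: nat list set) \<and> card I \<ge> M ^ D \<and>
      (\<forall>i\<in>I. Poly_Mapping.keys (v i) \<subseteq> {w \<in> lists {x, y}. length w \<le> C * M}) \<and>
      (\<forall>a. (\<Sum>i\<in>I. scale (a i) (v i)) \<in> phi_kernel \<chi> {x, y} \<longrightarrow> (\<forall>i\<in>I. a i = 0))"
proof (intro exI[of _ "D * (2 * D + 1) + 1"] conjI allI impI)
  fix M :: nat assume M: "M \<ge> 1"
  define I where "I = {es :: nat list. set es \<subseteq> {..<M} \<and> length es = D}"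
  show "\<exists>I v. finite (I :: nat list set) \<and> card I \<ge> M ^ D \<and>
      (\<forall>i\<in>I. Poly_Mapping.keys (v i) \<subseteq> {w \<in> lists {x, y}. length w \<le> (D * (2 * D + 1) + 1) * M}) \<and>
      (\<forall>a. (\<Sum>i\<in>I. scale (a i) (v i)) \<in> phi_kernel \<chi> {x, y} \<longrightarrow> (\<forall>i\<in>I. a i = 0))"
  proof (intro exI[of _ I] exI[of _ "\<lambda>es. prod_elem (spread M es)"] conjI ballI allI impI)
    show f: "finite I" unfolding I_def by (rule finite_lists_length_eq) simp
    show "M ^ D \<le> card I" unfolding I_def by (subst card_lists_length_eq) auto
    fix es assume es: "es \<in> I"
    have "2 * m + 1 \<le> (2 * D + 1) * M" if "m \<in> set (spread M es)" for m
    proof -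
      have "m < D * M" using spread_bounds(2)[of es M m] that es by (simp add: I_def)
      then show ?thesis using M by (simp add: algebra_simps)
    qed
    then have "Poly_Mapping.keys (prod_elem (spread M es)) \<subseteq>
        {w \<in> lists {x, y}. length w \<le> length (spread M es) * ((2 * D + 1) * M)}"
      by (rule keys_prod_elem)
    moreover have "length (spread M es) * ((2 * D + 1) * M) \<le> (D * (2 * D + 1) + 1) * M"
      using spread_bounds(1)[of es M] es by (simp add: I_def algebra_simps)
    then have "{w \<in> lists {x, y}. length w \<le> length (spread M es) * ((2 * D + 1) * M)} \<subseteq>
        {w \<in> lists {x, y}. length w \<le> (D * (2 * D + 1) + 1) * M}"
      using order.trans by blast
    ultimately show "Poly_Mapping.keys (prod_elem (spread M es)) \<subseteq> {w \<in> lists {x, y}. length w \<le> (D * (2 * D + 1) + 1) * M}"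
      by (rule order.trans)
  next
    fix a es
    assume z: "(\<Sum>es\<in>I. scale (a es) (prod_elem (spread M es))) \<in> phi_kernel \<chi> {x, y}" and es: "es \<in> I"
    have f: "finite I" unfolding I_def by (rule finite_lists_length_eq) simp
    have "length es = D \<and> set es \<subseteq> {..<M}" if "es \<in> I" for es using that by (simp add: I_def)
    from prod_elem_independent[OF f this z] es show "a es = 0" by blast
  qed
qed simp

end

lemma (in diagonal_basis) GKdim_infinite_two_letters:
  assumes "B = {x, y}" "two_letters x y q \<chi>"
  shows "GKdim nich = \<infinity>"
proof (rule GKdim_infinite_if_independent)
  interpret two_letters x y q \<chi> by (rule assms)
  show "finite B" using assms by simp
  show "\<exists>C>0. \<forall>M\<ge>1. \<exists>I v. finite (I :: nat list set) \<and> card I \<ge> M ^ D \<and>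
      (\<forall>i\<in>I. Poly_Mapping.keys (v i) \<subseteq> {w \<in> lists B. length w \<le> C * M}) \<and>
      (\<forall>a. (\<Sum>i\<in>I. scale (a i) (v i)) \<in> phi_kernel \<chi> B \<longrightarrow> (\<forall>i\<in>I. a i = 0))" for D
    unfolding assms(1) by (rule prod_elem_family)
qed

section \<open>Homogeneous vectors in Yetter--Drinfeld modules\<close>

text \<open>The linear extension of a map defined on symbols to the free space, with values in an abstract vector space.\<close>

definition vlin :: "(complex, 'v, 'm) module_scheme \<Rightarrow> ('s \<Rightarrow> 'v) \<Rightarrow> ('s \<Rightarrow>\<^sub>0 complex) \<Rightarrow> 'v" where
  "vlin V \<tau> p = (\<Oplus>\<^bsub>V\<^esub>s\<in>Poly_Mapping.keys p. Poly_Mapping.lookup p s \<odot>\<^bsub>V\<^esub> \<tau> s)"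

context
  fixes V :: "(complex, 'v, 'm) module_scheme" and \<tau> :: "'s \<Rightarrow> 'v" and S
  assumes V: "vectorspace CC V" and \<tau>: "\<And>s. s \<in> S \<Longrightarrow> \<tau> s \<in> carrier V"
begin

interpretation V: vectorspace CC V by (rule V)

lemma vlin_superset:
  assumes "finite A" "Poly_Mapping.keys p \<subseteq> A" "A \<subseteq> S"
  shows "vlin V \<tau> p = (\<Oplus>\<^bsub>V\<^esub>s\<in>A. Poly_Mapping.lookup p s \<odot>\<^bsub>V\<^esub> \<tau> s)"
  unfolding vlin_def
proof (rule V.add.finprod_mono_neutral_cong_left[OF assms(1,2)])
  show "Poly_Mapping.lookup p b \<odot>\<^bsub>V\<^esub> \<tau> b = \<zero>\<^bsub>V\<^esub>" if "b \<in> A - Poly_Mapping.keys p" for b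
    using that assms(3) CC_smult(1)[OF V, of "\<tau> b"] \<tau>[of b] by (auto simp: in_keys_iff)
  show "(\<lambda>b. Poly_Mapping.lookup p b \<odot>\<^bsub>V\<^esub> \<tau> b) \<in> A \<rightarrow> carrier V"
    using assms(3) CC_smult(3)[OF V] \<tau> by blast
qed simp

lemma vlin_closed: "Poly_Mapping.keys p \<subseteq> S \<Longrightarrow> vlin V \<tau> p \<in> carrier V"
  unfolding vlin_def using CC_smult(3)[OF V] \<tau> by (intro V.finsum_closed) blast

lemma vlin_add:
  assumes "Poly_Mapping.keys p \<subseteq> S" "Poly_Mapping.keys q \<subseteq> S"
  shows "vlin V \<tau> (p + q) = vlin V \<tau> p \<oplus>\<^bsub>V\<^esub> vlin V \<tau> q"
proof -
  let ?A = "Poly_Mapping.keys p \<union> Poly_Mapping.keys q"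
  have A: "finite ?A" "?A \<subseteq> S" using assms by auto
  have f: "(\<lambda>s. Poly_Mapping.lookup p s \<odot>\<^bsub>V\<^esub> \<tau> s) \<in> ?A \<rightarrow> carrier V" for p
    using A(2) CC_smult(3)[OF V] \<tau> by blast
  have "vlin V \<tau> (p + q) = (\<Oplus>\<^bsub>V\<^esub>s\<in>?A. Poly_Mapping.lookup (p + q) s \<odot>\<^bsub>V\<^esub> \<tau> s)"
    by (rule vlin_superset[OF A(1) Poly_Mapping.keys_add A(2)])
  also have "\<dots> = (\<Oplus>\<^bsub>V\<^esub>s\<in>?A. Poly_Mapping.lookup p s \<odot>\<^bsub>V\<^esub> \<tau> s \<oplus>\<^bsub>V\<^esub> Poly_Mapping.lookup q s \<odot>\<^bsub>V\<^esub> \<tau> s)"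
  proof (rule V.finsum_cong')
    show "(\<lambda>s. Poly_Mapping.lookup p s \<odot>\<^bsub>V\<^esub> \<tau> s \<oplus>\<^bsub>V\<^esub> Poly_Mapping.lookup q s \<odot>\<^bsub>V\<^esub> \<tau> s) \<in> ?A \<rightarrow> carrier V"
      using f[of p] f[of q] by blast
    fix s assume "s \<in> ?A"
    then have "\<tau> s \<in> carrier V" using A(2) \<tau> by blast
    then show "Poly_Mapping.lookup (p + q) s \<odot>\<^bsub>V\<^esub> \<tau> s =
        Poly_Mapping.lookup p s \<odot>\<^bsub>V\<^esub> \<tau> s \<oplus>\<^bsub>V\<^esub> Poly_Mapping.lookup q s \<odot>\<^bsub>V\<^esub> \<tau> s"
      by (simp add: lookup_add CC_smult(5)[OF V])
  qed simp
  also have "\<dots> = (\<Oplus>\<^bsub>V\<^esub>s\<in>?A. Poly_Mapping.lookup p s \<odot>\<^bsub>V\<^esub> \<tau> s) \<oplus>\<^bsub>V\<^esub> (\<Oplus>\<^bsub>V\<^esub>s\<in>?A. Poly_Mapping.lookup q s \<odot>\<^bsub>V\<^esub> \<tau> s)"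
    by (rule V.finsum_addf[OF f f])
  also have "\<dots> = vlin V \<tau> p \<oplus>\<^bsub>V\<^esub> vlin V \<tau> q"
    using vlin_superset[of ?A p] vlin_superset[of ?A q] A by simp
  finally show ?thesis .
qed

lemma vlin_single:
  assumes "s \<in> S"
  shows "vlin V \<tau> (Poly_Mapping.single s c) = c \<odot>\<^bsub>V\<^esub> \<tau> s"
  using vlin_superset[of "{s}" "Poly_Mapping.single s c"] assms CC_smult(3)[OF V \<tau>[OF assms]] by simp

lemma vlin_zero [simp]: "vlin V \<tau> 0 = \<zero>\<^bsub>V\<^esub>"
  by (simp add: vlin_def)

lemma vlin_scale:
  assumes "Poly_Mapping.keys p \<subseteq> S"
  shows "vlin V \<tau> (scale c p) = c \<odot>\<^bsub>V\<^esub> vlin V \<tau> p"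
proof -
  have "Poly_Mapping.keys p \<subseteq> S \<and> vlin V \<tau> (scale c p) = c \<odot>\<^bsub>V\<^esub> vlin V \<tau> p"
    using assms
  proof (induction rule: free_induct)
    case zero
    then show ?case using CC_smult(4)[OF V V.zero_closed, of c] by simp
  next
    case (add f g)
    then show ?case
      by (simp add: keys_closed scale_distrib vlin_add CC_smult(7)[OF V] vlin_closed)
  next
    case (single s d)
    then show ?case using CC_smult(6)[OF V \<tau>[OF single]] by (simp add: vlin_single)
  qed
  then show ?thesis by simp
qed

lemma vlin_minus:
  assumes "Poly_Mapping.keys p \<subseteq> S" "Poly_Mapping.keys q \<subseteq> S"
  shows "vlin V \<tau> (p - q) = vlin V \<tau> p \<ominus>\<^bsub>V\<^esub> vlin V \<tau> q"
proof -
  have "vlin V \<tau> (p - q) = vlin V \<tau> (p + scale (- 1) q)" by simp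
  also have "\<dots> = vlin V \<tau> p \<oplus>\<^bsub>V\<^esub> (- 1) \<odot>\<^bsub>V\<^esub> vlin V \<tau> q"
    using assms by (simp only: vlin_add keys_closed vlin_scale)
  finally show ?thesis using CC_smult(8)[OF V vlin_closed[OF assms(2)]] by (simp add: a_minus_def)
qed

lemma vlin_sum:
  assumes "finite A" "\<And>a. a \<in> A \<Longrightarrow> Poly_Mapping.keys (h a) \<subseteq> S"
  shows "vlin V \<tau> (sum h A) = (\<Oplus>\<^bsub>V\<^esub>a\<in>A. vlin V \<tau> (h a))"
  using assms
proof (induction A)
  case (insert a A)
  have "(\<lambda>a. vlin V \<tau> (h a)) \<in> A \<rightarrow> carrier V" "vlin V \<tau> (h a) \<in> carrier V"
    using insert.prems vlin_closed by blast+
  then show ?case using insert by (simp add: vlin_add keys_sum_subset)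
qed simp

end

context yd_module
begin

lemma comp_closed: "g \<in> carrier G \<Longrightarrow> v \<in> yd_comp V g \<Longrightarrow> v \<in> carrier V"
  using csubspaceD(2)[OF comp_subspace] by blast

lemma act_closed [simp]: "g \<in> carrier G \<Longrightarrow> v \<in> carrier V \<Longrightarrow> yd_act V g v \<in> carrier V"
  using act_linear unfolding module_hom_def by blast

lemma act_add: "g \<in> carrier G \<Longrightarrow> v \<in> carrier V \<Longrightarrow> w \<in> carrier V \<Longrightarrow>
    yd_act V g (v \<oplus>\<^bsub>V\<^esub> w) = yd_act V g v \<oplus>\<^bsub>V\<^esub> yd_act V g w"
  using act_linear unfolding module_hom_def by blast

lemma act_smult: "g \<in> carrier G \<Longrightarrow> v \<in> carrier V \<Longrightarrow> yd_act V g (c \<odot>\<^bsub>V\<^esub> v) = c \<odot>\<^bsub>V\<^esub> yd_act V g v"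
  using act_linear unfolding module_hom_def by simp

lemma act_zero [simp]: "g \<in> carrier G \<Longrightarrow> yd_act V g \<zero>\<^bsub>V\<^esub> = \<zero>\<^bsub>V\<^esub>"
  using act_smult[of g "\<zero>\<^bsub>V\<^esub>" 0] CC_smult(1)[OF spc.vectorspace_axioms] by simp

lemma act_inv: "g \<in> carrier G \<Longrightarrow> v \<in> carrier V \<Longrightarrow> yd_act V (inv\<^bsub>G\<^esub> g) (yd_act V g v) = v"
  using act_mult[of "inv\<^bsub>G\<^esub> g" g v] act_one by simp

lemma act_comp_mem: "g \<in> carrier G \<Longrightarrow> h \<in> carrier G \<Longrightarrow> v \<in> yd_comp V h \<Longrightarrow>
    yd_act V g v \<in> yd_comp V (g \<otimes>\<^bsub>G\<^esub> h \<otimes>\<^bsub>G\<^esub> inv\<^bsub>G\<^esub> g)"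
  using act_comp by blast

lemma parts_sum:
  assumes "finite (carrier G)" "\<And>s. s \<in> carrier G \<Longrightarrow> m s \<in> yd_comp V s" "v = (\<Oplus>\<^bsub>V\<^esub>s\<in>carrier G. m s)"
  shows "homogeneous_parts G V v (\<lambda>s. if s \<in> carrier G then m s else \<zero>\<^bsub>V\<^esub>)"
proof -
  let ?m = "\<lambda>s. if s \<in> carrier G then m s else \<zero>\<^bsub>V\<^esub>"
  have sub: "{g. ?m g \<noteq> \<zero>\<^bsub>V\<^esub>} \<subseteq> carrier G" by auto
  have mc: "m s \<in> carrier V" if "s \<in> carrier G" for s using comp_closed[OF that assms(2)[OF that]] .
  have "(\<Oplus>\<^bsub>V\<^esub>s\<in>carrier G. m s) = (\<Oplus>\<^bsub>V\<^esub>s\<in>{g. ?m g \<noteq> \<zero>\<^bsub>V\<^esub>}. ?m s)"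
    by (rule spc.add.finprod_mono_neutral_cong_right[OF assms(1) sub]) (use mc in auto)
  then show ?thesis unfolding homogeneous_parts_def
    using assms finite_subset[OF sub assms(1)] by auto
qed

lemma parts_unique: "homogeneous_parts G V v m \<Longrightarrow> homogeneous_parts G V v m' \<Longrightarrow> v \<in> carrier V \<Longrightarrow> m = m'"
  using comp_direct_sum by blast

lemma parts_zero: "homogeneous_parts G V \<zero>\<^bsub>V\<^esub> (\<lambda>_. \<zero>\<^bsub>V\<^esub>)"
  unfolding homogeneous_parts_def using csubspaceD(3)[OF comp_subspace] by auto

lemma parts_single:
  assumes "g \<in> carrier G" "v \<in> yd_comp V g"
  shows "homogeneous_parts G V v (\<lambda>s. if s = g then v else \<zero>\<^bsub>V\<^esub>)"
proof (cases "v = \<zero>\<^bsub>V\<^esub>")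
  case True
  then show ?thesis using parts_zero by (simp cong: if_cong)
next
  case False
  then have "{s. (if s = g then v else \<zero>\<^bsub>V\<^esub>) \<noteq> \<zero>\<^bsub>V\<^esub>} = {g}" by auto
  then show ?thesis unfolding homogeneous_parts_def
    using assms comp_closed[OF assms] csubspaceD(3)[OF comp_subspace] by auto
qed

end

context yd_module
begin

definition orbit_span :: "'v \<Rightarrow> 'v set" where
  "orbit_span v = cspan V {yd_act V k v | k. k \<in> carrier G}"

lemma orbit_closed: "v \<in> carrier V \<Longrightarrow> {yd_act V k v | k. k \<in> carrier G} \<subseteq> carrier V"
  by auto

lemma orbit_span_subspace:
  assumes "v \<in> carrier V"
  shows "csubspace (orbit_span v) V" "k \<in> carrier G \<Longrightarrow> yd_act V k v \<in> orbit_span v" "v \<in> orbit_span v"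
proof -
  note s = cspan_closed[OF spc.vectorspace_axioms orbit_closed[OF assms]]
  show "csubspace (orbit_span v) V" unfolding orbit_span_def by (rule s(1))
  show k: "yd_act V k v \<in> orbit_span v" if "k \<in> carrier G" for k
    unfolding orbit_span_def using s(2) that by blast
  show "v \<in> orbit_span v" using k[of "\<one>\<^bsub>G\<^esub>"] act_one[OF assms] by simp
qed

text \<open>The orbit of a homogeneous vector consists of homogeneous vectors, so the homogeneous parts of a
  combination of them are again such combinations.\<close>

lemma orbit_span_submodule:
  assumes fin: "finite (carrier G)" and g: "g \<in> carrier G" and v: "v \<in> yd_comp V g"
  shows "yd_submodule G V (orbit_span v)"
  unfolding yd_submodule_def
proof (intro conjI ballI allI impI)
  have vc: "v \<in> carrier V" using comp_closed[OF g v] .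
  note U = orbit_span_subspace[OF vc]
  note Ud = csubspaceD[OF U(1)]
  show "csubspace (orbit_span v) V" by (rule U(1))
  fix s assume s: "s \<in> carrier G"
  let ?T = "{u \<in> carrier V. yd_act V s u \<in> orbit_span v}"
  have T: "csubspace ?T V"
    by (rule csubspaceI[OF spc.vectorspace_axioms])
      (auto simp: s act_add act_smult Ud(3,4,5) CC_smult(3)[OF spc.vectorspace_axioms])
  have "orbit_span v \<subseteq> ?T" unfolding orbit_span_def
  proof (rule cspan_least[OF T[unfolded orbit_span_def]], clarify)
    fix k assume k: "k \<in> carrier G"
    show "yd_act V k v \<in> carrier V \<and> yd_act V s (yd_act V k v) \<in> cspan V {yd_act V k v |k. k \<in> carrier G}"
      using U(2)[of "s \<otimes>\<^bsub>G\<^esub> k"] s k vc by (simp add: act_mult orbit_span_def)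
  qed
  then show "yd_act V s ` orbit_span v \<subseteq> orbit_span v" by blast
next
  have vc: "v \<in> carrier V" using comp_closed[OF g v] .
  note U = orbit_span_subspace[OF vc]
  note Ud = csubspaceD[OF U(1)]
  let ?T = "{\<Oplus>\<^bsub>V\<^esub>s\<in>carrier G. n s | n. \<forall>s\<in>carrier G. n s \<in> yd_comp V s \<and> n s \<in> orbit_span v}"
  have nc: "n \<in> carrier G \<rightarrow> carrier V" if "\<forall>s\<in>carrier G. n s \<in> yd_comp V s \<and> n s \<in> orbit_span v" for n
    using that comp_closed by blast
  have T: "csubspace ?T V"
  proof (rule csubspaceI[OF spc.vectorspace_axioms])
    show "?T \<subseteq> carrier V" using nc by (auto intro!: spc.finsum_closed)
    have "(\<Oplus>\<^bsub>V\<^esub>s\<in>carrier G. \<zero>\<^bsub>V\<^esub>) = \<zero>\<^bsub>V\<^esub>" by (rule spc.finsum_zero)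
    then show "\<zero>\<^bsub>V\<^esub> \<in> ?T" using Ud(3) csubspaceD(3)[OF comp_subspace]
      by (intro CollectI exI[of _ "\<lambda>_. \<zero>\<^bsub>V\<^esub>"]) auto
    show "a \<oplus>\<^bsub>V\<^esub> b \<in> ?T" if ab: "a \<in> ?T" "b \<in> ?T" for a b
    proof -
      obtain n n' where n: "a = (\<Oplus>\<^bsub>V\<^esub>s\<in>carrier G. n s)" "\<forall>s\<in>carrier G. n s \<in> yd_comp V s \<and> n s \<in> orbit_span v"
        "b = (\<Oplus>\<^bsub>V\<^esub>s\<in>carrier G. n' s)" "\<forall>s\<in>carrier G. n' s \<in> yd_comp V s \<and> n' s \<in> orbit_span v" using ab by blast
      have "a \<oplus>\<^bsub>V\<^esub> b = (\<Oplus>\<^bsub>V\<^esub>s\<in>carrier G. n s \<oplus>\<^bsub>V\<^esub> n' s)"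
        unfolding n(1,3) by (rule spc.finsum_addf[symmetric, OF nc[OF n(2)] nc[OF n(4)]])
      then show ?thesis using n(2,4) Ud(4) csubspaceD(4)[OF comp_subspace]
        by (intro CollectI exI[of _ "\<lambda>s. n s \<oplus>\<^bsub>V\<^esub> n' s"]) auto
    qed
    show "c \<odot>\<^bsub>V\<^esub> a \<in> ?T" if a: "a \<in> ?T" for c a
    proof -
      obtain n where n: "a = (\<Oplus>\<^bsub>V\<^esub>s\<in>carrier G. n s)" "\<forall>s\<in>carrier G. n s \<in> yd_comp V s \<and> n s \<in> orbit_span v"
        using a by blast
      have "c \<odot>\<^bsub>V\<^esub> a = (\<Oplus>\<^bsub>V\<^esub>s\<in>carrier G. c \<odot>\<^bsub>V\<^esub> n s)"
        unfolding n(1) using spc.finsum_smult[OF _ nc[OF n(2)], of c] by simp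
      then show ?thesis using n(2) Ud(5) csubspaceD(5)[OF comp_subspace]
        by (intro CollectI exI[of _ "\<lambda>s. c \<odot>\<^bsub>V\<^esub> n s"]) auto
    qed
  qed
  have gen: "yd_act V k v \<in> ?T" if k: "k \<in> carrier G" for k
  proof -
    let ?d = "k \<otimes>\<^bsub>G\<^esub> g \<otimes>\<^bsub>G\<^esub> inv\<^bsub>G\<^esub> k"
    have d: "?d \<in> carrier G" "yd_act V k v \<in> yd_comp V ?d" using k g act_comp_mem[OF k g v] by auto
    define n where "n s = (if s = ?d then yd_act V k v else \<zero>\<^bsub>V\<^esub>)" for s
    have n: "\<forall>s\<in>carrier G. n s \<in> yd_comp V s \<and> n s \<in> orbit_span v"
      using d U(2)[OF k] Ud(3) csubspaceD(3)[OF comp_subspace] by (auto simp: n_def)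
    have "(\<Oplus>\<^bsub>V\<^esub>s\<in>carrier G. n s) = yd_act V k v"
      unfolding n_def by (rule spc.add.finprod_singleton_swap[OF d(1) fin]) (use comp_closed[OF d] in auto)
    then show ?thesis using n by (intro CollectI exI[of _ n]) simp
  qed
  fix u m s assume u: "u \<in> orbit_span v" and m: "homogeneous_parts G V u m"
  have "orbit_span v \<subseteq> ?T" unfolding orbit_span_def[of v]
    by (rule cspan_least[OF T[unfolded orbit_span_def]]) (use gen[unfolded orbit_span_def] in blast)
  then obtain n where n: "u = (\<Oplus>\<^bsub>V\<^esub>s\<in>carrier G. n s)" "\<forall>s\<in>carrier G. n s \<in> yd_comp V s \<and> n s \<in> orbit_span v"
    using u by blast
  have "m = (\<lambda>s. if s \<in> carrier G then n s else \<zero>\<^bsub>V\<^esub>)"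
    by (rule parts_unique[OF m parts_sum[OF fin _ n(1)]]) (use n(2) Ud(2) u in auto)
  then show "m s \<in> orbit_span v" using n(2) Ud(3) by simp
qed

lemma homogeneous_vector_exists:
  assumes "carrier V \<noteq> {\<zero>\<^bsub>V\<^esub>}"
  shows "\<exists>g\<in>carrier G. \<exists>v\<in>yd_comp V g. v \<noteq> \<zero>\<^bsub>V\<^esub>"
proof -
  obtain u where u: "u \<in> carrier V" "u \<noteq> \<zero>\<^bsub>V\<^esub>" using assms spc.zero_closed by blast
  obtain m where m: "homogeneous_parts G V u m" using comp_direct_sum[OF u(1)] by blast
  have "{g. m g \<noteq> \<zero>\<^bsub>V\<^esub>} \<noteq> {}"
  proof
    assume "{g. m g \<noteq> \<zero>\<^bsub>V\<^esub>} = {}"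
    then have "u = \<zero>\<^bsub>V\<^esub>" using m unfolding homogeneous_parts_def by simp
    then show False using u by simp
  qed
  then show ?thesis using m unfolding homogeneous_parts_def by blast
qed

lemma irreducible_generated:
  assumes "finite (carrier G)" "yd_irreducible G V" "g \<in> carrier G" "v \<in> yd_comp V g" "v \<noteq> \<zero>\<^bsub>V\<^esub>"
  shows "orbit_span v = carrier V"
  using orbit_span_submodule[OF assms(1,3,4)] assms(2,5) orbit_span_subspace(3)[OF comp_closed[OF assms(3,4)]]
  unfolding yd_irreducible_def by blast

text \<open>A minimal generating subset of the orbit of a homogeneous vector is a basis.\<close>

lemma homogeneous_basis_exists:
  assumes fin: "finite (carrier G)" and irr: "yd_irreducible G V"
  shows "\<exists>B. homogeneous_basis G V B"
proof -
  obtain g v where gv: "g \<in> carrier G" "v \<in> yd_comp V g" "v \<noteq> \<zero>\<^bsub>V\<^esub>"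
    using homogeneous_vector_exists irr unfolding yd_irreducible_def by blast
  let ?O = "{yd_act V k v | k. k \<in> carrier G}"
  have vc: "v \<in> carrier V" by (rule comp_closed[OF gv(1,2)])
  have "finite ?O" using fin by simp
  moreover have "?O \<subseteq> carrier V \<and> spc.gen_set ?O"
    using irreducible_generated[OF fin irr gv] orbit_closed[OF vc] by (simp add: orbit_span_def)
  ultimately obtain B where B: "B \<subseteq> ?O" "minimal B (\<lambda>S. S \<subseteq> carrier V \<and> spc.gen_set S)"
    using minimal_exists[of ?O "\<lambda>S. S \<subseteq> carrier V \<and> spc.gen_set S"] by blast
  have "?O \<subseteq> (\<Union>g\<in>carrier G. yd_comp V g)"
  proof clarify
    fix k assume k: "k \<in> carrier G"
    show "yd_act V k v \<in> (\<Union>g\<in>carrier G. yd_comp V g)"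
    proof (rule UN_I)
      show "yd_act V k v \<in> yd_comp V (k \<otimes>\<^bsub>G\<^esub> g \<otimes>\<^bsub>G\<^esub> inv\<^bsub>G\<^esub> k)" by (rule act_comp_mem[OF k gv(1,2)])
    qed (use k gv(1) in simp)
  qed
  then have "homogeneous_basis G V B"
    unfolding homogeneous_basis_def using spc.min_gen_is_basis[OF B(2)] order.trans[OF B(1)] by simp
  then show ?thesis by blast
qed

end

section \<open>Recognising induced modules\<close>

abbreviation translate :: "('g, 'k) monoid_scheme \<Rightarrow> 'g \<Rightarrow> ('g \<times> 'w \<Rightarrow>\<^sub>0 complex) \<Rightarrow> ('g \<times> 'w \<Rightarrow>\<^sub>0 complex)" where
  "translate G s \<equiv> lin_ext (\<lambda>(h, w). bvec (s \<otimes>\<^bsub>G\<^esub> h, w))"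

locale induced_data = grp: group G + rep: vectorspace CC W
  for G :: "('g, 'k) monoid_scheme" and W :: "(complex, 'w, 'n) module_scheme" +
  fixes g :: 'g and \<rho> :: "'g \<Rightarrow> 'w \<Rightarrow> 'w"
  assumes g: "g \<in> carrier G"
    and rho_closed: "\<lbrakk>k \<in> centralizer G g; w \<in> carrier W\<rbrakk> \<Longrightarrow> \<rho> k w \<in> carrier W"
begin

abbreviation "F \<equiv> induced_free G W"
abbreviation "N \<equiv> induced_relations G g W \<rho>"
abbreviation "M \<equiv> yd_induced G g W \<rho>"
abbreviation "Q \<equiv> quotient_module F N"
abbreviation "cl p \<equiv> N +>\<^bsub>F\<^esub> p"
abbreviation "S \<equiv> carrier G \<times> carrier W"

definition relators :: "('g \<times> 'w \<Rightarrow>\<^sub>0 complex) set" where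
  "relators = {bvec (h, w \<oplus>\<^bsub>W\<^esub> w') - bvec (h, w) - bvec (h, w') | h w w'.
         h \<in> carrier G \<and> w \<in> carrier W \<and> w' \<in> carrier W} \<union>
      {bvec (h, c \<odot>\<^bsub>W\<^esub> w) - Poly_Mapping.single (h, w) c | h c w.
         h \<in> carrier G \<and> w \<in> carrier W} \<union>
      {bvec (h \<otimes>\<^bsub>G\<^esub> k, w) - bvec (h, \<rho> k w) | h k w.
         h \<in> carrier G \<and> k \<in> centralizer G g \<and> w \<in> carrier W}"

lemma relations_span: "N = cspan F relators"
  by (simp add: induced_relations_def relators_def)

lemma centralizer_closed: "k \<in> centralizer G g \<Longrightarrow> k \<in> carrier G"
  by (simp add: centralizer_def)

lemma smult_closed [simp]: "w \<in> carrier W \<Longrightarrow> c \<odot>\<^bsub>W\<^esub> w \<in> carrier W"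
  by (rule CC_smult(3)[OF rep.vectorspace_axioms])

lemma relators_free: "relators \<subseteq> carrier F"
proof
  fix r assume "r \<in> relators"
  then show "r \<in> carrier F"
    unfolding relators_def free_likeD(1)[OF free_like_space(4)]
    by (elim UnE CollectE exE conjE; hypsubst; intro keys_closed) (auto simp: rho_closed centralizer_closed)
qed

lemmas FL = free_like_space(4)[of G W]

lemma relations_subspace: "csubspace N F" and relators_in: "relators \<subseteq> N"
  unfolding relations_span by (rule cspan_closed[OF free_like_vectorspace[OF FL] relators_free])+

lemmas FN = FL relations_subspace
lemmas Nc = free_like_subspaceD[OF FN]

lemma relation_add: "h \<in> carrier G \<Longrightarrow> w \<in> carrier W \<Longrightarrow> w' \<in> carrier W \<Longrightarrow>
    bvec (h, w \<oplus>\<^bsub>W\<^esub> w') - bvec (h, w) - bvec (h, w') \<in> N"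
  by (rule subsetD[OF relators_in]) (unfold relators_def, blast)

lemma relation_smult: "h \<in> carrier G \<Longrightarrow> w \<in> carrier W \<Longrightarrow>
    bvec (h, c \<odot>\<^bsub>W\<^esub> w) - Poly_Mapping.single (h, w) c \<in> N"
  by (rule subsetD[OF relators_in]) (unfold relators_def, blast)

lemma relation_balance: "h \<in> carrier G \<Longrightarrow> k \<in> centralizer G g \<Longrightarrow> w \<in> carrier W \<Longrightarrow>
    bvec (h \<otimes>\<^bsub>G\<^esub> k, w) - bvec (h, \<rho> k w) \<in> N"
  by (rule subsetD[OF relators_in]) (unfold relators_def, blast)

lemma relation_zero: "h \<in> carrier G \<Longrightarrow> bvec (h, \<zero>\<^bsub>W\<^esub>) \<in> N"
  using relation_smult[of h "\<zero>\<^bsub>W\<^esub>" 0] CC_smult(1)[OF rep.vectorspace_axioms rep.zero_closed] by simp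

lemma translate_relations:
  assumes s: "s \<in> carrier G" and p: "p \<in> N"
  shows "translate G s p \<in> N"
proof -
  let ?T = "{p. Poly_Mapping.keys p \<subseteq> S \<and> translate G s p \<in> N}"
  have T: "csubspace ?T F"
    by (rule free_like_subspaceI[OF FL]) (simp_all add: keys_closed lin_ext_simps Nc)
  have "relators \<subseteq> ?T"
  proof
    fix r assume r: "r \<in> relators"
    have "Poly_Mapping.keys r \<subseteq> S" using relators_free r free_likeD(1)[OF FL] by blast
    moreover have "translate G s r \<in> N" using r s unfolding relators_def
      by (elim UnE CollectE exE conjE; hypsubst)
        (simp_all add: lin_ext_simps relation_add relation_smult relation_balance grp.m_assoc[symmetric] centralizer_closed)
    ultimately show "r \<in> ?T" by simp
  qed
  then have "N \<subseteq> ?T" unfolding relations_span by (rule cspan_least[OF T[unfolded relations_span]])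
  then show ?thesis using p by blast
qed

lemma induced_fields:
  "carrier M = carrier Q" "add M = add Q" "zero M = zero Q" "smult M = smult Q"
  "yd_act M = (\<lambda>s. coset_map F N (translate G s))"
  "yd_comp M = (\<lambda>s. cspan Q {cl (bvec (h, w)) | h w.
                   h \<in> carrier G \<and> w \<in> carrier W \<and> h \<otimes>\<^bsub>G\<^esub> g \<otimes>\<^bsub>G\<^esub> inv\<^bsub>G\<^esub> h = s})"
  by (simp_all add: yd_induced_def Let_def module.defs yd_struct.defs)

lemma induced_act: "s \<in> carrier G \<Longrightarrow> yd_act M s (cl p) = cl (translate G s p)"
  unfolding induced_fields
  by (rule coset_map_coset[OF FN]) (simp_all add: lin_ext_simps translate_relations)

lemma induced_carrier: "carrier M = cl ` {p. Poly_Mapping.keys p \<subseteq> S}"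
  unfolding induced_fields(1) by (rule quotient_carrier[OF FN])

text \<open>\<open>s \<cdot> (h \<otimes> w) = h \<otimes> (h\<^sup>-\<^sup>1 s h) w\<close> whenever the conjugate centralises \<open>g\<close>.\<close>

lemma induced_scalar_action:
  assumes conj: "\<And>h. h \<in> carrier G \<Longrightarrow> inv\<^bsub>G\<^esub> h \<otimes>\<^bsub>G\<^esub> s \<otimes>\<^bsub>G\<^esub> h \<in> centralizer G g"
    and rho: "\<And>h w. h \<in> carrier G \<Longrightarrow> w \<in> carrier W \<Longrightarrow> \<rho> (inv\<^bsub>G\<^esub> h \<otimes>\<^bsub>G\<^esub> s \<otimes>\<^bsub>G\<^esub> h) w = \<epsilon> \<odot>\<^bsub>W\<^esub> w"
    and s: "s \<in> carrier G" and X: "X \<in> carrier M"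
  shows "yd_act M s X = \<epsilon> \<odot>\<^bsub>M\<^esub> X"
proof -
  obtain p where p: "X = cl p" "Poly_Mapping.keys p \<subseteq> S" using X unfolding induced_carrier by blast
  have "translate G s p - scale \<epsilon> p \<in> N" using p(2)
  proof (induction rule: free_induct)
    case zero
    then show ?case using Nc(2) by (simp add: lin_ext_simps)
  next
    case (add f h)
    have "translate G s (f + h) - scale \<epsilon> (f + h) = (translate G s f - scale \<epsilon> f) + (translate G s h - scale \<epsilon> h)"
      by (simp add: lin_ext_simps scale_distrib)
    then show ?case using Nc(3)[OF add] by simp
  next
    case (single hw c)
    obtain h w where hw: "hw = (h, w)" "h \<in> carrier G" "w \<in> carrier W" using single by blast
    let ?k = "inv\<^bsub>G\<^esub> h \<otimes>\<^bsub>G\<^esub> s \<otimes>\<^bsub>G\<^esub> h"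
    have "h \<otimes>\<^bsub>G\<^esub> ?k = s \<otimes>\<^bsub>G\<^esub> h" using hw s by (simp add: grp.m_assoc[symmetric])
    then have 1: "bvec (s \<otimes>\<^bsub>G\<^esub> h, w) - bvec (h, \<epsilon> \<odot>\<^bsub>W\<^esub> w) \<in> N"
      using relation_balance[OF hw(2) conj[OF hw(2)] hw(3)] rho[OF hw(2,3)] by simp
    have "bvec (s \<otimes>\<^bsub>G\<^esub> h, w) - Poly_Mapping.single (h, w) \<epsilon> \<in> N"
      using Nc(3)[OF 1 relation_smult[OF hw(2,3), of \<epsilon>]] by simp
    from Nc(4)[OF this, of c] show ?case by (simp add: hw(1) scale_distrib mult.commute)
  qed
  then show ?thesis
    unfolding p(1) induced_act[OF s] by (simp add: induced_fields quotient_smult[OF FN] coset_eq_iff[OF FN])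
qed

lemma induced_comp_empty:
  assumes "\<And>h. h \<in> carrier G \<Longrightarrow> h \<otimes>\<^bsub>G\<^esub> g \<otimes>\<^bsub>G\<^esub> inv\<^bsub>G\<^esub> h \<noteq> s"
  shows "yd_comp M s = {\<zero>\<^bsub>M\<^esub>}"
proof -
  have "{cl (bvec (h, w)) | h w. h \<in> carrier G \<and> w \<in> carrier W \<and> h \<otimes>\<^bsub>G\<^esub> g \<otimes>\<^bsub>G\<^esub> inv\<^bsub>G\<^esub> h = s} = {}"
    using assms by blast
  then show ?thesis
    by (simp only: induced_fields vectorspace.span_empty[OF quotient_vectorspace[OF FN]])
qed

lemma induced_vectorspace: "vectorspace CC M"
proof (rule vectorspace_CC_I)
  interpret Q: vectorspace CC Q by (rule quotient_vectorspace[OF FN])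
  show "abelian_group M"
  proof (rule abelian_groupI)
    show "\<exists>w\<in>carrier M. w \<oplus>\<^bsub>M\<^esub> v = \<zero>\<^bsub>M\<^esub>" if "v \<in> carrier M" for v
      using Q.l_neg[of v] Q.a_inv_closed[of v] that unfolding induced_fields by blast
    show "v \<oplus>\<^bsub>M\<^esub> w = w \<oplus>\<^bsub>M\<^esub> v" if "v \<in> carrier M" "w \<in> carrier M" for v w
      using Q.a_comm that unfolding induced_fields by blast
  qed (simp_all add: induced_fields Q.a_assoc)
qed (auto simp: induced_fields CC_smult[OF quotient_vectorspace[OF FN]])

end

text \<open>Frobenius reciprocity: an injective map \<open>\<theta>\<close> of the representation \<open>W\<close> into the component of degree \<open>g\<close> extends to
  \<open>h \<otimes> w \<mapsto> h \<cdot> \<theta>(w)\<close> on the induced module.  The extension is surjective if the images generate, and injective since it is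
  injective in each degree.\<close>

locale induced_comparison = induced_data G W g \<rho> + yd: yd_module G V
  for G :: "('g, 'k) monoid_scheme" and W :: "(complex, 'w, 'n) module_scheme"
    and g \<rho> and V :: "('g, 'v, 'm) yd_struct_scheme" +
  fixes \<theta>
  assumes finG: "finite (carrier G)"
    and theta_hom: "\<theta> \<in> chom W V" and theta_inj: "inj_on \<theta> (carrier W)"
    and theta_comp: "w \<in> carrier W \<Longrightarrow> \<theta> w \<in> yd_comp V g"
    and theta_equiv: "\<lbrakk>k \<in> centralizer G g; w \<in> carrier W\<rbrakk> \<Longrightarrow> \<theta> (\<rho> k w) = yd_act V k (\<theta> w)"
    and generate: "carrier V \<subseteq> cspan V {yd_act V h (\<theta> w) | h w. h \<in> carrier G \<and> w \<in> carrier W}"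
begin

abbreviation "\<tau> \<equiv> \<lambda>(h, w). yd_act V h (\<theta> w)"
abbreviation "\<Phi> \<equiv> vlin V \<tau>"

lemma theta_closed: "w \<in> carrier W \<Longrightarrow> \<theta> w \<in> carrier V"
  using yd.comp_closed[OF g theta_comp] .

lemma theta_lin: "w \<in> carrier W \<Longrightarrow> w' \<in> carrier W \<Longrightarrow> \<theta> (w \<oplus>\<^bsub>W\<^esub> w') = \<theta> w \<oplus>\<^bsub>V\<^esub> \<theta> w'"
  "w \<in> carrier W \<Longrightarrow> \<theta> (c \<odot>\<^bsub>W\<^esub> w) = c \<odot>\<^bsub>V\<^esub> \<theta> w"
  using theta_hom unfolding module_hom_def by auto

lemma theta_zero: "\<theta> \<zero>\<^bsub>W\<^esub> = \<zero>\<^bsub>V\<^esub>"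
  using theta_lin(2)[OF rep.zero_closed, of 0] CC_smult(1)[OF rep.vectorspace_axioms rep.zero_closed]
    CC_smult(1)[OF yd.spc.vectorspace_axioms theta_closed[OF rep.zero_closed]] by simp

lemma tau_closed: "s \<in> S \<Longrightarrow> \<tau> s \<in> carrier V"
  using theta_closed by auto

lemma Phi_add: "Poly_Mapping.keys p \<subseteq> S \<Longrightarrow> Poly_Mapping.keys q \<subseteq> S \<Longrightarrow> \<Phi> (p + q) = \<Phi> p \<oplus>\<^bsub>V\<^esub> \<Phi> q"
  by (rule vlin_add[where S = S]) (simp_all add: yd.spc.vectorspace_axioms tau_closed)

lemma Phi_scale: "Poly_Mapping.keys p \<subseteq> S \<Longrightarrow> \<Phi> (scale c p) = c \<odot>\<^bsub>V\<^esub> \<Phi> p"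
  by (rule vlin_scale[where S = S]) (simp_all add: yd.spc.vectorspace_axioms tau_closed)

lemma Phi_minus: "Poly_Mapping.keys p \<subseteq> S \<Longrightarrow> Poly_Mapping.keys q \<subseteq> S \<Longrightarrow> \<Phi> (p - q) = \<Phi> p \<ominus>\<^bsub>V\<^esub> \<Phi> q"
  by (rule vlin_minus[where S = S]) (simp_all add: yd.spc.vectorspace_axioms tau_closed)

lemma Phi_single: "s \<in> S \<Longrightarrow> \<Phi> (Poly_Mapping.single s c) = c \<odot>\<^bsub>V\<^esub> \<tau> s"
  by (rule vlin_single[where S = S]) (simp_all add: yd.spc.vectorspace_axioms tau_closed)

lemma Phi_closed: "Poly_Mapping.keys p \<subseteq> S \<Longrightarrow> \<Phi> p \<in> carrier V"
  by (rule vlin_closed[where S = S]) (simp_all add: yd.spc.vectorspace_axioms tau_closed)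

lemma Phi_zero: "\<Phi> 0 = \<zero>\<^bsub>V\<^esub>"
  by (rule vlin_zero[where S = S]) (simp_all add: yd.spc.vectorspace_axioms tau_closed)

lemma Phi_sum: "finite A \<Longrightarrow> (\<And>a. a \<in> A \<Longrightarrow> Poly_Mapping.keys (h a) \<subseteq> S) \<Longrightarrow> \<Phi> (sum h A) = (\<Oplus>\<^bsub>V\<^esub>a\<in>A. \<Phi> (h a))"
  by (rule vlin_sum[where S = S]) (simp_all add: yd.spc.vectorspace_axioms tau_closed)

lemma Phi_bvec: "h \<in> carrier G \<Longrightarrow> w \<in> carrier W \<Longrightarrow> \<Phi> (bvec (h, w)) = yd_act V h (\<theta> w)"
  using Phi_single[of "(h, w)" 1] CC_smult(2)[OF yd.spc.vectorspace_axioms tau_closed[of "(h, w)"]] by simp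

lemma Phi_relations: "p \<in> N \<Longrightarrow> \<Phi> p = \<zero>\<^bsub>V\<^esub>"
proof -
  assume p: "p \<in> N"
  let ?T = "{p. Poly_Mapping.keys p \<subseteq> S \<and> \<Phi> p = \<zero>\<^bsub>V\<^esub>}"
  have T: "csubspace ?T F"
    by (rule free_like_subspaceI[OF FL])
      (auto simp: keys_closed Phi_add Phi_scale Phi_zero CC_smult(4)[OF yd.spc.vectorspace_axioms yd.spc.zero_closed])
  have k: "Poly_Mapping.keys (bvec (h, w)) \<subseteq> S" "Poly_Mapping.keys (Poly_Mapping.single (h, w) c) \<subseteq> S"
    if "h \<in> carrier G" "w \<in> carrier W" for h w c using that by auto
  have "relators \<subseteq> ?T"
  proof
    fix r assume r: "r \<in> relators"
    then have kr: "Poly_Mapping.keys r \<subseteq> S" using relators_free free_likeD(1)[OF FL] by blast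
    have "\<Phi> r = \<zero>\<^bsub>V\<^esub>" using r unfolding relators_def
    proof (elim UnE CollectE exE conjE; hypsubst)
      fix h w w' assume a: "h \<in> carrier G" "w \<in> carrier W" "w' \<in> carrier W"
      then have "\<Phi> (bvec (h, w \<oplus>\<^bsub>W\<^esub> w') - bvec (h, w) - bvec (h, w')) =
          (yd_act V h (\<theta> w) \<oplus>\<^bsub>V\<^esub> yd_act V h (\<theta> w')) \<ominus>\<^bsub>V\<^esub> yd_act V h (\<theta> w) \<ominus>\<^bsub>V\<^esub> yd_act V h (\<theta> w')"
        by (simp only: Phi_minus keys_closed k rep.a_closed Phi_bvec theta_lin yd.act_add theta_closed)
      then show "\<Phi> (bvec (h, w \<oplus>\<^bsub>W\<^esub> w') - bvec (h, w) - bvec (h, w')) = \<zero>\<^bsub>V\<^esub>"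
        using a theta_closed yd.act_closed
        by (simp add: a_minus_def yd.spc.a_ac yd.spc.r_neg yd.spc.r_neg1 yd.spc.r_neg2)
    next
      fix h c w assume a: "h \<in> carrier G" "w \<in> carrier W"
      then have "\<Phi> (bvec (h, c \<odot>\<^bsub>W\<^esub> w) - Poly_Mapping.single (h, w) c) =
          c \<odot>\<^bsub>V\<^esub> yd_act V h (\<theta> w) \<ominus>\<^bsub>V\<^esub> c \<odot>\<^bsub>V\<^esub> yd_act V h (\<theta> w)"
        using Phi_single[of "(h, w)" c]
        by (simp add: Phi_minus Phi_bvec theta_lin yd.act_smult theta_closed)
      then show "\<Phi> (bvec (h, c \<odot>\<^bsub>W\<^esub> w) - Poly_Mapping.single (h, w) c) = \<zero>\<^bsub>V\<^esub>"
        using a theta_closed CC_smult(3)[OF yd.spc.vectorspace_axioms yd.act_closed]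
        by (simp add: a_minus_def yd.spc.r_neg)
    next
      fix h k w assume a: "h \<in> carrier G" "k \<in> centralizer G g" "w \<in> carrier W"
      then have "\<Phi> (bvec (h \<otimes>\<^bsub>G\<^esub> k, w) - bvec (h, \<rho> k w)) = yd_act V h (yd_act V k (\<theta> w)) \<ominus>\<^bsub>V\<^esub> yd_act V h (yd_act V k (\<theta> w))"
        by (simp add: Phi_minus Phi_bvec rho_closed centralizer_closed theta_equiv yd.act_mult theta_closed)
      then show "\<Phi> (bvec (h \<otimes>\<^bsub>G\<^esub> k, w) - bvec (h, \<rho> k w)) = \<zero>\<^bsub>V\<^esub>"
        using a theta_closed yd.act_closed centralizer_closed by (simp add: a_minus_def yd.spc.r_neg)
    qed
    then show "r \<in> ?T" using kr by simp
  qed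
  then have "N \<subseteq> ?T" unfolding relations_span by (rule cspan_least[OF T[unfolded relations_span]])
  then show ?thesis using p by blast
qed

text \<open>The part of \<open>p\<close> that has degree \<open>s\<close> in the induced module.\<close>

definition part :: "'g \<Rightarrow> ('g \<times> 'w \<Rightarrow>\<^sub>0 complex) \<Rightarrow> ('g \<times> 'w \<Rightarrow>\<^sub>0 complex)" where
  "part s = lin_ext (\<lambda>(h, w). if h \<otimes>\<^bsub>G\<^esub> g \<otimes>\<^bsub>G\<^esub> inv\<^bsub>G\<^esub> h = s then bvec (h, w) else 0)"

abbreviation "fibre s \<equiv> {(h, w). h \<in> carrier G \<and> w \<in> carrier W \<and> h \<otimes>\<^bsub>G\<^esub> g \<otimes>\<^bsub>G\<^esub> inv\<^bsub>G\<^esub> h = s}"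

lemma keys_part: "Poly_Mapping.keys p \<subseteq> S \<Longrightarrow> Poly_Mapping.keys (part s p) \<subseteq> fibre s"
  unfolding part_def by (rule keys_lin_ext) (auto split: if_splits)

lemma keys_part_S: "Poly_Mapping.keys p \<subseteq> S \<Longrightarrow> Poly_Mapping.keys (part s p) \<subseteq> S"
  using keys_part[of p s] by auto

lemma sum_parts: "Poly_Mapping.keys p \<subseteq> S \<Longrightarrow> (\<Sum>s\<in>carrier G. part s p) = p"
proof (rule lin_map_eqI[of "\<lambda>p. \<Sum>s\<in>carrier G. part s p" "\<lambda>p. p" p S])
  show "lin_map (\<lambda>p. \<Sum>s\<in>carrier G. part s p)"
    unfolding part_def by (simp add: lin_map_def lin_ext_simps sum.distrib scale_sum)
  fix hw assume "hw \<in> S"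
  then obtain h w where hw: "hw = (h, w)" "h \<in> carrier G" by blast
  have "(\<Sum>s\<in>carrier G. part s (bvec hw)) = (\<Sum>s\<in>carrier G. if h \<otimes>\<^bsub>G\<^esub> g \<otimes>\<^bsub>G\<^esub> inv\<^bsub>G\<^esub> h = s then bvec hw else 0)"
    by (rule sum.cong) (auto simp: part_def hw(1))
  also have "\<dots> = bvec hw" using finG g hw(2) by (simp add: sum.delta')
  finally show "(\<Sum>s\<in>carrier G. part s (bvec hw)) = bvec hw" .
qed (auto simp: lin_map_id)

lemma Phi_fibre:
  assumes "s \<in> carrier G" "Poly_Mapping.keys p \<subseteq> fibre s"
  shows "\<Phi> p \<in> yd_comp V s"
proof -
  note c = csubspaceD[OF yd.comp_subspace[OF assms(1)]]
  have "Poly_Mapping.keys p \<subseteq> S \<and> \<Phi> p \<in> yd_comp V s" using assms(2)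
  proof (induction rule: free_induct)
    case zero
    then show ?case using c(3) by (simp add: Phi_zero)
  next
    case (add f h)
    then show ?case using c(4) by (simp add: keys_closed Phi_add)
  next
    case (single hw d)
    obtain h w where hw: "hw = (h, w)" "h \<in> carrier G" "w \<in> carrier W" "h \<otimes>\<^bsub>G\<^esub> g \<otimes>\<^bsub>G\<^esub> inv\<^bsub>G\<^esub> h = s"
      using single by auto
    have "yd_act V h (\<theta> w) \<in> yd_comp V s" using yd.act_comp_mem[OF hw(2) g theta_comp[OF hw(3)]] hw(4) by simp
    then show ?case using c(5) Phi_single[of "(h, w)" d] hw by auto
  qed
  then show ?thesis by simp
qed

lemma Phi_parts:
  assumes "Poly_Mapping.keys p \<subseteq> S"
  shows "homogeneous_parts G V (\<Phi> p) (\<lambda>s. if s \<in> carrier G then \<Phi> (part s p) else \<zero>\<^bsub>V\<^esub>)"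
proof (rule yd.parts_sum[OF finG])
  show "\<Phi> (part s p) \<in> yd_comp V s" if "s \<in> carrier G" for s
    by (rule Phi_fibre[OF that keys_part[OF assms]])
  have "\<Phi> (\<Sum>s\<in>carrier G. part s p) = (\<Oplus>\<^bsub>V\<^esub>s\<in>carrier G. \<Phi> (part s p))"
    by (rule Phi_sum[OF finG]) (use keys_part_S[OF assms] in auto)
  then show "\<Phi> p = (\<Oplus>\<^bsub>V\<^esub>s\<in>carrier G. \<Phi> (part s p))" by (simp add: sum_parts[OF assms])
qed

text \<open>Any two elements of the group that conjugate \<open>g\<close> to \<open>s\<close> differ by an element of the centralizer, which can be moved to
  the other side of the tensor sign.  So the component of degree \<open>s\<close> is \<open>h\<^sub>0 \<otimes> W\<close>.\<close>

lemma fibre_normal_form: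
  assumes h0: "h0 \<in> carrier G" "h0 \<otimes>\<^bsub>G\<^esub> g \<otimes>\<^bsub>G\<^esub> inv\<^bsub>G\<^esub> h0 = s" and p: "Poly_Mapping.keys p \<subseteq> fibre s"
  shows "\<exists>w\<in>carrier W. p - bvec (h0, w) \<in> N"
  using p
proof (induction rule: free_induct)
  case zero
  show ?case using relation_zero[OF h0(1)] Nc(5) by (intro bexI[of _ "\<zero>\<^bsub>W\<^esub>"]) auto
next
  case (add p q)
  then obtain w w' where w: "w \<in> carrier W" "p - bvec (h0, w) \<in> N" "w' \<in> carrier W" "q - bvec (h0, w') \<in> N" by blast
  have "(p + q) - bvec (h0, w \<oplus>\<^bsub>W\<^esub> w') =
      (p - bvec (h0, w)) + (q - bvec (h0, w')) - (bvec (h0, w \<oplus>\<^bsub>W\<^esub> w') - bvec (h0, w) - bvec (h0, w'))" by simp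
  also have "\<dots> \<in> N" by (intro Nc(3,6) w relation_add h0)
  finally show ?case using w by (intro bexI[of _ "w \<oplus>\<^bsub>W\<^esub> w'"]) auto
next
  case (single hw c)
  obtain h w where hw: "hw = (h, w)" "h \<in> carrier G" "w \<in> carrier W" "h \<otimes>\<^bsub>G\<^esub> g \<otimes>\<^bsub>G\<^esub> inv\<^bsub>G\<^esub> h = s"
    using single by auto
  let ?k = "inv\<^bsub>G\<^esub> h0 \<otimes>\<^bsub>G\<^esub> h"
  have kc: "?k \<in> carrier G" using hw h0 by simp
  have "h \<otimes>\<^bsub>G\<^esub> g \<otimes>\<^bsub>G\<^esub> inv\<^bsub>G\<^esub> h \<otimes>\<^bsub>G\<^esub> h = h0 \<otimes>\<^bsub>G\<^esub> g \<otimes>\<^bsub>G\<^esub> inv\<^bsub>G\<^esub> h0 \<otimes>\<^bsub>G\<^esub> h"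
    using hw(4) h0(2) by simp
  then have hg: "h \<otimes>\<^bsub>G\<^esub> g = h0 \<otimes>\<^bsub>G\<^esub> g \<otimes>\<^bsub>G\<^esub> inv\<^bsub>G\<^esub> h0 \<otimes>\<^bsub>G\<^esub> h"
    using hw(2) g by (simp add: grp.m_assoc)
  have "?k \<otimes>\<^bsub>G\<^esub> g = inv\<^bsub>G\<^esub> h0 \<otimes>\<^bsub>G\<^esub> (h \<otimes>\<^bsub>G\<^esub> g)" using hw(2) h0(1) g by (simp add: grp.m_assoc)
  also have "\<dots> = g \<otimes>\<^bsub>G\<^esub> ?k" unfolding hg using hw(2) h0(1) g by (simp add: grp.m_assoc[symmetric])
  finally have "?k \<otimes>\<^bsub>G\<^esub> g = g \<otimes>\<^bsub>G\<^esub> ?k" .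
  then have k: "?k \<in> centralizer G g" using kc by (simp add: centralizer_def)
  have hk: "h0 \<otimes>\<^bsub>G\<^esub> ?k = h" using hw h0 by (simp add: grp.m_assoc[symmetric])
  have cw: "c \<odot>\<^bsub>W\<^esub> w \<in> carrier W" using hw by simp
  have "Poly_Mapping.single (h, w) c - bvec (h0, \<rho> ?k (c \<odot>\<^bsub>W\<^esub> w)) =
      (bvec (h0 \<otimes>\<^bsub>G\<^esub> ?k, c \<odot>\<^bsub>W\<^esub> w) - bvec (h0, \<rho> ?k (c \<odot>\<^bsub>W\<^esub> w))) - (bvec (h, c \<odot>\<^bsub>W\<^esub> w) - Poly_Mapping.single (h, w) c)"
    by (simp add: hk)
  also have "\<dots> \<in> N" by (intro Nc(6) relation_balance relation_smult h0 k cw hw)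
  finally show ?case using rho_closed[OF k cw] hw(1) by blast
qed

text \<open>The homogeneous parts of \<open>p\<close> are mapped to distinct components of \<open>V\<close>, so each of them is mapped to zero.  In normal form
  such a part is \<open>h\<^sub>0 \<otimes> w\<close> with \<open>h\<^sub>0 \<cdot> \<theta>(w) = 0\<close>, hence \<open>w = 0\<close>.\<close>

lemma Phi_kernel:
  assumes p: "Poly_Mapping.keys p \<subseteq> S" "\<Phi> p = \<zero>\<^bsub>V\<^esub>"
  shows "p \<in> N"
proof -
  have "part s p \<in> N" if s: "s \<in> carrier G" for s
  proof (cases "\<exists>h\<in>carrier G. h \<otimes>\<^bsub>G\<^esub> g \<otimes>\<^bsub>G\<^esub> inv\<^bsub>G\<^esub> h = s")
    case False
    then have "fibre s = {}" by blast
    then have "Poly_Mapping.keys (part s p) = {}" using keys_part[OF p(1), of s] by blast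
    then have "part s p = 0" unfolding keys_eq_empty .
    then show ?thesis using Nc(2) by simp
  next
    case True
    then obtain h0 where h0: "h0 \<in> carrier G" "h0 \<otimes>\<^bsub>G\<^esub> g \<otimes>\<^bsub>G\<^esub> inv\<^bsub>G\<^esub> h0 = s" by blast
    have hp: "homogeneous_parts G V \<zero>\<^bsub>V\<^esub> (\<lambda>s. if s \<in> carrier G then \<Phi> (part s p) else \<zero>\<^bsub>V\<^esub>)"
      using Phi_parts[OF p(1)] p(2) by simp
    have "(\<lambda>s. if s \<in> carrier G then \<Phi> (part s p) else \<zero>\<^bsub>V\<^esub>) = (\<lambda>_. \<zero>\<^bsub>V\<^esub>)"
      by (rule yd.parts_unique[OF hp yd.parts_zero]) simp
    from fun_cong[OF this, of s] have z: "\<Phi> (part s p) = \<zero>\<^bsub>V\<^esub>" using s by simp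
    obtain w where w: "w \<in> carrier W" "part s p - bvec (h0, w) \<in> N"
      using fibre_normal_form[OF h0 keys_part[OF p(1)]] by blast
    have c: "yd_act V h0 (\<theta> w) \<in> carrier V" using w(1) h0(1) theta_closed by simp
    have "\<zero>\<^bsub>V\<^esub> = \<zero>\<^bsub>V\<^esub> \<ominus>\<^bsub>V\<^esub> yd_act V h0 (\<theta> w)"
      using Phi_relations[OF w(2)] Phi_minus[OF keys_part_S[OF p(1), of s], of "bvec (h0, w)"] w h0 z
      by (simp add: Phi_bvec)
    then have "\<ominus>\<^bsub>V\<^esub> yd_act V h0 (\<theta> w) = \<zero>\<^bsub>V\<^esub>" using c by (simp add: a_minus_def)
    then have "yd_act V h0 (\<theta> w) = \<zero>\<^bsub>V\<^esub>" using yd.spc.r_neg[OF c] yd.spc.r_zero[OF c] by simp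
    then have "\<theta> w = \<zero>\<^bsub>V\<^esub>" using yd.act_inv[OF h0(1) theta_closed[OF w(1)]] h0(1) by simp
    then have "w = \<zero>\<^bsub>W\<^esub>" using inj_onD[OF theta_inj _ w(1) rep.zero_closed] theta_zero by simp
    then have "(part s p - bvec (h0, w)) + bvec (h0, w) \<in> N" using w(2) relation_zero[OF h0(1)] by (intro Nc(3)) auto
    then show ?thesis by simp
  qed
  then have "(\<Sum>s\<in>carrier G. part s p) \<in> N" by (rule Nc(7))
  then show ?thesis by (simp add: sum_parts[OF p(1)])
qed

lemma Phi_surj: "v \<in> carrier V \<Longrightarrow> \<exists>p. Poly_Mapping.keys p \<subseteq> S \<and> \<Phi> p = v"
proof -
  assume v: "v \<in> carrier V"
  let ?T = "\<Phi> ` {p. Poly_Mapping.keys p \<subseteq> S}"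
  have T: "csubspace ?T V"
  proof (rule csubspaceI[OF yd.spc.vectorspace_axioms])
    show "?T \<subseteq> carrier V" using Phi_closed by blast
    show "\<zero>\<^bsub>V\<^esub> \<in> ?T" by (rule image_eqI[of _ _ 0]) (simp_all add: Phi_zero)
    show "a \<oplus>\<^bsub>V\<^esub> b \<in> ?T" if ab: "a \<in> ?T" "b \<in> ?T" for a b
    proof -
      obtain p q where "a = \<Phi> p" "b = \<Phi> q" "Poly_Mapping.keys p \<subseteq> S" "Poly_Mapping.keys q \<subseteq> S" using ab by blast
      then show ?thesis by (intro image_eqI[of _ _ "p + q"]) (simp_all add: Phi_add keys_closed)
    qed
    show "c \<odot>\<^bsub>V\<^esub> a \<in> ?T" if a: "a \<in> ?T" for c a
    proof -
      obtain p where "a = \<Phi> p" "Poly_Mapping.keys p \<subseteq> S" using a by blast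
      then show ?thesis by (intro image_eqI[of _ _ "scale c p"]) (simp_all add: Phi_scale keys_closed)
    qed
  qed
  have "cspan V {yd_act V h (\<theta> w) | h w. h \<in> carrier G \<and> w \<in> carrier W} \<subseteq> ?T"
  proof (rule cspan_least[OF T], clarify)
    fix h w assume hw: "h \<in> carrier G" "w \<in> carrier W"
    show "yd_act V h (\<theta> w) \<in> ?T"
      by (rule image_eqI[of _ _ "bvec (h, w)"]) (use hw in \<open>simp_all add: Phi_bvec\<close>)
  qed
  then have "v \<in> ?T" using generate v by blast
  then show ?thesis by blast
qed

lemma Phi_eq_iff: "Poly_Mapping.keys p \<subseteq> S \<Longrightarrow> Poly_Mapping.keys q \<subseteq> S \<Longrightarrow> \<Phi> p = \<Phi> q \<longleftrightarrow> cl p = cl q"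
proof -
  assume pq: "Poly_Mapping.keys p \<subseteq> S" "Poly_Mapping.keys q \<subseteq> S"
  have "cl p = cl q \<longleftrightarrow> \<Phi> (p - q) = \<zero>\<^bsub>V\<^esub>"
    unfolding coset_eq_iff[OF FN] using Phi_relations Phi_kernel[of "p - q"] pq by (auto simp: keys_closed)
  also have "\<dots> \<longleftrightarrow> \<Phi> p = \<Phi> q"
    using Phi_closed[of p] Phi_closed[of q] pq by (simp add: Phi_minus)
  finally show ?thesis by simp
qed

lemma Phi_translate:
  assumes "s \<in> carrier G" "Poly_Mapping.keys p \<subseteq> S"
  shows "Poly_Mapping.keys (translate G s p) \<subseteq> S" "\<Phi> (translate G s p) = yd_act V s (\<Phi> p)"
proof -
  have k: "Poly_Mapping.keys (translate G s p) \<subseteq> S" if "Poly_Mapping.keys p \<subseteq> S" for p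
    by (rule keys_lin_ext) (use that assms(1) in auto)
  then show "Poly_Mapping.keys (translate G s p) \<subseteq> S" using assms(2) .
  have "Poly_Mapping.keys p \<subseteq> S \<and> \<Phi> (translate G s p) = yd_act V s (\<Phi> p)" using assms(2)
  proof (induction rule: free_induct)
    case zero
    then show ?case using assms(1) by (simp add: lin_ext_simps Phi_zero)
  next
    case (add f h)
    then show ?case using assms(1) by (simp add: keys_closed lin_ext_simps Phi_add k yd.act_add Phi_closed)
  next
    case (single hw c)
    then show ?case using assms(1) Phi_single[of "(s \<otimes>\<^bsub>G\<^esub> fst hw, snd hw)" c] Phi_single[of hw c] theta_closed
      by (auto simp: yd.act_smult yd.act_mult)
  qed
  then show "\<Phi> (translate G s p) = yd_act V s (\<Phi> p)" by simp
qed

theorem induced_isomorphic: "yd_isomorphic G V M"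
proof -
  \<comment> \<open>The isomorphism is the inverse of the map induced by \<open>\<Phi>\<close> on the quotient.\<close>
  define lift where "lift v = (SOME p. Poly_Mapping.keys p \<subseteq> S \<and> \<Phi> p = v)" for v
  have lift: "Poly_Mapping.keys (lift v) \<subseteq> S" "\<Phi> (lift v) = v" if "v \<in> carrier V" for v
    using someI_ex[OF Phi_surj[OF that]] unfolding lift_def by auto
  define f where "f v = cl (lift v)" for v
  have f: "f (\<Phi> p) = cl p" if "Poly_Mapping.keys p \<subseteq> S" for p
    unfolding f_def using lift[OF Phi_closed[OF that]] that
    by (subst Phi_eq_iff[symmetric]) auto
  have hom: "f \<in> chom V M"
    unfolding module_hom_def
  proof (intro CollectI conjI allI impI funcsetI)
    show "f v \<in> carrier M" if "v \<in> carrier V" for v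
      unfolding induced_carrier f_def using lift[OF that] by blast
    fix v w assume vw: "v \<in> carrier V \<and> w \<in> carrier V"
    then have "f (v \<oplus>\<^bsub>V\<^esub> w) = f (\<Phi> (lift v + lift w))" using lift[of v] lift[of w] by (simp add: Phi_add)
    also have "\<dots> = cl (lift v + lift w)" by (rule f) (simp add: keys_closed lift vw)
    finally show "f (v \<oplus>\<^bsub>V\<^esub> w) = f v \<oplus>\<^bsub>M\<^esub> f w" unfolding induced_fields f_def by (simp add: quotient_add[OF FN])
  next
    fix c v assume v: "c \<in> carrier CC \<and> v \<in> carrier V"
    then have "f (c \<odot>\<^bsub>V\<^esub> v) = f (\<Phi> (scale c (lift v)))" using lift[of v] by (simp add: Phi_scale)
    also have "\<dots> = cl (scale c (lift v))" by (rule f) (simp add: keys_closed lift v)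
    finally show "f (c \<odot>\<^bsub>V\<^esub> v) = c \<odot>\<^bsub>M\<^esub> f v" unfolding induced_fields f_def by (simp add: quotient_smult[OF FN])
  qed
  have "inj_on f (carrier V)"
  proof (rule inj_onI)
    fix v w assume vw: "v \<in> carrier V" "w \<in> carrier V" "f v = f w"
    then have "\<Phi> (lift v) = \<Phi> (lift w)" using lift[OF vw(1)] lift[OF vw(2)] Phi_eq_iff[of "lift v" "lift w"] by (simp add: f_def)
    then show "v = w" using lift vw by simp
  qed
  moreover have "f ` carrier V = carrier M"
  proof
    show "f ` carrier V \<subseteq> carrier M" using hom unfolding module_hom_def by blast
    show "carrier M \<subseteq> f ` carrier V"
    proof
      fix X assume "X \<in> carrier M"
      then obtain p where p: "X = cl p" "Poly_Mapping.keys p \<subseteq> S" unfolding induced_carrier by blast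
      then show "X \<in> f ` carrier V" using f[OF p(2)] Phi_closed[OF p(2)] by (intro image_eqI[of _ _ "\<Phi> p"]) auto
    qed
  qed
  ultimately have "bij_betw f (carrier V) (carrier M)" by (simp add: bij_betw_def)
  moreover have "f (yd_act V s v) = yd_act M s (f v)" if "s \<in> carrier G" "v \<in> carrier V" for s v
  proof -
    have "yd_act V s v = \<Phi> (translate G s (lift v))" using Phi_translate(2)[OF that(1) lift(1)[OF that(2)]] lift(2)[OF that(2)] by simp
    then show ?thesis using f[OF Phi_translate(1)[OF that(1) lift(1)[OF that(2)]]] induced_act[OF that(1)] by (simp add: f_def)
  qed
  moreover have "f ` yd_comp V s \<subseteq> yd_comp M s" if s: "s \<in> carrier G" for s
  proof clarify
    fix v assume v: "v \<in> yd_comp V s"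
    then have vc: "v \<in> carrier V" using yd.comp_closed[OF s] by blast
    let ?p = "part s (lift v)"
    have "homogeneous_parts G V v (\<lambda>s. if s \<in> carrier G then \<Phi> (part s (lift v)) else \<zero>\<^bsub>V\<^esub>)"
      using Phi_parts[OF lift(1)[OF vc]] lift(2)[OF vc] by simp
    from fun_cong[OF yd.parts_unique[OF this yd.parts_single[OF s v] vc], of s]
    have "\<Phi> ?p = v" using s by simp
    then have fv: "f v = cl ?p" using f[OF keys_part_S[OF lift(1)[OF vc], of s]] by simp
    let ?P = "{cl (bvec (h, w)) | h w. h \<in> carrier G \<and> w \<in> carrier W \<and> h \<otimes>\<^bsub>G\<^esub> g \<otimes>\<^bsub>G\<^esub> inv\<^bsub>G\<^esub> h = s}"
    have P: "?P \<subseteq> carrier Q"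
    proof clarify
      fix h w assume "h \<in> carrier G" "w \<in> carrier W"
      then show "cl (bvec (h, w)) \<in> carrier Q" unfolding quotient_carrier[OF FN] by (intro imageI) simp
    qed
    show "f v \<in> yd_comp M s"
      unfolding fv induced_fields
    proof (rule quotient_in_span[OF FN P _ keys_part[OF lift(1)[OF vc]]])
      fix hw assume "hw \<in> fibre s"
      then have "cl (bvec hw) \<in> ?P" by blast
      then show "cl (bvec hw) \<in> cspan Q ?P" using cspan_closed(2)[OF quotient_vectorspace[OF FN] P] by blast
    qed
  qed
  ultimately show ?thesis unfolding yd_isomorphic_def using hom by blast
qed

end

section \<open>Modules on which every degree acts by a sign\<close>

lemma (in diagonal_basis) nichols_algebra_eq:
  assumes "B = (SOME B. homogeneous_basis G V B)"
  shows "nichols_algebra G V = nich"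
  unfolding nichols_algebra_def Let_def assms[symmetric] nichols_ideal_eq ..

lemma basis_finite:
  assumes "vectorspace CC V" "cfin_dim V" "cbasis V B"
  shows "finite B"
proof -
  interpret vectorspace CC V by (rule assms)
  show ?thesis using fin_dim_li_fin[OF assms(2)] assms(3) unfolding basis_def by blast
qed

lemma GKdim_finite_scalar_support:
  fixes V :: "('g, 'v, 'm) yd_struct_scheme"
  assumes V: "yd_module G V" "finite (carrier G)" "cfin_dim V" "yd_irreducible G V"
    and eps: "\<epsilon> * \<epsilon> = 1"
    and act: "\<And>k b a. k \<in> carrier G \<Longrightarrow> b \<in> yd_comp V k \<Longrightarrow> b \<noteq> \<zero>\<^bsub>V\<^esub> \<Longrightarrow> a \<in> carrier V \<Longrightarrow> yd_act V k a = \<epsilon> \<odot>\<^bsub>V\<^esub> a"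
  shows "GKdim (nichols_algebra G V) < \<infinity>"
proof -
  interpret yd_module G V by (rule V(1))
  define B where "B = (SOME B. homogeneous_basis G V B)"
  have B: "homogeneous_basis G V B"
    unfolding B_def using someI_ex[OF homogeneous_basis_exists[OF V(2,4)]] .
  have Bb: "cbasis V B" using B by (simp add: homogeneous_basis_def)
  have Bc: "B \<subseteq> carrier V" "\<not> spc.lin_dep B" using Bb by (auto simp: spc.basis_def)
  interpret diagonal_basis G V B "\<lambda>_ _. \<epsilon>"
  proof unfold_locales
    show "homogeneous_basis G V B" by (rule B)
    fix a b g assume ab: "a \<in> B" "b \<in> B" "g \<in> carrier G" "b \<in> yd_comp V g"
    have "b \<noteq> \<zero>\<^bsub>V\<^esub>" "a \<in> carrier V" using ab(1,2) Bc(1) spc.vs_zero_lin_dep[OF Bc] by auto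
    then show "yd_act V g a = \<epsilon> \<odot>\<^bsub>V\<^esub> a" by (rule act[OF ab(3,4)])
  qed
  show ?thesis unfolding nichols_algebra_eq[OF B_def]
    by (rule GKdim_finite_if_sign[OF basis_finite[OF spc.vectorspace_axioms V(3) Bb] refl eps])
qed

text \<open>The support of the induced module is the conjugacy class of \<open>g\<close>, and by hypothesis all its elements act by \<open>\<epsilon>\<close>.\<close>

lemma GKdim_finite_of_induced:
  fixes V :: "('g, 'v, 'm) yd_struct_scheme"
  assumes V: "yd_module G V" "finite (carrier G)" "cfin_dim V" "yd_irreducible G V"
    and M: "induced_data G W g \<rho>" and iso: "yd_isomorphic G V (yd_induced G g W \<rho>)"
    and eps: "\<epsilon> * \<epsilon> = 1"
    and conj: "\<And>h. h \<in> carrier G \<Longrightarrow> h \<otimes>\<^bsub>G\<^esub> g \<otimes>\<^bsub>G\<^esub> inv\<^bsub>G\<^esub> h \<in> centralizer G g"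
    and rho: "\<And>h w. h \<in> carrier G \<Longrightarrow> w \<in> carrier W \<Longrightarrow> \<rho> (h \<otimes>\<^bsub>G\<^esub> g \<otimes>\<^bsub>G\<^esub> inv\<^bsub>G\<^esub> h) w = \<epsilon> \<odot>\<^bsub>W\<^esub> w"
  shows "GKdim (nichols_algebra G V) < \<infinity>"
proof (rule GKdim_finite_scalar_support[OF V eps])
  interpret yd_module G V by (rule V(1))
  interpret I: induced_data G W g \<rho> by (rule M)
  interpret M: vectorspace CC I.M by (rule I.induced_vectorspace)
  obtain f where f: "f \<in> chom V I.M" "inj_on f (carrier V)" "f ` carrier V = carrier I.M"
    "\<And>k v. k \<in> carrier G \<Longrightarrow> v \<in> carrier V \<Longrightarrow> f (yd_act V k v) = yd_act I.M k (f v)"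
    "\<And>k. k \<in> carrier G \<Longrightarrow> f ` yd_comp V k \<subseteq> yd_comp I.M k"
    using iso unfolding yd_isomorphic_def bij_betw_def by (elim bexE conjE) (simp add: Ball_def)
  have fc: "v \<in> carrier V \<Longrightarrow> f v \<in> carrier I.M" "v \<in> carrier V \<Longrightarrow> f (c \<odot>\<^bsub>V\<^esub> v) = c \<odot>\<^bsub>I.M\<^esub> f v" for c v
    using f(1) unfolding module_hom_def by auto
  have f0: "f \<zero>\<^bsub>V\<^esub> = \<zero>\<^bsub>I.M\<^esub>"
    using fc(2)[OF spc.zero_closed, of 0] CC_smult(1)[OF spc.vectorspace_axioms spc.zero_closed]
      CC_smult(1)[OF I.induced_vectorspace fc(1)[OF spc.zero_closed]] by simp
  fix k b a assume k: "k \<in> carrier G" and b: "b \<in> yd_comp V k" "b \<noteq> \<zero>\<^bsub>V\<^esub>" and a: "a \<in> carrier V"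
  have "f b \<in> yd_comp I.M k" using f(5)[OF k] b(1) by blast
  moreover have "f b \<noteq> \<zero>\<^bsub>I.M\<^esub>"
    using inj_onD[OF f(2), of b "\<zero>\<^bsub>V\<^esub>"] f0 b comp_closed[OF k b(1)] spc.zero_closed by auto
  ultimately have "yd_comp I.M k \<noteq> {\<zero>\<^bsub>I.M\<^esub>}" by blast
  then obtain l where l: "l \<in> carrier G" "l \<otimes>\<^bsub>G\<^esub> g \<otimes>\<^bsub>G\<^esub> inv\<^bsub>G\<^esub> l = k"
    using I.induced_comp_empty by blast
  have c: "inv\<^bsub>G\<^esub> h \<otimes>\<^bsub>G\<^esub> k \<otimes>\<^bsub>G\<^esub> h = (inv\<^bsub>G\<^esub> h \<otimes>\<^bsub>G\<^esub> l) \<otimes>\<^bsub>G\<^esub> g \<otimes>\<^bsub>G\<^esub> inv\<^bsub>G\<^esub> (inv\<^bsub>G\<^esub> h \<otimes>\<^bsub>G\<^esub> l)" if "h \<in> carrier G" for h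
    using that l I.g by (simp add: grp.inv_mult_group grp.m_assoc l(2)[symmetric])
  have "yd_act I.M k (f a) = \<epsilon> \<odot>\<^bsub>I.M\<^esub> f a"
    by (rule I.induced_scalar_action) (use c conj rho l k fc(1)[OF a] in auto)
  then have "f (yd_act V k a) = f (\<epsilon> \<odot>\<^bsub>V\<^esub> a)" using f(4)[OF k a] fc(2)[OF a] by simp
  then show "yd_act V k a = \<epsilon> \<odot>\<^bsub>V\<^esub> a"
    using inj_onD[OF f(2)] act_closed[OF k a] CC_smult(3)[OF spc.vectorspace_axioms a] by blast
qed

section \<open>Eigenvectors\<close>

context yd_module
begin

text \<open>If \<open>k\<^sup>2\<close> acts on \<open>u\<close> by \<open>\<mu>\<^sup>2\<close>, then \<open>k u + \<mu> u\<close> is an eigenvector for \<open>\<mu>\<close>, unless it vanishes and \<open>u\<close> is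
  an eigenvector for \<open>-\<mu>\<close>.\<close>

lemma square_eigenvector:
  assumes X: "csubspace X V" "\<And>u. u \<in> X \<Longrightarrow> yd_act V k u \<in> X" and k: "k \<in> carrier G"
    and u: "u \<in> X" "u \<noteq> \<zero>\<^bsub>V\<^esub>" "yd_act V k (yd_act V k u) = (\<mu> * \<mu>) \<odot>\<^bsub>V\<^esub> u"
  shows "\<exists>w\<in>X. w \<noteq> \<zero>\<^bsub>V\<^esub> \<and> (yd_act V k w = \<mu> \<odot>\<^bsub>V\<^esub> w \<or> yd_act V k w = (- \<mu>) \<odot>\<^bsub>V\<^esub> w)"
proof -
  note Xd = csubspaceD[OF X(1)] and s = CC_smult[OF spc.vectorspace_axioms]
  have uc: "u \<in> carrier V" "yd_act V k u \<in> carrier V" using Xd(2) u(1) X(2)[OF u(1)] by auto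
  define w where "w = yd_act V k u \<oplus>\<^bsub>V\<^esub> \<mu> \<odot>\<^bsub>V\<^esub> u"
  show ?thesis
  proof (cases "w = \<zero>\<^bsub>V\<^esub>")
    case False
    have "yd_act V k w = (\<mu> * \<mu>) \<odot>\<^bsub>V\<^esub> u \<oplus>\<^bsub>V\<^esub> \<mu> \<odot>\<^bsub>V\<^esub> yd_act V k u"
      unfolding w_def using uc k by (simp add: act_add act_smult s(3) u(3))
    also have "\<dots> = \<mu> \<odot>\<^bsub>V\<^esub> w" unfolding w_def using uc by (simp add: s spc.a_comm)
    finally show ?thesis using False X(2)[OF u(1)] u(1) Xd(4,5) unfolding w_def by blast
  next
    case True
    have "yd_act V k u = yd_act V k u \<oplus>\<^bsub>V\<^esub> (\<mu> + - \<mu>) \<odot>\<^bsub>V\<^esub> u" using uc s(1) by simp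
    also have "\<dots> = w \<oplus>\<^bsub>V\<^esub> (- \<mu>) \<odot>\<^bsub>V\<^esub> u"
      unfolding w_def using uc by (simp only: s(5)[OF uc(1)] spc.a_assoc[OF uc(2) s(3)[OF uc(1)] s(3)[OF uc(1)]])
    also have "\<dots> = (- \<mu>) \<odot>\<^bsub>V\<^esub> u" unfolding True using s(3)[OF uc(1)] by simp
    finally show ?thesis using u by blast
  qed
qed

text \<open>Apply \<open>square_eigenvector\<close> first to \<open>k\<^sup>2\<close> and then to \<open>k\<close>.\<close>

lemma fourth_root_eigenvector:
  assumes X: "csubspace X V" "\<And>u. u \<in> X \<Longrightarrow> yd_act V k u \<in> X" and k: "k \<in> carrier G"
    and k4: "(k \<otimes>\<^bsub>G\<^esub> k) \<otimes>\<^bsub>G\<^esub> (k \<otimes>\<^bsub>G\<^esub> k) = \<one>\<^bsub>G\<^esub>" and u: "u \<in> X" "u \<noteq> \<zero>\<^bsub>V\<^esub>"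
  shows "\<exists>w\<in>X. w \<noteq> \<zero>\<^bsub>V\<^esub> \<and> (\<exists>t<4. yd_act V k w = \<i> ^ t \<odot>\<^bsub>V\<^esub> w)"
proof -
  note Xd = csubspaceD[OF X(1)] and s = CC_smult[OF spc.vectorspace_axioms]
  have kk: "k \<otimes>\<^bsub>G\<^esub> k \<in> carrier G" using k by simp
  have sq: "yd_act V (k \<otimes>\<^bsub>G\<^esub> k) u = yd_act V k (yd_act V k u)" if "u \<in> X" for u
    using act_mult[OF k k] Xd(2) that by blast
  have X2: "yd_act V (k \<otimes>\<^bsub>G\<^esub> k) u \<in> X" if "u \<in> X" for u using sq[OF that] X(2) that by simp
  have "yd_act V (k \<otimes>\<^bsub>G\<^esub> k) (yd_act V (k \<otimes>\<^bsub>G\<^esub> k) u) = (1 * 1) \<odot>\<^bsub>V\<^esub> u"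
    using act_mult[OF kk kk, of u] act_one[of u] k4 Xd(2) u(1) s(2)[of u] by auto
  from square_eigenvector[OF X(1) X2 kk u this] obtain w1 where
    w1: "w1 \<in> X" "w1 \<noteq> \<zero>\<^bsub>V\<^esub>" "yd_act V (k \<otimes>\<^bsub>G\<^esub> k) w1 = 1 \<odot>\<^bsub>V\<^esub> w1 \<or> yd_act V (k \<otimes>\<^bsub>G\<^esub> k) w1 = (- 1) \<odot>\<^bsub>V\<^esub> w1" by blast
  define \<mu> where "\<mu> = (if yd_act V (k \<otimes>\<^bsub>G\<^esub> k) w1 = 1 \<odot>\<^bsub>V\<^esub> w1 then 1 else \<i>)"
  have "yd_act V k (yd_act V k w1) = (\<mu> * \<mu>) \<odot>\<^bsub>V\<^esub> w1"
    using w1(3) sq[OF w1(1)] by (auto simp: \<mu>_def)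
  from square_eigenvector[OF X k w1(1,2) this] obtain w where
    w: "w \<in> X" "w \<noteq> \<zero>\<^bsub>V\<^esub>" "yd_act V k w = \<mu> \<odot>\<^bsub>V\<^esub> w \<or> yd_act V k w = (- \<mu>) \<odot>\<^bsub>V\<^esub> w" by blast
  have "\<exists>t<4. \<mu> = \<i> ^ t" "\<exists>t<4. - \<mu> = \<i> ^ t"
  proof -
    show "\<exists>t<4. \<mu> = \<i> ^ t"
      by (cases "\<mu> = 1", rule exI[of _ 0], simp, rule exI[of _ 1]) (auto simp: \<mu>_def)
    show "\<exists>t<4. - \<mu> = \<i> ^ t"
      by (cases "\<mu> = 1", rule exI[of _ 2], simp, rule exI[of _ 3]) (auto simp: \<mu>_def power3_eq_cube)
  qed
  then show ?thesis using w by metis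
qed

end

section \<open>The quaternion group\<close>

lemma Q8_cases:
  assumes "u \<in> carrier Q8"
  shows "u \<in> {(0, 0), (1, 0), (2, 0), (3, 0), (0, 1), (1, 1), (2, 1), (3, 1)}"
proof -
  obtain a b where u: "u = (a, b)" by fastforce
  have "a = 0 \<or> a = 1 \<or> a = 2 \<or> a = 3" "b = 0 \<or> b = 1"
    using assms unfolding u Q8_carrier by presburger+
  then show ?thesis unfolding u by auto
qed

lemma Q8_finite: "finite (carrier Q8)"
  by (simp add: Q8_def)

lemma Q8_inv:
  "inv\<^bsub>Q8\<^esub> (0, 0) = (0, 0)" "inv\<^bsub>Q8\<^esub> (1, 0) = (3, 0)" "inv\<^bsub>Q8\<^esub> (2, 0) = (2, 0)" "inv\<^bsub>Q8\<^esub> (3, 0) = (1, 0)"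
  "inv\<^bsub>Q8\<^esub> (0, 1) = (2, 1)" "inv\<^bsub>Q8\<^esub> (1, 1) = (3, 1)" "inv\<^bsub>Q8\<^esub> (2, 1) = (0, 1)" "inv\<^bsub>Q8\<^esub> (3, 1) = (1, 1)"
  by (rule group.inv_equality[OF group_Q8]; simp add: Q8_mult Q8_one Q8_carrier)+

lemma less_4: "(j :: nat) < 4 \<longleftrightarrow> j = 0 \<or> j = 1 \<or> j = 2 \<or> j = 3"
  by auto

lemma Q8_small_pow:
  "u [^]\<^bsub>Q8\<^esub> (0::nat) = \<one>\<^bsub>Q8\<^esub>"
  "u \<in> carrier Q8 \<Longrightarrow> u [^]\<^bsub>Q8\<^esub> (1::nat) = u"
  "u \<in> carrier Q8 \<Longrightarrow> u [^]\<^bsub>Q8\<^esub> (2::nat) = u \<otimes>\<^bsub>Q8\<^esub> u"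
  "u \<in> carrier Q8 \<Longrightarrow> u [^]\<^bsub>Q8\<^esub> (3::nat) = u \<otimes>\<^bsub>Q8\<^esub> u \<otimes>\<^bsub>Q8\<^esub> u"
proof -
  interpret group Q8 by (rule group_Q8)
  show "u [^]\<^bsub>Q8\<^esub> (0::nat) = \<one>\<^bsub>Q8\<^esub>" by simp
  assume u: "u \<in> carrier Q8"
  then show "u [^]\<^bsub>Q8\<^esub> (1::nat) = u" by simp
  show "u [^]\<^bsub>Q8\<^esub> (2::nat) = u \<otimes>\<^bsub>Q8\<^esub> u" using u by (simp add: numeral_2_eq_2)
  show "u [^]\<^bsub>Q8\<^esub> (3::nat) = u \<otimes>\<^bsub>Q8\<^esub> u \<otimes>\<^bsub>Q8\<^esub> u" using u by (simp add: numeral_3_eq_3)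
qed

text \<open>An element \<open>g\<close> of order four together with an element \<open>h\<close> that inverts it.  The definition collects the finite checks
  in the group, so that the classes of \<open>x\<close>, \<open>y\<close> and \<open>xy\<close> are treated by the same arguments.\<close>

definition quaternion_pair :: "int \<times> int \<Rightarrow> int \<times> int \<Rightarrow> bool" where
  "quaternion_pair g h \<longleftrightarrow> g \<in> carrier Q8 \<and> h \<in> carrier Q8 \<and>
     h \<otimes>\<^bsub>Q8\<^esub> g = inv\<^bsub>Q8\<^esub> g \<otimes>\<^bsub>Q8\<^esub> h \<and> inv\<^bsub>Q8\<^esub> g \<noteq> g \<and>
     (g \<otimes>\<^bsub>Q8\<^esub> g) \<otimes>\<^bsub>Q8\<^esub> (g \<otimes>\<^bsub>Q8\<^esub> g) = \<one>\<^bsub>Q8\<^esub> \<and>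
     (\<forall>k\<in>carrier Q8. \<exists>j<4::nat. k = g [^]\<^bsub>Q8\<^esub> j \<or> k = h \<otimes>\<^bsub>Q8\<^esub> g [^]\<^bsub>Q8\<^esub> j) \<and>
     (\<forall>k\<in>centralizer Q8 g. \<exists>j<4::nat. k = g [^]\<^bsub>Q8\<^esub> j) \<and>
     inj_on (\<lambda>j::nat. g [^]\<^bsub>Q8\<^esub> j) {..<4} \<and>
     (\<forall>k\<in>carrier Q8. k \<otimes>\<^bsub>Q8\<^esub> g \<otimes>\<^bsub>Q8\<^esub> inv\<^bsub>Q8\<^esub> k \<in> {g, g [^]\<^bsub>Q8\<^esub> (3::nat)})"

lemma quaternion_pairs: "quaternion_pair qx qy" "quaternion_pair qy qx" "quaternion_pair (qx \<otimes>\<^bsub>Q8\<^esub> qy) qx"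
proof -
  have ex4: "(\<exists>j<4::nat. P j) \<longleftrightarrow> P 0 \<or> P 1 \<or> P 2 \<or> P 3" for P
    unfolding less_4 by blast
  have set4: "{..<4::nat} = {0, 1, 2, 3}" by auto
  have ball: "(\<forall>k\<in>carrier Q8. P k) \<longleftrightarrow> P (0, 0) \<and> P (1, 0) \<and> P (2, 0) \<and> P (3, 0) \<and> P (0, 1) \<and> P (1, 1) \<and> P (2, 1) \<and> P (3, 1)" for P
  proof
    assume "\<forall>k\<in>carrier Q8. P k"
    then show "P (0, 0) \<and> P (1, 0) \<and> P (2, 0) \<and> P (3, 0) \<and> P (0, 1) \<and> P (1, 1) \<and> P (2, 1) \<and> P (3, 1)"
      by (simp add: Q8_carrier)
  next
    assume P: "P (0, 0) \<and> P (1, 0) \<and> P (2, 0) \<and> P (3, 0) \<and> P (0, 1) \<and> P (1, 1) \<and> P (2, 1) \<and> P (3, 1)"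
    show "\<forall>k\<in>carrier Q8. P k"
    proof
      fix k assume "k \<in> carrier Q8"
      from Q8_cases[OF this] P show "P k" by auto
    qed
  qed
  have cent: "(\<forall>k\<in>centralizer Q8 g. P k) \<longleftrightarrow> (\<forall>k\<in>carrier Q8. k \<otimes>\<^bsub>Q8\<^esub> g = g \<otimes>\<^bsub>Q8\<^esub> k \<longrightarrow> P k)" for g P
    by (auto simp: centralizer_def)
  have c: "(1, 0) \<in> carrier Q8" "(0, 1) \<in> carrier Q8" "(1, 1) \<in> carrier Q8" by (simp_all add: Q8_carrier)
  note s = Q8_small_pow(1) Q8_small_pow(2-4)[OF c(1)] Q8_small_pow(2-4)[OF c(2)] Q8_small_pow(2-4)[OF c(3)]
  show "quaternion_pair qx qy" "quaternion_pair qy qx" "quaternion_pair (qx \<otimes>\<^bsub>Q8\<^esub> qy) qx"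
    unfolding quaternion_pair_def cent ball ex4 set4 qx_def qy_def
    by (simp_all add: Q8_mult Q8_inv Q8_one s c inj_on_def)
qed

lemma smult_cancel:
  assumes V: "vectorspace CC V" and w: "w \<in> carrier V" "w \<noteq> \<zero>\<^bsub>V\<^esub>" and e: "c \<odot>\<^bsub>V\<^esub> w = d \<odot>\<^bsub>V\<^esub> w"
  shows "c = d"
proof (rule ccontr)
  assume cd: "c \<noteq> d"
  interpret vectorspace CC V by (rule V)
  note s = CC_smult[OF V]
  have "(c - d) \<odot>\<^bsub>V\<^esub> w = c \<odot>\<^bsub>V\<^esub> w \<oplus>\<^bsub>V\<^esub> (- d) \<odot>\<^bsub>V\<^esub> w" using s(5)[OF w(1), of c "- d"] by simp
  also have "\<dots> = (d + - d) \<odot>\<^bsub>V\<^esub> w" unfolding e by (rule s(5)[OF w(1), symmetric])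
  also have "\<dots> = \<zero>\<^bsub>V\<^esub>" using s(1)[OF w(1)] by simp
  finally have z: "(c - d) \<odot>\<^bsub>V\<^esub> w = \<zero>\<^bsub>V\<^esub>" .
  have "w = (1 / (c - d) * (c - d)) \<odot>\<^bsub>V\<^esub> w" using cd s(2)[OF w(1)] by simp
  also have "\<dots> = \<zero>\<^bsub>V\<^esub>" using s(6)[OF w(1), of "1 / (c - d)" "c - d"] s(4)[OF w(1), of "1 / (c - d)"] z by simp
  finally show False using w(2) by simp
qed

text \<open>On the powers below the order of \<open>g\<close> the least exponent in the definition of \<open>\<phi>\<^sub>t\<close> is the given one.\<close>

lemma phi_pow:
  assumes inj: "inj_on (\<lambda>j::nat. g [^]\<^bsub>Q8\<^esub> j) {..<4}" and j: "j < 4"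
  shows "phi t g (g [^]\<^bsub>Q8\<^esub> j) = (\<i> ^ t) ^ j"
proof -
  have "(LEAST k::nat. g [^]\<^bsub>Q8\<^esub> k = g [^]\<^bsub>Q8\<^esub> j) = j"
  proof (rule Least_equality)
    fix k :: nat assume e: "g [^]\<^bsub>Q8\<^esub> k = g [^]\<^bsub>Q8\<^esub> j"
    show "j \<le> k"
    proof (rule ccontr)
      assume "\<not> j \<le> k"
      then have "k < 4" "k \<noteq> j" using j by auto
      then show False using inj_onD[OF inj e] j by simp
    qed
  qed simp
  then have "phi t g (g [^]\<^bsub>Q8\<^esub> j) = exp (of_nat t * of_real pi * \<i> * of_nat j / 2)" by (simp add: phi_def)
  also have "\<dots> = exp (of_nat (t * j) * (\<i> * of_real pi / 2))" by (simp add: mult_ac)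
  also have "\<dots> = exp (\<i> * of_real pi / 2) ^ (t * j)" by (rule exp_of_nat_mult)
  also have "exp (\<i> * of_real pi / 2) = \<i>"
    using cis_conv_exp[of "pi / 2"] by (simp add: mult.commute)
  finally show ?thesis by (simp add: power_mult)
qed

locale Q8_irreducible = yd_module Q8 V for V :: "(int \<times> int, 'v) yd_struct" +
  assumes fin_dim: "cfin_dim V" and irreducible: "yd_irreducible Q8 V"
begin

abbreviation act where "act \<equiv> yd_act V"
lemmas smult = CC_smult[OF spc.vectorspace_axioms]

lemma act_pow:
  assumes k: "k \<in> carrier Q8" and w: "w \<in> carrier V" "act k w = c \<odot>\<^bsub>V\<^esub> w"
  shows "act (k [^]\<^bsub>Q8\<^esub> (j::nat)) w = c ^ j \<odot>\<^bsub>V\<^esub> w"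
proof (induction j)
  case 0
  then show ?case using act_one[OF w(1)] smult(2)[OF w(1)] by simp
next
  case (Suc j)
  have "act (k [^]\<^bsub>Q8\<^esub> Suc j) w = act (k [^]\<^bsub>Q8\<^esub> j) (act k w)" using k w(1) by (simp add: act_mult)
  then show ?case using k w Suc by (simp add: act_smult smult)
qed

lemma generated: "k \<in> carrier Q8 \<Longrightarrow> w \<in> yd_comp V k \<Longrightarrow> w \<noteq> \<zero>\<^bsub>V\<^esub> \<Longrightarrow> orbit_span w = carrier V"
  by (rule irreducible_generated[OF Q8_finite irreducible])

lemma generated_subset:
  assumes "k \<in> carrier Q8" "w \<in> yd_comp V k" "w \<noteq> \<zero>\<^bsub>V\<^esub>" "P \<subseteq> carrier V" "\<And>k. k \<in> carrier Q8 \<Longrightarrow> act k w \<in> P"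
  shows "carrier V \<subseteq> cspan V P"
proof -
  have "{act k w | k. k \<in> carrier Q8} \<subseteq> P" using assms(5) by blast
  then have "orbit_span w \<subseteq> cspan V P" unfolding orbit_span_def by (rule spc.span_is_monotone)
  then show ?thesis using generated[OF assms(1-3)] by simp
qed

end

lemma vec_1_eqI: "v \<in> carrier_vec 1 \<Longrightarrow> w \<in> carrier_vec 1 \<Longrightarrow> v $ 0 = w $ 0 \<Longrightarrow> v = (w :: complex vec)"
  by (intro eq_vecI) auto

lemma M_phi_data: "g \<in> carrier Q8 \<Longrightarrow> induced_data Q8 (module_vec TYPE(complex) 1) g (\<lambda>h v. phi t g h \<cdot>\<^sub>v v)"
  unfolding induced_data_def induced_data_axioms_def using group_Q8 vec_vs by (auto simp: module_vec_simps)

context Q8_irreducible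
begin

lemma noncentral_isomorphic:
  assumes gh: "quaternion_pair g h" and w: "w \<in> yd_comp V g" "w \<noteq> \<zero>\<^bsub>V\<^esub>" "act g w = \<i> ^ t \<odot>\<^bsub>V\<^esub> w"
  shows "yd_isomorphic Q8 V (M_phi g t)"
proof -
  let ?W = "module_vec TYPE(complex) 1"
  have g: "g \<in> carrier Q8" using gh by (simp add: quaternion_pair_def)
  have wc: "w \<in> carrier V" by (rule comp_closed[OF g w(1)])
  define \<theta> where "\<theta> v = v $ 0 \<odot>\<^bsub>V\<^esub> w" for v :: "complex vec"
  interpret D: induced_data Q8 ?W g "\<lambda>h v. phi t g h \<cdot>\<^sub>v v" by (rule M_phi_data[OF g])
  interpret induced_comparison Q8 ?W g "\<lambda>h v. phi t g h \<cdot>\<^sub>v v" V \<theta>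
  proof unfold_locales
    show "finite (carrier Q8)" by (rule Q8_finite)
    show "\<theta> \<in> chom ?W V" unfolding module_hom_def
      by (auto simp: module_vec_simps \<theta>_def smult wc)
    show "inj_on \<theta> (carrier ?W)"
      using smult_cancel[OF spc.vectorspace_axioms wc w(2)] vec_1_eqI
      by (auto simp: inj_on_def \<theta>_def module_vec_simps)
    show "\<theta> v \<in> yd_comp V g" for v unfolding \<theta>_def using csubspaceD(5)[OF comp_subspace[OF g] w(1)] .
    show "\<theta> (phi t g k \<cdot>\<^sub>v v) = act k (\<theta> v)" if k: "k \<in> centralizer Q8 g" and v: "v \<in> carrier ?W" for k v
    proof -
      have "\<forall>k\<in>centralizer Q8 g. \<exists>j<4::nat. k = g [^]\<^bsub>Q8\<^esub> j"
        using gh unfolding quaternion_pair_def by (elim conjE)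
      then obtain j :: nat where j: "j < 4" "k = g [^]\<^bsub>Q8\<^esub> j" using bspec[OF _ k] by blast
      have kc: "k \<in> carrier Q8" using k by (simp add: centralizer_def)
      have "act k w = (\<i> ^ t) ^ j \<odot>\<^bsub>V\<^esub> w" unfolding j(2) by (rule act_pow[OF g wc w(3)])
      moreover have "phi t g k = (\<i> ^ t) ^ j" unfolding j(2)
        by (rule phi_pow[OF _ j(1)]) (use gh in \<open>simp add: quaternion_pair_def\<close>)
      ultimately show ?thesis using v kc wc
        by (simp add: \<theta>_def module_vec_simps act_smult smult mult.commute)
    qed
    show "carrier V \<subseteq> cspan V {act k (\<theta> v) | k v. k \<in> carrier Q8 \<and> v \<in> carrier ?W}"
    proof (rule generated_subset[OF g w(1,2)])
      show "{act k (\<theta> v) | k v. k \<in> carrier Q8 \<and> v \<in> carrier ?W} \<subseteq> carrier V"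
        using wc by (auto simp: \<theta>_def smult)
      fix k assume k: "k \<in> carrier Q8"
      have "\<theta> (vec 1 (\<lambda>_. 1)) = w" by (simp add: \<theta>_def smult(2)[OF wc])
      then show "act k w \<in> {act k (\<theta> v) | k v. k \<in> carrier Q8 \<and> v \<in> carrier ?W}"
        using k by (intro CollectI exI[of _ k] exI[of _ "vec 1 (\<lambda>_. 1)"]) (simp add: module_vec_simps)
    qed
  qed
  show ?thesis using induced_isomorphic by (simp add: M_phi_def)
qed

lemma noncentral_eigenvector:
  assumes gh: "quaternion_pair g h" and u: "u \<in> yd_comp V g" "u \<noteq> \<zero>\<^bsub>V\<^esub>"
  shows "\<exists>w\<in>yd_comp V g. w \<noteq> \<zero>\<^bsub>V\<^esub> \<and> (\<exists>t<4. act g w = \<i> ^ t \<odot>\<^bsub>V\<^esub> w)"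
proof (rule fourth_root_eigenvector[OF comp_subspace])
  show g: "g \<in> carrier Q8" "g \<in> carrier Q8" using gh by (simp_all add: quaternion_pair_def)
  show "(g \<otimes>\<^bsub>Q8\<^esub> g) \<otimes>\<^bsub>Q8\<^esub> (g \<otimes>\<^bsub>Q8\<^esub> g) = \<one>\<^bsub>Q8\<^esub>" using gh by (simp add: quaternion_pair_def)
  show "act g v \<in> yd_comp V g" if "v \<in> yd_comp V g" for v
    using act_comp_mem[OF g(1) g(1) that] g by (simp add: grp.m_assoc)
qed (use u in auto)

text \<open>The module has a basis of two vectors of degrees \<open>g\<close> and \<open>g\<^sup>-\<^sup>1\<close>, proportional to \<open>w\<close> and \<open>w' = h \<cdot> w\<close>.  Each degree acts by \<open>q\<close> on the vector
  of that degree and by \<open>1/q\<close> on the other one, which is the affine braiding matrix.\<close>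

lemma noncentral_infinite:
  assumes gh: "quaternion_pair g h" and w: "w \<in> yd_comp V g" "w \<noteq> \<zero>\<^bsub>V\<^esub>" "act g w = q \<odot>\<^bsub>V\<^esub> w"
    and q: "q ^ 4 = 1" "q\<^sup>2 \<noteq> 1"
  shows "GKdim (nichols_algebra Q8 V) = \<infinity>"
proof -
  note gh' = gh[unfolded quaternion_pair_def]
  have g: "g \<in> carrier Q8" and h: "h \<in> carrier Q8" using gh' by simp_all
  let ?g' = "inv\<^bsub>Q8\<^esub> g"
  have g': "?g' \<in> carrier Q8" "?g' \<noteq> g" using gh' by auto
  have q0: "q \<noteq> 0" using q by auto
  have wc: "w \<in> carrier V" by (rule comp_closed[OF g w(1)])
  define w' where "w' = act h w"
  have hg: "h \<otimes>\<^bsub>Q8\<^esub> g = ?g' \<otimes>\<^bsub>Q8\<^esub> h" using gh' by simp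
  have conj: "h \<otimes>\<^bsub>Q8\<^esub> g \<otimes>\<^bsub>Q8\<^esub> inv\<^bsub>Q8\<^esub> h = ?g'" unfolding hg using g' h by (simp add: grp.m_assoc)
  have w': "w' \<in> yd_comp V ?g'" using act_comp_mem[OF h g w(1)] by (simp add: w'_def conj)
  have w'c: "w' \<in> carrier V" by (rule comp_closed[OF g'(1) w'])
  have w'0: "w' \<noteq> \<zero>\<^bsub>V\<^esub>"
  proof
    assume "w' = \<zero>\<^bsub>V\<^esub>"
    then have "w = \<zero>\<^bsub>V\<^esub>" using act_inv[OF h wc] h by (simp add: w'_def)
    then show False using w by simp
  qed
  have inv_act: "act ?g' v = (1 / c) \<odot>\<^bsub>V\<^esub> v" if "v \<in> carrier V" "act g v = c \<odot>\<^bsub>V\<^esub> v" "c \<noteq> 0" for v c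
  proof -
    have "v = act ?g' (c \<odot>\<^bsub>V\<^esub> v)" using act_inv[OF g that(1)] that(2) by simp
    also have "\<dots> = c \<odot>\<^bsub>V\<^esub> act ?g' v" by (rule act_smult[OF g'(1) that(1)])
    finally have "(1 / c) \<odot>\<^bsub>V\<^esub> v = (1 / c) \<odot>\<^bsub>V\<^esub> (c \<odot>\<^bsub>V\<^esub> act ?g' v)" by simp
    also have "\<dots> = act ?g' v" using that g' by (simp add: smult)
    finally show ?thesis by simp
  qed
  have g'w: "act ?g' w = (1 / q) \<odot>\<^bsub>V\<^esub> w" by (rule inv_act[OF wc w(3) q0])
  have g'w': "act ?g' w' = q \<odot>\<^bsub>V\<^esub> w'"
  proof -
    have "act ?g' w' = act (h \<otimes>\<^bsub>Q8\<^esub> g) w" unfolding hg w'_def using g' h wc by (simp add: act_mult)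
    also have "\<dots> = act h (q \<odot>\<^bsub>V\<^esub> w)" using g h wc w(3) by (simp add: act_mult)
    finally show ?thesis using h wc by (simp add: act_smult w'_def)
  qed
  have gw': "act g w' = (1 / q) \<odot>\<^bsub>V\<^esub> w'"
  proof -
    have "w' = act g (act ?g' w')" using act_mult[OF g g'(1) w'c] act_one[OF w'c] g by simp
    also have "\<dots> = q \<odot>\<^bsub>V\<^esub> act g w'" unfolding g'w' by (rule act_smult[OF g w'c])
    finally have "(1 / q) \<odot>\<^bsub>V\<^esub> w' = (1 / q) \<odot>\<^bsub>V\<^esub> (q \<odot>\<^bsub>V\<^esub> act g w')" by simp
    also have "\<dots> = act g w'" using q0 g w'c by (simp add: smult)
    finally show ?thesis by simp
  qed
  have span: "\<exists>\<alpha> \<beta>. v = \<alpha> \<odot>\<^bsub>V\<^esub> w \<oplus>\<^bsub>V\<^esub> \<beta> \<odot>\<^bsub>V\<^esub> w'" if "v \<in> carrier V" for v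
  proof -
    let ?T = "{\<alpha> \<odot>\<^bsub>V\<^esub> w \<oplus>\<^bsub>V\<^esub> \<beta> \<odot>\<^bsub>V\<^esub> w' | \<alpha> \<beta>. True}"
    have T: "csubspace ?T V"
    proof (rule csubspaceI[OF spc.vectorspace_axioms])
      show "?T \<subseteq> carrier V" using smult(3) wc w'c by auto
      show "\<zero>\<^bsub>V\<^esub> \<in> ?T" by (intro CollectI exI[of _ 0]) (simp add: smult(1) wc w'c)
      show "a \<oplus>\<^bsub>V\<^esub> b \<in> ?T" if ab: "a \<in> ?T" "b \<in> ?T" for a b
      proof -
        obtain \<alpha> \<beta> \<gamma> \<delta> where e: "a = \<alpha> \<odot>\<^bsub>V\<^esub> w \<oplus>\<^bsub>V\<^esub> \<beta> \<odot>\<^bsub>V\<^esub> w'" "b = \<gamma> \<odot>\<^bsub>V\<^esub> w \<oplus>\<^bsub>V\<^esub> \<delta> \<odot>\<^bsub>V\<^esub> w'" using ab by blast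
        have "a \<oplus>\<^bsub>V\<^esub> b = (\<alpha> + \<gamma>) \<odot>\<^bsub>V\<^esub> w \<oplus>\<^bsub>V\<^esub> (\<beta> + \<delta>) \<odot>\<^bsub>V\<^esub> w'"
          unfolding e using wc w'c by (simp add: smult spc.a_ac)
        then show ?thesis by blast
      qed
      show "c \<odot>\<^bsub>V\<^esub> a \<in> ?T" if a: "a \<in> ?T" for c a
      proof -
        obtain \<alpha> \<beta> where e: "a = \<alpha> \<odot>\<^bsub>V\<^esub> w \<oplus>\<^bsub>V\<^esub> \<beta> \<odot>\<^bsub>V\<^esub> w'" using a by blast
        have "c \<odot>\<^bsub>V\<^esub> a = (c * \<alpha>) \<odot>\<^bsub>V\<^esub> w \<oplus>\<^bsub>V\<^esub> (c * \<beta>) \<odot>\<^bsub>V\<^esub> w'" unfolding e using wc w'c by (simp add: smult)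
        then show ?thesis by blast
      qed
    qed
    have "orbit_span w \<subseteq> ?T" unfolding orbit_span_def
    proof (rule cspan_least[OF T], clarify)
      fix k assume k: "k \<in> carrier Q8"
      have "\<forall>k\<in>carrier Q8. \<exists>j<4::nat. k = g [^]\<^bsub>Q8\<^esub> j \<or> k = h \<otimes>\<^bsub>Q8\<^esub> g [^]\<^bsub>Q8\<^esub> j"
        using gh' by (elim conjE)
      from bspec[OF this k] obtain j :: nat where j: "k = g [^]\<^bsub>Q8\<^esub> j \<or> k = h \<otimes>\<^bsub>Q8\<^esub> g [^]\<^bsub>Q8\<^esub> j"
        by (elim exE conjE)
      have p: "act (g [^]\<^bsub>Q8\<^esub> j) w = q ^ j \<odot>\<^bsub>V\<^esub> w" by (rule act_pow[OF g wc w(3)])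
      have pc: "g [^]\<^bsub>Q8\<^esub> j \<in> carrier Q8" using g by simp
      from j show "\<exists>\<alpha> \<beta>. act k w = \<alpha> \<odot>\<^bsub>V\<^esub> w \<oplus>\<^bsub>V\<^esub> \<beta> \<odot>\<^bsub>V\<^esub> w' \<and> True"
      proof
        assume "k = g [^]\<^bsub>Q8\<^esub> j"
        then show ?thesis using p wc w'c by (intro exI[of _ "q ^ j"] exI[of _ 0]) (simp add: smult)
      next
        assume "k = h \<otimes>\<^bsub>Q8\<^esub> g [^]\<^bsub>Q8\<^esub> j"
        then have "act k w = q ^ j \<odot>\<^bsub>V\<^esub> w'" using p pc h wc by (simp add: act_mult act_smult w'_def)
        then show ?thesis using wc w'c by (intro exI[of _ 0] exI[of _ "q ^ j"]) (simp add: smult)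
      qed
    qed
    then show ?thesis using generated[OF g w(1,2)] that by blast
  qed
  \<comment> \<open>Splitting \<open>\<alpha> w + \<beta> w'\<close> into homogeneous parts shows that each component is spanned by \<open>w\<close> or \<open>w'\<close>.\<close>
  have homog: "(k = g \<and> (\<exists>\<alpha>. v = \<alpha> \<odot>\<^bsub>V\<^esub> w)) \<or> (k = ?g' \<and> (\<exists>\<beta>. v = \<beta> \<odot>\<^bsub>V\<^esub> w'))"
    if v: "v \<in> yd_comp V k" "k \<in> carrier Q8" "v \<noteq> \<zero>\<^bsub>V\<^esub>" for v k
  proof -
    obtain \<alpha> \<beta> where ab: "v = \<alpha> \<odot>\<^bsub>V\<^esub> w \<oplus>\<^bsub>V\<^esub> \<beta> \<odot>\<^bsub>V\<^esub> w'" using span comp_closed[OF v(2,1)] by blast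
    define m where "m s = (if s = g then \<alpha> \<odot>\<^bsub>V\<^esub> w else if s = ?g' then \<beta> \<odot>\<^bsub>V\<^esub> w' else \<zero>\<^bsub>V\<^esub>)" for s
    have mc: "m s \<in> carrier V" for s using wc w'c smult(3) by (simp add: m_def)
    have "homogeneous_parts Q8 V v (\<lambda>s. if s \<in> carrier Q8 then m s else \<zero>\<^bsub>V\<^esub>)"
    proof (rule parts_sum[OF Q8_finite])
      show "m s \<in> yd_comp V s" if "s \<in> carrier Q8" for s
        using csubspaceD(3,5)[OF comp_subspace[OF that]] w(1) w' by (auto simp: m_def)
      have "(\<Oplus>\<^bsub>V\<^esub>s\<in>carrier Q8. m s) = (\<Oplus>\<^bsub>V\<^esub>s\<in>{g, ?g'}. m s)"
        by (rule spc.add.finprod_mono_neutral_cong_right[OF Q8_finite]) (use g g' mc in \<open>auto simp: m_def\<close>)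
      also have "\<dots> = m g \<oplus>\<^bsub>V\<^esub> m ?g'" using g' mc by simp
      finally show "v = (\<Oplus>\<^bsub>V\<^esub>s\<in>carrier Q8. m s)" using ab g' by (simp add: m_def)
    qed
    from fun_cong[OF parts_unique[OF parts_single[OF v(2,1)] this comp_closed[OF v(2,1)]]]
    have e: "(if s = k then v else \<zero>\<^bsub>V\<^esub>) = (if s \<in> carrier Q8 then m s else \<zero>\<^bsub>V\<^esub>)" for s .
    show ?thesis
    proof (cases "k = g \<or> k = ?g'")
      case True
      then show ?thesis using e[of k] v(2) by (auto simp: m_def)
    next
      case False
      then show ?thesis using e[of k] v by (auto simp: m_def)
    qed
  qed
  define B where "B = (SOME B. homogeneous_basis Q8 V B)"
  have B: "homogeneous_basis Q8 V B"
    unfolding B_def using someI_ex[OF homogeneous_basis_exists[OF Q8_finite irreducible]] .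
  then have Bb: "\<not> spc.lin_dep B" "cspan V B = carrier V" "B \<subseteq> carrier V"
    unfolding homogeneous_basis_def spc.basis_def by auto
  have B0: "b \<noteq> \<zero>\<^bsub>V\<^esub>" if "b \<in> B" for b using spc.vs_zero_lin_dep[OF Bb(3,1)] that by auto
  have Bcase: "b \<in> yd_comp V g \<or> b \<in> yd_comp V ?g'" if b: "b \<in> B" for b
  proof -
    have "b \<in> (\<Union>k\<in>carrier Q8. yd_comp V k)" using B b unfolding homogeneous_basis_def by (elim conjE subsetD)
    then obtain k where k: "k \<in> carrier Q8" "b \<in> yd_comp V k" by (elim UN_E)
    from homog[OF k(2,1) B0[OF b]] k(2) show ?thesis by (elim disjE conjE) simp_all
  qed
  have disj: "\<not> (b \<in> yd_comp V g \<and> b \<in> yd_comp V ?g')" if "b \<noteq> \<zero>\<^bsub>V\<^esub>" for b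
    using component_unique[of b g ?g'] g g' that by auto
  have collinear: "b = b'" if b: "b \<in> B" "b' \<in> B" "b = \<alpha> \<odot>\<^bsub>V\<^esub> u" "b' = \<beta> \<odot>\<^bsub>V\<^esub> u" and u: "u \<in> carrier V" for b b' \<alpha> \<beta> u
  proof (rule ccontr)
    assume ne: "b \<noteq> b'"
    have a0: "\<alpha> \<noteq> 0" using B0[OF b(1)] b(3) smult(1)[OF u] by auto
    have b': "b' = (\<beta> / \<alpha>) \<odot>\<^bsub>V\<^esub> b" using b(3,4) a0 u by (simp add: smult)
    have "spc.lincomb (\<lambda>v. if v = b' then 1 else - (\<beta> / \<alpha>)) {b', b} = \<zero>\<^bsub>V\<^esub>"
    proof -
      have bc: "b \<in> carrier V" "b' \<in> carrier V" using b Bb(3) by auto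
      have "spc.lincomb (\<lambda>v. if v = b' then 1 else - (\<beta> / \<alpha>)) {b', b} = 1 \<odot>\<^bsub>V\<^esub> b' \<oplus>\<^bsub>V\<^esub> (- (\<beta> / \<alpha>)) \<odot>\<^bsub>V\<^esub> b"
        unfolding spc.lincomb_def using ne bc smult(3) by simp
      also have "\<dots> = ((\<beta> / \<alpha>) + - (\<beta> / \<alpha>)) \<odot>\<^bsub>V\<^esub> b"
        using smult(2)[OF bc(2)] b' by (simp only: smult(5)[OF bc(1)])
      finally show ?thesis using smult(1)[OF bc(1)] by simp
    qed
    then have "(\<lambda>v. if v = b' then 1 else - (\<beta> / \<alpha>)) \<in> {b', b} \<rightarrow> {\<zero>\<^bsub>CC\<^esub>}"
      by (intro spc.not_lindepD[OF Bb(1)]) (use b in auto)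
    then show False by auto
  qed
  have "\<exists>b1. b1 \<in> B \<and> b1 \<in> yd_comp V g"
  proof (rule ccontr)
    assume "\<not> ?thesis"
    then have "B \<subseteq> yd_comp V ?g'" using Bcase by (intro subsetI) metis
    then have "cspan V B \<subseteq> yd_comp V ?g'" by (rule cspan_least[OF comp_subspace[OF g'(1)]])
    with Bb(2) wc have "w \<in> yd_comp V ?g'" by (metis subsetD)
    then show False using disj[OF w(2)] w(1) by simp
  qed
  then obtain b1 where b1: "b1 \<in> B" "b1 \<in> yd_comp V g" by (elim exE conjE)
  have "\<exists>b2. b2 \<in> B \<and> b2 \<in> yd_comp V ?g'"
  proof (rule ccontr)
    assume "\<not> ?thesis"
    then have "B \<subseteq> yd_comp V g" using Bcase by (intro subsetI) metis
    then have "cspan V B \<subseteq> yd_comp V g" by (rule cspan_least[OF comp_subspace[OF g]])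
    with Bb(2) w'c have "w' \<in> yd_comp V g" by (metis subsetD)
    then show False using disj[OF w'0] w' by simp
  qed
  then obtain b2 where b2: "b2 \<in> B" "b2 \<in> yd_comp V ?g'" by (elim exE conjE)
  have b1w: "\<exists>\<alpha>. b = \<alpha> \<odot>\<^bsub>V\<^esub> w" if "b \<in> B" "b \<in> yd_comp V g" for b
    using homog[OF that(2) g B0[OF that(1)]] g'(2) by auto
  have b2w: "\<exists>\<alpha>. b = \<alpha> \<odot>\<^bsub>V\<^esub> w'" if "b \<in> B" "b \<in> yd_comp V ?g'" for b
    using homog[OF that(2) g'(1) B0[OF that(1)]] g'(2) by auto
  have BB: "B = {b1, b2}"
  proof
    show "B \<subseteq> {b1, b2}"
    proof
      fix b assume b: "b \<in> B"
      from Bcase[OF b] show "b \<in> {b1, b2}"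
      proof
        assume bg: "b \<in> yd_comp V g"
        obtain \<alpha> \<beta> where "b = \<alpha> \<odot>\<^bsub>V\<^esub> w" "b1 = \<beta> \<odot>\<^bsub>V\<^esub> w" using b1w[OF b bg] b1w[OF b1] by blast
        from collinear[OF b b1(1) this wc] show ?thesis by simp
      next
        assume bg: "b \<in> yd_comp V ?g'"
        obtain \<alpha> \<beta> where "b = \<alpha> \<odot>\<^bsub>V\<^esub> w'" "b2 = \<beta> \<odot>\<^bsub>V\<^esub> w'" using b2w[OF b bg] b2w[OF b2] by blast
        from collinear[OF b b2(1) this w'c] show ?thesis by simp
      qed
    qed
  qed (use b1 b2 in auto)
  have b12: "b1 \<noteq> b2" using disj[OF B0[OF b1(1)]] b1 b2 by auto
  define \<chi> where "\<chi> b a = (if b = a then q else 1 / q)" for b a :: 'v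
  have scal: "act k (c \<odot>\<^bsub>V\<^esub> v) = d \<odot>\<^bsub>V\<^esub> (c \<odot>\<^bsub>V\<^esub> v)" if "k \<in> carrier Q8" "v \<in> carrier V" "act k v = d \<odot>\<^bsub>V\<^esub> v" for k c d v
    using that by (simp add: act_smult smult mult.commute)
  have acts: "act g b1 = q \<odot>\<^bsub>V\<^esub> b1" "act ?g' b1 = (1 / q) \<odot>\<^bsub>V\<^esub> b1"
    "act g b2 = (1 / q) \<odot>\<^bsub>V\<^esub> b2" "act ?g' b2 = q \<odot>\<^bsub>V\<^esub> b2"
  proof -
    obtain \<alpha> \<beta> where e: "b1 = \<alpha> \<odot>\<^bsub>V\<^esub> w" "b2 = \<beta> \<odot>\<^bsub>V\<^esub> w'" using b1w[OF b1] b2w[OF b2] by blast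
    show "act g b1 = q \<odot>\<^bsub>V\<^esub> b1" "act ?g' b1 = (1 / q) \<odot>\<^bsub>V\<^esub> b1"
      "act g b2 = (1 / q) \<odot>\<^bsub>V\<^esub> b2" "act ?g' b2 = q \<odot>\<^bsub>V\<^esub> b2"
      unfolding e by (rule scal[OF g wc w(3)] scal[OF g'(1) wc g'w] scal[OF g w'c gw'] scal[OF g'(1) w'c g'w'])+
  qed
  interpret diagonal_basis Q8 V B \<chi>
  proof unfold_locales
    show "homogeneous_basis Q8 V B" by (rule B)
    fix a b k assume ab: "a \<in> B" "b \<in> B" "k \<in> carrier Q8" "b \<in> yd_comp V k"
    have kb: "(b = b1 \<and> k = g) \<or> (b = b2 \<and> k = ?g')"
      using ab(2-4) component_unique[of b k g] component_unique[of b k ?g'] b1 b2 B0 g g' unfolding BB by auto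
    then show "act k a = \<chi> b a \<odot>\<^bsub>V\<^esub> a" using ab(1) acts b12 unfolding BB by (auto simp: \<chi>_def)
  qed
  have "two_letters b1 b2 q \<chi>"
    unfolding two_letters_def using b12 q0 q(2) by (auto simp: \<chi>_def)
  then show ?thesis unfolding nichols_algebra_eq[OF B_def] by (rule GKdim_infinite_two_letters[OF BB])
qed

end

section \<open>The list of irreducible modules\<close>

lemma rho_carrier: "rho_x i \<in> carrier_mat (rho_dim i) (rho_dim i)" "rho_y i \<in> carrier_mat (rho_dim i) (rho_dim i)"
  "rho i h \<in> carrier_mat (rho_dim i) (rho_dim i)"
proof -
  show c: "rho_x i \<in> carrier_mat (rho_dim i) (rho_dim i)" "rho_y i \<in> carrier_mat (rho_dim i) (rho_dim i)"
    by (auto simp: rho_x_def rho_y_def rho_dim_def mat_of_rows_list_def)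
  show "rho i h \<in> carrier_mat (rho_dim i) (rho_dim i)"
    using c by (auto simp: rho_def split: prod.split)
qed

lemma rho_apply:
  assumes v: "v \<in> carrier_vec (rho_dim i)"
  shows "rho i (a, b) *\<^sub>v v = rho_x i ^\<^sub>m nat a *\<^sub>v (rho_y i ^\<^sub>m nat b *\<^sub>v v)"
  unfolding rho_def prod.case
  by (rule assoc_mult_mat_vec[OF pow_carrier_mat[OF rho_carrier(1)] pow_carrier_mat[OF rho_carrier(2)] v])

lemma pow_mat_Suc_apply:
  assumes "(A :: complex mat) \<in> carrier_mat n n" "v \<in> carrier_vec n"
  shows "A ^\<^sub>m Suc k *\<^sub>v v = A ^\<^sub>m k *\<^sub>v (A *\<^sub>v v)"
  unfolding pow_mat.simps by (rule assoc_mult_mat_vec[OF pow_carrier_mat[OF assms(1)] assms])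

lemma rho_1_apply:
  assumes "i \<noteq> 5" "v \<in> carrier_vec 1"
  shows "rho_x i *\<^sub>v v = (if i \<in> {1, 2} then 1 else - 1) \<cdot>\<^sub>v v"
    "rho_y i *\<^sub>v v = (if i \<in> {1, 3} then 1 else - 1) \<cdot>\<^sub>v v"
proof -
  have s: "rho_x i *\<^sub>v v \<in> carrier_vec 1" "rho_y i *\<^sub>v v \<in> carrier_vec 1"
    using mult_mat_vec_carrier[OF rho_carrier(1)[of i]] mult_mat_vec_carrier[OF rho_carrier(2)[of i]] assms
    by (simp_all add: rho_dim_def)
  show "rho_x i *\<^sub>v v = (if i \<in> {1, 2} then 1 else - 1) \<cdot>\<^sub>v v"
    by (rule vec_1_eqI[OF s(1)]) (use assms in \<open>auto simp: rho_x_def mat_of_rows_list_def scalar_prod_def\<close>)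
  show "rho_y i *\<^sub>v v = (if i \<in> {1, 3} then 1 else - 1) \<cdot>\<^sub>v v"
    by (rule vec_1_eqI[OF s(2)]) (use assms in \<open>auto simp: rho_y_def mat_of_rows_list_def scalar_prod_def\<close>)
qed

lemma rho_5_apply:
  assumes "v \<in> carrier_vec 2"
  shows "(rho_x 5 *\<^sub>v v) $ 0 = \<i> * v $ 0" "(rho_x 5 *\<^sub>v v) $ 1 = - \<i> * v $ 1"
    "(rho_y 5 *\<^sub>v v) $ 0 = - v $ 1" "(rho_y 5 *\<^sub>v v) $ 1 = v $ 0"
  using assms by (auto simp: rho_x_def rho_y_def mat_of_rows_list_def scalar_prod_def numeral_2_eq_2)

lemma vec_2_eqI: "v \<in> carrier_vec 2 \<Longrightarrow> w \<in> carrier_vec 2 \<Longrightarrow> v $ 0 = w $ 0 \<Longrightarrow> v $ 1 = w $ 1 \<Longrightarrow> v = (w :: complex vec)"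
  by (intro eq_vecI) (auto simp: less_2_cases_iff)

lemma rho_central:
  assumes v: "v \<in> carrier_vec (rho_dim i)"
  shows "rho i (0, 0) *\<^sub>v v = v" "rho i (2, 0) *\<^sub>v v = (if i = 5 then - 1 else 1) \<cdot>\<^sub>v v"
proof -
  show "rho i (0, 0) *\<^sub>v v = v" using rho_carrier(1,2)[of i] v by (simp add: rho_apply)
  have X: "rho_x i *\<^sub>v v \<in> carrier_vec (rho_dim i)" "rho_x i *\<^sub>v (rho_x i *\<^sub>v v) \<in> carrier_vec (rho_dim i)"
    using rho_carrier(1)[of i] v by auto
  have "rho i (2, 0) *\<^sub>v v = rho_x i ^\<^sub>m Suc (Suc 0) *\<^sub>v v"
    using rho_carrier(1,2)[of i] v by (simp add: rho_apply numeral_2_eq_2)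
  also have "\<dots> = rho_x i *\<^sub>v (rho_x i *\<^sub>v v)"
    unfolding pow_mat_Suc_apply[OF rho_carrier(1) v] pow_mat_Suc_apply[OF rho_carrier(1) X(1)]
    using rho_carrier(1)[of i] X(2) by simp
  also have "\<dots> = (if i = 5 then - 1 else 1) \<cdot>\<^sub>v v"
  proof (cases "i = 5")
    case True
    have d: "v \<in> carrier_vec 2" "rho_x 5 *\<^sub>v v \<in> carrier_vec 2" "rho_x 5 *\<^sub>v (rho_x 5 *\<^sub>v v) \<in> carrier_vec 2"
      using v X by (simp_all add: True rho_dim_def)
    have "rho_x 5 *\<^sub>v (rho_x 5 *\<^sub>v v) = - 1 \<cdot>\<^sub>v v"
      by (rule vec_2_eqI[OF d(3)])
        (use d(1) in \<open>simp_all add: rho_5_apply[OF d(1), simplified] rho_5_apply[OF d(2), simplified] flip: mult.assoc\<close>)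
    then show ?thesis using True by simp
  next
    case False
    then have d: "v \<in> carrier_vec 1" using v by (simp add: rho_dim_def)
    show ?thesis using False d by (auto simp: rho_1_apply smult_smult_assoc)
  qed
  finally show "rho i (2, 0) *\<^sub>v v = (if i = 5 then - 1 else 1) \<cdot>\<^sub>v v" .
qed

lemma M_rho_data: "g \<in> carrier Q8 \<Longrightarrow> induced_data Q8 (module_vec TYPE(complex) (rho_dim i)) g (\<lambda>h v. rho i h *\<^sub>v v)"
  unfolding induced_data_def induced_data_axioms_def using group_Q8 vec_vs mult_mat_vec_carrier[OF rho_carrier(3)]
  by (auto simp: module_vec_simps)

context Q8_irreducible
begin

lemma rho_equivariant:
  assumes closed: "\<And>v. v \<in> carrier_vec (rho_dim i) \<Longrightarrow> \<theta> v \<in> carrier V"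
    and x: "\<And>v. v \<in> carrier_vec (rho_dim i) \<Longrightarrow> \<theta> (rho_x i *\<^sub>v v) = act qx (\<theta> v)"
    and y: "\<And>v. v \<in> carrier_vec (rho_dim i) \<Longrightarrow> \<theta> (rho_y i *\<^sub>v v) = act qy (\<theta> v)"
    and k: "k \<in> carrier Q8" and v: "v \<in> carrier_vec (rho_dim i)"
  shows "\<theta> (rho i k *\<^sub>v v) = act k (\<theta> v)"
proof -
  obtain a b where ab: "k = (a, b)" by fastforce
  have pow: "\<theta> (A ^\<^sub>m n *\<^sub>v v) = act (h [^]\<^bsub>Q8\<^esub> n) (\<theta> v)"
    if h: "h \<in> carrier Q8" and A: "A \<in> carrier_mat (rho_dim i) (rho_dim i)"
      and e: "\<And>v. v \<in> carrier_vec (rho_dim i) \<Longrightarrow> \<theta> (A *\<^sub>v v) = act h (\<theta> v)"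
      and v: "v \<in> carrier_vec (rho_dim i)" for A h v and n :: nat
    using v
  proof (induction n arbitrary: v)
    case 0
    then show ?case using A closed by (simp add: act_one)
  next
    case (Suc n)
    have "A *\<^sub>v v \<in> carrier_vec (rho_dim i)" using A Suc.prems by simp
    from Suc.IH[OF this] show ?case
      unfolding pow_mat_Suc_apply[OF A Suc.prems] using e[OF Suc.prems] h closed[OF Suc.prems] by (simp add: act_mult)
  qed
  have yv: "rho_y i ^\<^sub>m nat b *\<^sub>v v \<in> carrier_vec (rho_dim i)"
    using mult_mat_vec_carrier[OF pow_carrier_mat[OF rho_carrier(2)] v] .
  have ey: "\<theta> (rho_y i ^\<^sub>m nat b *\<^sub>v v) = act (qy [^]\<^bsub>Q8\<^esub> nat b) (\<theta> v)"
    by (rule pow[OF Q8_relations(2) rho_carrier(2) _ v]) (rule y)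
  have ex: "\<theta> (rho_x i ^\<^sub>m nat a *\<^sub>v (rho_y i ^\<^sub>m nat b *\<^sub>v v)) = act (qx [^]\<^bsub>Q8\<^esub> nat a) (\<theta> (rho_y i ^\<^sub>m nat b *\<^sub>v v))"
    by (rule pow[OF Q8_relations(1) rho_carrier(1) _ yv]) (rule x)
  have "\<theta> (rho i k *\<^sub>v v) = act (qx [^]\<^bsub>Q8\<^esub> nat a) (act (qy [^]\<^bsub>Q8\<^esub> nat b) (\<theta> v))"
    unfolding ab rho_apply[OF v] ex ey ..
  also have "\<dots> = act (qx [^]\<^bsub>Q8\<^esub> nat a \<otimes>\<^bsub>Q8\<^esub> qy [^]\<^bsub>Q8\<^esub> nat b) (\<theta> v)"
    using Q8_relations(1,2) closed[OF v] by (simp add: act_mult)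
  also have "qx [^]\<^bsub>Q8\<^esub> nat a \<otimes>\<^bsub>Q8\<^esub> qy [^]\<^bsub>Q8\<^esub> nat b = k"
    using Q8_normal_form k unfolding ab by metis
  finally show ?thesis .
qed

text \<open>For central \<open>g\<close> the component of degree \<open>g\<close> is a representation of the whole group, and equivariance of \<open>\<theta>\<close> need only be
  checked for the generators.\<close>

lemma central_isomorphic:
  assumes g: "g \<in> carrier Q8"
    and hom: "\<theta> \<in> chom (module_vec TYPE(complex) (rho_dim i)) V"
    and inj: "inj_on \<theta> (carrier_vec (rho_dim i))"
    and comp: "\<And>v. v \<in> carrier_vec (rho_dim i) \<Longrightarrow> \<theta> v \<in> yd_comp V g"
    and x: "\<And>v. v \<in> carrier_vec (rho_dim i) \<Longrightarrow> \<theta> (rho_x i *\<^sub>v v) = act qx (\<theta> v)"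
    and y: "\<And>v. v \<in> carrier_vec (rho_dim i) \<Longrightarrow> \<theta> (rho_y i *\<^sub>v v) = act qy (\<theta> v)"
    and u: "u \<in> carrier_vec (rho_dim i)" "\<theta> u \<noteq> \<zero>\<^bsub>V\<^esub>"
  shows "yd_isomorphic Q8 V (M_rho g i)"
proof -
  let ?W = "module_vec TYPE(complex) (rho_dim i)"
  have closed: "\<theta> v \<in> carrier V" if "v \<in> carrier_vec (rho_dim i)" for v
    by (rule comp_closed[OF g comp[OF that]])
  interpret D: induced_data Q8 ?W g "\<lambda>h v. rho i h *\<^sub>v v" by (rule M_rho_data[OF g])
  interpret induced_comparison Q8 ?W g "\<lambda>h v. rho i h *\<^sub>v v" V \<theta>
  proof unfold_locales
    show "finite (carrier Q8)" by (rule Q8_finite)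
    show "\<theta> \<in> chom ?W V" by (rule hom)
    show "inj_on \<theta> (carrier ?W)" using inj by (simp add: module_vec_simps)
    show "\<theta> v \<in> yd_comp V g" if "v \<in> carrier ?W" for v using comp that by (simp add: module_vec_simps)
    show "\<theta> (rho i k *\<^sub>v v) = act k (\<theta> v)" if k: "k \<in> centralizer Q8 g" and v: "v \<in> carrier ?W" for k v
    proof (rule rho_equivariant[OF closed x y])
      show "k \<in> carrier Q8" using k by (simp add: centralizer_def)
      show "v \<in> carrier_vec (rho_dim i)" using v by (simp add: module_vec_simps)
    qed
    show "carrier V \<subseteq> cspan V {act k (\<theta> v) | k v. k \<in> carrier Q8 \<and> v \<in> carrier ?W}"
    proof (rule generated_subset[OF g comp[OF u(1)] u(2)])
      show "{act k (\<theta> v) | k v. k \<in> carrier Q8 \<and> v \<in> carrier ?W} \<subseteq> carrier V"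
      proof (rule subsetI, elim CollectE exE conjE)
        fix p k v assume "p = act k (\<theta> v)" "k \<in> carrier Q8" "v \<in> carrier ?W"
        then show "p \<in> carrier V" using closed by (simp add: module_vec_simps)
      qed
      fix k assume k: "k \<in> carrier Q8"
      then show "act k (\<theta> u) \<in> {act k (\<theta> v) | k v. k \<in> carrier Q8 \<and> v \<in> carrier ?W}"
        using u by (intro CollectI exI[of _ k] exI[of _ u]) (simp add: module_vec_simps)
    qed
  qed
  show ?thesis using induced_isomorphic by (simp add: M_rho_def)
qed

text \<open>A joint eigenvector of \<open>x\<close> and \<open>y\<close> with eigenvalues \<open>1\<close> or \<open>-1\<close> spans a copy of one of the characters.\<close>

lemma central_isomorphic_one_dim:
  assumes g: "g \<in> carrier Q8" and w: "w \<in> yd_comp V g" "w \<noteq> \<zero>\<^bsub>V\<^esub>"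
    and x: "act qx w = (if i \<in> {1, 2} then 1 else - 1) \<odot>\<^bsub>V\<^esub> w"
    and y: "act qy w = (if i \<in> {1, 3} then 1 else - 1) \<odot>\<^bsub>V\<^esub> w" and i: "i \<noteq> 5"
  shows "yd_isomorphic Q8 V (M_rho g i)"
proof -
  have wc: "w \<in> carrier V" by (rule comp_closed[OF g w(1)])
  have d: "rho_dim i = 1" using i by (simp add: rho_dim_def)
  note [simp] = smult(3)[OF wc] smult(6)[OF wc] smult(5)[OF wc]
  show ?thesis
  proof (rule central_isomorphic[OF g, of "\<lambda>v. v $ 0 \<odot>\<^bsub>V\<^esub> w" _ "vec 1 (\<lambda>_. 1)"], unfold d)
    show "(\<lambda>v. v $ 0 \<odot>\<^bsub>V\<^esub> w) \<in> chom (module_vec TYPE(complex) 1) V"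
      unfolding module_hom_def by (auto simp: module_vec_simps)
    show "inj_on (\<lambda>v. v $ 0 \<odot>\<^bsub>V\<^esub> w) (carrier_vec 1)"
      using smult_cancel[OF spc.vectorspace_axioms wc w(2)] vec_1_eqI by (auto simp: inj_on_def)
    show "v $ 0 \<odot>\<^bsub>V\<^esub> w \<in> yd_comp V g" for v :: "complex vec"
      by (rule csubspaceD(5)[OF comp_subspace[OF g] w(1)])
    show "(rho_x i *\<^sub>v v) $ 0 \<odot>\<^bsub>V\<^esub> w = act qx (v $ 0 \<odot>\<^bsub>V\<^esub> w)" if "v \<in> carrier_vec 1" for v
      using that by (simp add: rho_1_apply[OF i that] act_smult[OF Q8_relations(1) wc] x)
    show "(rho_y i *\<^sub>v v) $ 0 \<odot>\<^bsub>V\<^esub> w = act qy (v $ 0 \<odot>\<^bsub>V\<^esub> w)" if "v \<in> carrier_vec 1" for v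
      using that by (simp add: rho_1_apply[OF i that] act_smult[OF Q8_relations(2) wc] y)
    show "vec 1 (\<lambda>_. 1) $ 0 \<odot>\<^bsub>V\<^esub> w \<noteq> \<zero>\<^bsub>V\<^esub>" using w(2) smult(2)[OF wc] by simp
  qed simp
qed

text \<open>The vectors \<open>w\<close> and \<open>w' = y \<cdot> w\<close> correspond to the basis \<open>v\<^sub>1, v\<^sub>2\<close> of the two-dimensional representation.\<close>

lemma central_isomorphic_two_dim:
  assumes g: "g \<in> carrier Q8" and w: "w \<in> yd_comp V g" "w \<noteq> \<zero>\<^bsub>V\<^esub>" "w' \<in> yd_comp V g"
    and x: "act qx w = \<i> \<odot>\<^bsub>V\<^esub> w" "act qx w' = (- \<i>) \<odot>\<^bsub>V\<^esub> w'"
    and y: "act qy w = w'" "act qy w' = (- 1) \<odot>\<^bsub>V\<^esub> w"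
  shows "yd_isomorphic Q8 V (M_rho g 5)"
proof -
  have wc: "w \<in> carrier V" "w' \<in> carrier V" using comp_closed[OF g] w by auto
  have w'0: "w' \<noteq> \<zero>\<^bsub>V\<^esub>"
  proof
    assume "w' = \<zero>\<^bsub>V\<^esub>"
    then have "w = \<zero>\<^bsub>V\<^esub>" using act_inv[OF Q8_relations(2) wc(1)] y(1) Q8_relations(2) by simp
    then show False using w(2) by simp
  qed
  have d: "rho_dim 5 = 2" by (simp add: rho_dim_def)
  define \<theta> where "\<theta> v = v $ 0 \<odot>\<^bsub>V\<^esub> w \<oplus>\<^bsub>V\<^esub> v $ 1 \<odot>\<^bsub>V\<^esub> w'" for v :: "complex vec"
  note c = smult(3)[OF wc(1)] smult(3)[OF wc(2)]
  note s = c smult(6)[OF wc(1)] smult(6)[OF wc(2)]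
  have \<theta>x: "act qx (\<theta> v) = (v $ 0 * \<i>) \<odot>\<^bsub>V\<^esub> w \<oplus>\<^bsub>V\<^esub> (v $ 1 * - \<i>) \<odot>\<^bsub>V\<^esub> w'" for v
    unfolding \<theta>_def act_add[OF Q8_relations(1) c] act_smult[OF Q8_relations(1) wc(1)] act_smult[OF Q8_relations(1) wc(2)] x s ..
  have \<theta>y: "act qy (\<theta> v) = v $ 0 \<odot>\<^bsub>V\<^esub> w' \<oplus>\<^bsub>V\<^esub> (v $ 1 * - 1) \<odot>\<^bsub>V\<^esub> w" for v
    unfolding \<theta>_def act_add[OF Q8_relations(2) c] act_smult[OF Q8_relations(2) wc(1)] act_smult[OF Q8_relations(2) wc(2)] y s ..
  have \<theta>_add: "\<theta> (v + v') = \<theta> v \<oplus>\<^bsub>V\<^esub> \<theta> v'" if "v \<in> carrier_vec 2" "v' \<in> carrier_vec 2" for v v'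
    using that c by (simp add: \<theta>_def smult(5)[OF wc(1)] smult(5)[OF wc(2)] spc.a_ac)
  have \<theta>_smult: "\<theta> (r \<cdot>\<^sub>v v) = r \<odot>\<^bsub>V\<^esub> \<theta> v" if "v \<in> carrier_vec 2" for r v
    using that by (simp add: \<theta>_def smult(7)[OF c] s)
  have \<theta>c: "\<theta> v \<in> carrier V" for v unfolding \<theta>_def using c by simp
  \<comment> \<open>\<open>w\<close> and \<open>w'\<close> are eigenvectors of \<open>x\<close> with distinct eigenvalues.\<close>
  have ker: "v $ 0 = 0 \<and> v $ 1 = 0" if v: "\<theta> v = \<zero>\<^bsub>V\<^esub>" for v
  proof -
    have "act qx (\<theta> v) \<oplus>\<^bsub>V\<^esub> \<i> \<odot>\<^bsub>V\<^esub> \<theta> v = (v $ 0 * \<i> + \<i> * v $ 0) \<odot>\<^bsub>V\<^esub> w \<oplus>\<^bsub>V\<^esub> (v $ 1 * - \<i> + \<i> * v $ 1) \<odot>\<^bsub>V\<^esub> w'"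
      unfolding \<theta>x smult(5)[OF wc(1)] smult(5)[OF wc(2)] unfolding \<theta>_def smult(7)[OF c] s(3,4)
      using c by (simp add: spc.a_ac)
    also have "\<dots> = (2 * \<i> * v $ 0) \<odot>\<^bsub>V\<^esub> w" using c smult(1)[OF wc(2)] by (simp add: mult_ac)
    finally have "(2 * \<i> * v $ 0) \<odot>\<^bsub>V\<^esub> w = \<zero>\<^bsub>V\<^esub>" unfolding v
      using smult(4)[OF wc(1)] Q8_relations(1) by simp
    then have "2 * \<i> * v $ 0 = 0"
      using smult_cancel[OF spc.vectorspace_axioms wc(1) w(2), of _ 0] smult(1)[OF wc(1)] by metis
    then have 0: "v $ 0 = 0" by simp
    then have "v $ 1 \<odot>\<^bsub>V\<^esub> w' = \<zero>\<^bsub>V\<^esub>" using v c smult(1)[OF wc(1)] by (simp add: \<theta>_def)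
    then have "v $ 1 = 0"
      using smult_cancel[OF spc.vectorspace_axioms wc(2) w'0, of _ 0] smult(1)[OF wc(2)] by metis
    with 0 show ?thesis by simp
  qed
  show ?thesis
  proof (rule central_isomorphic[OF g, of \<theta> _ "vec 2 (\<lambda>j. if j = 0 then 1 else 0)"], unfold d)
    show "\<theta> \<in> chom (module_vec TYPE(complex) 2) V"
      unfolding module_hom_def using \<theta>c \<theta>_add \<theta>_smult by (auto simp: module_vec_simps)
    show "inj_on \<theta> (carrier_vec 2)"
    proof (rule inj_onI)
      fix v v' :: "complex vec" assume v: "v \<in> carrier_vec 2" "v' \<in> carrier_vec 2" and e: "\<theta> v = \<theta> v'"
      have c': "- 1 \<cdot>\<^sub>v v' \<in> carrier_vec 2" using v by simp
      have "\<theta> (v + - 1 \<cdot>\<^sub>v v') = \<theta> v' \<oplus>\<^bsub>V\<^esub> (- 1) \<odot>\<^bsub>V\<^esub> \<theta> v'"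
        unfolding \<theta>_add[OF v(1) c'] \<theta>_smult[OF v(2)] e ..
      also have "\<dots> = \<zero>\<^bsub>V\<^esub>" unfolding smult(8)[OF \<theta>c] using \<theta>c by (simp add: spc.r_neg)
      finally have "(v + - 1 \<cdot>\<^sub>v v') $ 0 = 0 \<and> (v + - 1 \<cdot>\<^sub>v v') $ 1 = 0" by (rule ker)
      then show "v = v'" using v by (intro vec_2_eqI) auto
    qed
    show "\<theta> v \<in> yd_comp V g" for v unfolding \<theta>_def
      by (intro csubspaceD(4)[OF comp_subspace[OF g]] csubspaceD(5)[OF comp_subspace[OF g]] w(1,3))
    show "\<theta> (rho_x 5 *\<^sub>v v) = act qx (\<theta> v)" if "v \<in> carrier_vec 2" for v
      unfolding \<theta>x by (simp add: \<theta>_def rho_5_apply[OF that, simplified] mult.commute)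
    show "\<theta> (rho_y 5 *\<^sub>v v) = act qy (\<theta> v)" if "v \<in> carrier_vec 2" for v
      unfolding \<theta>y using c by (simp add: \<theta>_def rho_5_apply[OF that, simplified] spc.a_comm)
    show "\<theta> (vec 2 (\<lambda>j. if j = 0 then 1 else 0)) \<noteq> \<zero>\<^bsub>V\<^esub>"
      using ker[of "vec 2 (\<lambda>j. if j = 0 then 1 else 0)"] by auto
  qed simp
qed

text \<open>Take an eigenvector of \<open>x\<close> in the component of degree \<open>g\<close>, with eigenvalue \<open>\<lambda>\<close>; then \<open>y\<close> maps the eigenspace for \<open>\<lambda>\<close> to that
  for \<open>\<lambda>\<^sup>3\<close>, and \<open>y\<^sup>2 = x\<^sup>2\<close> acts on it by \<open>\<lambda>\<^sup>2\<close>.  If \<open>\<lambda>\<^sup>2 = 1\<close>, the eigenspace is stable under \<open>y\<close> and contains an eigenvector of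
  \<open>y\<close> with eigenvalue \<open>1\<close> or \<open>-1\<close>, which gives a character.  Otherwise \<open>\<lambda>\<close> and \<open>\<lambda>\<^sup>3\<close> are \<open>\<i>\<close> and \<open>-\<i>\<close>, and the two-dimensional representation appears.\<close>

lemma central_classification:
  assumes g: "g = (0, 0) \<or> g = (2, 0)" and u: "u \<in> yd_comp V g" "u \<noteq> \<zero>\<^bsub>V\<^esub>"
  shows "\<exists>i\<in>{1..5}. yd_isomorphic Q8 V (M_rho g i)"
proof -
  have gc: "g \<in> carrier Q8" using g by (auto simp: Q8_carrier)
  have central: "k \<otimes>\<^bsub>Q8\<^esub> g = g \<otimes>\<^bsub>Q8\<^esub> k" if "k \<in> carrier Q8" for k
    using Q8_cases[OF that] g by (auto simp: Q8_mult)
  have stable: "act k v \<in> yd_comp V g" if k: "k \<in> carrier Q8" and v: "v \<in> yd_comp V g" for k v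
    using act_comp_mem[OF k gc v] k gc by (simp add: central grp.m_assoc)
  note x = Q8_relations(1) and y = Q8_relations(2)
  have "\<exists>w\<in>yd_comp V g. w \<noteq> \<zero>\<^bsub>V\<^esub> \<and> (\<exists>t<4. act qx w = \<i> ^ t \<odot>\<^bsub>V\<^esub> w)"
  proof (rule fourth_root_eigenvector[OF comp_subspace[OF gc] _ x _ u])
    show "act qx v \<in> yd_comp V g" if "v \<in> yd_comp V g" for v by (rule stable[OF x that])
    show "(qx \<otimes>\<^bsub>Q8\<^esub> qx) \<otimes>\<^bsub>Q8\<^esub> (qx \<otimes>\<^bsub>Q8\<^esub> qx) = \<one>\<^bsub>Q8\<^esub>" by (simp add: Q8_mult Q8_one qx_def)
  qed
  then obtain w t where w: "w \<in> yd_comp V g" "w \<noteq> \<zero>\<^bsub>V\<^esub>" "act qx w = \<i> ^ t \<odot>\<^bsub>V\<^esub> w" and t: "t < 4"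
    by (elim bexE conjE exE)
  have closed: "v \<in> carrier V" if "v \<in> yd_comp V g" for v by (rule comp_closed[OF gc that])
  have yy: "qy \<otimes>\<^bsub>Q8\<^esub> qy = qx \<otimes>\<^bsub>Q8\<^esub> qx" by (simp add: Q8_mult qx_def qy_def)
  have xy: "qx \<otimes>\<^bsub>Q8\<^esub> qy = qy \<otimes>\<^bsub>Q8\<^esub> (qx \<otimes>\<^bsub>Q8\<^esub> qx \<otimes>\<^bsub>Q8\<^esub> qx)" by (simp add: Q8_mult qx_def qy_def)
  have act_yy: "act qy (act qy v) = (l * l) \<odot>\<^bsub>V\<^esub> v" if "v \<in> yd_comp V g" "act qx v = l \<odot>\<^bsub>V\<^esub> v" for v l
  proof -
    note vc = closed[OF that(1)]
    have "act qy (act qy v) = act qx (act qx v)"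
      unfolding act_mult[OF y y vc, symmetric] act_mult[OF x x vc, symmetric] yy ..
    then show ?thesis using that(2) vc x by (simp add: act_smult smult)
  qed
  have act_xy: "act qx (act qy v) = (l * l * l) \<odot>\<^bsub>V\<^esub> act qy v" if "v \<in> yd_comp V g" "act qx v = l \<odot>\<^bsub>V\<^esub> v" for v l
  proof -
    note vc = closed[OF that(1)]
    have "act qx (act qy v) = act qy (act (qx \<otimes>\<^bsub>Q8\<^esub> qx \<otimes>\<^bsub>Q8\<^esub> qx) v)"
      unfolding act_mult[OF x y vc, symmetric] xy using x y vc by (simp add: act_mult)
    also have "act (qx \<otimes>\<^bsub>Q8\<^esub> qx \<otimes>\<^bsub>Q8\<^esub> qx) v = (l * l * l) \<odot>\<^bsub>V\<^esub> v"
      using x vc that(2) by (simp add: act_mult act_smult smult mult.assoc)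
    finally show ?thesis using y vc by (simp add: act_smult)
  qed
  show ?thesis
  proof (cases "t = 0 \<or> t = 2")
    case True
    define l :: complex where "l = \<i> ^ t"
    have l: "l = 1 \<or> l = - 1" "l * l = 1" using True by (auto simp: l_def)
    define X where "X = {v \<in> yd_comp V g. act qx v = l \<odot>\<^bsub>V\<^esub> v}"
    note Vg = csubspaceD[OF comp_subspace[OF gc]]
    have X: "csubspace X V"
    proof (rule csubspaceI[OF spc.vectorspace_axioms])
      show "X \<subseteq> carrier V" using closed by (auto simp: X_def)
      show "\<zero>\<^bsub>V\<^esub> \<in> X" using Vg(3) x smult(4)[OF spc.zero_closed] by (simp add: X_def)
      show "a \<oplus>\<^bsub>V\<^esub> b \<in> X" if "a \<in> X" "b \<in> X" for a b
        using that Vg(4) x closed by (simp add: X_def act_add smult(7))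
      show "c \<odot>\<^bsub>V\<^esub> a \<in> X" if "a \<in> X" for c a
        using that Vg(5) x closed by (simp add: X_def act_smult smult(6) mult.commute)
    qed
    have Xy: "act qy v \<in> X" if "v \<in> X" for v
      using that stable[OF y] act_xy[of v l] by (simp add: X_def l(2))
    have "w \<in> X" using w by (simp add: X_def l_def)
    moreover have "act qy (act qy w) = (1 * 1) \<odot>\<^bsub>V\<^esub> w" using act_yy[OF w(1,3)] l(2) by (simp add: l_def)
    ultimately have "\<exists>v\<in>X. v \<noteq> \<zero>\<^bsub>V\<^esub> \<and> (act qy v = 1 \<odot>\<^bsub>V\<^esub> v \<or> act qy v = (- 1) \<odot>\<^bsub>V\<^esub> v)"
      using w(2) by (intro square_eigenvector[OF X Xy y])
    then have "\<exists>v m. v \<in> X \<and> v \<noteq> \<zero>\<^bsub>V\<^esub> \<and> act qy v = m \<odot>\<^bsub>V\<^esub> v \<and> (m = 1 \<or> m = - 1)"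
    proof (elim bexE conjE disjE)
      fix v assume "v \<in> X" "v \<noteq> \<zero>\<^bsub>V\<^esub>" "act qy v = 1 \<odot>\<^bsub>V\<^esub> v"
      then show ?thesis by (intro exI[of _ v] exI[of _ 1]) simp
    next
      fix v assume "v \<in> X" "v \<noteq> \<zero>\<^bsub>V\<^esub>" "act qy v = (- 1) \<odot>\<^bsub>V\<^esub> v"
      then show ?thesis by (intro exI[of _ v] exI[of _ "- 1"]) simp
    qed
    then obtain v m where v: "v \<in> X" "v \<noteq> \<zero>\<^bsub>V\<^esub>" "act qy v = m \<odot>\<^bsub>V\<^esub> v" and m: "m = 1 \<or> m = - 1"
      by (elim exE conjE)
    have vg: "v \<in> yd_comp V g" "act qx v = l \<odot>\<^bsub>V\<^esub> v" using v(1) by (simp_all add: X_def)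
    define i :: nat where "i = (if l = 1 then if m = 1 then 1 else 2 else if m = 1 then 3 else 4)"
    have i: "(if i \<in> {1, 2} then 1 else - 1) = l" "(if i \<in> {1, 3} then 1 else - 1) = m" "i \<noteq> 5" "i \<in> {1..5}"
      using l(1) m by (auto simp: i_def)
    have "yd_isomorphic Q8 V (M_rho g i)"
      by (rule central_isomorphic_one_dim[OF gc vg(1) v(2) _ _ i(3)]) (simp_all only: i(1,2) vg(2) v(3))
    then show ?thesis using i(4) by (rule bexI)
  next
    case False
    then have t: "t = 1 \<or> t = 3" using t by linarith
    have i3: "\<i> ^ 3 = - \<i>" by (simp add: power3_eq_cube)
    have "\<exists>v\<in>yd_comp V g. v \<noteq> \<zero>\<^bsub>V\<^esub> \<and> act qx v = \<i> \<odot>\<^bsub>V\<^esub> v"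
      using t
    proof
      assume "t = 1"
      then show ?thesis using w by (intro bexI[of _ w]) simp_all
    next
      assume t3: "t = 3"
      have "act qy w \<noteq> \<zero>\<^bsub>V\<^esub>" using act_inv[OF y closed[OF w(1)]] w(2) y by auto
      moreover have "act qx w = (- \<i>) \<odot>\<^bsub>V\<^esub> w" using w(3) by (simp add: t3 i3)
      ultimately show ?thesis
        using act_xy[OF w(1), of "- \<i>"] stable[OF y w(1)] by (intro bexI[of _ "act qy w"]) simp_all
    qed
    then obtain v where v: "v \<in> yd_comp V g" "v \<noteq> \<zero>\<^bsub>V\<^esub>" "act qx v = \<i> \<odot>\<^bsub>V\<^esub> v" by (elim bexE conjE)
    have "yd_isomorphic Q8 V (M_rho g 5)"
      by (rule central_isomorphic_two_dim[OF gc v(1,2) stable[OF y v(1)] v(3) _ refl])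
        (use act_xy[OF v(1,3)] act_yy[OF v(1,3)] in simp_all)
    then show ?thesis by (rule bexI[of _ 5]) simp
  qed
qed

text \<open>A vector of degree \<open>g\<^sup>-\<^sup>1\<close> is moved to degree \<open>g\<close> by \<open>h\<^sup>-\<^sup>1\<close>.  An eigenvector of \<open>g\<close> in degree \<open>g\<close> has eigenvalue \<open>\<i>\<^sup>t\<close>, and odd
  \<open>t\<close> is excluded by the affine case.\<close>

lemma noncentral_classification:
  assumes gh: "quaternion_pair g h" and u: "u \<in> yd_comp V g \<or> u \<in> yd_comp V (inv\<^bsub>Q8\<^esub> g)" "u \<noteq> \<zero>\<^bsub>V\<^esub>"
    and fin: "GKdim (nichols_algebra Q8 V) < \<infinity>"
  shows "\<exists>t\<in>{0, 2}. yd_isomorphic Q8 V (M_phi g t)"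
proof -
  note gh' = gh[unfolded quaternion_pair_def]
  have g: "g \<in> carrier Q8" and h: "h \<in> carrier Q8" and hg: "h \<otimes>\<^bsub>Q8\<^esub> g = inv\<^bsub>Q8\<^esub> g \<otimes>\<^bsub>Q8\<^esub> h"
    using gh' by simp_all
  have "\<exists>v\<in>yd_comp V g. v \<noteq> \<zero>\<^bsub>V\<^esub>"
    using u(1)
  proof
    assume "u \<in> yd_comp V g"
    then show ?thesis using u(2) by (rule bexI[rotated])
  next
    assume u': "u \<in> yd_comp V (inv\<^bsub>Q8\<^esub> g)"
    let ?k = "inv\<^bsub>Q8\<^esub> h"
    have k: "?k \<in> carrier Q8" and uc: "u \<in> carrier V" using h g comp_closed[OF _ u'] by auto
    have "?k \<otimes>\<^bsub>Q8\<^esub> inv\<^bsub>Q8\<^esub> g \<otimes>\<^bsub>Q8\<^esub> inv\<^bsub>Q8\<^esub> ?k = ?k \<otimes>\<^bsub>Q8\<^esub> (inv\<^bsub>Q8\<^esub> g \<otimes>\<^bsub>Q8\<^esub> h)"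
      using g h by (simp add: grp.m_assoc)
    also have "\<dots> = g" unfolding hg[symmetric] using g h by (simp add: grp.m_assoc[symmetric])
    finally have "act ?k u \<in> yd_comp V g" using act_comp_mem[OF k _ u'] g by simp
    moreover have "act ?k u \<noteq> \<zero>\<^bsub>V\<^esub>" using act_inv[OF k uc] u(2) h by auto
    ultimately show ?thesis by (rule bexI[rotated])
  qed
  then obtain v where v: "v \<in> yd_comp V g" "v \<noteq> \<zero>\<^bsub>V\<^esub>" by (elim bexE)
  from noncentral_eigenvector[OF gh v]
  obtain w t where w: "w \<in> yd_comp V g" "w \<noteq> \<zero>\<^bsub>V\<^esub>" "act g w = \<i> ^ t \<odot>\<^bsub>V\<^esub> w" and t: "t < 4"
    by (elim bexE conjE exE)
  have "t \<in> {0, 2}"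
  proof (rule ccontr)
    assume "t \<notin> {0, 2}"
    then have "t = 1 \<or> t = 3" using t by auto
    then have "(\<i> ^ t) ^ 4 = 1" "(\<i> ^ t)\<^sup>2 \<noteq> 1" by (elim disjE; simp flip: power_mult)+
    from noncentral_infinite[OF gh w this] show False using fin by simp
  qed
  with noncentral_isomorphic[OF gh w] show ?thesis by (rule bexI)
qed

text \<open>Here \<open>x\<^sup>2\<close> acts by \<open>-1\<close> in the two-dimensional representation and by \<open>1\<close> in the others.\<close>

lemma GKdim_finite_central:
  assumes g: "g = (0, 0) \<or> g = (2, 0)" and iso: "yd_isomorphic Q8 V (M_rho g i)"
  shows "GKdim (nichols_algebra Q8 V) < \<infinity>"
proof -
  have gc: "g \<in> carrier Q8" using g by (auto simp: Q8_carrier)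
  have central: "k \<otimes>\<^bsub>Q8\<^esub> g \<otimes>\<^bsub>Q8\<^esub> inv\<^bsub>Q8\<^esub> k = g" if "k \<in> carrier Q8" for k
    using Q8_cases[OF that] g by (auto simp: Q8_mult Q8_inv)
  define e :: complex where "e = (if g = (2, 0) \<and> i = 5 then - 1 else 1)"
  show ?thesis
  proof (rule GKdim_finite_of_induced[OF yd_module_axioms Q8_finite fin_dim irreducible M_rho_data[OF gc] iso[unfolded M_rho_def], of e])
    show "e * e = 1" by (simp add: e_def)
    show "k \<otimes>\<^bsub>Q8\<^esub> g \<otimes>\<^bsub>Q8\<^esub> inv\<^bsub>Q8\<^esub> k \<in> centralizer Q8 g" if "k \<in> carrier Q8" for k
      using gc by (simp add: central[OF that] centralizer_def)
    show "rho i (k \<otimes>\<^bsub>Q8\<^esub> g \<otimes>\<^bsub>Q8\<^esub> inv\<^bsub>Q8\<^esub> k) *\<^sub>v v = e \<odot>\<^bsub>module_vec TYPE(complex) (rho_dim i)\<^esub> v"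
      if "k \<in> carrier Q8" "v \<in> carrier (module_vec TYPE(complex) (rho_dim i))" for k v
    proof -
      have v: "v \<in> carrier_vec (rho_dim i)" using that(2) by (simp add: module_vec_simps)
      show ?thesis unfolding central[OF that(1)] module_vec_simps
        using g rho_central[OF v] by (auto simp: e_def)
    qed
  qed
qed

text \<open>The degrees are \<open>g\<close> and \<open>g\<^sup>3\<close>, and \<open>\<phi>\<^sub>t\<close> has the same value, \<open>1\<close> or \<open>-1\<close>, at both.\<close>

lemma GKdim_finite_noncentral:
  assumes gh: "quaternion_pair g h" and t: "t \<in> {0, 2}" and iso: "yd_isomorphic Q8 V (M_phi g t)"
  shows "GKdim (nichols_algebra Q8 V) < \<infinity>"
proof -
  note gh' = gh[unfolded quaternion_pair_def]
  have g: "g \<in> carrier Q8" using gh' by simp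
  have inj: "inj_on (\<lambda>j::nat. g [^]\<^bsub>Q8\<^esub> j) {..<4}" using gh' by (elim conjE)
  have "\<forall>k\<in>carrier Q8. k \<otimes>\<^bsub>Q8\<^esub> g \<otimes>\<^bsub>Q8\<^esub> inv\<^bsub>Q8\<^esub> k \<in> {g, g [^]\<^bsub>Q8\<^esub> (3::nat)}" using gh' by (elim conjE)
  note cc = bspec[OF this]
  have conj: "k \<otimes>\<^bsub>Q8\<^esub> g \<otimes>\<^bsub>Q8\<^esub> inv\<^bsub>Q8\<^esub> k = g [^]\<^bsub>Q8\<^esub> (1::nat) \<or> k \<otimes>\<^bsub>Q8\<^esub> g \<otimes>\<^bsub>Q8\<^esub> inv\<^bsub>Q8\<^esub> k = g [^]\<^bsub>Q8\<^esub> (3::nat)"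
    if "k \<in> carrier Q8" for k using cc[OF that] by (simp only: insert_iff empty_iff simp_thms Q8_small_pow(2)[OF g])
  have comm: "g [^]\<^bsub>Q8\<^esub> (j::nat) \<in> centralizer Q8 g" for j
    using g grp.nat_pow_comm[OF g, of j 1] by (simp add: centralizer_def)
  show ?thesis
  proof (rule GKdim_finite_of_induced[OF yd_module_axioms Q8_finite fin_dim irreducible M_phi_data[OF g] iso[unfolded M_phi_def], of "\<i> ^ t"])
    show "\<i> ^ t * \<i> ^ t = 1" using t by auto
    show "k \<otimes>\<^bsub>Q8\<^esub> g \<otimes>\<^bsub>Q8\<^esub> inv\<^bsub>Q8\<^esub> k \<in> centralizer Q8 g" if "k \<in> carrier Q8" for k
      using conj[OF that] by (elim disjE) (erule ssubst, rule comm)+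
    show "phi t g (k \<otimes>\<^bsub>Q8\<^esub> g \<otimes>\<^bsub>Q8\<^esub> inv\<^bsub>Q8\<^esub> k) \<cdot>\<^sub>v v = \<i> ^ t \<odot>\<^bsub>module_vec TYPE(complex) 1\<^esub> v" if "k \<in> carrier Q8" for k v
    proof -
      have "phi t g (k \<otimes>\<^bsub>Q8\<^esub> g \<otimes>\<^bsub>Q8\<^esub> inv\<^bsub>Q8\<^esub> k) = \<i> ^ t"
        using conj[OF that]
      proof
        assume e: "k \<otimes>\<^bsub>Q8\<^esub> g \<otimes>\<^bsub>Q8\<^esub> inv\<^bsub>Q8\<^esub> k = g [^]\<^bsub>Q8\<^esub> (1::nat)"
        show ?thesis unfolding e using phi_pow[OF inj, of 1 t] by simp
      next
        assume e: "k \<otimes>\<^bsub>Q8\<^esub> g \<otimes>\<^bsub>Q8\<^esub> inv\<^bsub>Q8\<^esub> k = g [^]\<^bsub>Q8\<^esub> (3::nat)"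
        show ?thesis unfolding e using phi_pow[OF inj, of 3 t] t by (auto simp: power3_eq_cube)
      qed
      then show ?thesis by (simp add: module_vec_simps)
    qed
  qed
qed

end

theorem theorem1p1:
  fixes V :: "(int \<times> int, 'v) yd_struct"
  assumes "yd_module Q8 V"
    and "cfin_dim V"
    and "yd_irreducible Q8 V"
  shows "GKdim (nichols_algebra Q8 V) < \<infinity> \<longleftrightarrow>
    (\<exists>i\<in>{1..5}. yd_isomorphic Q8 V (M_rho \<one>\<^bsub>Q8\<^esub> i)) \<or>
    (\<exists>t\<in>{0, 2}. yd_isomorphic Q8 V (M_phi qx t)) \<or>
    (\<exists>i\<in>{1..5}. yd_isomorphic Q8 V (M_rho (qx [^]\<^bsub>Q8\<^esub> (2::nat)) i)) \<or>
    (\<exists>t\<in>{0, 2}. yd_isomorphic Q8 V (M_phi qy t)) \<or>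
    (\<exists>t\<in>{0, 2}. yd_isomorphic Q8 V (M_phi (qx \<otimes>\<^bsub>Q8\<^esub> qy) t))"
    (is "?fin \<longleftrightarrow> ?one \<or> ?x \<or> ?xx \<or> ?y \<or> ?xy")
proof -
  interpret yd_module Q8 V by (rule assms(1))
  interpret Q8_irreducible V by unfold_locales (rule assms)+
  note pairs = quaternion_pairs
  have x2: "qx [^]\<^bsub>Q8\<^esub> (2::nat) = (2, 0)" by (simp add: Q8_x_pow)
  have inv: "inv\<^bsub>Q8\<^esub> qx = (3, 0)" "inv\<^bsub>Q8\<^esub> qy = (2, 1)" "qx \<otimes>\<^bsub>Q8\<^esub> qy = (1, 1)" "inv\<^bsub>Q8\<^esub> (1, 1) = (3, 1)"
    by (simp_all add: qx_def qy_def Q8_inv Q8_mult)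
  show ?thesis
  proof
    assume fin: ?fin
    have "carrier V \<noteq> {\<zero>\<^bsub>V\<^esub>}" using irreducible by (simp add: yd_irreducible_def)
    from homogeneous_vector_exists[OF this] obtain s u
      where s: "s \<in> carrier Q8" and u: "u \<in> yd_comp V s" "u \<noteq> \<zero>\<^bsub>V\<^esub>" by (elim bexE)
    consider "s = (0, 0)" | "s = (2, 0)" | "s = qx \<or> s = inv\<^bsub>Q8\<^esub> qx" | "s = qy \<or> s = inv\<^bsub>Q8\<^esub> qy"
      | "s = qx \<otimes>\<^bsub>Q8\<^esub> qy \<or> s = inv\<^bsub>Q8\<^esub> (qx \<otimes>\<^bsub>Q8\<^esub> qy)"
      using Q8_cases[OF s] unfolding inv by (auto simp: qx_def qy_def)
    then show "?one \<or> ?x \<or> ?xx \<or> ?y \<or> ?xy"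
    proof cases
      case 1
      have ?one unfolding Q8_one by (rule central_classification[OF _ _ u(2)]) (use 1 u(1) in auto)
      then show ?thesis ..
    next
      case 2
      have ?xx unfolding x2 by (rule central_classification[OF _ _ u(2)]) (use 2 u(1) in auto)
      then show ?thesis by (rule disjI2[OF disjI2[OF disjI1]])
    next
      case 3
      have ?x by (rule noncentral_classification[OF pairs(1) _ u(2) fin]) (use 3 u(1) in auto)
      then show ?thesis by (rule disjI2[OF disjI1])
    next
      case 4
      have ?y by (rule noncentral_classification[OF pairs(2) _ u(2) fin]) (use 4 u(1) in auto)
      then show ?thesis by (rule disjI2[OF disjI2[OF disjI2[OF disjI1]]])
    next
      case 5
      have ?xy by (rule noncentral_classification[OF pairs(3) _ u(2) fin]) (use 5 u(1) in auto)
      then show ?thesis by (rule disjI2[OF disjI2[OF disjI2[OF disjI2]]])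
    qed
  next
    assume "?one \<or> ?x \<or> ?xx \<or> ?y \<or> ?xy"
    then show ?fin
    proof (elim disjE bexE)
      fix i assume "yd_isomorphic Q8 V (M_rho \<one>\<^bsub>Q8\<^esub> i)"
      then show ?fin unfolding Q8_one by (rule GKdim_finite_central[rotated]) simp
    next
      fix i assume "yd_isomorphic Q8 V (M_rho (qx [^]\<^bsub>Q8\<^esub> (2::nat)) i)"
      then show ?fin unfolding x2 by (rule GKdim_finite_central[rotated]) simp
    next
      fix t :: nat assume "t \<in> {0, 2}" "yd_isomorphic Q8 V (M_phi qx t)"
      then show ?fin by (rule GKdim_finite_noncentral[OF pairs(1)])
    next
      fix t :: nat assume "t \<in> {0, 2}" "yd_isomorphic Q8 V (M_phi qy t)"
      then show ?fin by (rule GKdim_finite_noncentral[OF pairs(2)])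
    next
      fix t :: nat assume "t \<in> {0, 2}" "yd_isomorphic Q8 V (M_phi (qx \<otimes>\<^bsub>Q8\<^esub> qy) t)"
      then show ?fin by (rule GKdim_finite_noncentral[OF pairs(3)])
    qed
  qed
qed

end
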